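(* Assume the setting and notation of the context, and let $\delta\in(0,1]$. Suppose: (i) $\sup_{s\in\mathcal X}G(s,s)=:\gamma^2<\infty$ (a.s. with respect to any probability measure on $\mathcal X$); (ii) $\sup_{m\in\mathcal P}K(m,m)=:\kappa^2<\infty$ ($\rho_\mu$-a.s.); (iii) for some $\alpha\in(0,1]$, $L>0$: $\|K_{m_1}-K_{m_2}\|_{\mathcal H_K}\le L\|m_1-m_2\|_{\mathcal H_G}^{\alpha}$ for all $m_1,m_2\in\mathcal P$; (iv) $f_\rho=L_K^r h_\rho$ with $h_\rho\in L^2(\mathcal P,\rho_\mu)$, $\|h_\rho\|_{L^2}\le R<\infty$, where $r\ge\frac12$; (v) for some $\nu\in(0,1]$, $c_\nu<\infty$: $\mathcal N(\lambda)\le c_\nu\lambda^{-\nu}$; (vi) with $\lambda=(\eta_nT_n)^{-1}$, $n\ge \frac{32\kappa^2\log(4/\delta)}{\lambda}\log\big(e\,\mathcal N(\lambda)(1+\frac{\lambda}{\|L_K\|})\big)$, and $\eta_n<\frac1{4\kappa^2}$. Let $\eta_0<\frac1{4\kappa^2}$ and choose the second-stage sample size $$N=N_n\ge \log^{2/\alpha}(n)\Big(\frac{R^2n}{M^2}\Big)^{\frac{2r+1}{\alpha(2r+\nu)}}.$$ Then, for any $n$ sufficiently large, with probability at least $1-\delta$ with respect to the data $D$, $$\mathbb E_{\hat D|D}\big[\|S_K\bar{\hat h}_{T_n}-f_\rho\|_{L^2}\big]\le C\log(6/\delta)\,R\Big(\frac{M^2}{R^2n}\Big)^{\frac{r}{2r+\nu}},$$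 where $C<\infty$ is a constant not depending on $n$ or $N$, for tail-averaged mini-batch SGD with batch size $b_n$, step size $\eta_n$ and $T_n$ iterations given by each of the following choices: 1. (one-pass SGD) $b_n=1$, $\eta_n=\eta_0\frac{R^2}{M^2}\big(\frac{M^2}{R^2n}\big)^{\frac{2r+\nu-1}{2r+\nu}}$, $T_n=\frac{R^2}{M^2}n$; 2. (early stopping and one-pass SGD) $b_n=n^{\frac{2r+\nu-1}{2r+\nu}}$, $\eta_n=\eta_0$, $T_n=\big(\frac{R^2n}{M^2}\big)^{\frac1{2r+\nu}}$; 3. (batch GD) $b_n=n$, $\eta_n=\eta_0$, $T_n=\big(\frac{R^2n}{M^2}\big)^{\frac1{2r+\nu}}$.
   Context: Setting. $\mathcal X$ is a compact topological space, $\mathcal M^+(\mathcal X)$ the Borel probability measures on $\mathcal X$ (weak topology), $\mathcal Y\subseteq[-M,M]$ with $M>0$. $G$ is a Mercer kernel on $\mathcal X$ (symmetric, continuous, positive semidefinite) with reproducing kernel Hilbert space (RKHS) $\mathcal H_G$; the mean embedding of $x\in\mathcal M^+(\mathcal X)$ is $\mu_x=\int_{\mathcal X}G(s,\cdot)\,dx(s)\in\mathcal H_G$; $\mathcal P:=\{\mu_x:x\in\mathcal M^+(\mathcal X)\}\subset\mathcal H_G$. $K$ is a reproducing kernel on $\mathcal P$ with RKHS $\mathcal H_K$; $K_m:=K(m,\cdot)$. $\rho$ is a probability measure on $\mathcal P\times\mathcal Y$ with marginal $\rho_\mu$ on $\mathcal P$; $L^2=L^2(\mathcal P,\rho_\mu)$;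 $f_\rho(m)=\int_{\mathcal Y}y\,d\rho(y|m)$ is the regression function. $S_K:\mathcal H_K\to L^2$ is the inclusion, $L_K=S_KS_K^*$ (the kernel integral operator on $L^2$; powers via spectral calculus), and $\mathcal N(\lambda)=\mathrm{trace}(L_K(L_K+\lambda)^{-1})$ for $\lambda>0$. Data. First stage: $(x_j,y_j)$, $j=1,\dots,n$, i.i.d. on $\mathcal M^+(\mathcal X)\times\mathcal Y$ such that $(\mu_{x_j},y_j)\sim\rho$; $D=\{(\mu_{x_j},y_j)\}_{j=1}^n$. Second stage: for each $j$, $x_{j,1},\dots,x_{j,N}$ are i.i.d. from $x_j$; $\mu_{\hat x_j}=\frac1N\sum_{i=1}^NG(x_{j,i},\cdot)$; $\hat D=\{(\mu_{\hat x_j},y_j)\}_{j=1}^n$. $\mathbb E_{\hat D|D}$ denotes the conditional expectation with respect to the sample $\hat D$ given $D$. Algorithm (second-stage tail-averaged SGD with batch size $b\in\{1,\dots,n\}$, step size $\eta>0$). With $j_1,\dots,j_{bT}$ i.i.d. uniform on $\{1,\dots,n\}$, starting with $\hat h_0\in\mathcal H_K$, $\hat h_{t+1}=\hat h_t-\eta\frac1b\sum_{i=bt+1}^{b(t+1)}(\hat h_t(\mu_{\hat x_{j_i}})-y_{j_i})K_{\mu_{\hat x_{j_i}}}$; $\ \bar{\hat h}_T=\frac2T\sum_{t=\lfloor T/2\rfloor+1}^T\hat h_t$.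
   Formalization: The starting point is assumed to satisfy the same source condition as f_ρ (S_K h_0 = L_K^r g_0 for some g_0 in L^2; the claim fails for arbitrary h_0 when r > 1/2), and T_n is rounded to an even integer, b_n to an integer. *)

theory Defs
  imports "HOL-Probability.Probability"
begin

section \<open>Kernels and reproducing kernel Hilbert spaces\<close>

definition mercer_kernel :: "('x::topological_space \<Rightarrow> 'x \<Rightarrow> real) \<Rightarrow> bool" where
  "mercer_kernel G \<longleftrightarrow>
     (\<forall>s t. G s t = G t s) \<and>
     continuous_on UNIV (\<lambda>(s, t). G s t) \<and>
     (\<forall>S c. finite S \<longrightarrow> (\<Sum>s\<in>S. \<Sum>t\<in>S. c s * c t * G s t) \<ge> 0)"

text \<open>
  A Hilbert space of functions on \<open>A\<close> is a Hilbert space type \<open>'h\<close> together with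
  an evaluation map \<open>evl\<close> that is linear and under which an element is determined by its
  values on \<open>A\<close>. It is the RKHS of \<open>K\<close> if every section \<open>K m\<close> belongs to it and
  reproduces the value at \<open>m\<close>.
\<close>

definition rkhs_on ::
    "'a set \<Rightarrow> ('a \<Rightarrow> 'a \<Rightarrow> real) \<Rightarrow> ('h::{real_inner,banach} \<Rightarrow> 'a \<Rightarrow> real) \<Rightarrow> bool" where
  "rkhs_on A K evl \<longleftrightarrow>
     (\<forall>a\<in>A. linear (\<lambda>f. evl f a)) \<and>
     (\<forall>f g. (\<forall>a\<in>A. evl f a = evl g a) \<longrightarrow> f = g) \<and>
     (\<forall>m\<in>A. \<exists>k. (\<forall>a\<in>A. evl k a = K m a) \<and> (\<forall>f. evl f m = f \<bullet> k))"

definition kernel_section ::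
    "'a set \<Rightarrow> ('a \<Rightarrow> 'a \<Rightarrow> real) \<Rightarrow> ('h::{real_inner,banach} \<Rightarrow> 'a \<Rightarrow> real) \<Rightarrow> 'a \<Rightarrow> 'h" where
  "kernel_section A K evl m = (THE k. \<forall>a\<in>A. evl k a = K m a)"

text \<open>
  The mean embedding is a Bochner integral. The sort constraint of separability this needs
  is no restriction: for continuous \<open>G\<close> on a compact space, \<open>s \<mapsto> G(s,\<sqdot>)\<close> is norm-continuous,
  so its range is compact and the RKHS, the closed span of that range, is separable.
\<close>

definition mean_embedding ::
    "('x::topological_space \<Rightarrow> 'x \<Rightarrow> real) \<Rightarrow>
     ('g::{real_inner,banach,second_countable_topology} \<Rightarrow> 'x \<Rightarrow> real) \<Rightarrow> 'x measure \<Rightarrow> 'g" where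
  "mean_embedding G evl x = (\<integral>s. kernel_section UNIV G evl s \<partial>x)"

definition mean_embeddings ::
    "('x::topological_space \<Rightarrow> 'x \<Rightarrow> real) \<Rightarrow>
     ('g::{real_inner,banach,second_countable_topology} \<Rightarrow> 'x \<Rightarrow> real) \<Rightarrow> 'g set" where
  "mean_embeddings G evl = mean_embedding G evl ` {x. prob_space x \<and> sets x = sets borel}"


section \<open>The space of square integrable functions\<close>

definition square_integrable :: "'a measure \<Rightarrow> ('a \<Rightarrow> real) \<Rightarrow> bool" where
  "square_integrable M f \<longleftrightarrow> f \<in> borel_measurable M \<and> integrable M (\<lambda>x. (f x)\<^sup>2)"

text \<open>
  \<open>'l\<close> is the Hilbert space of classes of square integrable functions, with
  \<open>cls f\<close> the class of \<open>f\<close>. Linearity of \<open>cls\<close> on square integrable functions, and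
  \<open>cls f = cls g\<close> iff \<open>f = g\<close> almost everywhere, follow from the inner product formula.
\<close>

definition is_L2 :: "'a measure \<Rightarrow> (('a \<Rightarrow> real) \<Rightarrow> 'l::{real_inner,banach}) \<Rightarrow> bool" where
  "is_L2 M cls \<longleftrightarrow>
     (\<forall>f g. square_integrable M f \<longrightarrow> square_integrable M g \<longrightarrow>
        cls f \<bullet> cls g = (\<integral>x. f x * g x \<partial>M)) \<and>
     (\<forall>v. \<exists>f. square_integrable M f \<and> cls f = v)"


section \<open>Operators\<close>

definition orthonormal_basis :: "'l::{real_inner,banach} set \<Rightarrow> bool" where
  "orthonormal_basis B \<longleftrightarrow>
     pairwise orthogonal B \<and> (\<forall>e\<in>B. norm e = 1) \<and> closure (span B) = UNIV"

text \<open>Independent of the basis for the positive trace class operators it is used for.\<close>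

definition op_trace :: "('l::{real_inner,banach} \<Rightarrow> 'l) \<Rightarrow> real" where
  "op_trace A = (\<Sum>\<^sub>\<infinity>e\<in>(SOME B. orthonormal_basis B). A e \<bullet> e)"

text \<open>
  Spectral calculus for a compact positive self-adjoint operator, which has an orthonormal basis
  of eigenvectors; the eigenvalue of a unit eigenvector \<open>e\<close> is \<open>A e \<bullet> e\<close>. Used with \<open>r > 0\<close>, where
  \<open>0 powr r = 0\<close>; the value does not depend on the eigenbasis.
\<close>

definition eigenbasis :: "('l::{real_inner,banach} \<Rightarrow> 'l) \<Rightarrow> 'l set \<Rightarrow> bool" where
  "eigenbasis A B \<longleftrightarrow> orthonormal_basis B \<and> (\<forall>e\<in>B. \<exists>c. A e = c *\<^sub>R e)"

definition op_power :: "('l::{real_inner,banach} \<Rightarrow> 'l) \<Rightarrow> real \<Rightarrow> 'l \<Rightarrow> 'l" where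
  "op_power A r v = (\<Sum>\<^sub>\<infinity>e\<in>(SOME B. eigenbasis A B). ((A e \<bullet> e) powr r * (v \<bullet> e)) *\<^sub>R e)"

definition effective_dim :: "('l::{real_inner,banach} \<Rightarrow> 'l) \<Rightarrow> real \<Rightarrow> real" where
  "effective_dim A l = op_trace (A \<circ> inv (\<lambda>v. A v + l *\<^sub>R v))"

text \<open>The inclusion of \<open>'h\<close> (functions via \<open>evl\<close>) into the space of classes.\<close>

definition inclusion ::
    "(('a \<Rightarrow> real) \<Rightarrow> 'l) \<Rightarrow> ('h \<Rightarrow> 'a \<Rightarrow> real) \<Rightarrow> 'h \<Rightarrow> 'l" where
  "inclusion cls evl h = cls (evl h)"


section \<open>Sampling\<close>

text \<open>
  \<open>k\<close> is a conditional distribution of the second component given the first: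
  \<open>k m\<close> is \<open>\<rho>(\<sqdot>|m)\<close>, and \<open>\<rho>m\<close> is the first marginal.
\<close>

definition conditional_distribution ::
    "('a \<times> real) measure \<Rightarrow> 'a measure \<Rightarrow> real set \<Rightarrow> ('a \<Rightarrow> real measure) \<Rightarrow> bool" where
  "conditional_distribution \<rho> \<rho>m Y k \<longleftrightarrow>
     k \<in> measurable \<rho>m (prob_algebra (restrict_space borel Y)) \<and>
     (\<forall>A\<in>sets \<rho>. emeasure \<rho> A = (\<integral>\<^sup>+m. emeasure (k m) {y. (m, y) \<in> A} \<partial>\<rho>m))"

text \<open>
  A sample point is \<open>((d, z), J)\<close>: \<open>d j = (x\<^sub>j, y\<^sub>j)\<close> are i.i.d. from \<open>Q\<close>; given \<open>d\<close>, the points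
  \<open>z j i = x\<^sub>j\<^sub>,\<^sub>i\<close> are independent with law \<open>x\<^sub>j\<close>; and the mini-batch indices \<open>J i\<close>
  are i.i.d. uniform, independent of the data.
\<close>

definition two_stage_sample ::
    "('x::topological_space measure \<times> real) measure \<Rightarrow> nat \<Rightarrow> nat \<Rightarrow>
     ((nat \<Rightarrow> 'x measure \<times> real) \<times> (nat \<Rightarrow> nat \<Rightarrow> 'x)) measure" where
  "two_stage_sample Q n N =
     do {
       d \<leftarrow> (\<Pi>\<^sub>M j\<in>{1..n}. Q);
       z \<leftarrow> (\<Pi>\<^sub>M j\<in>{1..n}. \<Pi>\<^sub>M i\<in>{1..N}. fst (d j));
       return ((\<Pi>\<^sub>M j\<in>{1..n}. Q) \<Otimes>\<^sub>M (\<Pi>\<^sub>M j\<in>{1..n}. \<Pi>\<^sub>M i\<in>{1..N}. borel)) (d, z)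
     }"

definition sgd_experiment ::
    "('x::topological_space measure \<times> real) measure \<Rightarrow> nat \<Rightarrow> nat \<Rightarrow> nat \<Rightarrow>
     (((nat \<Rightarrow> 'x measure \<times> real) \<times> (nat \<Rightarrow> nat \<Rightarrow> 'x)) \<times> (nat \<Rightarrow> nat)) measure" where
  "sgd_experiment Q n N k =
     two_stage_sample Q n N \<Otimes>\<^sub>M (\<Pi>\<^sub>M i\<in>{1..k}. uniform_count_measure {1..n})"

definition first_stage_data ::
    "('x measure \<Rightarrow> 'g) \<Rightarrow> nat \<Rightarrow> (nat \<Rightarrow> 'x measure \<times> real) \<Rightarrow> nat \<Rightarrow> 'g \<times> real" where
  "first_stage_data \<mu> n d = (\<lambda>j\<in>{1..n}. (\<mu> (fst (d j)), snd (d j)))"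

definition second_stage_data ::
    "('x \<Rightarrow> 'g::real_vector) \<Rightarrow> nat \<Rightarrow> (nat \<Rightarrow> 'x measure \<times> real) \<Rightarrow> (nat \<Rightarrow> nat \<Rightarrow> 'x) \<Rightarrow>
     nat \<Rightarrow> 'g \<times> real" where
  "second_stage_data Gs N d z j =
     ((1 / real N) *\<^sub>R (\<Sum>i=1..N. Gs (z j i)), snd (d j))"


section \<open>Tail-averaged mini-batch SGD\<close>

primrec sgd ::
    "('h::real_vector \<Rightarrow> 'g \<Rightarrow> real) \<Rightarrow> ('g \<Rightarrow> 'h) \<Rightarrow> nat \<Rightarrow> real \<Rightarrow> 'h \<Rightarrow>
     (nat \<Rightarrow> 'g \<times> real) \<Rightarrow> (nat \<Rightarrow> nat) \<Rightarrow> nat \<Rightarrow> 'h" where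
  "sgd evl Ks b \<eta> h0 D J 0 = h0"
| "sgd evl Ks b \<eta> h0 D J (Suc t) =
     sgd evl Ks b \<eta> h0 D J t -
     (\<eta> / real b) *\<^sub>R
       (\<Sum>i = b * t + 1..b * (t + 1).
          (evl (sgd evl Ks b \<eta> h0 D J t) (fst (D (J i))) - snd (D (J i))) *\<^sub>R Ks (fst (D (J i))))"

definition tail_averaged_sgd ::
    "('h::real_vector \<Rightarrow> 'g \<Rightarrow> real) \<Rightarrow> ('g \<Rightarrow> 'h) \<Rightarrow> nat \<Rightarrow> real \<Rightarrow> 'h \<Rightarrow>
     (nat \<Rightarrow> 'g \<times> real) \<Rightarrow> (nat \<Rightarrow> nat) \<Rightarrow> nat \<Rightarrow> 'h" where
  "tail_averaged_sgd evl Ks b \<eta> h0 D J T =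
     (2 / real T) *\<^sub>R (\<Sum>t = T div 2 + 1..T. sgd evl Ks b \<eta> h0 D J t)"

text \<open>
  The prescribed batch sizes and iteration numbers are real numbers. A batch size is rounded either
  way. A number of iterations is rounded, either way, to an even integer, because only for even
  \<open>T\<close> do the weights \<open>2 / T\<close> of the tail average sum to \<open>1\<close>.
\<close>

definition batch_size_for :: "real \<Rightarrow> nat \<Rightarrow> nat \<Rightarrow> bool" where
  "batch_size_for v n b \<longleftrightarrow> b \<in> {1..n} \<and> \<bar>real b - v\<bar> < 1"

definition iterations_for :: "real \<Rightarrow> nat \<Rightarrow> bool" where
  "iterations_for v T \<longleftrightarrow> even T \<and> \<bar>real T - v\<bar> < 2"

definition one_pass_sgd ::
    "real \<Rightarrow> real \<Rightarrow> real \<Rightarrow> real \<Rightarrow> real \<Rightarrow> nat \<Rightarrow> nat \<Rightarrow> real \<Rightarrow> nat \<Rightarrow> bool" where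
  "one_pass_sgd R M r \<nu> \<eta>0 n b \<eta> T \<longleftrightarrow>
     b = 1 \<and>
     \<eta> = \<eta>0 * (R\<^sup>2 / M\<^sup>2) * (M\<^sup>2 / (R\<^sup>2 * real n)) powr ((2 * r + \<nu> - 1) / (2 * r + \<nu>)) \<and>
     iterations_for (R\<^sup>2 / M\<^sup>2 * real n) T"

definition early_stopping_sgd ::
    "real \<Rightarrow> real \<Rightarrow> real \<Rightarrow> real \<Rightarrow> real \<Rightarrow> nat \<Rightarrow> nat \<Rightarrow> real \<Rightarrow> nat \<Rightarrow> bool" where
  "early_stopping_sgd R M r \<nu> \<eta>0 n b \<eta> T \<longleftrightarrow>
     batch_size_for (real n powr ((2 * r + \<nu> - 1) / (2 * r + \<nu>))) n b \<and>
     \<eta> = \<eta>0 \<and>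
     iterations_for ((R\<^sup>2 * real n / M\<^sup>2) powr (1 / (2 * r + \<nu>))) T"

definition batch_gd ::
    "real \<Rightarrow> real \<Rightarrow> real \<Rightarrow> real \<Rightarrow> real \<Rightarrow> nat \<Rightarrow> nat \<Rightarrow> real \<Rightarrow> nat \<Rightarrow> bool" where
  "batch_gd R M r \<nu> \<eta>0 n b \<eta> T \<longleftrightarrow>
     b = n \<and>
     \<eta> = \<eta>0 \<and>
     iterations_for ((R\<^sup>2 * real n / M\<^sup>2) powr (1 / (2 * r + \<nu>))) T"

end

theory Submission
  imports Defs
begin

text \<open>
  Let \<open>f = h\<^sub>0 - v\<^sub>0\<close> with \<open>S f = f\<^sub>\<rho>\<close>, and let \<open>v\<^sub>t = (I - \<eta> S\<^sup>* S)\<^sup>t v\<^sub>0\<close> be the bias of population gradient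
  descent, for which \<open>\<parallel>S v\<^sub>t\<parallel> \<lesssim> (\<eta> t)\<^sup>-\<^sup>r\<close> by the source condition. On a fixed sample, SGD splits into
  gradient descent plus a martingale, whose tail average costs \<open>\<eta> b\<^sup>-\<^sup>1 \<lambda> \<N>(\<lambda>)\<close> in squared prediction norm with
  \<open>\<lambda> = 1 / (\<eta> T)\<close>; and gradient descent minus \<open>f + v\<^sub>t\<close> solves a recursion driven by the sampling noise,
  the fluctuation of the empirical covariance along \<open>v\<^sub>t\<close>, and the second-stage error. An energy estimate
  bounds its prediction norm by the norms of these sources dual to \<open>\<parallel>S q\<parallel>\<^sup>2 + \<lambda> \<parallel>q\<parallel>\<^sup>2\<close>, as soon as the empirical
  quadratic form dominates \<open>\<parallel>S q\<parallel>\<^sup>2\<close> up to \<open>\<lambda> \<parallel>q\<parallel>\<^sup>2\<close>.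

  The sample size may depend on \<open>\<delta>\<close>, so only the sampling noise needs an exponential inequality, which
  gives the factor \<open>log(6/\<delta>)\<close>; second and fourth moments suffice for the other two events. The
  second-stage error enters through \<open>E \<parallel>K\<^sub>m - K\<^sub>m\<^sub>'\<parallel>\<^sup>2\<close> only: where it is too large for the comparison of
  quadratic forms, SGD grows at most like \<open>(\<eta> T)\<^bsup>1/2\<^esup>\<close> and Markov's inequality compensates for this.
\<close>

section \<open>Orthonormal series\<close>

text \<open>The hypothesis \<open>r \<ge> 1/2\<close> puts the target into the RKHS: by
  \<open>start\<close> the initial error \<open>S h0 - f\<rho>\<close> is the power \<open>r\<close>
  of \<open>LK\<close> at \<open>g0 - h\<rho>\<close>, and its lift \<open>v0\<close> has
  coefficients with the exponent \<open>r - 1/2\<close> in the singular system of \<open>S\<close>.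
  Sizes are measured in \<open>a = (R^2 n / M^2)^(1 / (2 r + \<nu>))\<close>:
  \<open>\<lambda>\<close> is of order \<open>1 / a\<close>, the effective dimension at most of
  order \<open>a^\<nu>\<close>, and its ratio to \<open>n\<close> at most of order
  \<open>a^(-2 r)\<close>, the square of the target rate. The second moment of the covariance
  fluctuation along \<open>v_t\<close> has this very order, so Markov's inequality needs one more
  small factor: the time average of the squared norms of \<open>v_t\<close> tends to 0, without a
  rate, and the sample size may wait for it. The noise has no such factor. The comparison of
  quadratic forms is made in finitely many directions that carry almost all of the effective
  dimension; the remaining part of it bounds what they miss. Given the first stage, only the mean of
  the squared second-stage error is known, so every bound is brought into a form affine in
  it.\<close>

definition orthonormal :: "'v::real_inner set \<Rightarrow> bool" where
  "orthonormal B \<longleftrightarrow> (\<forall>e\<in>B. \<forall>f\<in>B. e \<bullet> f = (if e = f then 1 else 0))"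

lemma orthonormal_iff: "orthonormal B \<longleftrightarrow> pairwise orthogonal B \<and> (\<forall>e\<in>B. norm e = 1)"
  unfolding orthonormal_def pairwise_def orthogonal_def norm_eq_1 by auto

lemma orthonormal_basis_orthonormal: "orthonormal_basis B \<Longrightarrow> orthonormal B"
  by (simp add: orthonormal_basis_def orthonormal_iff)

lemma orthonormal_subset: "orthonormal B \<Longrightarrow> A \<subseteq> B \<Longrightarrow> orthonormal A"
  unfolding orthonormal_def by blast

lemma orthonormal_norm: "orthonormal B \<Longrightarrow> e \<in> B \<Longrightarrow> norm e = 1"
  by (simp add: orthonormal_iff)

lemma orthonormal_inner_sum:
  assumes "orthonormal F" "finite F" "e \<in> F"
  shows "(\<Sum>f\<in>F. c f *\<^sub>R f) \<bullet> e = c e"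
proof -
  have "(\<Sum>f\<in>F. c f *\<^sub>R f) \<bullet> e = (\<Sum>f\<in>F. if f = e then c f else 0)"
    unfolding inner_sum_left using assms by (intro sum.cong) (auto simp: orthonormal_def)
  then show ?thesis using assms by simp
qed

lemma orthonormal_norm_sum:
  assumes "orthonormal F" "finite F"
  shows "(norm (\<Sum>f\<in>F. c f *\<^sub>R f))^2 = (\<Sum>f\<in>F. (c f)^2)"
proof -
  have "(\<Sum>f\<in>F. c f *\<^sub>R f) \<bullet> (\<Sum>f\<in>F. c f *\<^sub>R f) = (\<Sum>e\<in>F. c e * ((\<Sum>f\<in>F. c f *\<^sub>R f) \<bullet> e))"
    by (subst inner_sum_right) simp
  also have "\<dots> = (\<Sum>e\<in>F. (c e)^2)"
    using orthonormal_inner_sum[OF assms, of _ c] by (intro sum.cong) (auto simp: power2_eq_square)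
  finally show ?thesis by (simp add: power2_norm_eq_inner)
qed

lemma orthonormal_residual:
  assumes "orthonormal F" "finite F"
  shows "(norm (x - (\<Sum>f\<in>F. (x \<bullet> f) *\<^sub>R f)))^2 = (norm x)^2 - (\<Sum>f\<in>F. (x \<bullet> f)^2)"
proof -
  let ?p = "\<Sum>f\<in>F. (x \<bullet> f) *\<^sub>R f"
  have "x \<bullet> ?p = (\<Sum>f\<in>F. (x \<bullet> f)^2)" by (simp add: inner_sum_right power2_eq_square)
  moreover have "?p \<bullet> ?p = (\<Sum>f\<in>F. (x \<bullet> f)^2)"
    using orthonormal_norm_sum[OF assms, of "\<lambda>f. x \<bullet> f"] by (simp add: power2_norm_eq_inner)
  ultimately show ?thesis
    by (simp add: power2_norm_eq_inner inner_diff_left inner_diff_right inner_commute)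
qed

lemma bessel_finite:
  assumes "orthonormal F" "finite F"
  shows "(\<Sum>f\<in>F. (x \<bullet> f)^2) \<le> (norm x)^2"
  using orthonormal_residual[OF assms, of x] zero_le_power2[of "norm (x - (\<Sum>f\<in>F. (x \<bullet> f) *\<^sub>R f))"]
  by linarith

lemma bessel_summable:
  assumes "orthonormal B"
  shows "(\<lambda>e. (x \<bullet> e)^2) summable_on B"
  by (rule nonneg_bounded_partial_sums_imp_summable_on[where C = "(norm x)^2"])
     (auto intro!: eventually_finite_subsets_at_top_weakI bessel_finite orthonormal_subset[OF assms])

text \<open>A finite \<open>F0\<close> carries the sum of squares up to \<open>r/2\<close>; by
  Pythagoras any further finite set of terms adds a vector of norm below \<open>d/2\<close>. The
  partial sums therefore form a Cauchy net, indexed by finite subsets because \<open>B\<close> may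
  be uncountable.\<close>

lemma orthonormal_series_summable:
  fixes B :: "'v::{real_inner,banach} set"
  assumes B: "orthonormal B" and c: "(\<lambda>e. (c e)^2) summable_on B"
  shows "(\<lambda>e. c e *\<^sub>R e) summable_on B"
proof -
  have "\<exists>P. eventually P (finite_subsets_at_top B) \<and>
     (\<forall>F F'. P F \<and> P F' \<longrightarrow> dist (\<Sum>e\<in>F. c e *\<^sub>R e) (\<Sum>e\<in>F'. c e *\<^sub>R e) < d)" if "d > 0" for d
  proof -
    obtain L where L: "((\<lambda>e. (c e)^2) has_sum L) B" using c by (auto simp: summable_on_def)
    define r where "r = (d / 2)^2"
    have "r > 0" using that by (simp add: r_def)
    obtain F0 where F0: "finite F0" "F0 \<subseteq> B" "dist (\<Sum>e\<in>F0. (c e)^2) L \<le> r/2"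
      using has_sum_finite_approximation[OF L, of "r/2"] \<open>r > 0\<close> by auto
    have small: "dist (\<Sum>e\<in>F. c e *\<^sub>R e) (\<Sum>e\<in>F0. c e *\<^sub>R e) < d / 2"
      if F: "finite F" "F0 \<subseteq> F" "F \<subseteq> B" for F
    proof -
      have "(\<Sum>e\<in>F. (c e)^2) \<le> L"
        by (rule finite_sum_le_has_sum[OF L]) (use F in auto)
      moreover have "L - (\<Sum>e\<in>F0. (c e)^2) \<le> r / 2"
        using F0(3) unfolding dist_real_def by linarith
      moreover have "(\<Sum>e\<in>F - F0. (c e)^2) = (\<Sum>e\<in>F. (c e)^2) - (\<Sum>e\<in>F0. (c e)^2)"
        using F by (intro sum_diff) auto
      ultimately have "(\<Sum>e\<in>F - F0. (c e)^2) \<le> r / 2" by linarith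
      moreover have "(norm (\<Sum>e\<in>F - F0. c e *\<^sub>R e))^2 = (\<Sum>e\<in>F - F0. (c e)^2)"
        using F by (intro orthonormal_norm_sum orthonormal_subset[OF B]) auto
      ultimately have "(norm (\<Sum>e\<in>F - F0. c e *\<^sub>R e))^2 < r" using \<open>r > 0\<close> by linarith
      then have "(norm (\<Sum>e\<in>F - F0. c e *\<^sub>R e))^2 < (d/2)^2" by (simp add: r_def)
      then have "norm (\<Sum>e\<in>F - F0. c e *\<^sub>R e) < d / 2"
        using \<open>d > 0\<close> by (meson less_eq_real_def half_gt_zero power_less_imp_less_base)
      then show ?thesis using F by (simp add: sum_diff dist_norm)
    qed
    show ?thesis
    proof (intro exI conjI allI impI)
      show "eventually (\<lambda>F. finite F \<and> F0 \<subseteq> F \<and> F \<subseteq> B) (finite_subsets_at_top B)"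
        unfolding eventually_finite_subsets_at_top using F0 by blast
      fix F F' assume "(finite F \<and> F0 \<subseteq> F \<and> F \<subseteq> B) \<and> (finite F' \<and> F0 \<subseteq> F' \<and> F' \<subseteq> B)"
      then show "dist (\<Sum>e\<in>F. c e *\<^sub>R e) (\<Sum>e\<in>F'. c e *\<^sub>R e) < d"
        using small[of F] small[of F'] by (smt (verit) dist_triangle2 field_sum_of_halves)
    qed
  qed
  then have "cauchy_filter (filtermap (sum (\<lambda>e. c e *\<^sub>R e)) (finite_subsets_at_top B))"
    by (simp add: cauchy_filter_metric_filtermap)
  then obtain L' where "(sum (\<lambda>e. c e *\<^sub>R e) \<longlongrightarrow> L') (finite_subsets_at_top B)"
    using complete_uniform[where S="UNIV :: 'v set"] complete_UNIV[where 'a='v]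
    by (force simp add: filterlim_def)
  then show ?thesis using summable_on_def has_sum_def by blast
qed

lemma has_sum_orthonormal_series:
  fixes B :: "'v::{real_inner,banach} set"
  assumes "orthonormal B" "(\<lambda>e. (c e)^2) summable_on B"
  shows "((\<lambda>e. c e *\<^sub>R e) has_sum (\<Sum>\<^sub>\<infinity>e\<in>B. c e *\<^sub>R e)) B"
  using orthonormal_series_summable[OF assms] by simp

lemma has_sum_inner_orthonormal_series:
  fixes B :: "'v::{real_inner,banach} set"
  assumes "orthonormal B" "(\<lambda>e. (c e)^2) summable_on B"
  shows "((\<lambda>e. c e * (e \<bullet> x)) has_sum ((\<Sum>\<^sub>\<infinity>e\<in>B. c e *\<^sub>R e) \<bullet> x)) B"
  using has_sum_bounded_linear[OF bounded_linear_inner_left has_sum_orthonormal_series[OF assms], of x] by simp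

lemma orthonormal_series_inner:
  fixes B :: "'v::{real_inner,banach} set"
  assumes "orthonormal B" "(\<lambda>e. (c e)^2) summable_on B"
  shows "(\<Sum>\<^sub>\<infinity>e\<in>B. c e *\<^sub>R e) \<bullet> x = (\<Sum>\<^sub>\<infinity>e\<in>B. c e * (e \<bullet> x))"
  using has_sum_inner_orthonormal_series[OF assms, of x] by (simp add: infsumI)

lemma orthonormal_series_coeff:
  fixes B :: "'v::{real_inner,banach} set"
  assumes B: "orthonormal B" and c: "(\<lambda>e. (c e)^2) summable_on B" and e: "e \<in> B"
  shows "(\<Sum>\<^sub>\<infinity>e\<in>B. c e *\<^sub>R e) \<bullet> e = c e"
proof -
  have "(\<Sum>\<^sub>\<infinity>f\<in>B. c f * (f \<bullet> e)) = (\<Sum>\<^sub>\<infinity>f\<in>{e}. c f * (f \<bullet> e))"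
    using B e by (intro infsum_cong_neutral) (auto simp: orthonormal_def)
  then show ?thesis using B e by (simp add: orthonormal_series_inner[OF B c] orthonormal_def)
qed

lemma orthonormal_series_norm:
  fixes B :: "'v::{real_inner,banach} set"
  assumes B: "orthonormal B" and c: "(\<lambda>e. (c e)^2) summable_on B"
  shows "(norm (\<Sum>\<^sub>\<infinity>e\<in>B. c e *\<^sub>R e))^2 = (\<Sum>\<^sub>\<infinity>e\<in>B. (c e)^2)"
proof -
  have "(norm (\<Sum>\<^sub>\<infinity>e\<in>B. c e *\<^sub>R e))^2 = (\<Sum>\<^sub>\<infinity>e\<in>B. c e * (e \<bullet> (\<Sum>\<^sub>\<infinity>e\<in>B. c e *\<^sub>R e)))"
    by (simp add: power2_norm_eq_inner orthonormal_series_inner[OF B c])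
  also have "\<dots> = (\<Sum>\<^sub>\<infinity>e\<in>B. (c e)^2)"
  proof (intro infsum_cong)
    fix e assume "e \<in> B"
    then show "c e * (e \<bullet> (\<Sum>\<^sub>\<infinity>e\<in>B. c e *\<^sub>R e)) = (c e)^2"
      using orthonormal_series_coeff[OF B c, of e] by (simp add: inner_commute power2_eq_square)
  qed
  finally show ?thesis .
qed

text \<open>Also used with orthonormal sets that need not be complete:
  \<open>proj_on B x = x\<close> then says that \<open>x\<close> lies in the closed span of
  \<open>B\<close>.\<close>

definition proj_on :: "'v::{real_inner,banach} set \<Rightarrow> 'v \<Rightarrow> 'v" where
  "proj_on B x = (\<Sum>\<^sub>\<infinity>e\<in>B. (x \<bullet> e) *\<^sub>R e)"

lemma proj_on_residual:
  assumes "orthonormal B" "e \<in> B" shows "(x - proj_on B x) \<bullet> e = 0"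
  unfolding proj_on_def inner_diff_left
  by (simp add: orthonormal_series_coeff[OF assms(1) bessel_summable[OF assms(1)] assms(2)])

lemma orthonormal_basis_complete:
  fixes z :: "'v::{real_inner,banach}"
  assumes "orthonormal_basis B" "\<And>e. e \<in> B \<Longrightarrow> z \<bullet> e = 0" shows "z = 0"
proof -
  have "span B \<subseteq> {x. z \<bullet> x = 0}"
    using assms(2) by (intro span_minimal) (auto simp: subspace_def inner_right_distrib)
  moreover have "closed {x. z \<bullet> x = 0}"
    by (intro closed_Collect_eq continuous_intros)
  ultimately have "closure (span B) \<subseteq> {x. z \<bullet> x = 0}" by (rule closure_minimal)
  then have "z \<in> {x. z \<bullet> x = 0}" using assms(1) unfolding orthonormal_basis_def by blast
  then show ?thesis by simp
qed

text \<open>\<open>x - proj_on B x\<close> is orthogonal to \<open>B\<close>, hence zero by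
  \<open>complete\<close>, and the Fourier series of \<open>x\<close> exhibits it as a limit of
  finite combinations.\<close>

lemma orthonormal_basisI:
  fixes B :: "'v::{real_inner,banach} set"
  assumes B: "orthonormal B" and complete: "\<And>z. (\<And>e. e \<in> B \<Longrightarrow> z \<bullet> e = 0) \<Longrightarrow> z = 0"
  shows "orthonormal_basis B"
proof -
  have "x \<in> closure (span B)" for x
  proof -
    have "x - proj_on B x = 0"
      by (rule complete) (simp add: proj_on_residual[OF B])
    then have sum: "((\<lambda>e. (x \<bullet> e) *\<^sub>R e) has_sum x) B"
      using has_sum_orthonormal_series[OF B bessel_summable[OF B], of x] by (simp add: proj_on_def)
    show ?thesis unfolding closure_approachable
    proof (intro allI impI)
      fix d :: real assume "d > 0"
      then obtain F where F: "finite F" "F \<subseteq> B" "dist (\<Sum>e\<in>F. (x \<bullet> e) *\<^sub>R e) x \<le> d/2"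
        using has_sum_finite_approximation[OF sum, of "d/2"] by auto
      moreover have "(\<Sum>e\<in>F. (x \<bullet> e) *\<^sub>R e) \<in> span B"
        using F by (intro span_sum span_mul span_base) auto
      ultimately show "\<exists>y\<in>span B. dist y x < d" using \<open>d > 0\<close> by force
    qed
  qed
  then show ?thesis using B by (auto simp: orthonormal_basis_def orthonormal_iff)
qed

lemma orthonormal_basis_expand:
  fixes B :: "'v::{real_inner,banach} set"
  assumes "orthonormal_basis B"
  shows "proj_on B x = x"
proof -
  have B: "orthonormal B" by (rule orthonormal_basis_orthonormal[OF assms])
  have "x - proj_on B x = 0"
    by (rule orthonormal_basis_complete[OF assms]) (simp add: proj_on_residual[OF B])
  then show ?thesis by simp
qed

lemma parseval:
  fixes B :: "'v::{real_inner,banach} set"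
  assumes "orthonormal_basis B"
  shows "((\<lambda>e. (x \<bullet> e) * (y \<bullet> e)) has_sum (x \<bullet> y)) B"
proof -
  have B: "orthonormal B" by (rule orthonormal_basis_orthonormal[OF assms])
  show ?thesis
    using has_sum_inner_orthonormal_series[OF B bessel_summable[OF B], of x y]
      orthonormal_basis_expand[OF assms, of x] by (simp add: proj_on_def inner_commute)
qed

lemma parseval_norm:
  fixes B :: "'v::{real_inner,banach} set"
  assumes "orthonormal_basis B"
  shows "((\<lambda>e. (x \<bullet> e)^2) has_sum (norm x)\<^sup>2) B"
  using parseval[OF assms, of x x] unfolding power2_norm_eq_inner by (simp add: power2_eq_square)

section \<open>Positive trace class operators\<close>

lemma le_of_square_le_mult: "a * a \<le> b * a \<Longrightarrow> 0 \<le> b \<Longrightarrow> a \<le> (b::real)"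
  by (cases "a > 0") (auto dest: mult_right_le_imp_le)

text \<open>The trace is bounded over finite orthonormal families only, so that no basis is
  presupposed before the eigenbasis is constructed. This bound is the source of compactness.\<close>

locale positive_trace_class =
  fixes A :: "'v::{real_inner,banach} \<Rightarrow> 'v" and C :: real
  assumes bounded: "bounded_linear A"
    and selfadjoint: "A x \<bullet> y = x \<bullet> A y"
    and positive: "A x \<bullet> x \<ge> 0"
    and trace_bound: "orthonormal F \<Longrightarrow> finite F \<Longrightarrow> (\<Sum>e\<in>F. A e \<bullet> e) \<le> C"
begin

lemma linear: "linear A"
  using bounded by (rule bounded_linear.linear)

lemma cauchy_schwarz: "(A x \<bullet> y)^2 \<le> (A x \<bullet> x) * (A y \<bullet> y)"
proof -
  have "0 \<le> A (t *\<^sub>R x + y) \<bullet> (t *\<^sub>R x + y)" for t by (rule positive)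
  then have q: "0 \<le> (A x \<bullet> x) * t^2 + 2 * (A x \<bullet> y) * t + A y \<bullet> y" for t
    using selfadjoint[of y x]
    by (simp add: linear_add[OF linear] linear_scale[OF linear] inner_simps power2_eq_square
        inner_commute algebra_simps)
  show ?thesis
  proof (cases "A x \<bullet> x = 0")
    case True
    have "A x \<bullet> y = 0"
    proof (rule ccontr)
      assume "A x \<bullet> y \<noteq> 0"
      \<comment> \<open>Without a leading term the form is affine in \<open>t\<close>, and this
        \<open>t\<close> gives it the value -1.\<close>
      then show False using q[of "- (A y \<bullet> y + 1) / (2 * (A x \<bullet> y))"] True by simp
    qed
    then show ?thesis using True by simp
  next
    case False
    with positive[of x] have p: "A x \<bullet> x > 0" by simp
    have "0 \<le> (A x \<bullet> x) * ((A x \<bullet> x) * (- (A x \<bullet> y) / (A x \<bullet> x))^2 + 2 * (A x \<bullet> y) * (- (A x \<bullet> y) / (A x \<bullet> x)) + A y \<bullet> y)"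
      by (intro mult_nonneg_nonneg q less_imp_le[OF p])
    also have "\<dots> = (A x \<bullet> x) * (A y \<bullet> y) - (A x \<bullet> y)^2"
      using p by (simp add: field_simps power2_eq_square)
    finally show ?thesis by simp
  qed
qed

text \<open>Cauchy-Schwarz for the form \<open>A x \<bullet> y\<close> with \<open>y = A x\<close>,
  divided by \<open>(norm (A x))^2\<close>.\<close>

lemma norm_sq_le: "(norm (A x))^2 \<le> onorm A * (A x \<bullet> x)"
proof -
  have "(A x \<bullet> A x)^2 \<le> (A x \<bullet> x) * (A (A x) \<bullet> A x)"
    by (rule cauchy_schwarz)
  also have "A (A x) \<bullet> A x \<le> norm (A (A x)) * norm (A x)" by (rule norm_cauchy_schwarz)
  also have "\<dots> \<le> (onorm A * norm (A x)) * norm (A x)"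
    by (intro mult_right_mono onorm bounded) auto
  also have "\<dots> = onorm A * (norm (A x))^2" by (simp add: power2_eq_square)
  finally have "(norm (A x))^2 * (norm (A x))^2 \<le> (onorm A * (A x \<bullet> x)) * (norm (A x))^2"
    using mult_left_mono[OF _ positive[of x]]
    unfolding power2_norm_eq_inner[symmetric] power2_eq_square by (smt (verit) mult.assoc mult.commute)
  then show ?thesis
    by (rule le_of_square_le_mult) (simp add: onorm_pos_le[OF bounded] positive)
qed

text \<open>An orthonormal family with \<open>A e \<bullet> e \<ge> \<epsilon>\<close> throughout
  has at most \<open>C / \<epsilon>\<close> members. One of maximal size works: a vector orthogonal
  to it that violates the bound could be normalized and added.\<close>

lemma small_off_finite:
  assumes "\<epsilon> > 0"
  obtains F where "finite F" "orthonormal F"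
    "\<And>x. (\<And>e. e \<in> F \<Longrightarrow> x \<bullet> e = 0) \<Longrightarrow> A x \<bullet> x \<le> \<epsilon> * (norm x)^2"
proof -
  define \<F> where "\<F> = {F. finite F \<and> orthonormal F \<and> (\<forall>e\<in>F. A e \<bullet> e \<ge> \<epsilon>)}"
  have "{} \<in> \<F>" by (simp add: \<F>_def orthonormal_def)
  have card: "card F \<le> nat \<lceil>C / \<epsilon>\<rceil>" if "F \<in> \<F>" for F
  proof -
    have "real (card F) * \<epsilon> \<le> (\<Sum>e\<in>F. A e \<bullet> e)"
      using that by (intro sum_bounded_below) (auto simp: \<F>_def)
    also have "\<dots> \<le> C" using that by (intro trace_bound) (auto simp: \<F>_def)
    finally have "real (card F) \<le> C / \<epsilon>" using assms by (simp add: field_simps)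
    then show ?thesis by linarith
  qed
  obtain F where F: "F \<in> \<F>" and max: "\<And>G. G \<in> \<F> \<Longrightarrow> card G \<le> card F"
    using ex_has_greatest_nat[of "\<lambda>F. F \<in> \<F>" "{}" card "nat \<lceil>C / \<epsilon>\<rceil> + 1"] \<open>{} \<in> \<F>\<close> card
    by (metis le_imp_less_Suc Suc_eq_plus1)
  show thesis
  proof (rule that)
    show "finite F" "orthonormal F" using F by (auto simp: \<F>_def)
    fix x assume perp: "\<And>e. e \<in> F \<Longrightarrow> x \<bullet> e = 0"
    show "A x \<bullet> x \<le> \<epsilon> * (norm x)^2"
    proof (rule ccontr)
      assume neg: "\<not> ?thesis"
      then have "x \<noteq> 0" by auto
      define u where "u = (1 / norm x) *\<^sub>R x"
      have u: "u \<bullet> u = 1" "\<And>e. e \<in> F \<Longrightarrow> u \<bullet> e = 0"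
        using \<open>x \<noteq> 0\<close> perp by (auto simp: u_def power2_norm_eq_inner[symmetric] power2_eq_square)
      have "A u \<bullet> u = (A x \<bullet> x) / (norm x)^2"
        by (simp add: u_def linear_scale[OF linear] power2_eq_square)
      then have "A u \<bullet> u > \<epsilon>" using neg \<open>x \<noteq> 0\<close> by (simp add: pos_less_divide_eq)
      moreover have "u \<notin> F" using u by force
      ultimately have "insert u F \<in> \<F>"
        using F u by (auto simp: \<F>_def orthonormal_def inner_commute)
      then have "card (insert u F) \<le> card F" by (rule max)
      then show False using \<open>u \<notin> F\<close> F by (auto simp: \<F>_def)
    qed
  qed
qed

text \<open>For orthonormal \<open>F\<close> this cube contains the projection of the unit ball onto
  the span of \<open>F\<close>.\<close>

lemma compact_combinations:
  assumes "finite (F :: 'v set)"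
  shows "compact {\<Sum>e\<in>F. c e *\<^sub>R e |c. \<forall>e\<in>F. \<bar>c e\<bar> \<le> (1::real)}"
  using assms
proof induction
  case empty then show ?case by simp
next
  case (insert f F)
  let ?K = "{\<Sum>e\<in>F. c e *\<^sub>R e |c. \<forall>e\<in>F. \<bar>c e\<bar> \<le> (1::real)}"
  have "compact ((\<lambda>t. t *\<^sub>R f) ` {-1..1::real})"
    by (intro compact_continuous_image continuous_intros compact_Icc)
  then have "compact {x + y |x y. x \<in> (\<lambda>t. t *\<^sub>R f) ` {-1..1} \<and> y \<in> ?K}"
    by (rule compact_sums) (rule insert)
  also have "{x + y |x y. x \<in> (\<lambda>t. t *\<^sub>R f) ` {-1..1} \<and> y \<in> ?K}
      = {\<Sum>e\<in>insert f F. c e *\<^sub>R e |c. \<forall>e\<in>insert f F. \<bar>c e\<bar> \<le> (1::real)}" (is "?L = ?R")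
  proof (intro set_eqI iffI)
    fix z assume "z \<in> ?L"
    then obtain t c where tc: "\<bar>t\<bar> \<le> 1" "\<forall>e\<in>F. \<bar>c e\<bar> \<le> (1::real)" "z = t *\<^sub>R f + (\<Sum>e\<in>F. c e *\<^sub>R e)"
      by (auto simp: abs_le_iff)
    have "(\<Sum>e\<in>F. (c(f := t)) e *\<^sub>R e) = (\<Sum>e\<in>F. c e *\<^sub>R e)"
      using insert by (intro sum.cong) auto
    then have "z = (\<Sum>e\<in>insert f F. (c(f := t)) e *\<^sub>R e)" using insert tc by simp
    moreover have "\<forall>e\<in>insert f F. \<bar>(c(f := t)) e\<bar> \<le> 1" using tc by auto
    ultimately show "z \<in> ?R" by blast
  next
    fix z assume "z \<in> ?R"
    then obtain c where "\<forall>e\<in>insert f F. \<bar>c e\<bar> \<le> (1::real)" "z = c f *\<^sub>R f + (\<Sum>e\<in>F. c e *\<^sub>R e)"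
      using insert by auto
    then have "c f *\<^sub>R f \<in> (\<lambda>t. t *\<^sub>R f) ` {-1..1}" "(\<Sum>e\<in>F. c e *\<^sub>R e) \<in> ?K" "z = c f *\<^sub>R f + (\<Sum>e\<in>F. c e *\<^sub>R e)"
      by (auto simp: abs_le_iff)
    then show "z \<in> ?L" by blast
  qed
  finally show ?case .
qed

text \<open>Up to \<open>d/4\<close> the image of the ball lies in the image of the compact cube
  over the family from \<open>small_off_finite\<close>: on the orthogonal remainder
  \<open>norm_sq_le\<close> turns a small quadratic form into a small norm.\<close>

lemma compact_closure_image: "compact (closure (A ` cball 0 1))"
proof -
  have "\<exists>k. finite k \<and> closure (A ` cball 0 1) \<subseteq> (\<Union>x\<in>k. ball x d)" if "d > 0" for d
  proof -
    \<comment> \<open>The summand 1 keeps \<open>M\<close> positive;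
      \<open>M * \<epsilon> = (d/4)^2\<close> is what the last estimate asks for.\<close>
    define M where "M = onorm A + 1"
    have "M > 0" using onorm_pos_le[OF bounded] by (simp add: M_def)
    define \<epsilon> where "\<epsilon> = (d / 4)^2 / M"
    have "\<epsilon> > 0" using \<open>M > 0\<close> that by (simp add: \<epsilon>_def)
    obtain F where F: "finite F" "orthonormal F"
      and small: "\<And>x. (\<And>e. e \<in> F \<Longrightarrow> x \<bullet> e = 0) \<Longrightarrow> A x \<bullet> x \<le> \<epsilon> * (norm x)^2"
      using small_off_finite[OF \<open>\<epsilon> > 0\<close>] by blast
    define K where "K = {\<Sum>e\<in>F. c e *\<^sub>R e |c. \<forall>e\<in>F. \<bar>c e\<bar> \<le> (1::real)}"
    have "compact (A ` K)"
      unfolding K_def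
      by (intro compact_continuous_image compact_combinations F linear_continuous_on bounded)
    then obtain k where k: "finite k" "A ` K \<subseteq> (\<Union>x\<in>k. ball x (d/2))"
      unfolding compact_eq_totally_bounded using \<open>d > 0\<close> by (meson half_gt_zero)
    have "A ` cball 0 1 \<subseteq> (\<Union>x\<in>k. cball x (3 * d / 4))"
    proof
      fix y assume "y \<in> A ` cball 0 1"
      then obtain x where x: "y = A x" "norm x \<le> 1" by auto
      define p where "p = (\<Sum>e\<in>F. (x \<bullet> e) *\<^sub>R e)"
      have "\<bar>x \<bullet> e\<bar> \<le> 1" if "e \<in> F" for e
        using Cauchy_Schwarz_ineq2[of x e] orthonormal_norm[OF F(2) that] x by simp
      then have "p \<in> K" unfolding p_def K_def by blast
      then obtain c where c: "c \<in> k" "dist c (A p) < d / 2" using k by auto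
      have "(norm (x - p))^2 \<le> (norm x)^2"
        unfolding p_def orthonormal_residual[OF F(2,1)] by (simp add: sum_nonneg)
      then have nxp: "(norm (x - p))^2 \<le> 1" using x by (meson norm_ge_zero order_trans power_le_one)
      have "A (x - p) \<bullet> (x - p) \<le> \<epsilon> * (norm (x - p))^2"
        by (rule small) (simp add: p_def inner_diff_left orthonormal_inner_sum[OF F(2,1)])
      also have "\<dots> \<le> \<epsilon>" using nxp \<open>\<epsilon> > 0\<close> by simp
      finally have *: "A (x - p) \<bullet> (x - p) \<le> \<epsilon>" .
      have "(norm (A (x - p)))^2 \<le> onorm A * (A (x - p) \<bullet> (x - p))" by (rule norm_sq_le)
      also have "\<dots> \<le> M * \<epsilon>"
        using * positive onorm_pos_le[OF bounded] by (intro mult_mono) (auto simp: M_def)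
      also have "\<dots> = (d/4)^2" using \<open>M > 0\<close> by (simp add: \<epsilon>_def)
      finally have "norm (A (x - p)) \<le> d / 4" using \<open>d > 0\<close> by (simp add: power2_le_iff_abs_le)
      then have "dist (A p) y \<le> d / 4" using x by (simp add: dist_norm linear_diff[OF linear] norm_minus_commute)
      then have "dist c y \<le> 3 * d / 4" using c dist_triangle[of c y "A p"] by simp
      then show "y \<in> (\<Union>x\<in>k. cball x (3 * d / 4))" using c by auto
    qed
    then have "closure (A ` cball 0 1) \<subseteq> (\<Union>x\<in>k. cball x (3 * d / 4))"
      by (rule closure_minimal) (use k in auto)
    also have "\<dots> \<subseteq> (\<Union>x\<in>k. ball x d)" using \<open>d > 0\<close> by force
    finally show ?thesis using k by blast
  qed
  then show ?thesis
    unfolding compact_eq_totally_bounded by (simp add: complete_eq_closed)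
qed

text \<open>Maximize the Rayleigh quotient on the unit sphere of \<open>V\<close>. For a maximizing
  sequence \<open>s *\<^sub>R X n - A (X n)\<close> tends to 0; compactness lets
  \<open>A (X n)\<close> converge along a subsequence, and division by \<open>s > 0\<close> makes
  \<open>X n\<close> itself converge. If \<open>s = 0\<close>, then \<open>A\<close> annihilates the
  unit vector \<open>z1\<close>.\<close>

lemma eigenvector_exists:
  assumes V: "subspace V" "closed V" and inv: "\<And>x. x \<in> V \<Longrightarrow> A x \<in> V" and z: "z \<in> V" "z \<noteq> 0"
  shows "\<exists>e\<in>V. norm e = 1 \<and> (\<exists>c. A e = c *\<^sub>R e)"
proof -
  define R where "R = {A x \<bullet> x |x. x \<in> V \<and> norm x = 1}"
  define s where "s = Sup R"
  define z1 where "z1 = (1 / norm z) *\<^sub>R z"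
  have z1: "z1 \<in> V" "norm z1 = 1" using z V by (auto simp: z1_def subspace_scale)
  then have "R \<noteq> {}" unfolding R_def by blast
  have "bdd_above R"
  proof (rule bdd_aboveI)
    fix t assume "t \<in> R"
    then obtain x where x: "norm x = 1" "t = A x \<bullet> x" by (auto simp: R_def)
    have "t \<le> norm (A x) * norm x" unfolding x(2) by (rule norm_cauchy_schwarz)
    also have "\<dots> \<le> onorm A" using onorm[OF bounded, of x] x by simp
    finally show "t \<le> onorm A" .
  qed
  then have unit_le: "A x \<bullet> x \<le> s" if "x \<in> V" "norm x = 1" for x
    unfolding s_def using that by (intro cSup_upper) (auto simp: R_def)
  have le: "A x \<bullet> x \<le> s * (norm x)^2" if "x \<in> V" for x
  proof (cases "x = 0")
    case True then show ?thesis by (simp add: linear_0[OF linear])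
  next
    case False
    have "A ((1 / norm x) *\<^sub>R x) \<bullet> ((1 / norm x) *\<^sub>R x) \<le> s"
      using False that V by (intro unit_le) (auto simp: subspace_scale)
    then show ?thesis using False
      by (simp add: linear_scale[OF linear] field_simps power2_eq_square)
  qed
  have "s \<ge> 0" using unit_le[OF z1] positive[of z1] by linarith
  show ?thesis
  proof (cases "s = 0")
    case True
    have "A z1 \<bullet> z1 = 0" using unit_le[OF z1] positive[of z1] True by simp
    then have "(norm (A z1))^2 \<le> 0" using norm_sq_le[of z1] by simp
    then have "A z1 = 0 *\<^sub>R z1" by simp
    then show ?thesis using z1 by blast
  next
    case False
    with \<open>s \<ge> 0\<close> have "s > 0" by simp
    have "\<exists>x. x \<in> V \<and> norm x = 1 \<and> s - inverse (real (Suc n)) < A x \<bullet> x" for n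
    proof -
      have "s - inverse (real (Suc n)) < Sup R" by (simp add: s_def)
      then obtain t where "t \<in> R" "s - inverse (real (Suc n)) < t"
        using less_cSup_iff[OF \<open>R \<noteq> {}\<close> \<open>bdd_above R\<close>] by blast
      then show ?thesis by (auto simp: R_def)
    qed
    then obtain X where X: "\<And>n. X n \<in> V" "\<And>n. norm (X n) = 1"
      "\<And>n. s - inverse (real (Suc n)) < A (X n) \<bullet> X n"
      using choice[of "\<lambda>n x. x \<in> V \<and> norm x = 1 \<and> s - inverse (real (Suc n)) < A x \<bullet> x"] by blast
    define Y where "Y n = s *\<^sub>R X n - A (X n)" for n
    have Y_le: "(norm (Y n))^2 \<le> s * inverse (real (Suc n))" for n
    proof -
      \<comment> \<open>Since \<open>A\<close> maps \<open>V\<close> into itself, the bound by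
        \<open>s\<close> applies to \<open>A (X n)\<close> as well, which gives \<open>s\<close>
        where \<open>norm_sq_le\<close> has \<open>onorm A\<close>.\<close>
      have ax: "(norm (A (X n)))^2 \<le> s * (A (X n) \<bullet> X n)"
      proof -
        have "(A (X n) \<bullet> A (X n))^2 \<le> (A (X n) \<bullet> X n) * (A (A (X n)) \<bullet> A (X n))"
          by (rule cauchy_schwarz)
        also have "\<dots> \<le> (A (X n) \<bullet> X n) * (s * (norm (A (X n)))^2)"
          by (intro mult_left_mono le inv X positive)
        finally have "(norm (A (X n)))^2 * (norm (A (X n)))^2 \<le> (s * (A (X n) \<bullet> X n)) * (norm (A (X n)))^2"
          by (simp add: power2_norm_eq_inner[symmetric] power2_eq_square mult_ac)
        then show ?thesis by (rule le_of_square_le_mult) (use \<open>s > 0\<close> positive[of "X n"] in simp)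
      qed
      have "(norm (Y n))^2 = s^2 - 2 * s * (A (X n) \<bullet> X n) + (norm (A (X n)))^2"
      proof -
        have "X n \<bullet> X n = 1" using X(2)[of n] by (simp add: norm_eq_1)
        then show ?thesis
          using inner_commute[of "X n" "A (X n)"]
          unfolding power2_norm_eq_inner Y_def by (simp add: inner_diff_left inner_diff_right power2_eq_square right_diff_distrib)
      qed
      also have "\<dots> \<le> s * (s - A (X n) \<bullet> X n)" using ax by (simp add: algebra_simps power2_eq_square)
      also have "\<dots> \<le> s * inverse (real (Suc n))" using X(3)[of n] \<open>s > 0\<close> by (intro mult_left_mono) auto
      finally show ?thesis .
    qed
    have "(\<lambda>n. s * inverse (real (Suc n))) \<longlonglongrightarrow> s * 0"
      by (intro tendsto_mult tendsto_const LIMSEQ_inverse_real_of_nat)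
    then have "(\<lambda>n. (norm (Y n))^2) \<longlonglongrightarrow> 0"
      unfolding mult_zero_right
      by (rule tendsto_sandwich[OF _ _ tendsto_const, rotated 2])
         (simp_all only: Y_le zero_le_power2 eventually_True)
    then have "(\<lambda>n. sqrt ((norm (Y n))^2)) \<longlonglongrightarrow> sqrt 0" by (rule tendsto_real_sqrt)
    then have Y0: "Y \<longlonglongrightarrow> 0"
      unfolding real_sqrt_zero real_sqrt_abs abs_norm_cancel by (rule tendsto_norm_zero_cancel)
    have "A (X n) \<in> closure (A ` cball 0 1)" for n
      by (rule subsetD[OF closure_subset], rule imageI) (simp add: X(2))
    then obtain l \<phi> where \<phi>: "strict_mono (\<phi> :: nat \<Rightarrow> nat)" "((\<lambda>n. A (X n)) \<circ> \<phi>) \<longlonglongrightarrow> l"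
      using seq_compactE[OF compact_imp_seq_compact[OF compact_closure_image], of "\<lambda>n. A (X n)"] by blast
    define x where "x = (1 / s) *\<^sub>R l"
    have "(\<lambda>n. (1 / s) *\<^sub>R (A (X (\<phi> n)) + Y (\<phi> n))) \<longlonglongrightarrow> (1 / s) *\<^sub>R (l + 0)"
      using \<phi> LIMSEQ_subseq_LIMSEQ[OF Y0 \<phi>(1)] by (intro tendsto_intros) (auto simp: o_def)
    moreover have "(1 / s) *\<^sub>R (A (X n) + Y n) = X n" for n using \<open>s > 0\<close> by (simp add: Y_def)
    ultimately have Xx: "(\<lambda>n. X (\<phi> n)) \<longlonglongrightarrow> x" unfolding x_def by (simp only: add_0_right)
    have "x \<in> V" using closed_sequentially[OF V(2) _ Xx] X by blast
    moreover have "norm x = 1" using tendsto_norm[OF Xx] X(2) by (simp add: LIMSEQ_const_iff)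
    moreover have "A x = s *\<^sub>R x"
    proof -
      have "(\<lambda>n. A (X (\<phi> n))) \<longlonglongrightarrow> A x" by (rule bounded_linear.tendsto[OF bounded Xx])
      then have "A x = l" using \<phi>(2) by (intro LIMSEQ_unique[of "\<lambda>n. A (X (\<phi> n))"]) (simp_all add: o_def)
      then show ?thesis using \<open>s > 0\<close> by (simp add: x_def)
    qed
    ultimately show ?thesis by blast
  qed
qed

text \<open>Zorn's lemma on orthonormal sets of eigenvectors. The orthogonal complement of a maximal
  one is closed and invariant, so a nonzero vector in it would yield one more eigenvector.\<close>

theorem eigenbasis_exists: "\<exists>B. eigenbasis A B"
proof -
  define \<B> where "\<B> = {B. orthonormal B \<and> (\<forall>e\<in>B. \<exists>c. A e = c *\<^sub>R e)}"
  have ub: "\<exists>U\<in>\<B>. \<forall>X\<in>\<C>. X \<subseteq> U" if "subset.chain \<B> \<C>" for \<C>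
  proof (intro bexI ballI)
    show "X \<subseteq> \<Union>\<C>" if "X \<in> \<C>" for X using that by blast
    have sub: "\<C> \<subseteq> \<B>" and chain: "\<And>X Y. X \<in> \<C> \<Longrightarrow> Y \<in> \<C> \<Longrightarrow> X \<subseteq> Y \<or> Y \<subseteq> X"
      using that by (auto simp: subset.chain_def)
    have "e \<bullet> f = (if e = f then 1 else 0)" if ef: "e \<in> \<Union>\<C>" "f \<in> \<Union>\<C>" for e f
    proof -
      obtain X Y where XY: "X \<in> \<C>" "Y \<in> \<C>" "e \<in> X" "f \<in> Y" using ef by blast
      then obtain Z where "Z \<in> \<C>" "e \<in> Z" "f \<in> Z" using chain[OF XY(1,2)] by blast
      then show ?thesis using sub by (auto simp: \<B>_def orthonormal_def)
    qed
    then show "\<Union>\<C> \<in> \<B>" using sub by (auto simp: \<B>_def orthonormal_def)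
  qed
  have "\<exists>M\<in>\<B>. \<forall>X\<in>\<B>. M \<subseteq> X \<longrightarrow> X = M"
    by (rule subset_Zorn) (rule ub)
  then obtain B where B: "B \<in> \<B>" and max: "\<And>X. X \<in> \<B> \<Longrightarrow> B \<subseteq> X \<Longrightarrow> X = B"
    by blast
  then have on: "orthonormal B" and eig: "\<And>e. e \<in> B \<Longrightarrow> \<exists>c. A e = c *\<^sub>R e" by (auto simp: \<B>_def)
  define V where "V = {x. \<forall>e\<in>B. x \<bullet> e = 0}"
  have "orthonormal_basis B"
  proof (rule orthonormal_basisI[OF on])
    fix z assume "\<And>e. e \<in> B \<Longrightarrow> z \<bullet> e = 0"
    then have "z \<in> V" by (simp add: V_def)
    show "z = 0"
    proof (rule ccontr)
      assume "z \<noteq> 0"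
      have V: "subspace V" by (auto simp: V_def subspace_def inner_simps)
      have "V = (\<Inter>e\<in>B. {x. x \<bullet> e = 0})" by (auto simp: V_def)
      moreover have "closed {x. x \<bullet> e = 0}" for e :: 'v
        by (intro closed_Collect_eq continuous_intros)
      ultimately have cl: "closed V" by auto
      have "A x \<in> V" if x: "x \<in> V" for x
        unfolding V_def
      proof (intro CollectI ballI)
        fix e assume e: "e \<in> B"
        then obtain c where "A e = c *\<^sub>R e" using eig by blast
        then show "A x \<bullet> e = 0" using x e by (simp add: selfadjoint V_def)
      qed
      then obtain e where e: "e \<in> V" "norm e = 1" "\<exists>c. A e = c *\<^sub>R e"
        using eigenvector_exists[OF V cl _ \<open>z \<in> V\<close> \<open>z \<noteq> 0\<close>] by blast
      have "e \<notin> B" using e by (auto simp: V_def norm_eq_1)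
      moreover have "insert e B \<in> \<B>"
      proof -
        have "orthonormal (insert e B)"
          unfolding orthonormal_def
        proof (intro ballI)
          fix f g assume "f \<in> insert e B" "g \<in> insert e B"
          then show "f \<bullet> g = (if f = g then 1 else 0)"
            using e on \<open>e \<notin> B\<close> inner_commute[of e f] inner_commute[of e g]
            unfolding orthonormal_def V_def norm_eq_1 by (smt (verit) insertE mem_Collect_eq)
        qed
        then show ?thesis using e(3) eig by (auto simp: \<B>_def)
      qed
      ultimately show False using max[of "insert e B"] by blast
    qed
  qed
  then show ?thesis using eig by (auto simp: eigenbasis_def)
qed

end

section \<open>Orthonormal bases, Riesz representation and adjoints\<close>

lemma orthonormal_basis_exists: "\<exists>B :: 'v::{real_inner,banach} set. orthonormal_basis B"
proof -
  \<comment> \<open>Every vector is an eigenvector of the zero operator, so its eigenbasis is just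
    an orthonormal basis.\<close>
  interpret positive_trace_class "\<lambda>_::'v. 0" 0
    by unfold_locales (auto intro: exI[of _ 0])
  show ?thesis using eigenbasis_exists by (auto simp: eigenbasis_def)
qed

text \<open>The representing vector has the coefficients \<open>\<phi> e\<close>. They are square
  summable because testing \<open>\<phi>\<close> on their own finite combinations bounds the sum of
  squares by \<open>(onorm \<phi>)^2\<close>.\<close>

lemma riesz_representation:
  fixes \<phi> :: "'v::{real_inner,banach} \<Rightarrow> real"
  assumes "bounded_linear \<phi>" shows "\<exists>z. \<forall>x. \<phi> x = x \<bullet> z"
proof -
  interpret bounded_linear \<phi> by fact
  obtain B :: "'v set" where B: "orthonormal_basis B" using orthonormal_basis_exists by blast
  note on = orthonormal_basis_orthonormal[OF B]
  have bound: "(\<Sum>e\<in>F. (\<phi> e)^2) \<le> (onorm \<phi>)^2" if F: "finite F" "F \<subseteq> B" for F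
  proof -
    let ?q = "\<Sum>e\<in>F. (\<phi> e)^2" and ?v = "\<Sum>e\<in>F. \<phi> e *\<^sub>R e"
    have nv: "(norm ?v)^2 = ?q" using F by (intro orthonormal_norm_sum orthonormal_subset[OF on])
    have "?q = \<phi> ?v" by (simp add: sum scale power2_eq_square)
    also have "\<dots> \<le> onorm \<phi> * norm ?v" using onorm[OF assms, of ?v] by simp
    finally have "?q^2 \<le> (onorm \<phi> * norm ?v)^2" by (rule power_mono) (simp add: sum_nonneg)
    then have "?q * ?q \<le> (onorm \<phi>)^2 * ?q" by (simp only: power_mult_distrib nv) (simp only: power2_eq_square)
    then show ?thesis by (rule le_of_square_le_mult) simp
  qed
  have s: "(\<lambda>e. (\<phi> e)^2) summable_on B"
    by (rule nonneg_bounded_partial_sums_imp_summable_on[where C = "(onorm \<phi>)^2"])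
       (auto intro!: eventually_finite_subsets_at_top_weakI bound)
  have "\<phi> x = x \<bullet> (\<Sum>\<^sub>\<infinity>e\<in>B. \<phi> e *\<^sub>R e)" for x
  proof -
    have "((\<lambda>e. (x \<bullet> e) *\<^sub>R e) has_sum x) B"
      using has_sum_orthonormal_series[OF on bessel_summable[OF on], of x]
        orthonormal_basis_expand[OF B, of x] by (simp add: proj_on_def)
    then have "((\<lambda>e. \<phi> ((x \<bullet> e) *\<^sub>R e)) has_sum \<phi> x) B" by (rule has_sum_bounded_linear[OF assms])
    moreover have "((\<lambda>e. \<phi> e * (e \<bullet> x)) has_sum ((\<Sum>\<^sub>\<infinity>e\<in>B. \<phi> e *\<^sub>R e) \<bullet> x)) B"
      by (rule has_sum_inner_orthonormal_series[OF on s])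
    ultimately show ?thesis by (simp add: scale inner_commute mult.commute has_sum_unique)
  qed
  then show ?thesis by blast
qed

text \<open>\<open>adjoint\<close> is a choice among the maps satisfying the identity, so it
  suffices that one exists; Riesz provides its value at each \<open>y\<close>.\<close>

lemma adjoint_works_hilbert:
  fixes S :: "'v::{real_inner,banach} \<Rightarrow> 'w::real_inner"
  assumes "bounded_linear S"
  shows "S x \<bullet> y = x \<bullet> adjoint S y"
proof -
  have "\<exists>z. \<forall>x. S x \<bullet> y = x \<bullet> z" for y
    by (rule riesz_representation)
       (rule bounded_linear_compose[OF bounded_linear_inner_left assms])
  then have "\<forall>y. \<exists>z. \<forall>x. S x \<bullet> y = x \<bullet> z" by blast
  from choice[OF this] have "\<exists>f'. \<forall>x y. S x \<bullet> y = x \<bullet> f' y" by blast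
  from someI_ex[OF this] show ?thesis unfolding adjoint_def by blast
qed

lemma bounded_linear_adjoint:
  fixes S :: "'v::{real_inner,banach} \<Rightarrow> 'w::real_inner"
  assumes S: "bounded_linear S"
  shows "bounded_linear (adjoint S)"
proof (rule bounded_linear_intro[where K = "onorm S"])
  note adj = adjoint_works_hilbert[OF S, symmetric]
  have eqI: "a = b" if "\<And>x. x \<bullet> a = x \<bullet> b" for a b :: 'v
  proof -
    have "(a - b) \<bullet> (a - b) = 0" unfolding inner_diff_right[of "a - b" a b] using that[of "a - b"] by simp
    then show ?thesis by simp
  qed
  show "adjoint S (x + y) = adjoint S x + adjoint S y" for x y
    by (rule eqI) (simp add: adj inner_simps)
  show "adjoint S (r *\<^sub>R x) = r *\<^sub>R adjoint S x" for r x
    by (rule eqI) (simp add: adj)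
  show "norm (adjoint S x) \<le> norm x * onorm S" for x
  proof -
    have "norm (adjoint S x) * norm (adjoint S x) = S (adjoint S x) \<bullet> x"
      by (simp add: adjoint_works_hilbert[OF S] power2_norm_eq_inner[symmetric] power2_eq_square)
    also have "\<dots> \<le> norm (S (adjoint S x)) * norm x" by (rule norm_cauchy_schwarz)
    also have "\<dots> \<le> (onorm S * norm (adjoint S x)) * norm x"
      by (intro mult_right_mono onorm S) auto
    finally have "norm (adjoint S x) * norm (adjoint S x) \<le> (norm x * onorm S) * norm (adjoint S x)"
      by (simp add: mult_ac)
    then show ?thesis by (rule le_of_square_le_mult) (simp add: onorm_pos_le[OF S])
  qed
qed

section \<open>Resolvent and effective dimension in an eigenbasis\<close>

locale eigen_decomposition = positive_trace_class A C
  for A :: "'v::{real_inner,banach} \<Rightarrow> 'v" and C +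
  fixes B :: "'v set"
  assumes eigenbasis: "eigenbasis A B"
begin

definition eig :: "'v \<Rightarrow> real" where "eig e = A e \<bullet> e"

lemma basis: "orthonormal_basis B" and on: "orthonormal B"
  using eigenbasis orthonormal_basis_orthonormal by (auto simp: eigenbasis_def)

lemma eig_nonneg: "eig e \<ge> 0" by (simp add: eig_def positive)

lemma eigenvector: "e \<in> B \<Longrightarrow> A e = eig e *\<^sub>R e"
  using eigenbasis orthonormal_norm[OF on, of e] by (auto simp: eigenbasis_def eig_def norm_eq_1)

lemma inner_A: "e \<in> B \<Longrightarrow> A x \<bullet> e = eig e * (x \<bullet> e)"
  by (simp add: selfadjoint eigenvector)

lemma eig_sum_le: "finite F \<Longrightarrow> F \<subseteq> B \<Longrightarrow> (\<Sum>e\<in>F. eig e) \<le> C"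
  unfolding eig_def by (rule trace_bound) (auto intro: orthonormal_subset[OF on])

lemma eig_le: "e \<in> B \<Longrightarrow> eig e \<le> C"
  using eig_sum_le[of "{e}"] by simp

lemma eig_summable: "eig summable_on B"
  by (rule nonneg_bounded_partial_sums_imp_summable_on[where C = C])
     (auto intro!: eventually_finite_subsets_at_top_weakI eig_sum_le eig_nonneg)

text \<open>The resolvent \<open>(A + l I)^-1\<close>.\<close>

definition resolv :: "real \<Rightarrow> 'v \<Rightarrow> 'v" where
  "resolv l v = (\<Sum>\<^sub>\<infinity>e\<in>B. ((v \<bullet> e) / (eig e + l)) *\<^sub>R e)"

lemma resolv_summable: "l > 0 \<Longrightarrow> (\<lambda>e. ((v \<bullet> e) / (eig e + l))^2) summable_on B"
proof -
  assume l: "l > 0"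
  have "((v \<bullet> e) / (eig e + l))^2 \<le> (v \<bullet> e)^2 * (1 / l^2)" for e
    unfolding power_divide using l eig_nonneg[of e] by (simp add: frac_le power_mono)
  then show ?thesis
    by (intro summable_on_comparison_test[OF summable_on_cmult_left[OF bessel_summable[OF on, of v], of "1 / l^2"]]) auto
qed

lemma resolv_coeff: "l > 0 \<Longrightarrow> e \<in> B \<Longrightarrow> resolv l v \<bullet> e = (v \<bullet> e) / (eig e + l)"
  unfolding resolv_def by (rule orthonormal_series_coeff[OF on resolv_summable])

lemma basis_eqI: "(\<And>e. e \<in> B \<Longrightarrow> x \<bullet> e = y \<bullet> e) \<Longrightarrow> x = y"
  using orthonormal_basis_complete[OF basis, of "x - y"] by (simp add: inner_diff_left)

lemma resolv_inverse:
  assumes l: "l > 0"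
  shows "A (resolv l v) + l *\<^sub>R resolv l v = v" "resolv l (A v + l *\<^sub>R v) = v"
proof -
  have coeff: "(A w + l *\<^sub>R w) \<bullet> e = (eig e + l) * (w \<bullet> e)" if "e \<in> B" for w e
    using that by (simp add: inner_add_left inner_A algebra_simps)
  have pos: "eig e + l \<noteq> 0" for e using eig_nonneg[of e] l by linarith
  show "resolv l (A v + l *\<^sub>R v) = v"
    by (rule basis_eqI) (simp add: resolv_coeff[OF l] coeff pos)
  show "A (resolv l v) + l *\<^sub>R resolv l v = v"
    by (rule basis_eqI) (simp add: resolv_coeff[OF l] coeff pos)
qed

text \<open>\<open>effective_dim\<close> is stated with the function inverse \<open>inv\<close>,
  which is determined because \<open>resolv l\<close> inverts the shift from both sides.\<close>

lemma inv_shift: "l > 0 \<Longrightarrow> inv (\<lambda>v. A v + l *\<^sub>R v) = resolv l"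
  by (rule inv_equality) (simp_all add: resolv_inverse)

lemma degrees_of_freedom_summable:
  assumes "l > 0" shows "(\<lambda>e. eig e / (eig e + l)) summable_on B"
proof -
  have "eig e / (eig e + l) \<le> eig e * (1 / l)" for e
    using assms eig_nonneg[of e] by (simp add: frac_le)
  then show ?thesis
    using assms eig_nonneg
    by (intro summable_on_comparison_test[OF summable_on_cmult_left[OF eig_summable, of "1 / l"]]) auto
qed

text \<open>\<open>op_trace\<close> sums over an arbitrarily chosen orthonormal basis
  \<open>D\<close>, not over eigenvectors. The family \<open>c e * (d \<bullet> e)^2\<close> is
  nonnegative and summable over \<open>B \<times> D\<close>: summing over \<open>d\<close> first
  gives \<open>c e\<close> by Parseval in \<open>D\<close>, summing over \<open>e\<close> first
  gives the diagonal entry at \<open>d\<close>.\<close>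

lemma effective_dim_eq:
  assumes l: "l > 0"
  shows "effective_dim A l = (\<Sum>\<^sub>\<infinity>e\<in>B. eig e / (eig e + l))"
proof -
  define D :: "'v set" where "D = (SOME B. orthonormal_basis B)"
  have D: "orthonormal_basis D" unfolding D_def by (rule someI_ex[OF orthonormal_basis_exists])
  define c where "c e = eig e / (eig e + l)" for e
  have c: "c e \<ge> 0" for e using l eig_nonneg[of e] by (simp add: c_def)
  have row: "(\<Sum>\<^sub>\<infinity>d\<in>D. c e * (d \<bullet> e)^2) = c e" "(\<lambda>d. c e * (d \<bullet> e)^2) summable_on D" if "e \<in> B" for e
  proof -
    have "((\<lambda>d. c e * (d \<bullet> e)^2) has_sum (c e * (norm e)^2)) D"
      using has_sum_cmult_right[OF parseval_norm[OF D, of e], of "c e"] by (simp add: inner_commute)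
    then show "(\<Sum>\<^sub>\<infinity>d\<in>D. c e * (d \<bullet> e)^2) = c e" "(\<lambda>d. c e * (d \<bullet> e)^2) summable_on D"
      using orthonormal_norm[OF on that] by (auto simp: has_sum_imp_summable infsumI)
  qed
  have "(\<lambda>(e, d). c e * (d \<bullet> e)^2) summable_on B \<times> D"
  proof (rule summable_on_SigmaI[where g = c])
    show "c summable_on B" unfolding c_def by (rule degrees_of_freedom_summable[OF l])
    show "((\<lambda>d. case (e, d) of (e, d) \<Rightarrow> c e * (d \<bullet> e)^2) has_sum c e) D" if "e \<in> B" for e
      using row[OF that] by (simp add: has_sum_iff)
  qed (simp add: c)
  then have "(\<Sum>\<^sub>\<infinity>e\<in>B. \<Sum>\<^sub>\<infinity>d\<in>D. c e * (d \<bullet> e)^2) = (\<Sum>\<^sub>\<infinity>d\<in>D. \<Sum>\<^sub>\<infinity>e\<in>B. c e * (d \<bullet> e)^2)"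
    by (rule infsum_swap_banach)
  moreover have "(\<Sum>\<^sub>\<infinity>e\<in>B. c e * (d \<bullet> e)^2) = A (resolv l d) \<bullet> d" for d
  proof -
    have "((\<lambda>e. (A (resolv l d) \<bullet> e) * (d \<bullet> e)) has_sum A (resolv l d) \<bullet> d) B"
      by (rule parseval[OF basis])
    then have "((\<lambda>e. c e * (d \<bullet> e)^2) has_sum A (resolv l d) \<bullet> d) B"
      by (rule iffD1[OF has_sum_cong, rotated])
         (simp add: inner_A resolv_coeff[OF l] c_def power2_eq_square)
    then show ?thesis by (rule infsumI)
  qed
  moreover have "(\<Sum>\<^sub>\<infinity>e\<in>B. \<Sum>\<^sub>\<infinity>d\<in>D. c e * (d \<bullet> e)^2) = (\<Sum>\<^sub>\<infinity>e\<in>B. c e)"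
    by (intro infsum_cong row)
  ultimately show ?thesis
    by (simp add: effective_dim_def op_trace_def inv_shift[OF l] D_def[symmetric] c_def o_def)
qed

end

section \<open>Sums of independent Hilbert space valued vectors\<close>

text \<open>A supermartingale argument without filtrations: \<open>\<Phi> j s\<close> bounds the
  expected final value when \<open>j\<close> draws remain in state \<open>s\<close>, so integrating
  out the last draw trades one step of \<open>st\<close> for one unit of \<open>j\<close>.\<close>

lemma nn_integral_chain_le:
  fixes st :: "nat \<Rightarrow> (nat \<Rightarrow> 'a) \<Rightarrow> 's" and \<Phi> :: "nat \<Rightarrow> 's \<Rightarrow> ennreal"
  assumes M: "prob_space M"
    and st0: "\<And>\<omega>. st 0 \<omega> = s0" and stS: "\<And>k \<omega>. st (Suc k) \<omega> = step (st k \<omega>) (\<omega> (Suc k))"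
    and meas: "\<And>j k. (\<lambda>\<omega>. \<Phi> j (st k \<omega>)) \<in> borel_measurable (\<Pi>\<^sub>M i\<in>{1..k}. M)"
    and step: "\<And>j s. (\<integral>\<^sup>+y. \<Phi> j (step s y) \<partial>M) \<le> \<Phi> (Suc j) s"
  shows "(\<integral>\<^sup>+\<omega>. \<Phi> j (st k \<omega>) \<partial>(\<Pi>\<^sub>M i\<in>{1..k}. M)) \<le> \<Phi> (j + k) s0"
proof (induction k arbitrary: j)
  case 0
  interpret product_prob_space "\<lambda>_::nat. M" "{1..0::nat}"
    by (rule product_prob_spaceI) (rule M)
  show ?case using emeasure_space_1 by (simp add: st0)
next
  case (Suc k)
  interpret product_sigma_finite "\<lambda>_::nat. M"
    by (rule product_sigma_finite.intro) (simp add: M prob_space_imp_sigma_finite)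
  \<comment> \<open>The state after \<open>i\<close> draws reads the coordinates \<open>1..i\<close>
    only, so a later coordinate may be overwritten.\<close>
  have depends: "st i (x(m := y)) = st i x" if "i < m" for i m x y
    using that by (induction i) (simp_all add: st0 stS)
  have ins: "{1..Suc k} = insert (Suc k) {1..k}" by auto
  have "(\<integral>\<^sup>+\<omega>. \<Phi> j (st (Suc k) \<omega>) \<partial>(\<Pi>\<^sub>M i\<in>{1..Suc k}. M))
      = (\<integral>\<^sup>+x. \<integral>\<^sup>+y. \<Phi> j (st (Suc k) (x(Suc k := y))) \<partial>M \<partial>(\<Pi>\<^sub>M i\<in>{1..k}. M))"
    unfolding ins
    by (rule product_nn_integral_insert) (use meas[of j "Suc k"] in \<open>simp_all only: ins finite_atLeastAtMost, simp_all\<close>)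
  also have "\<dots> = (\<integral>\<^sup>+x. \<integral>\<^sup>+y. \<Phi> j (step (st k x) y) \<partial>M \<partial>(\<Pi>\<^sub>M i\<in>{1..k}. M))"
    by (simp add: stS depends)
  also have "\<dots> \<le> (\<integral>\<^sup>+x. \<Phi> (Suc j) (st k x) \<partial>(\<Pi>\<^sub>M i\<in>{1..k}. M))"
    by (intro nn_integral_mono step)
  also have "\<dots> \<le> \<Phi> (Suc j + k) s0" by (rule Suc.IH)
  finally show ?case by simp
qed

section \<open>Scalar inequalities for powers and hyperbolic functions\<close>

lemma power_mean_2: "0 \<le> x \<Longrightarrow> 0 \<le> y \<Longrightarrow> ((x + y) / 2) ^ k \<le> (x ^ k + y ^ k) / (2::real)"
proof (induction k)
  case 0 then show ?case by simp
next
  case (Suc k)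
  have "((x + y) / 2) ^ Suc k \<le> ((x + y) / 2) * ((x ^ k + y ^ k) / 2)"
    unfolding power_Suc using Suc by (intro mult_left_mono) auto
  also have "\<dots> \<le> (x ^ Suc k + y ^ Suc k) / 2"
  proof -
    \<comment> \<open>Chebyshev's inequality for two similarly ordered pairs.\<close>
    have "0 \<le> (x - y) * (x ^ k - y ^ k)"
    proof (cases "x \<le> y")
      case True
      then have "x ^ k \<le> y ^ k" using Suc.prems by (intro power_mono)
      then show ?thesis using True by (intro mult_nonpos_nonpos) auto
    next
      case False
      then have "y ^ k \<le> x ^ k" using Suc.prems by (intro power_mono) auto
      then show ?thesis using False by (intro mult_nonneg_nonneg) auto
    qed
    then show ?thesis by (simp add: field_simps)
  qed
  finally show ?case .
qed

text \<open>Compare power series term by term: \<open>u^2 + q^2\<close> is the mean of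
  \<open>(u + q)^2\<close> and \<open>(u - q)^2\<close>, so its \<open>k\<close>-th power is at most
  the mean of their \<open>k\<close>-th powers, and \<open>cosh u * cosh q\<close> is the mean of
  \<open>cosh (u + q)\<close> and \<open>cosh (u - q)\<close>.\<close>

lemma cosh_sqrt_le: "cosh (sqrt (u^2 + q^2)) \<le> cosh u * cosh (q::real)"
proof -
  let ?t = "\<lambda>x n. if even n then x ^ n /\<^sub>R fact n else (0::real)"
  have s: "(\<lambda>n. (?t (u + q) n + ?t (u - q) n) / 2) sums ((cosh (u + q) + cosh (u - q)) / 2)"
    by (intro sums_divide sums_add cosh_converges)
  have le: "?t (sqrt (u^2 + q^2)) n \<le> (?t (u + q) n + ?t (u - q) n) / 2" for n
  proof (cases "even n")
    case True
    then obtain k where n: "n = 2 * k" by blast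
    have "sqrt (u^2 + q^2) ^ n = (((u + q)^2 + (u - q)^2) / 2) ^ k"
    proof -
      have *: "u^2 + q^2 = ((u + q)^2 + (u - q)^2) / 2" by (simp add: power2_eq_square algebra_simps)
      have "sqrt (u^2 + q^2) ^ n = (u^2 + q^2) ^ k" by (simp add: n power_mult)
      then show ?thesis by (simp only: *)
    qed
    also have "\<dots> \<le> ((u + q) ^ n + (u - q) ^ n) / 2"
      using power_mean_2[of "(u + q)^2" "(u - q)^2" k] by (simp add: n power_mult)
    finally show ?thesis using True by (simp add: field_simps)
  qed simp
  have "cosh (sqrt (u^2 + q^2)) \<le> (cosh (u + q) + cosh (u - q)) / 2"
    by (rule sums_le[OF le cosh_converges s])
  also have "\<dots> = cosh u * cosh q" by (simp add: cosh_add cosh_diff)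
  finally show ?thesis .
qed

lemma exp_minus_le_quadratic: "0 \<le> q \<Longrightarrow> exp (- q) \<le> 1 - q + (q::real)^2"
proof -
  assume q: "0 \<le> q"
  have "exp (- q) \<le> 1 / (1 + q)"
    using exp_ge_add_one_self[of q] q by (simp add: exp_minus field_simps)
  also have "\<dots> \<le> 1 - q + q^2"
  proof -
    have "(1 - q + q^2) * (1 + q) = 1 + q ^ 3" by (simp add: algebra_simps power2_eq_square power3_eq_cube)
    then show ?thesis using q by (simp add: divide_le_eq)
  qed
  finally show ?thesis .
qed

lemma cosh_le_quadratic:
  assumes "\<bar>q\<bar> \<le> 1" shows "cosh q \<le> 1 + (q::real)^2"
proof -
  have "cosh \<bar>q\<bar> \<le> 1 + \<bar>q\<bar>^2"
    using exp_bound[of "\<bar>q\<bar>"] exp_minus_le_quadratic[of "\<bar>q\<bar>"] assms unfolding cosh_def by simp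
  then show ?thesis by (simp add: cosh_real_abs)
qed

lemma sinh_minus_le:
  assumes "\<bar>p\<bar> \<le> 1" shows "\<bar>sinh p - p\<bar> \<le> (p::real)^2"
proof -
  have pos: "\<bar>sinh p - p\<bar> \<le> p^2" if p: "0 \<le> p" "p \<le> 1" for p :: real
  proof -
    have "exp p \<le> 1 + p + p^2" "exp (- p) \<le> 1 - p + p^2"
      using exp_bound exp_minus_le_quadratic p by auto
    moreover have "1 + p \<le> exp p" "1 - p \<le> exp (- p)"
      using exp_ge_add_one_self[of p] exp_ge_add_one_self[of "-p"] by auto
    moreover have "\<bar>(a - c) / 2 - p\<bar> \<le> p^2"
      if "a \<le> 1 + p + p^2" "c \<le> 1 - p + p^2" "1 + p \<le> a" "1 - p \<le> c" for a c
      using that p zero_le_power2[of p] by (simp add: abs_le_iff field_simps)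
    ultimately show ?thesis unfolding sinh_field_def by blast
  qed
  show ?thesis using pos[of p] pos[of "- p"] assms by (cases "p \<ge> 0") (auto simp: abs_minus_commute)
qed

text \<open>
  The one-step inequality of Pinelis: integrating it over a centred \<open>x\<close> removes the term linear in \<open>x\<close>.
\<close>

lemma cosh_norm_add_le:
  fixes s x :: "'v::real_inner"
  assumes "norm x \<le> 1"
  shows "cosh (norm (s + x)) \<le> cosh (norm s) * (1 + 4 * (norm x)^2) + sinh (norm s) / norm s * (s \<bullet> x)"
proof -
  \<comment> \<open>\<open>p\<close> is the component of \<open>x\<close> along \<open>s\<close> and
    \<open>q\<close> the length of the orthogonal one. At \<open>s = 0\<close> the division gives
    \<open>p = 0\<close>, and the identities below still hold.\<close>
  define p where "p = (s \<bullet> x) / norm s"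
  define q where "q = sqrt ((norm x)^2 - p^2)"
  have "\<bar>p\<bar> \<le> norm x"
    using Cauchy_Schwarz_ineq2[of s x] by (cases "s = 0") (auto simp: p_def field_simps)
  then have p: "\<bar>p\<bar> \<le> 1" "p^2 \<le> (norm x)^2" using assms by (auto simp: power2_le_iff_abs_le)
  have q2: "q^2 = (norm x)^2 - p^2" using p by (simp add: q_def)
  have "(norm x)^2 \<le> 1" using assms by (simp add: power_le_one)
  then have "q^2 \<le> 1" "p^2 \<le> 1" using p(2) q2 zero_le_power2[of p] by linarith+
  then have q: "q \<ge> 0" "q^2 \<le> 1" "p^2 \<le> 1" using p by (auto simp: q_def)
  then have q1: "\<bar>q\<bar> \<le> 1" by (simp add: abs_square_le_1)
  have "(norm (s + x))^2 = (norm s)^2 + 2 * (s \<bullet> x) + (norm x)^2"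
    by (simp add: power2_norm_eq_inner inner_simps inner_commute)
  also have "s \<bullet> x = norm s * p" by (cases "s = 0") (auto simp: p_def)
  finally have "norm (s + x) = sqrt ((norm s + p)^2 + q^2)"
    unfolding q2 by (intro real_sqrt_unique[symmetric]) (auto simp: power2_eq_square algebra_simps)
  then have "cosh (norm (s + x)) \<le> cosh (norm s + p) * cosh q" using cosh_sqrt_le by simp
  also have "\<dots> = cosh (norm s) * (cosh p * cosh q) + sinh (norm s) * (sinh p * cosh q)"
    by (simp add: cosh_add algebra_simps)
  also have "cosh p * cosh q \<le> (1 + p^2) * (1 + q^2)"
    by (intro mult_mono cosh_le_quadratic p q1) auto
  also have "(1 + p^2) * (1 + q^2) \<le> 1 + 2 * (norm x)^2"
  proof -
    have "p^2 * q^2 \<le> p^2 * 1" by (intro mult_left_mono q) auto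
    moreover have "(1 + p^2) * (1 + q^2) = 1 + p^2 + q^2 + p^2 * q^2" by (simp add: algebra_simps)
    ultimately show ?thesis using q2 p(2) by linarith
  qed
  also have "sinh p * cosh q \<le> p + 2 * (norm x)^2"
  proof -
    have "sinh p * cosh q = sinh p + sinh p * (cosh q - 1)" by (simp add: algebra_simps)
    also have "sinh p * (cosh q - 1) \<le> 2 * q^2"
    proof -
      have "\<bar>sinh p\<bar> \<le> \<bar>p\<bar> + p^2" using sinh_minus_le[OF p(1)] by linarith
      then have "\<bar>sinh p\<bar> \<le> 2" using p(1) q(3) by linarith
      then have "sinh p * (cosh q - 1) \<le> 2 * (cosh q - 1)"
        using cosh_real_ge_1[of q] by (intro mult_right_mono) auto
      also have "\<dots> \<le> 2 * q^2" using cosh_le_quadratic[OF q1] by simp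
      finally show ?thesis .
    qed
    also have "sinh p \<le> p + p^2" using sinh_minus_le[OF p(1)] by linarith
    finally show ?thesis using q2 p(2) zero_le_power2[of p] by linarith
  qed
  finally have "cosh (norm (s + x)) \<le> cosh (norm s) * (1 + 2 * (norm x)^2) + sinh (norm s) * (p + 2 * (norm x)^2)"
    by (simp add: mult_left_mono)
  also have "sinh (norm s) * (p + 2 * (norm x)^2) \<le> sinh (norm s) * p + cosh (norm s) * (2 * (norm x)^2)"
    using sinh_less_cosh_real[of "norm s"] by (simp add: distrib_left mult_right_mono)
  also have "sinh (norm s) * p = sinh (norm s) / norm s * (s \<bullet> x)" by (simp add: p_def)
  finally show ?thesis by (simp add: algebra_simps)
qed

text \<open>The value space need not be second countable, so only inner products are assumed
  measurable; the Gram matrix then makes norms of sums measurable. The mean vanishes in the weak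
  sense, tested against every vector.\<close>

locale centered_vectors = prob_space M
  for M :: "'a measure" +
  fixes X :: "'a \<Rightarrow> 'v::real_inner" and b v :: real
  assumes inner_meas [measurable]: "(\<lambda>m. s \<bullet> X m) \<in> borel_measurable M"
    and kernel_meas: "(\<lambda>(m, m'). X m \<bullet> X m') \<in> borel_measurable (M \<Otimes>\<^sub>M M)"
    and bound: "m \<in> space M \<Longrightarrow> norm (X m) \<le> b"
    and mean: "(\<integral>m. s \<bullet> X m \<partial>M) = 0"
    and variance: "(\<integral>m. (norm (X m))^2 \<partial>M) \<le> v"
begin

lemma norm_meas [measurable]: "(\<lambda>m. (norm (X m))^2) \<in> borel_measurable M"
proof -
  have "(\<lambda>m. (\<lambda>(m, m'). X m \<bullet> X m') (m, m)) \<in> borel_measurable M"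
    by (rule measurable_compose[OF _ kernel_meas]) measurable
  then show ?thesis by (simp add: power2_norm_eq_inner)
qed

lemma integrable_inner: "integrable M (\<lambda>m. s \<bullet> X m)"
proof (rule integrable_const_bound)
  show "AE m in M. norm (s \<bullet> X m) \<le> norm s * b"
  proof (rule AE_I2)
    fix m assume "m \<in> space M"
    then show "norm (s \<bullet> X m) \<le> norm s * b"
      using Cauchy_Schwarz_ineq2[of s "X m"] mult_left_mono[OF bound, of m "norm s"] by simp
  qed
qed measurable

lemma integrable_norm: "integrable M (\<lambda>m. (norm (X m))^2)"
proof (rule integrable_const_bound)
  show "AE m in M. norm ((norm (X m))^2) \<le> b^2"
    by (rule AE_I2) (simp add: bound power_mono)
qed measurable

lemma sum_norm_meas [measurable]:
  "(\<lambda>\<omega>. norm (\<Sum>i=1..k. X (\<omega> i))) \<in> borel_measurable (\<Pi>\<^sub>M i\<in>{1..k}. M)"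
proof -
  have "(\<lambda>\<omega>. X (\<omega> i) \<bullet> X (\<omega> j)) \<in> borel_measurable (\<Pi>\<^sub>M i\<in>{1..k}. M)"
    if "i \<in> {1..k}" "j \<in> {1..k}" for i j
  proof -
    have "(\<lambda>\<omega>. (\<omega> i, \<omega> j)) \<in> (\<Pi>\<^sub>M i\<in>{1..k}. M) \<rightarrow>\<^sub>M M \<Otimes>\<^sub>M M" using that by measurable
    from measurable_compose[OF this kernel_meas] show ?thesis by simp
  qed
  then have "(\<lambda>\<omega>. sqrt (\<Sum>i=1..k. \<Sum>j=1..k. X (\<omega> j) \<bullet> X (\<omega> i))) \<in> borel_measurable (\<Pi>\<^sub>M i\<in>{1..k}. M)"
    by (intro measurable_compose[OF _ borel_measurable_sqrt] borel_measurable_sum) auto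
  then show ?thesis unfolding norm_eq_sqrt_inner inner_sum_left inner_sum_right .
qed

lemma variance_nonneg: "v \<ge> 0"
  by (rule order_trans[OF _ variance]) simp

text \<open>In the potential \<open>(norm s)^2 + j * v\<close> the cross term integrates to zero,
  and \<open>v\<close> pays for each remaining draw.\<close>

theorem second_moment_sum:
  "(\<integral>\<^sup>+\<omega>. ennreal ((norm (\<Sum>i=1..k. X (\<omega> i)))^2) \<partial>(\<Pi>\<^sub>M i\<in>{1..k}. M)) \<le> ennreal (real k * v)"
proof -
  have "(\<integral>\<^sup>+\<omega>. ennreal ((norm (\<Sum>i=1..k. X (\<omega> i)))^2 + real 0 * v) \<partial>(\<Pi>\<^sub>M i\<in>{1..k}. M))
    \<le> ennreal ((norm (0::'v))^2 + real (0 + k) * v)"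
  proof (rule nn_integral_chain_le[OF prob_space_axioms, where st = "\<lambda>k \<omega>. \<Sum>i=1..k. X (\<omega> i)"
        and \<Phi> = "\<lambda>j s. ennreal ((norm s)^2 + real j * v)" and step = "\<lambda>s y. s + X y"])
    fix j s
    have "(\<integral>\<^sup>+ y. ennreal ((norm (s + X y))^2 + real j * v) \<partial>M)
       = (\<integral>\<^sup>+ y. ennreal ((norm s)^2 + real j * v + 2 * (s \<bullet> X y) + (norm (X y))^2) \<partial>M)"
      by (intro nn_integral_cong) (simp add: power2_norm_eq_inner inner_simps inner_commute algebra_simps)
    also have "\<dots> = ennreal (\<integral>y. (norm s)^2 + real j * v + 2 * (s \<bullet> X y) + (norm (X y))^2 \<partial>M)"
    proof (rule nn_integral_eq_integral)
      show "integrable M (\<lambda>y. (norm s)^2 + real j * v + 2 * (s \<bullet> X y) + (norm (X y))^2)"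
        by (intro Bochner_Integration.integrable_add integrable_mult_right integrable_const integrable_inner integrable_norm)
      have "(norm s)^2 + real j * v + 2 * (s \<bullet> X y) + (norm (X y))^2 = (norm (s + X y))^2 + real j * v" for y
        by (simp add: power2_norm_eq_inner inner_simps inner_commute algebra_simps)
      moreover have "0 \<le> (norm (s + X y))^2 + real j * v" for y
        using variance_nonneg by simp
      ultimately show "AE y in M. 0 \<le> (norm s)^2 + real j * v + 2 * (s \<bullet> X y) + (norm (X y))^2"
        by (intro AE_I2) metis
    qed
    also have "(\<integral>y. (norm s)^2 + real j * v + 2 * (s \<bullet> X y) + (norm (X y))^2 \<partial>M)
       = (norm s)^2 + real j * v + (\<integral>y. (norm (X y))^2 \<partial>M)"
      using integrable_inner integrable_norm mean by (simp add: prob_space)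
    also have "\<dots> \<le> (norm s)^2 + real (Suc j) * v" using variance by (simp add: algebra_simps)
    finally show "(\<integral>\<^sup>+ y. ennreal ((norm (s + X y))^2 + real j * v) \<partial>M) \<le> ennreal ((norm s)^2 + real (Suc j) * v)"
      by (simp add: ennreal_leI order_trans)
  next
    show "(\<lambda>\<omega>. ennreal ((norm (\<Sum>i=1..k. X (\<omega> i)))^2 + real j * v)) \<in> borel_measurable (\<Pi>\<^sub>M i\<in>{1..k}. M)" for j k
      by measurable
  qed auto
  then show ?thesis by simp
qed

text \<open>The potential is \<open>exp (4 * j * v) * cosh (norm s)\<close>: one draw multiplies
  \<open>cosh (norm s)\<close> on average by at most \<open>1 + 4 * v \<le> exp (4 * v)\<close>, the
  linear term having mean zero. Unlike \<open>exp\<close>, \<open>cosh\<close> of the norm is smooth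
  at the origin.\<close>

theorem exponential_moment_sum:
  assumes b: "b \<le> 1"
  shows "(\<integral>\<^sup>+\<omega>. ennreal (cosh (norm (\<Sum>i=1..k. X (\<omega> i)))) \<partial>(\<Pi>\<^sub>M i\<in>{1..k}. M)) \<le> ennreal (exp (4 * real k * v))"
proof -
  have "(\<integral>\<^sup>+\<omega>. ennreal (exp (4 * real 0 * v) * cosh (norm (\<Sum>i=1..k. X (\<omega> i)))) \<partial>(\<Pi>\<^sub>M i\<in>{1..k}. M))
    \<le> ennreal (exp (4 * real (0 + k) * v) * cosh (norm (0::'v)))"
  proof (rule nn_integral_chain_le[OF prob_space_axioms, where st = "\<lambda>k \<omega>. \<Sum>i=1..k. X (\<omega> i)"
        and \<Phi> = "\<lambda>j s. ennreal (exp (4 * real j * v) * cosh (norm s))" and step = "\<lambda>s y. s + X y"])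
    fix j s
    let ?g = "\<lambda>y. cosh (norm s) * (1 + 4 * (norm (X y))^2) + sinh (norm s) / norm s * (s \<bullet> X y)"
    have g: "cosh (norm (s + X y)) \<le> ?g y" if "y \<in> space M" for y
      using bound[OF that] b by (intro cosh_norm_add_le) auto
    have int: "integrable M ?g"
      by (intro Bochner_Integration.integrable_add integrable_mult_right integrable_const integrable_inner integrable_norm)
    have "(\<integral>\<^sup>+ y. ennreal (exp (4 * real j * v) * cosh (norm (s + X y))) \<partial>M)
       \<le> (\<integral>\<^sup>+ y. ennreal (exp (4 * real j * v) * ?g y) \<partial>M)"
      by (intro nn_integral_mono ennreal_leI mult_left_mono g) auto
    also have "\<dots> = ennreal (\<integral>y. exp (4 * real j * v) * ?g y \<partial>M)"
    proof (rule nn_integral_eq_integral)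
      show "integrable M (\<lambda>y. exp (4 * real j * v) * ?g y)" using int by (rule integrable_mult_right)
      show "AE y in M. 0 \<le> exp (4 * real j * v) * ?g y"
      proof (rule AE_I2)
        fix y assume "y \<in> space M"
        from g[OF this] cosh_real_pos[of "norm (s + X y)"] have "0 \<le> ?g y" by linarith
        then show "0 \<le> exp (4 * real j * v) * ?g y" by (intro mult_nonneg_nonneg) auto
      qed
    qed
    also have "(\<integral>y. exp (4 * real j * v) * ?g y \<partial>M)
       = exp (4 * real j * v) * (cosh (norm s) * (1 + 4 * (\<integral>y. (norm (X y))^2 \<partial>M)))"
      using integrable_inner integrable_norm mean by (simp add: prob_space)
    also have "\<dots> \<le> exp (4 * real j * v) * (cosh (norm s) * exp (4 * v))"
    proof -
      have "1 + 4 * (\<integral>y. (norm (X y))^2 \<partial>M) \<le> exp (4 * v)"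
        using variance exp_ge_add_one_self[of "4 * v"] by linarith
      then show ?thesis by (intro mult_left_mono) auto
    qed
    also have "\<dots> = exp (4 * real (Suc j) * v) * cosh (norm s)" by (simp add: exp_add[symmetric] algebra_simps)
    finally show "(\<integral>\<^sup>+ y. ennreal (exp (4 * real j * v) * cosh (norm (s + X y))) \<partial>M)
        \<le> ennreal (exp (4 * real (Suc j) * v) * cosh (norm s))"
      by (simp add: ennreal_leI order_trans)
  next
    fix j k
    have "(\<lambda>\<omega>. cosh (norm (\<Sum>i=1..k. X (\<omega> i)))) \<in> borel_measurable (\<Pi>\<^sub>M i\<in>{1..k}. M)"
      unfolding cosh_def by measurable
    then show "(\<lambda>\<omega>. ennreal (exp (4 * real j * v) * cosh (norm (\<Sum>i=1..k. X (\<omega> i))))) \<in> borel_measurable (\<Pi>\<^sub>M i\<in>{1..k}. M)"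
      by measurable
  qed auto
  then show ?thesis by simp
qed

text \<open>Markov's inequality for \<open>cosh\<close>, which is at least \<open>exp u / 2\<close>
  beyond \<open>u\<close>; hence the factor 2.\<close>

theorem sum_tail_bound:
  assumes b: "b \<le> 1"
  shows "emeasure (\<Pi>\<^sub>M i\<in>{1..k}. M) {\<omega> \<in> space (\<Pi>\<^sub>M i\<in>{1..k}. M). norm (\<Sum>i=1..k. X (\<omega> i)) \<ge> u}
     \<le> ennreal (2 * exp (4 * real k * v - u))"
proof -
  let ?P = "\<Pi>\<^sub>M i\<in>{1..k}. M"
  let ?A = "{\<omega> \<in> space ?P. norm (\<Sum>i=1..k. X (\<omega> i)) \<ge> u}"
  have A: "?A \<in> sets ?P" by measurable
  have "ennreal (exp u / 2) * emeasure ?P ?A = (\<integral>\<^sup>+\<omega>. ennreal (exp u / 2) * indicator ?A \<omega> \<partial>?P)"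
    using A by (simp add: nn_integral_cmult_indicator)
  also have "\<dots> \<le> (\<integral>\<^sup>+\<omega>. ennreal (cosh (norm (\<Sum>i=1..k. X (\<omega> i)))) \<partial>?P)"
  proof (rule nn_integral_mono)
    fix \<omega>
    have "exp u / 2 \<le> cosh z" if "u \<le> z" for z
    proof -
      have "exp u \<le> exp z" using that by simp
      also have "\<dots> \<le> exp z + exp (- z)" by simp
      finally show ?thesis unfolding cosh_field_def by simp
    qed
    then show "ennreal (exp u / 2) * indicator ?A \<omega> \<le> ennreal (cosh (norm (\<Sum>i=1..k. X (\<omega> i))))"
      by (auto simp: indicator_def intro!: ennreal_leI)
  qed
  also have "\<dots> \<le> ennreal (exp (4 * real k * v))" by (rule exponential_moment_sum[OF b])
  finally have "ennreal (2 * exp (- u)) * (ennreal (exp u / 2) * emeasure ?P ?A)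
      \<le> ennreal (2 * exp (- u)) * ennreal (exp (4 * real k * v))"
    by (rule mult_left_mono) simp
  moreover have "ennreal (2 * exp (- u)) * (ennreal (exp u / 2) * e) = e" for e
    by (simp add: mult.assoc[symmetric] ennreal_mult[symmetric] exp_minus)
  moreover have "ennreal (2 * exp (- u)) * ennreal (exp (4 * real k * v)) = ennreal (2 * exp (4 * real k * v - u))"
    by (simp add: ennreal_mult[symmetric] exp_diff exp_minus divide_inverse mult_ac)
  ultimately show ?thesis by simp
qed

end

section \<open>Empirical covariance in finitely many directions\<close>

text \<open>Later \<open>\<psi> e\<close> is the coordinate of a kernel section along the singular
  vector \<open>e\<close>, divided by \<open>sqrt (s e + l)\<close>. Its covariance is then diagonal
  with entries \<open>a e = s e / (s e + l)\<close>, \<open>B\<close> is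
  \<open>\<kappa>^2 / l\<close>, and \<open>N\<close> bounds the effective dimension.\<close>

locale diagonal_design = prob_space M for M :: "'a measure" +
  fixes F :: "'i set" and \<psi> :: "'i \<Rightarrow> 'a \<Rightarrow> real" and a :: "'i \<Rightarrow> real" and B N :: real
  assumes fin: "finite F"
    and \<psi>_meas [measurable]: "e \<in> F \<Longrightarrow> \<psi> e \<in> borel_measurable M"
    and \<psi>_bound: "m \<in> space M \<Longrightarrow> (\<Sum>e\<in>F. (\<psi> e m)^2) \<le> B"
    and \<psi>_cov: "e \<in> F \<Longrightarrow> k \<in> F \<Longrightarrow> (\<integral>m. \<psi> e m * \<psi> k m \<partial>M) = (if e = k then a e else 0)"
    and a01: "e \<in> F \<Longrightarrow> 0 \<le> a e" "e \<in> F \<Longrightarrow> a e \<le> 1"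
    and a_sum: "(\<Sum>e\<in>F. a e) \<le> N"
begin

definition Z :: "'a \<Rightarrow> 'i \<Rightarrow> 'i \<Rightarrow> real" where
  "Z m e k = \<psi> e m * \<psi> k m - (if e = k then a e else 0)"

definition S :: "nat \<Rightarrow> (nat \<Rightarrow> 'a) \<Rightarrow> 'i \<Rightarrow> 'i \<Rightarrow> real" where
  "S n \<omega> e k = (\<Sum>j=1..n. Z (\<omega> j) e k)"

text \<open>The matrix \<open>S\<^sup>2 - \<Sum>\<^sub>j Z\<^sub>j\<^sup>2\<close>, written as the martingale of its increments.\<close>

primrec W :: "nat \<Rightarrow> (nat \<Rightarrow> 'a) \<Rightarrow> 'i \<Rightarrow> 'i \<Rightarrow> real" where
  "W 0 \<omega> e k = 0"
| "W (Suc n) \<omega> e k = W n \<omega> e k +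
     (\<Sum>l\<in>F. S n \<omega> e l * Z (\<omega> (Suc n)) l k + Z (\<omega> (Suc n)) e l * S n \<omega> l k)"

lemma B_nonneg: "B \<ge> 0"
  using \<psi>_bound not_empty by (meson ex_in_conv order_trans sum_nonneg zero_le_power2)

lemma \<psi>_sq_le: "m \<in> space M \<Longrightarrow> e \<in> F \<Longrightarrow> (\<psi> e m)^2 \<le> B"
  using member_le_sum[of e F "\<lambda>e. (\<psi> e m)^2"] \<psi>_bound[of m] fin by force

lemma \<psi>_abs_le: "m \<in> space M \<Longrightarrow> e \<in> F \<Longrightarrow> \<bar>\<psi> e m\<bar> \<le> sqrt B"
  using real_le_rsqrt[OF \<psi>_sq_le] by (metis abs_le_square_iff abs_of_nonneg B_nonneg real_sqrt_abs real_sqrt_le_mono \<psi>_sq_le)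

definition bdd_fun :: "('a \<Rightarrow> real) \<Rightarrow> bool" where
  "bdd_fun f \<longleftrightarrow> f \<in> borel_measurable M \<and> (\<exists>c. \<forall>m\<in>space M. \<bar>f m\<bar> \<le> c)"

lemma bdd_funD: "bdd_fun f \<Longrightarrow> integrable M f"
  unfolding bdd_fun_def by (auto intro!: integrable_const_bound AE_I2)

lemma bdd_fun_const [intro]: "bdd_fun (\<lambda>_. c)"
  by (auto simp: bdd_fun_def)

lemma bdd_fun_add [intro]: "bdd_fun f \<Longrightarrow> bdd_fun g \<Longrightarrow> bdd_fun (\<lambda>m. f m + g m)"
proof -
  assume f: "bdd_fun f" and g: "bdd_fun g"
  then obtain c d where "\<forall>m\<in>space M. \<bar>f m\<bar> \<le> c" "\<forall>m\<in>space M. \<bar>g m\<bar> \<le> d" by (auto simp: bdd_fun_def)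
  then have "\<forall>m\<in>space M. \<bar>f m + g m\<bar> \<le> c + d" by fastforce
  then show ?thesis using f g by (auto simp: bdd_fun_def)
qed

lemma bdd_fun_mult [intro]: "bdd_fun f \<Longrightarrow> bdd_fun g \<Longrightarrow> bdd_fun (\<lambda>m. f m * g m)"
proof -
  assume f: "bdd_fun f" and g: "bdd_fun g"
  then obtain c d where "\<forall>m\<in>space M. \<bar>f m\<bar> \<le> c" "\<forall>m\<in>space M. \<bar>g m\<bar> \<le> d" by (auto simp: bdd_fun_def)
  then have "\<forall>m\<in>space M. \<bar>f m * g m\<bar> \<le> c * d" by (auto simp: abs_mult intro!: mult_mono order_trans[OF abs_ge_zero])
  then show ?thesis using f g by (auto simp: bdd_fun_def)
qed

lemma bdd_fun_sum [intro]: "(\<And>i. i \<in> I \<Longrightarrow> bdd_fun (f i)) \<Longrightarrow> bdd_fun (\<lambda>m. \<Sum>i\<in>I. f i m)"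
  by (induction I rule: infinite_finite_induct) auto

lemma bdd_fun_power2 [intro]: "bdd_fun f \<Longrightarrow> bdd_fun (\<lambda>m. (f m)^2)"
  unfolding power2_eq_square by (rule bdd_fun_mult)

lemma bdd_fun_\<psi> [intro]: "e \<in> F \<Longrightarrow> bdd_fun (\<psi> e)"
  using \<psi>_abs_le by (auto simp: bdd_fun_def)

lemmas bdd_intros = bdd_fun_power2 bdd_fun_add bdd_fun_mult bdd_fun_sum bdd_fun_const bdd_fun_\<psi>

text \<open>For a constant plus a centred variable the cross term vanishes, and the variance is at
  most the second moment.\<close>

lemma second_moment_shift:
  assumes f: "bdd_fun f"
  shows "(\<integral>m. (c + (f m - (\<integral>m. f m \<partial>M)))^2 \<partial>M) \<le> c^2 + (\<integral>m. (f m)^2 \<partial>M)"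
proof -
  let ?\<mu> = "\<integral>m. f m \<partial>M"
  note int = bdd_funD[OF f] bdd_funD[OF bdd_fun_power2[OF f]]
  have "(\<integral>m. (c + (f m - ?\<mu>))^2 \<partial>M) = (\<integral>m. (c - ?\<mu>)^2 + 2 * (c - ?\<mu>) * f m + (f m)^2 \<partial>M)"
    by (intro Bochner_Integration.integral_cong) (auto simp: power2_eq_square algebra_simps)
  also have "\<dots> = (c - ?\<mu>)^2 + 2 * (c - ?\<mu>) * ?\<mu> + (\<integral>m. (f m)^2 \<partial>M)"
    using int by (simp add: prob_space)
  also have "\<dots> = c^2 - ?\<mu>^2 + (\<integral>m. (f m)^2 \<partial>M)" by (simp add: power2_eq_square algebra_simps)
  finally show ?thesis by simp
qed

lemma cov_sum:
  assumes "e \<in> F" shows "(\<integral>m. (\<Sum>l\<in>F. c l * \<psi> l m) * \<psi> e m \<partial>M) = c e * a e"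
proof -
  have "(\<integral>m. (\<Sum>l\<in>F. c l * \<psi> l m) * \<psi> e m \<partial>M) = (\<integral>m. (\<Sum>l\<in>F. c l * (\<psi> l m * \<psi> e m)) \<partial>M)"
    by (simp add: sum_distrib_right mult.assoc)
  also have "\<dots> = (\<Sum>l\<in>F. c l * (\<integral>m. \<psi> l m * \<psi> e m \<partial>M))"
    using assms by (subst Bochner_Integration.integral_sum) (auto intro!: bdd_funD)
  also have "\<dots> = (\<Sum>l\<in>F. if l = e then c e * a e else 0)"
    using assms by (intro sum.cong) (auto simp: \<psi>_cov)
  finally show ?thesis using assms fin by simp
qed

lemma second_moment_sum: "(\<integral>m. (\<Sum>l\<in>F. c l * \<psi> l m)^2 \<partial>M) = (\<Sum>l\<in>F. a l * (c l)^2)"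
proof -
  have "(\<integral>m. (\<Sum>l\<in>F. c l * \<psi> l m)^2 \<partial>M) = (\<integral>m. (\<Sum>e\<in>F. c e * ((\<Sum>l\<in>F. c l * \<psi> l m) * \<psi> e m)) \<partial>M)"
    by (simp add: power2_eq_square sum_distrib_left sum_distrib_right mult_ac)
  also have "\<dots> = (\<Sum>e\<in>F. c e * (\<integral>m. (\<Sum>l\<in>F. c l * \<psi> l m) * \<psi> e m \<partial>M))"
  proof -
    have "integrable M (\<lambda>m. c e * ((\<Sum>l\<in>F. c l * \<psi> l m) * \<psi> e m))" if "e \<in> F" for e
      by (intro bdd_funD bdd_intros that)
    then show ?thesis by (subst Bochner_Integration.integral_sum) auto
  qed
  also have "\<dots> = (\<Sum>l\<in>F. a l * (c l)^2)"
    by (intro sum.cong) (auto simp: cov_sum power2_eq_square)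
  finally show ?thesis .
qed

lemma integral_times_norm_le:
  assumes g: "bdd_fun g" "\<And>m. g m \<ge> 0"
  shows "(\<Sum>k\<in>F. \<integral>m. g m * (\<psi> k m)^2 \<partial>M) \<le> B * (\<integral>m. g m \<partial>M)"
proof -
  have "(\<Sum>k\<in>F. \<integral>m. g m * (\<psi> k m)^2 \<partial>M) = (\<integral>m. (\<Sum>k\<in>F. g m * (\<psi> k m)^2) \<partial>M)"
    by (intro Bochner_Integration.integral_sum[symmetric] bdd_funD bdd_intros g)
  also have "\<dots> \<le> (\<integral>m. B * g m \<partial>M)"
  proof (intro integral_mono bdd_funD)
    fix m assume "m \<in> space M"
    then show "(\<Sum>k\<in>F. g m * (\<psi> k m)^2) \<le> B * g m"
      using mult_left_mono[OF \<psi>_bound g(2), of m m] by (simp add: sum_distrib_left mult.commute)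
  qed (intro bdd_fun_mult bdd_fun_sum bdd_fun_power2 bdd_fun_const bdd_fun_\<psi> g; assumption)+
  finally show ?thesis using bdd_funD[OF g(1)] by simp
qed

text \<open>Up to the factor \<open>2 * B\<close>, a bound for the second moment of the next
  increment of \<open>W\<close> when the matrix sum is \<open>s\<close>; rows and columns of
  \<open>s\<close> are weighted by the covariance.\<close>

definition weight :: "('i \<Rightarrow> 'i \<Rightarrow> real) \<Rightarrow> real" where
  "weight s = (\<Sum>e\<in>F. \<Sum>k\<in>F. (a e + a k) * (s e k)^2)"

definition incr :: "('i \<Rightarrow> 'i \<Rightarrow> real) \<Rightarrow> 'a \<Rightarrow> 'i \<Rightarrow> 'i \<Rightarrow> real" where
  "incr s m e k = (\<Sum>l\<in>F. s e l * Z m l k + Z m e l * s l k)"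

text \<open>Entry \<open>(e, k)\<close> of the increment is
  \<open>p e * \<psi> k + q k * \<psi> e\<close> minus its mean, where \<open>p\<close> and
  \<open>q\<close> are the vector \<open>\<psi>\<close> multiplied by \<open>s\<close> and by its
  transpose. Summing squares over the free index of \<open>\<psi>\<close> costs \<open>B\<close>;
  what remains are second moments of \<open>p\<close> and \<open>q\<close>, which are sums weighted
  by \<open>a\<close>.\<close>

lemma incr_second_moment:
  "(\<Sum>e\<in>F. \<Sum>k\<in>F. \<integral>m. (w e k + incr s m e k)^2 \<partial>M) \<le> (\<Sum>e\<in>F. \<Sum>k\<in>F. (w e k)^2) + 2 * B * weight s"
proof -
  define p where "p e m = (\<Sum>l\<in>F. s e l * \<psi> l m)" for e m
  define q where "q k m = (\<Sum>l\<in>F. s l k * \<psi> l m)" for k m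
  have lin: "bdd_fun (\<lambda>m. \<Sum>l\<in>F. c l * \<psi> l m)" for c
    by (intro bdd_intros)
  have pq: "bdd_fun (p e)" "bdd_fun (q e)" for e
    unfolding p_def q_def by (rule lin)+
  have one: "(\<integral>m. (w e k + incr s m e k)^2 \<partial>M)
      \<le> (w e k)^2 + (2 * (\<integral>m. (p e m)^2 * (\<psi> k m)^2 \<partial>M) + 2 * (\<integral>m. (q k m)^2 * (\<psi> e m)^2 \<partial>M))"
    if ek: "e \<in> F" "k \<in> F" for e k
  proof -
    define f where "f m = p e m * \<psi> k m + q k m * \<psi> e m" for m
    have f: "bdd_fun f" unfolding f_def by (intro bdd_intros pq ek)
    have "integrable M (\<lambda>m. p e m * \<psi> k m)" "integrable M (\<lambda>m. q k m * \<psi> e m)"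
      by (intro bdd_funD bdd_intros pq ek)+
    then have mean: "(\<integral>m. f m \<partial>M) = s e k * a k + s e k * a e"
      unfolding f_def p_def q_def using ek by (simp add: cov_sum)
    have incr: "incr s m e k = f m - (\<integral>m. f m \<partial>M)" for m
    proof -
      have "incr s m e k = (\<Sum>l\<in>F. s e l * \<psi> l m * \<psi> k m + s l k * \<psi> l m * \<psi> e m
              - (if l = k then s e k * a k else 0) - (if l = e then s e k * a e else 0))"
        unfolding incr_def Z_def by (intro sum.cong) (auto simp: algebra_simps)
      also have "\<dots> = f m - (s e k * a k + s e k * a e)"
        using ek fin by (simp add: sum.distrib sum_subtractf f_def p_def q_def sum_distrib_right)
      finally show ?thesis by (simp add: mean)
    qed
    have "(\<integral>m. (w e k + incr s m e k)^2 \<partial>M) \<le> (w e k)^2 + (\<integral>m. (f m)^2 \<partial>M)"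
      unfolding incr by (rule second_moment_shift[OF f])
    also have "(\<integral>m. (f m)^2 \<partial>M) \<le> (\<integral>m. 2 * ((p e m)^2 * (\<psi> k m)^2) + 2 * ((q k m)^2 * (\<psi> e m)^2) \<partial>M)"
    proof (intro integral_mono bdd_funD)
      fix m
      show "(f m)^2 \<le> 2 * ((p e m)^2 * (\<psi> k m)^2) + 2 * ((q k m)^2 * (\<psi> e m)^2)"
        using sum_squares_bound[of "p e m * \<psi> k m" "q k m * \<psi> e m"]
        unfolding f_def power2_sum power_mult_distrib by linarith
    qed (intro bdd_intros pq ek f)+
    also have "\<dots> = 2 * (\<integral>m. (p e m)^2 * (\<psi> k m)^2 \<partial>M) + 2 * (\<integral>m. (q k m)^2 * (\<psi> e m)^2 \<partial>M)"
    proof -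
      have "integrable M (\<lambda>m. (p e m)^2 * (\<psi> k m)^2)" "integrable M (\<lambda>m. (q k m)^2 * (\<psi> e m)^2)"
        by (intro bdd_funD bdd_intros pq ek)+
      then show ?thesis by simp
    qed
    finally show ?thesis by simp
  qed
  have P: "(\<Sum>e\<in>F. \<Sum>k\<in>F. \<integral>m. (p e m)^2 * (\<psi> k m)^2 \<partial>M) \<le> B * (\<Sum>e\<in>F. \<Sum>k\<in>F. a k * (s e k)^2)"
  proof -
    have "(\<Sum>e\<in>F. \<Sum>k\<in>F. \<integral>m. (p e m)^2 * (\<psi> k m)^2 \<partial>M) \<le> (\<Sum>e\<in>F. B * (\<integral>m. (p e m)^2 \<partial>M))"
      by (intro sum_mono integral_times_norm_le bdd_intros pq) auto
    also have "\<dots> = B * (\<Sum>e\<in>F. \<Sum>k\<in>F. a k * (s e k)^2)"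
      unfolding p_def second_moment_sum by (simp add: sum_distrib_left)
    finally show ?thesis .
  qed
  have Q: "(\<Sum>k\<in>F. \<Sum>e\<in>F. \<integral>m. (q k m)^2 * (\<psi> e m)^2 \<partial>M) \<le> B * (\<Sum>k\<in>F. \<Sum>e\<in>F. a e * (s e k)^2)"
  proof -
    have "(\<Sum>k\<in>F. \<Sum>e\<in>F. \<integral>m. (q k m)^2 * (\<psi> e m)^2 \<partial>M) \<le> (\<Sum>k\<in>F. B * (\<integral>m. (q k m)^2 \<partial>M))"
      by (intro sum_mono integral_times_norm_le bdd_intros pq) auto
    also have "\<dots> = B * (\<Sum>k\<in>F. \<Sum>e\<in>F. a e * (s e k)^2)"
      unfolding q_def second_moment_sum by (simp add: sum_distrib_left)
    finally show ?thesis .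
  qed
  have "(\<Sum>e\<in>F. \<Sum>k\<in>F. \<integral>m. (w e k + incr s m e k)^2 \<partial>M)
    \<le> (\<Sum>e\<in>F. \<Sum>k\<in>F. (w e k)^2 + (2 * (\<integral>m. (p e m)^2 * (\<psi> k m)^2 \<partial>M) + 2 * (\<integral>m. (q k m)^2 * (\<psi> e m)^2 \<partial>M)))"
    by (intro sum_mono one)
  also have "\<dots> = (\<Sum>e\<in>F. \<Sum>k\<in>F. (w e k)^2) + 2 * (\<Sum>e\<in>F. \<Sum>k\<in>F. \<integral>m. (p e m)^2 * (\<psi> k m)^2 \<partial>M)
      + 2 * (\<Sum>k\<in>F. \<Sum>e\<in>F. \<integral>m. (q k m)^2 * (\<psi> e m)^2 \<partial>M)"
    by (subst (3) sum.swap) (simp add: sum.distrib sum_distrib_left)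
  also have "\<dots> \<le> (\<Sum>e\<in>F. \<Sum>k\<in>F. (w e k)^2) + 2 * (B * (\<Sum>e\<in>F. \<Sum>k\<in>F. a k * (s e k)^2))
      + 2 * (B * (\<Sum>k\<in>F. \<Sum>e\<in>F. a e * (s e k)^2))"
    using P Q by linarith
  also have "(\<Sum>k\<in>F. \<Sum>e\<in>F. a e * (s e k)^2) = (\<Sum>e\<in>F. \<Sum>k\<in>F. a e * (s e k)^2)" by (rule sum.swap)
  finally show ?thesis by (simp add: weight_def distrib_right sum.distrib algebra_simps)
qed

text \<open>The new summand contributes at most \<open>2 * B\<close> times the sum of the
  \<open>(a e)^2\<close>, and \<open>a e \<le> 1\<close> reduces this to the trace.\<close>

lemma weight_step: "(\<Sum>e\<in>F. \<Sum>k\<in>F. \<integral>m. (a e + a k) * (s e k + Z m e k)^2 \<partial>M) \<le> weight s + 2 * B * N"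
proof -
  have one: "(\<integral>m. (a e + a k) * (s e k + Z m e k)^2 \<partial>M)
      \<le> (a e + a k) * (s e k)^2 + (a e * (\<integral>m. (\<psi> e m)^2 * (\<psi> k m)^2 \<partial>M) + a k * (\<integral>m. (\<psi> k m)^2 * (\<psi> e m)^2 \<partial>M))"
    if ek: "e \<in> F" "k \<in> F" for e k
  proof -
    have b: "bdd_fun (\<lambda>m. \<psi> e m * \<psi> k m)" using ek by auto
    have "(\<integral>m. (s e k + Z m e k)^2 \<partial>M) \<le> (s e k)^2 + (\<integral>m. (\<psi> e m * \<psi> k m)^2 \<partial>M)"
      using second_moment_shift[OF b, of "s e k"] ek by (simp add: Z_def \<psi>_cov)
    then have "(a e + a k) * (\<integral>m. (s e k + Z m e k)^2 \<partial>M) \<le> (a e + a k) * ((s e k)^2 + (\<integral>m. (\<psi> e m * \<psi> k m)^2 \<partial>M))"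
      using a01 ek by (intro mult_left_mono) auto
    moreover have "(\<integral>m. (a e + a k) * (s e k + Z m e k)^2 \<partial>M) = (a e + a k) * (\<integral>m. (s e k + Z m e k)^2 \<partial>M)"
      by simp
    moreover have "(\<integral>m. (\<psi> k m)^2 * (\<psi> e m)^2 \<partial>M) = (\<integral>m. (\<psi> e m)^2 * (\<psi> k m)^2 \<partial>M)"
      by (simp add: mult.commute)
    ultimately show ?thesis by (simp only: power_mult_distrib distrib_left distrib_right)
  qed
  have two: "(\<Sum>e\<in>F. \<Sum>k\<in>F. a e * (\<integral>m. (\<psi> e m)^2 * (\<psi> k m)^2 \<partial>M)) \<le> B * N"
  proof -
    have "(\<Sum>e\<in>F. \<Sum>k\<in>F. a e * (\<integral>m. (\<psi> e m)^2 * (\<psi> k m)^2 \<partial>M)) = (\<Sum>e\<in>F. a e * (\<Sum>k\<in>F. \<integral>m. (\<psi> e m)^2 * (\<psi> k m)^2 \<partial>M))"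
      by (simp add: sum_distrib_left)
    also have "\<dots> \<le> (\<Sum>e\<in>F. a e * (B * (\<integral>m. (\<psi> e m)^2 \<partial>M)))"
      using a01 by (intro sum_mono mult_left_mono integral_times_norm_le) auto
    also have "\<dots> = (\<Sum>e\<in>F. a e * (B * a e))"
      using \<psi>_cov by (intro sum.cong) (auto simp: power2_eq_square)
    also have "\<dots> \<le> (\<Sum>e\<in>F. a e * (B * 1))"
      using a01 B_nonneg by (intro sum_mono mult_left_mono) auto
    also have "\<dots> = B * (\<Sum>e\<in>F. a e)" by (simp add: sum_distrib_left mult.commute)
    also have "\<dots> \<le> B * N" using a_sum B_nonneg by (rule mult_left_mono)
    finally show ?thesis .
  qed
  have "(\<Sum>e\<in>F. \<Sum>k\<in>F. \<integral>m. (a e + a k) * (s e k + Z m e k)^2 \<partial>M)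
     \<le> (\<Sum>e\<in>F. \<Sum>k\<in>F. (a e + a k) * (s e k)^2 + (a e * (\<integral>m. (\<psi> e m)^2 * (\<psi> k m)^2 \<partial>M) + a k * (\<integral>m. (\<psi> k m)^2 * (\<psi> e m)^2 \<partial>M)))"
    by (intro sum_mono one)
  also have "\<dots> = weight s + (\<Sum>e\<in>F. \<Sum>k\<in>F. a e * (\<integral>m. (\<psi> e m)^2 * (\<psi> k m)^2 \<partial>M))
      + (\<Sum>k\<in>F. \<Sum>e\<in>F. a k * (\<integral>m. (\<psi> k m)^2 * (\<psi> e m)^2 \<partial>M))"
    unfolding weight_def sum.distrib
    using sum.swap[of "\<lambda>e k. a k * (\<integral>m. (\<psi> k m)^2 * (\<psi> e m)^2 \<partial>M)" F F] by linarith
  finally show ?thesis using two by linarith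
qed

text \<open>The middle term dominates the conditional second moments of the remaining \<open>j\<close> increments of \<open>W\<close>.\<close>

definition potential :: "nat \<Rightarrow> ('i \<Rightarrow> 'i \<Rightarrow> real) \<times> ('i \<Rightarrow> 'i \<Rightarrow> real) \<Rightarrow> real" where
  "potential j s = (\<Sum>e\<in>F. \<Sum>k\<in>F. (snd s e k)^2) + 2 * B * real j * weight (fst s) + 2 * B^2 * N * (real j)^2"

lemma N_nonneg: "N \<ge> 0"
  using a_sum sum_nonneg[of F a] a01 by force

text \<open>One draw adds \<open>2 * B * weight s\<close> to the first term and at most
  \<open>2 * B * N\<close> to the weight. The resulting \<open>4 * B^2 * N * j\<close> fits into the
  last term because \<open>j^2 + 2 * j \<le> (j + 1)^2\<close>.\<close>

lemma potential_step:
  "(\<integral>m. potential j (\<lambda>e k. s e k + Z m e k, \<lambda>e k. w e k + incr s m e k) \<partial>M) \<le> potential (Suc j) (s, w)"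
proof -
  have Zb: "bdd_fun (\<lambda>m. Z m e k)" if "e \<in> F" "k \<in> F" for e k
  proof -
    have "bdd_fun (\<lambda>m. \<psi> e m * \<psi> k m + (- (if e = k then a e else 0)))" by (intro bdd_intros that)
    then show ?thesis by (simp add: Z_def)
  qed
  have ib: "bdd_fun (\<lambda>m. incr s m e k)" if "e \<in> F" "k \<in> F" for e k
    unfolding incr_def by (intro bdd_fun_sum bdd_fun_add bdd_fun_mult bdd_fun_const Zb that; assumption)
  have i1: "integrable M (\<lambda>m. (w e k + incr s m e k)^2)" if "e \<in> F" "k \<in> F" for e k
    by (intro bdd_funD bdd_fun_power2 bdd_fun_add bdd_fun_const ib that)
  have i2: "integrable M (\<lambda>m. (a e + a k) * (s e k + Z m e k)^2)" if "e \<in> F" "k \<in> F" for e k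
    by (intro bdd_funD bdd_fun_mult bdd_fun_power2 bdd_fun_add bdd_fun_const Zb that)
  have "(\<integral>m. potential j (\<lambda>e k. s e k + Z m e k, \<lambda>e k. w e k + incr s m e k) \<partial>M)
      = (\<Sum>e\<in>F. \<Sum>k\<in>F. \<integral>m. (w e k + incr s m e k)^2 \<partial>M)
        + 2 * B * real j * (\<Sum>e\<in>F. \<Sum>k\<in>F. \<integral>m. (a e + a k) * (s e k + Z m e k)^2 \<partial>M) + 2 * B^2 * N * (real j)^2"
    unfolding potential_def weight_def fst_conv snd_conv
    using i1 i2 by (simp add: prob_space Bochner_Integration.integral_sum Bochner_Integration.integrable_sum)
  also have "\<dots> \<le> ((\<Sum>e\<in>F. \<Sum>k\<in>F. (w e k)^2) + 2 * B * weight s) + 2 * B * real j * (weight s + 2 * B * N) + 2 * B^2 * N * (real j)^2"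
    using B_nonneg by (intro add_mono mult_left_mono incr_second_moment weight_step order_refl) auto
  also have "\<dots> = (\<Sum>e\<in>F. \<Sum>k\<in>F. (w e k)^2) + 2 * B * real (Suc j) * weight s + 2 * B^2 * N * ((real j)^2 + 2 * real j)"
    by (simp add: algebra_simps power2_eq_square)
  also have "\<dots> \<le> potential (Suc j) (s, w)"
  proof -
    have "2 * B^2 * N * ((real j)^2 + 2 * real j) \<le> 2 * B^2 * N * (real (Suc j))^2"
    proof (rule mult_left_mono)
      show "0 \<le> 2 * B^2 * N" using N_nonneg by simp
    qed (simp add: power2_eq_square algebra_simps)
    then show ?thesis by (simp add: potential_def)
  qed
  finally show ?thesis .
qed

lemma potential_nonneg: "potential j s \<ge> 0"
  unfolding potential_def weight_def using B_nonneg N_nonneg a01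
  by (intro add_nonneg_nonneg sum_nonneg mult_nonneg_nonneg) auto

lemma Z_component_meas [measurable]:
  "i \<in> {1..n} \<Longrightarrow> e \<in> F \<Longrightarrow> k \<in> F \<Longrightarrow> (\<lambda>\<omega>. Z (\<omega> i) e k) \<in> borel_measurable (\<Pi>\<^sub>M i\<in>{1..n}. M)"
  unfolding Z_def by measurable

lemma S_meas [measurable]: "n \<le> n' \<Longrightarrow> e \<in> F \<Longrightarrow> k \<in> F \<Longrightarrow> (\<lambda>\<omega>. S n \<omega> e k) \<in> borel_measurable (\<Pi>\<^sub>M i\<in>{1..n'}. M)"
  unfolding S_def by (intro borel_measurable_sum Z_component_meas) auto

lemma W_meas [measurable]: "n \<le> n' \<Longrightarrow> e \<in> F \<Longrightarrow> k \<in> F \<Longrightarrow> (\<lambda>\<omega>. W n \<omega> e k) \<in> borel_measurable (\<Pi>\<^sub>M i\<in>{1..n'}. M)"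
proof (induction n arbitrary: e k)
  case (Suc n)
  then show ?case
    unfolding W.simps
    by (intro borel_measurable_add borel_measurable_sum borel_measurable_times S_meas Z_component_meas Suc.IH) auto
qed simp

lemma W_second_moment:
  "(\<integral>\<^sup>+\<omega>. ennreal (\<Sum>e\<in>F. \<Sum>k\<in>F. (W n \<omega> e k)^2) \<partial>(\<Pi>\<^sub>M i\<in>{1..n}. M)) \<le> ennreal (2 * B^2 * N * (real n)^2)"
proof -
  have "(\<integral>\<^sup>+\<omega>. ennreal (potential 0 (S n \<omega>, W n \<omega>)) \<partial>(\<Pi>\<^sub>M i\<in>{1..n}. M))
      \<le> ennreal (potential (0 + n) (\<lambda>e k. 0, \<lambda>e k. 0))"
  proof (rule nn_integral_chain_le[OF prob_space_axioms, where st = "\<lambda>n \<omega>. (S n \<omega>, W n \<omega>)" and \<Phi> = "\<lambda>j s. ennreal (potential j s)"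
        and step = "\<lambda>s m. (\<lambda>e k. fst s e k + Z m e k, \<lambda>e k. snd s e k + incr (fst s) m e k)"])
    show "(S 0 \<omega>, W 0 \<omega>) = (\<lambda>e k. 0, \<lambda>e k. 0)" for \<omega>
      by (auto simp: S_def fun_eq_iff)
    show "(S (Suc k) \<omega>, W (Suc k) \<omega>) = (\<lambda>e ka. fst (S k \<omega>, W k \<omega>) e ka + Z (\<omega> (Suc k)) e ka,
        \<lambda>e ka. snd (S k \<omega>, W k \<omega>) e ka + incr (fst (S k \<omega>, W k \<omega>)) (\<omega> (Suc k)) e ka)" for k \<omega>
      by (auto simp: S_def fun_eq_iff incr_def)
    show "(\<lambda>\<omega>. ennreal (potential j (S k \<omega>, W k \<omega>))) \<in> borel_measurable (\<Pi>\<^sub>M i\<in>{1..k}. M)" for j k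
      unfolding potential_def weight_def fst_conv snd_conv
      by (intro measurable_compose[OF _ measurable_ennreal] borel_measurable_add borel_measurable_sum borel_measurable_times borel_measurable_power borel_measurable_const S_meas W_meas) auto
    fix j s
    let ?f = "\<lambda>m. potential j (\<lambda>e k. fst s e k + Z m e k, \<lambda>e k. snd s e k + incr (fst s) m e k)"
    have Zb: "bdd_fun (\<lambda>m. Z m e k)" if "e \<in> F" "k \<in> F" for e k
    proof -
      have "bdd_fun (\<lambda>m. \<psi> e m * \<psi> k m + (- (if e = k then a e else 0)))" by (intro bdd_intros that)
      then show ?thesis by (simp add: Z_def)
    qed
    have "bdd_fun ?f" unfolding potential_def weight_def incr_def fst_conv snd_conv
      by (intro bdd_fun_add bdd_fun_sum bdd_fun_mult bdd_fun_const bdd_fun_power2 Zb)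
    then have "(\<integral>\<^sup>+m. ennreal (?f m) \<partial>M) = ennreal (\<integral>m. ?f m \<partial>M)"
      by (intro nn_integral_eq_integral bdd_funD) (auto simp: potential_nonneg)
    also have "\<dots> \<le> ennreal (potential (Suc j) s)"
      using potential_step[of j "fst s" "snd s"] by (intro ennreal_leI) simp
    finally show "(\<integral>\<^sup>+m. ennreal (?f m) \<partial>M) \<le> ennreal (potential (Suc j) s)" .
  qed
  then show ?thesis by (simp add: potential_def weight_def)
qed

definition good :: "nat \<Rightarrow> (nat \<Rightarrow> 'a) set" where
  "good n = {\<omega> \<in> space (\<Pi>\<^sub>M i\<in>{1..n}. M). (\<Sum>e\<in>F. \<Sum>k\<in>F. (W n \<omega> e k)^2) \<le> ((real n)^2 / 8)^2}"

lemma good_meas [measurable]: "good n \<in> sets (\<Pi>\<^sub>M i\<in>{1..n}. M)"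
proof -
  have "(\<lambda>\<omega>. \<Sum>e\<in>F. \<Sum>k\<in>F. (W n \<omega> e k)^2) \<in> borel_measurable (\<Pi>\<^sub>M i\<in>{1..n}. M)"
    by (intro borel_measurable_sum borel_measurable_power W_meas) auto
  then show ?thesis unfolding good_def by measurable
qed

text \<open>Markov's inequality: the second moment \<open>2 * B^2 * N * n^2\<close> over the
  threshold \<open>n^4 / 64\<close>. As \<open>W\<close> is quadratic in the \<open>Z\<close>, this
  is the fourth moment estimate for the empirical covariance.\<close>

lemma not_good_prob:
  assumes n: "n > 0"
  shows "emeasure (\<Pi>\<^sub>M i\<in>{1..n}. M) (space (\<Pi>\<^sub>M i\<in>{1..n}. M) - good n) \<le> ennreal (128 * B^2 * N / (real n)^2)"
proof -
  let ?P = "\<Pi>\<^sub>M i\<in>{1..n}. M"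
  let ?w = "\<lambda>\<omega>. \<Sum>e\<in>F. \<Sum>k\<in>F. (W n \<omega> e k)^2"
  let ?c = "((real n)^2 / 8)^2"
  have meas: "?w \<in> borel_measurable ?P"
    by (intro borel_measurable_sum borel_measurable_power W_meas) auto
  have c: "?c > 0" using n by simp
  have "emeasure ?P (space ?P - good n) \<le> emeasure ?P {\<omega> \<in> space ?P. 1 \<le> ennreal (1 / ?c) * ennreal (?w \<omega>)}"
  proof (rule emeasure_mono)
    show "space ?P - good n \<subseteq> {\<omega> \<in> space ?P. 1 \<le> ennreal (1 / ?c) * ennreal (?w \<omega>)}"
    proof
      fix \<omega> assume w: "\<omega> \<in> space ?P - good n"
      then have "?w \<omega> > ?c" by (auto simp: good_def)
      then have "1 \<le> 1 / ?c * ?w \<omega>" using c by (simp add: field_simps)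
      then show "\<omega> \<in> {\<omega> \<in> space ?P. 1 \<le> ennreal (1 / ?c) * ennreal (?w \<omega>)}"
        using w c by (simp add: ennreal_mult'[symmetric] sum_nonneg)
    qed
  qed (use meas in measurable)
  also have "\<dots> \<le> ennreal (1 / ?c) * (\<integral>\<^sup>+\<omega>. ennreal (?w \<omega>) * indicator (space ?P) \<omega> \<partial>?P)"
    by (rule nn_integral_Markov_inequality) (use meas in auto)
  also have "(\<integral>\<^sup>+\<omega>. ennreal (?w \<omega>) * indicator (space ?P) \<omega> \<partial>?P) = (\<integral>\<^sup>+\<omega>. ennreal (?w \<omega>) \<partial>?P)"
    by (intro nn_integral_cong) simp
  also have "\<dots> \<le> ennreal (2 * B^2 * N * (real n)^2)" by (rule W_second_moment)
  also have "ennreal (1 / ?c) * ennreal (2 * B^2 * N * (real n)^2) = ennreal (128 * B^2 * N / (real n)^2)"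
  proof -
    have "1 / ?c * (2 * B^2 * N * (real n)^2) = 128 * B^2 * N / (real n)^2"
      using n by (simp add: power2_eq_square field_simps)
    moreover have "ennreal (1 / ?c) * ennreal (2 * B^2 * N * (real n)^2) = ennreal (1 / ?c * (2 * B^2 * N * (real n)^2))"
      using N_nonneg by (intro ennreal_mult[symmetric]) auto
    ultimately show ?thesis by simp
  qed
  finally show ?thesis by (simp add: mult_left_mono)
qed

lemma S_symmetric: "S n \<omega> e k = S n \<omega> k e"
  unfolding S_def Z_def by (intro sum.cong) (auto simp: mult.commute)

text \<open>As matrices, the square of \<open>S\<close> is \<open>W\<close> plus the sum of the
  squares of the \<open>Z\<close>: a new draw adds \<open>S Z + Z S\<close> to \<open>W\<close> and
  its own square to the rest. Symmetry turns the quadratic form of a square into a squared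
  norm.\<close>

lemma norm_S_expand:
  "(\<Sum>e\<in>F. (\<Sum>k\<in>F. S n \<omega> e k * v k)^2)
     = (\<Sum>e\<in>F. \<Sum>k\<in>F. W n \<omega> e k * v e * v k) + (\<Sum>j=1..n. \<Sum>e\<in>F. (\<Sum>k\<in>F. Z (\<omega> j) e k * v k)^2)"
proof (induction n)
  case 0 then show ?case by (simp add: S_def)
next
  case (Suc n)
  define x where "x e = (\<Sum>k\<in>F. S n \<omega> e k * v k)" for e
  define z where "z e = (\<Sum>k\<in>F. Z (\<omega> (Suc n)) e k * v k)" for e
  have Zsym: "Z m e k = Z m k e" for m e k by (simp add: Z_def mult.commute)
  have "(\<Sum>e\<in>F. (\<Sum>k\<in>F. S (Suc n) \<omega> e k * v k)^2) = (\<Sum>e\<in>F. (x e + z e)^2)"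
    by (simp add: S_def x_def z_def distrib_right sum.distrib)
  also have "\<dots> = (\<Sum>e\<in>F. (x e)^2) + 2 * (\<Sum>l\<in>F. x l * z l) + (\<Sum>e\<in>F. (z e)^2)"
    by (simp add: power2_sum sum.distrib sum_distrib_left mult.assoc)
  also have "2 * (\<Sum>l\<in>F. x l * z l)
     = (\<Sum>e\<in>F. \<Sum>k\<in>F. (\<Sum>l\<in>F. S n \<omega> e l * Z (\<omega> (Suc n)) l k + Z (\<omega> (Suc n)) e l * S n \<omega> l k) * v e * v k)"
  proof -
    have "(\<Sum>e\<in>F. \<Sum>k\<in>F. (\<Sum>l\<in>F. S n \<omega> e l * Z (\<omega> (Suc n)) l k) * v e * v k)
        = (\<Sum>e\<in>F. \<Sum>k\<in>F. \<Sum>l\<in>F. (S n \<omega> l e * v e) * (Z (\<omega> (Suc n)) l k * v k))"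
    proof (intro sum.cong[OF refl])
      fix e k
      have "(\<Sum>l\<in>F. S n \<omega> e l * Z (\<omega> (Suc n)) l k) * v e * v k = (\<Sum>l\<in>F. S n \<omega> e l * Z (\<omega> (Suc n)) l k * v e * v k)"
        by (simp add: sum_distrib_right)
      also have "\<dots> = (\<Sum>l\<in>F. (S n \<omega> l e * v e) * (Z (\<omega> (Suc n)) l k * v k))"
        by (intro sum.cong[OF refl]) (simp add: S_symmetric[of n \<omega> e])
      finally show "(\<Sum>l\<in>F. S n \<omega> e l * Z (\<omega> (Suc n)) l k) * v e * v k = (\<Sum>l\<in>F. (S n \<omega> l e * v e) * (Z (\<omega> (Suc n)) l k * v k))" .
    qed
    also have "\<dots> = (\<Sum>l\<in>F. \<Sum>e\<in>F. \<Sum>k\<in>F. (S n \<omega> l e * v e) * (Z (\<omega> (Suc n)) l k * v k))"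
    proof -
      have "(\<Sum>k\<in>F. \<Sum>l\<in>F. (S n \<omega> l e * v e) * (Z (\<omega> (Suc n)) l k * v k))
          = (\<Sum>l\<in>F. \<Sum>k\<in>F. (S n \<omega> l e * v e) * (Z (\<omega> (Suc n)) l k * v k))" for e
        by (rule sum.swap)
      then show ?thesis by (simp only:) (rule sum.swap)
    qed
    also have "\<dots> = (\<Sum>l\<in>F. x l * z l)" by (simp add: x_def z_def sum_product)
    finally have 1: "(\<Sum>e\<in>F. \<Sum>k\<in>F. (\<Sum>l\<in>F. S n \<omega> e l * Z (\<omega> (Suc n)) l k) * v e * v k) = (\<Sum>l\<in>F. x l * z l)" .
    have "(\<Sum>e\<in>F. \<Sum>k\<in>F. (\<Sum>l\<in>F. Z (\<omega> (Suc n)) e l * S n \<omega> l k) * v e * v k)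
        = (\<Sum>k\<in>F. \<Sum>e\<in>F. (\<Sum>l\<in>F. S n \<omega> k l * Z (\<omega> (Suc n)) l e) * v k * v e)"
    proof (subst sum.swap, intro sum.cong[OF refl])
      fix k e
      have "(\<Sum>l\<in>F. Z (\<omega> (Suc n)) e l * S n \<omega> l k) = (\<Sum>l\<in>F. S n \<omega> k l * Z (\<omega> (Suc n)) l e)"
        by (intro sum.cong[OF refl]) (simp add: S_symmetric[of n \<omega> k] Zsym[of _ e])
      then show "(\<Sum>l\<in>F. Z (\<omega> (Suc n)) e l * S n \<omega> l k) * v e * v k = (\<Sum>l\<in>F. S n \<omega> k l * Z (\<omega> (Suc n)) l e) * v k * v e"
        by simp
    qed
    then show ?thesis using 1 by (simp add: sum.distrib distrib_right)
  qed
  finally show ?case using Suc.IH by (simp add: x_def[symmetric] z_def[symmetric] sum.distrib distrib_right)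
qed

text \<open>
  If \<open>v \<bullet> S v < - (n / 2) \<parallel>v\<parallel>\<^sup>2\<close>, then \<open>\<parallel>S v\<parallel>\<^sup>2 > (n\<^sup>2 / 4) \<parallel>v\<parallel>\<^sup>2\<close>, but both \<open>v \<bullet> W v\<close> and
  \<open>\<Sum>\<^sub>j \<parallel>Z\<^sub>j v\<parallel>\<^sup>2 \<le> 2 (B + 1) n \<parallel>v\<parallel>\<^sup>2\<close> are at most \<open>(n\<^sup>2 / 8) \<parallel>v\<parallel>\<^sup>2\<close>.
\<close>

theorem lower_comparison:
  assumes \<omega>: "\<omega> \<in> good n" and n: "16 * (B + 1) \<le> real n"
  shows "real n * (\<Sum>e\<in>F. a e * (v e)^2) - real n / 2 * (\<Sum>e\<in>F. (v e)^2) \<le> (\<Sum>j=1..n. (\<Sum>e\<in>F. \<psi> e (\<omega> j) * v e)^2)"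
proof (rule ccontr)
  assume neg: "\<not> ?thesis"
  define V where "V = (\<Sum>e\<in>F. (v e)^2)"
  define av where "av = (\<Sum>e\<in>F. a e * (v e)^2)"
  define P where "P j = (\<Sum>e\<in>F. \<psi> e (\<omega> j) * v e)" for j
  define s where "s = (\<Sum>e\<in>F. v e * (\<Sum>k\<in>F. S n \<omega> e k * v k))"
  have "real n \<ge> 1" using n B_nonneg by (simp add: field_simps)
  then have npos: "real n > 0" by simp
  have sp: "\<omega> j \<in> space M" if "j \<in> {1..n}" for j
    using \<omega> that by (auto simp: good_def space_PiM PiE_def Pi_def)
  have Zv: "(\<Sum>k\<in>F. Z m e k * v k) = \<psi> e m * (\<Sum>k\<in>F. \<psi> k m * v k) - a e * v e" if "e \<in> F" for m e
  proof -
    have "(\<Sum>k\<in>F. Z m e k * v k) = (\<Sum>k\<in>F. \<psi> e m * (\<psi> k m * v k) - (if k = e then a e * v e else 0))"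
      by (intro sum.cong) (auto simp: Z_def algebra_simps)
    then show ?thesis using that fin by (simp add: sum_subtractf sum_distrib_left)
  qed
  have s_eq: "s = (\<Sum>j=1..n. (P j)^2) - real n * av"
  proof -
    have "s = (\<Sum>e\<in>F. v e * (\<Sum>j=1..n. \<Sum>k\<in>F. Z (\<omega> j) e k * v k))"
      unfolding s_def S_def by (subst sum.swap) (simp add: sum_distrib_right)
    also have "\<dots> = (\<Sum>e\<in>F. \<Sum>j=1..n. v e * (\<psi> e (\<omega> j) * P j - a e * v e))"
      by (simp add: Zv P_def sum_distrib_left)
    also have "\<dots> = (\<Sum>j=1..n. \<Sum>e\<in>F. (\<psi> e (\<omega> j) * v e) * P j - a e * (v e)^2)"
      by (subst sum.swap) (simp add: power2_eq_square algebra_simps)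
    also have "\<dots> = (\<Sum>j=1..n. (P j)^2 - av)"
      by (intro sum.cong) (auto simp: sum_subtractf sum_distrib_right[symmetric] P_def av_def power2_eq_square)
    finally show ?thesis by (simp add: sum_subtractf)
  qed
  have neg': "s < - (real n / 2 * V)"
    using neg unfolding s_eq P_def V_def av_def by linarith
  have V0: "V \<ge> 0" "av \<ge> 0" "av \<le> V"
    unfolding V_def av_def using a01 by (auto intro!: sum_nonneg sum_mono mult_left_le_one_le)
  have "V \<noteq> 0"
  proof
    assume "V = 0"
    then have "\<forall>e\<in>F. v e = 0" using fin by (auto simp: V_def sum_nonneg_eq_0_iff)
    then have "s = 0" by (simp add: s_def)
    then show False using neg' \<open>V = 0\<close> by simp
  qed
  with V0 have Vpos: "V > 0" by simp
  have W_le: "(\<Sum>e\<in>F. \<Sum>k\<in>F. W n \<omega> e k * v e * v k) \<le> (real n)^2 / 8 * V"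
  proof -
    have "(\<Sum>e\<in>F. \<Sum>k\<in>F. W n \<omega> e k * v e * v k)^2 = (\<Sum>p\<in>F \<times> F. W n \<omega> (fst p) (snd p) * (v (fst p) * v (snd p)))^2"
      by (simp add: sum.cartesian_product case_prod_unfold mult.assoc)
    also have "\<dots> \<le> (\<Sum>p\<in>F \<times> F. (W n \<omega> (fst p) (snd p))^2) * (\<Sum>p\<in>F \<times> F. (v (fst p) * v (snd p))^2)"
      by (rule Cauchy_Schwarz_ineq_sum)
    also have "(\<Sum>p\<in>F \<times> F. (v (fst p) * v (snd p))^2) = V * V"
      by (simp add: V_def sum_product sum.cartesian_product case_prod_unfold power_mult_distrib)
    also have "(\<Sum>p\<in>F \<times> F. (W n \<omega> (fst p) (snd p))^2) \<le> ((real n)^2 / 8)^2"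
      using \<omega> by (simp add: good_def sum.cartesian_product case_prod_unfold)
    finally have "(\<Sum>e\<in>F. \<Sum>k\<in>F. W n \<omega> e k * v e * v k)^2 \<le> ((real n)^2 / 8 * V)^2"
      using V0 mult_right_mono[of _ _ "V * V"] unfolding power_mult_distrib power2_eq_square[of V] by simp
    then show ?thesis by (rule power2_le_imp_le) (use V0 in auto)
  qed
  have Z_le: "(\<Sum>e\<in>F. (\<Sum>k\<in>F. Z (\<omega> j) e k * v k)^2) \<le> 2 * B * (P j)^2 + 2 * av" if "j \<in> {1..n}" for j
  proof -
    have "(\<Sum>e\<in>F. (\<Sum>k\<in>F. Z (\<omega> j) e k * v k)^2) \<le> (\<Sum>e\<in>F. 2 * ((\<psi> e (\<omega> j))^2 * (P j)^2) + 2 * (a e * (v e)^2))"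
    proof (rule sum_mono)
      fix e assume e: "e \<in> F"
      have "(\<psi> e (\<omega> j) * P j - a e * v e)^2 \<le> 2 * (\<psi> e (\<omega> j) * P j)^2 + 2 * (a e * v e)^2"
        using zero_le_power2[of "\<psi> e (\<omega> j) * P j + a e * v e"] by (simp add: power2_sum power2_diff)
      also have "(a e * v e)^2 \<le> a e * (v e)^2"
      proof -
        have "a e * a e \<le> a e * 1" using a01[OF e] by (intro mult_left_mono)
        then have "(a e * a e) * (v e)^2 \<le> a e * (v e)^2" by (intro mult_right_mono) auto
        then show ?thesis by (simp add: power_mult_distrib power2_eq_square[of "a e"])
      qed
      finally show "(\<Sum>k\<in>F. Z (\<omega> j) e k * v k)^2 \<le> 2 * ((\<psi> e (\<omega> j))^2 * (P j)^2) + 2 * (a e * (v e)^2)"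
        using e by (simp add: Zv P_def power_mult_distrib)
    qed
    also have "\<dots> = 2 * ((\<Sum>e\<in>F. (\<psi> e (\<omega> j))^2) * (P j)^2) + 2 * av"
      by (simp add: sum.distrib sum_distrib_left sum_distrib_right av_def)
    also have "\<dots> \<le> 2 * (B * (P j)^2) + 2 * av"
      using \<psi>_bound[OF sp[OF that]] by (intro add_mono mult_left_mono mult_right_mono) auto
    finally show ?thesis by simp
  qed
  have "s^2 \<le> V * (\<Sum>e\<in>F. (\<Sum>k\<in>F. S n \<omega> e k * v k)^2)"
    unfolding s_def V_def by (rule Cauchy_Schwarz_ineq_sum)
  also have "(\<Sum>e\<in>F. (\<Sum>k\<in>F. S n \<omega> e k * v k)^2) \<le> (real n)^2 / 8 * V + (\<Sum>j=1..n. 2 * B * (P j)^2 + 2 * av)"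
    unfolding norm_S_expand by (intro add_mono W_le sum_mono Z_le)
  also have "(\<Sum>j=1..n. 2 * B * (P j)^2 + 2 * av) = 2 * B * (s + real n * av) + 2 * real n * av"
    by (simp add: s_eq sum.distrib sum_distrib_left)
  also have "\<dots> \<le> 2 * B * (real n * V) + 2 * real n * V"
  proof -
    \<comment> \<open>The assumed failure makes \<open>s\<close> negative, so the sum of the
      \<open>(P j)^2\<close>, which is \<open>s + n * av\<close>, is at most
      \<open>n * V\<close>.\<close>
    have "s \<le> 0" using neg' npos Vpos by (smt (verit, best) divide_pos_pos mult_pos_pos)
    moreover have nav: "real n * av \<le> real n * V" using V0 by (intro mult_left_mono) auto
    ultimately have "2 * B * (s + real n * av) \<le> 2 * B * (real n * V)"
      using B_nonneg by (intro mult_left_mono) auto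
    then show ?thesis using nav by linarith
  qed
  also have "(real n)^2 / 8 * V + (2 * B * (real n * V) + 2 * real n * V) = real n * V * (real n / 8 + 2 * (B + 1))"
    by (simp add: power2_eq_square algebra_simps)
  also have "\<dots> \<le> real n * V * (real n / 4)"
    using n npos Vpos by (intro mult_left_mono) auto
  finally have "s^2 \<le> (real n / 2 * V)^2" using Vpos by (simp add: power2_eq_square algebra_simps)
  moreover have "(real n / 2 * V)^2 < (- s)^2"
    using neg' npos Vpos by (intro power_strict_mono) auto
  ultimately show False by simp
qed

end

section \<open>Mini-batch SGD on a fixed sample\<close>

lemma power2_sum3_le: "(p + q + r)^2 \<le> 3 * (p^2 + q^2 + (r::real)^2)"
  using zero_le_power2[of "p - q"] zero_le_power2[of "p - r"] zero_le_power2[of "q - r"]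
  by (simp add: power2_eq_square algebra_simps)

lemma power2_sum2_le: "(p + q)^2 \<le> 2 * p^2 + 2 * (q::real)^2"
  using zero_le_power2[of "p - q"] by (simp add: power2_eq_square algebra_simps)

text \<open>Expectation over independent uniform indices \<open>J i\<close>, written as a finite sum
  so that no measurability arises; \<open>nn_integral_PiM_uniform\<close> links it to the
  experiment.\<close>

definition index_avg :: "nat set \<Rightarrow> nat \<Rightarrow> ((nat \<Rightarrow> nat) \<Rightarrow> real) \<Rightarrow> real" where
  "index_avg I n F = (\<Sum>J\<in>Pi\<^sub>E I (\<lambda>_. {1..n}). F J) / real n ^ card I"

lemma index_avg_add: "index_avg I n (\<lambda>J. F J + G J) = index_avg I n F + index_avg I n G"
  by (simp add: index_avg_def sum.distrib add_divide_distrib)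

lemma index_avg_diff: "index_avg I n (\<lambda>J. F J - G J) = index_avg I n F - index_avg I n G"
  by (simp add: index_avg_def sum_subtractf diff_divide_distrib)

lemma index_avg_cmult: "index_avg I n (\<lambda>J. c * F J) = c * index_avg I n F"
  by (simp add: index_avg_def sum_distrib_left[symmetric])

lemma index_avg_sum: "index_avg I n (\<lambda>J. \<Sum>a\<in>A. F a J) = (\<Sum>a\<in>A. index_avg I n (F a))"
  unfolding index_avg_def by (subst sum.swap) (simp add: sum_divide_distrib)

lemma index_avg_mono:
  "(\<And>J. J \<in> Pi\<^sub>E I (\<lambda>_. {1..n}) \<Longrightarrow> F J \<le> G J) \<Longrightarrow> index_avg I n F \<le> index_avg I n G"
  unfolding index_avg_def by (intro divide_right_mono sum_mono) auto

lemma index_avg_cong: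
  "(\<And>J. J \<in> Pi\<^sub>E I (\<lambda>_. {1..n}) \<Longrightarrow> F J = G J) \<Longrightarrow> index_avg I n F = index_avg I n G"
  unfolding index_avg_def by (simp cong: sum.cong)

lemma index_avg_const: "finite I \<Longrightarrow> n > 0 \<Longrightarrow> index_avg I n (\<lambda>_. c) = c"
  by (simp add: index_avg_def card_PiE)

lemma index_avg_nonneg:
  "(\<And>J. J \<in> Pi\<^sub>E I (\<lambda>_. {1..n}) \<Longrightarrow> F J \<ge> 0) \<Longrightarrow> index_avg I n F \<ge> 0"
  unfolding index_avg_def by (intro divide_nonneg_nonneg sum_nonneg) auto

text \<open>Redrawing one coordinate does not change the law of \<open>J\<close>. This takes the
  place of conditional expectations given the other indices.\<close>

lemma index_avg_resample:
  assumes I: "finite I" "i \<in> I" and n: "n > 0"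
  shows "index_avg I n (\<lambda>J. (\<Sum>x=1..n. F (J(i := x))) / real n) = index_avg I n F"
proof -
  define I' where "I' = I - {i}"
  have ins: "I = insert i I'" "i \<notin> I'" using I by (auto simp: I'_def)
  have sum_ins: "(\<Sum>J\<in>Pi\<^sub>E I (\<lambda>_. {1..n}). G J) = (\<Sum>g\<in>Pi\<^sub>E I' (\<lambda>_. {1..n}). \<Sum>x=1..n. G (g(i := x)))" for G :: "(nat \<Rightarrow> nat) \<Rightarrow> real"
  proof -
    have "inj_on (\<lambda>(x, g). g(i := x)) ({1..n} \<times> Pi\<^sub>E I' (\<lambda>_. {1..n}))"
      using inj_combinator[OF ins(2), of "\<lambda>_. {1..n}"] by simp
    then have "(\<Sum>J\<in>Pi\<^sub>E I (\<lambda>_. {1..n}). G J) = (\<Sum>(x, g)\<in>{1..n} \<times> Pi\<^sub>E I' (\<lambda>_. {1..n}). G (g(i := x)))"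
      unfolding ins(1) PiE_insert_eq by (subst sum.reindex) (auto simp: case_prod_unfold)
    also have "\<dots> = (\<Sum>x=1..n. \<Sum>g\<in>Pi\<^sub>E I' (\<lambda>_. {1..n}). G (g(i := x)))"
      by (simp add: sum.cartesian_product)
    finally show ?thesis by (subst (asm) sum.swap)
  qed
  have "(\<Sum>J\<in>Pi\<^sub>E I (\<lambda>_. {1..n}). (\<Sum>x=1..n. F (J(i := x))) / real n) = (\<Sum>J\<in>Pi\<^sub>E I (\<lambda>_. {1..n}). F J)"
    unfolding sum_ins using n by simp
  then show ?thesis by (simp add: index_avg_def)
qed

lemma index_avg_power2_le:
  assumes "finite I" "n > 0"
  shows "(index_avg I n F)^2 \<le> index_avg I n (\<lambda>J. (F J)^2)"
proof -
  let ?m = "index_avg I n F"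
  have "0 \<le> index_avg I n (\<lambda>J. (F J - ?m)^2)" by (rule index_avg_nonneg) simp
  also have "\<dots> = index_avg I n (\<lambda>J. (F J)^2 - 2 * ?m * F J + ?m^2)"
    by (intro index_avg_cong) (simp add: power2_diff)
  also have "\<dots> = index_avg I n (\<lambda>J. (F J)^2) - ?m^2"
    unfolding index_avg_add index_avg_diff index_avg_cmult index_avg_const[OF assms]
    by (simp add: power2_eq_square)
  finally show ?thesis by simp
qed

lemma index_avg_infsum_le:
  assumes sum: "\<And>J. J \<in> Pi\<^sub>E I (\<lambda>_. {1..n}) \<Longrightarrow> ((\<lambda>e. f e J) has_sum F J) B"
    and bound: "\<And>E. finite E \<Longrightarrow> E \<subseteq> B \<Longrightarrow> (\<Sum>e\<in>E. index_avg I n (f e)) \<le> c"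
  shows "index_avg I n F \<le> c"
proof -
  have fin: "((\<lambda>e. \<Sum>J\<in>A. f e J) has_sum (\<Sum>J\<in>A. F J)) B"
    if "finite A" "A \<subseteq> Pi\<^sub>E I (\<lambda>_. {1..n})" for A
    using that by induction (auto intro!: has_sum_add sum)
  have "((\<lambda>e. index_avg I n (f e)) has_sum index_avg I n F) B"
  proof (cases "finite (Pi\<^sub>E I (\<lambda>_. {1..n}))")
    case True
    have "((\<lambda>e. (\<Sum>J\<in>Pi\<^sub>E I (\<lambda>_. {1..n}). f e J) * (1 / real n ^ card I))
        has_sum (\<Sum>J\<in>Pi\<^sub>E I (\<lambda>_. {1..n}). F J) * (1 / real n ^ card I)) B"
      by (rule has_sum_cmult_left[OF fin[OF True order_refl]])
    then show ?thesis by (simp add: index_avg_def)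
  qed (simp add: index_avg_def)
  then show ?thesis by (rule has_sum_le_finite_sums) (rule bound)
qed

section \<open>Empirical covariance operator and the two descent recursions\<close>

locale empirical_sample =
  fixes n :: nat and \<kappa> :: real and k :: "nat \<Rightarrow> 'h::{real_inner,banach}" and y :: "nat \<Rightarrow> real"
  assumes n: "n > 0" and k_bound: "j \<in> {1..n} \<Longrightarrow> norm (k j) \<le> \<kappa>"
begin

definition L :: "'h \<Rightarrow> 'h" where "L h = (1 / real n) *\<^sub>R (\<Sum>j=1..n. (h \<bullet> k j) *\<^sub>R k j)"
definition g :: 'h where "g = (1 / real n) *\<^sub>R (\<Sum>j=1..n. y j *\<^sub>R k j)"
definition sq :: "'h \<Rightarrow> real" where "sq h = (\<Sum>j=1..n. (h \<bullet> k j)^2) / real n"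

lemma inner_L: "L h \<bullet> v = (\<Sum>j=1..n. (h \<bullet> k j) * (v \<bullet> k j)) / real n"
  by (simp add: L_def inner_sum_left inner_commute[of v])

lemma L_selfadjoint: "L h \<bullet> v = h \<bullet> L v"
  by (subst inner_commute[of h]) (simp add: inner_L mult.commute)

lemma L_quadratic: "L h \<bullet> h = sq h" by (simp add: inner_L sq_def power2_eq_square)

lemma sq_nonneg: "sq h \<ge> 0" by (simp add: sq_def sum_nonneg)

lemma linear_L: "linear L"
  by (rule linearI) (simp_all add: L_def inner_simps scaleR_add_left sum.distrib scaleR_add_right scaleR_sum_right mult_ac)

lemma norm_L_sq: "(norm (L h))^2 \<le> \<kappa>^2 * sq h"
proof -
  have "norm (L h) = (1 / real n) * norm (\<Sum>j=1..n. (h \<bullet> k j) *\<^sub>R k j)" by (simp add: L_def)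
  also have "\<dots> \<le> (1 / real n) * (\<Sum>j=1..n. norm ((h \<bullet> k j) *\<^sub>R k j))"
    by (intro mult_left_mono norm_sum) simp
  also have "\<dots> \<le> (1 / real n) * (\<Sum>j=1..n. \<bar>h \<bullet> k j\<bar> * \<kappa>)"
    by (intro mult_left_mono sum_mono) (auto intro!: mult_left_mono k_bound)
  also have "\<dots> = \<kappa> * ((\<Sum>j=1..n. \<bar>h \<bullet> k j\<bar>) / real n)" by (simp add: sum_distrib_right[symmetric])
  finally have "(norm (L h))^2 \<le> (\<kappa> * ((\<Sum>j=1..n. \<bar>h \<bullet> k j\<bar>) / real n))^2"
    by (rule power_mono) simp
  then have "(norm (L h))^2 \<le> \<kappa>^2 * ((\<Sum>j=1..n. \<bar>h \<bullet> k j\<bar>) / real n)^2"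
    by (simp only: power_mult_distrib)
  also have "((\<Sum>j=1..n. \<bar>h \<bullet> k j\<bar>) / real n)^2 \<le> sq h"
  proof -
    have "(\<Sum>j=1..n. \<bar>h \<bullet> k j\<bar> * 1)^2 \<le> (\<Sum>j=1..n. \<bar>h \<bullet> k j\<bar>^2) * (\<Sum>j=1..n. 1\<^sup>2)"
      by (rule Cauchy_Schwarz_ineq_sum)
    then show ?thesis using n by (simp add: sq_def power_divide divide_simps power2_eq_square mult_ac)
  qed
  finally show ?thesis by (simp add: mult_left_mono)
qed

lemma sq_le: "sq h \<le> \<kappa>^2 * (norm h)^2"
proof -
  have "(h \<bullet> k j)^2 \<le> \<kappa>^2 * (norm h)^2" if "j \<in> {1..n}" for j
  proof -
    have "\<bar>h \<bullet> k j\<bar> \<le> norm h * \<kappa>"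
      using Cauchy_Schwarz_ineq2[of h "k j"] mult_left_mono[OF k_bound[OF that], of "norm h"] by simp
    then have "\<bar>h \<bullet> k j\<bar>^2 \<le> (norm h * \<kappa>)^2" by (intro power_mono) auto
    then show ?thesis by (simp add: power_mult_distrib mult.commute)
  qed
  then have "(\<Sum>j=1..n. (h \<bullet> k j)^2) \<le> (\<Sum>j=1..n. \<kappa>^2 * (norm h)^2)" by (intro sum_mono)
  then show ?thesis using n by (simp add: sq_def divide_le_eq mult_ac)
qed

lemma positive_trace_class_L: "positive_trace_class L (\<kappa>^2)"
proof (rule positive_trace_class.intro)
  show "bounded_linear L"
  proof (rule bounded_linear_intro[where K = "\<kappa>^2"])
    show "norm (L x) \<le> norm x * \<kappa>^2" for x
    proof -
      have "(norm (L x))^2 \<le> \<kappa>^2 * (\<kappa>^2 * (norm x)^2)"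
        using norm_L_sq[of x] mult_left_mono[OF sq_le[of x], of "\<kappa>^2"] by simp
      also have "\<dots> = (norm x * \<kappa>^2)^2" by (simp add: power2_eq_square)
      finally show ?thesis by (rule power2_le_imp_le) simp
    qed
  qed (use linear_L in \<open>auto simp: linear_add linear_scale\<close>)
  show "L x \<bullet> z = x \<bullet> L z" for x z by (rule L_selfadjoint)
  show "L x \<bullet> x \<ge> 0" for x by (simp add: L_quadratic sq_nonneg)
  fix F :: "'h set" assume F: "orthonormal F" "finite F"
  have "(\<Sum>e\<in>F. L e \<bullet> e) = (\<Sum>j=1..n. \<Sum>e\<in>F. (k j \<bullet> e)^2) / real n"
    unfolding L_quadratic sq_def by (simp add: sum_divide_distrib[symmetric] inner_commute) (rule disjI2, rule sum.swap)
  also have "\<dots> \<le> (\<Sum>j=1..n. \<kappa>^2) / real n"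
  proof (intro divide_right_mono sum_mono)
    fix j assume "j \<in> {1..n}"
    then show "(\<Sum>e\<in>F. (k j \<bullet> e)^2) \<le> \<kappa>^2"
      using bessel_finite[OF F, of "k j"] power_mono[OF k_bound, of j 2] by simp
  qed simp
  also have "\<dots> = \<kappa>^2" using n by simp
  finally show "(\<Sum>e\<in>F. L e \<bullet> e) \<le> \<kappa>^2" .
qed

text \<open>The empirical covariance is itself positive with trace at most
  \<open>\<kappa>^2\<close>, so the spectral theory applies to it as well.\<close>

lemma resolvent_exists:
  assumes "l > 0" shows "\<exists>v. L v + l *\<^sub>R v = f"
proof -
  interpret A: positive_trace_class L "\<kappa>^2" by (rule positive_trace_class_L)
  obtain B where "eigenbasis L B" using A.eigenbasis_exists by blast
  then interpret eigen_decomposition L "\<kappa>^2" B by unfold_locales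
  show ?thesis using resolv_inverse(1)[OF assms] by blast
qed

text \<open>The quadratic term absorbs at most half of the decrease
  \<open>2 * \<eta> * sq v\<close>.\<close>

lemma contraction:
  assumes "\<eta> \<ge> 0" "\<eta> * \<kappa>^2 \<le> 1"
  shows "(norm (v - \<eta> *\<^sub>R L v))^2 \<le> (norm v)^2 - \<eta> * sq v"
proof -
  have "(norm (v - \<eta> *\<^sub>R L v))^2 = (norm v)^2 - 2 * \<eta> * sq v + \<eta>^2 * (norm (L v))^2"
    unfolding L_quadratic[symmetric] power2_norm_eq_inner
    by (simp add: inner_diff_left inner_diff_right inner_commute[of v "L v"] power2_eq_square algebra_simps)
  also have "\<eta>^2 * (norm (L v))^2 \<le> \<eta> * sq v"
  proof -
    have "\<eta>^2 * (norm (L v))^2 \<le> \<eta>^2 * (\<kappa>^2 * sq v)" by (intro mult_left_mono norm_L_sq) auto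
    also have "\<dots> = (\<eta> * sq v) * (\<eta> * \<kappa>^2)" by (simp add: power2_eq_square)
    also have "\<dots> \<le> (\<eta> * sq v) * 1" using assms sq_nonneg by (intro mult_left_mono) auto
    finally show ?thesis by simp
  qed
  finally show ?thesis by simp
qed

primrec gd :: "real \<Rightarrow> 'h \<Rightarrow> nat \<Rightarrow> 'h" where
  "gd \<eta> h0 0 = h0"
| "gd \<eta> h0 (Suc t) = gd \<eta> h0 t - \<eta> *\<^sub>R (L (gd \<eta> h0 t) - g)"

primrec iter :: "nat \<Rightarrow> real \<Rightarrow> 'h \<Rightarrow> (nat \<Rightarrow> nat) \<Rightarrow> nat \<Rightarrow> 'h" where
  "iter b \<eta> h0 J 0 = h0"
| "iter b \<eta> h0 J (Suc t) = iter b \<eta> h0 J t -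
     (\<eta> / real b) *\<^sub>R (\<Sum>i = b * t + 1..b * (t + 1). (iter b \<eta> h0 J t \<bullet> k (J i) - y (J i)) *\<^sub>R k (J i))"

end

section \<open>Martingale analysis of SGD around gradient descent\<close>

locale sgd_sample = empirical_sample n \<kappa> k y
  for n \<kappa> and k :: "nat \<Rightarrow> 'h::{real_inner,banach}" and y +
  fixes b T :: nat and \<eta> \<sigma> :: real and h0 :: 'h
  assumes b: "b > 0" and \<eta>: "\<eta> > 0" "4 * \<kappa>^2 * \<eta> \<le> 1"
    and \<sigma>: "\<And>t j. t \<le> T \<Longrightarrow> j \<in> {1..n} \<Longrightarrow> \<bar>gd \<eta> h0 t \<bullet> k j - y j\<bar> \<le> \<sigma>"
begin

definition I :: "nat set" where "I = {1..b * T}"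
abbreviation "E \<equiv> index_avg I n"
abbreviation "h J t \<equiv> iter b \<eta> h0 J t"

definition w :: "(nat \<Rightarrow> nat) \<Rightarrow> nat \<Rightarrow> 'h" where "w J t = h J t - gd \<eta> h0 t"

text \<open>Full gradient minus mini-batch gradient, both at the SGD iterate: a martingale
  difference in the indices.\<close>

definition \<xi> :: "(nat \<Rightarrow> nat) \<Rightarrow> nat \<Rightarrow> 'h" where
  "\<xi> J t = (L (h J t) - g) -
     (1 / real b) *\<^sub>R (\<Sum>i = b * t + 1..b * (t + 1). (h J t \<bullet> k (J i) - y (J i)) *\<^sub>R k (J i))"

text \<open>The fixed point of the covariance recursion: with this value the noise
  \<open>\<eta>^2 * (4 * \<sigma>^2 / b) * sq v\<close> of one step equals the loss
  \<open>c * \<eta> * sq v\<close> from the contraction.\<close>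

definition c :: real where "c = 4 * \<eta> * \<sigma>^2 / real b"

text \<open>Adaptedness: before step \<open>t\<close> only the indices up to \<open>b * t\<close>
  have been read.\<close>

definition past :: "nat \<Rightarrow> ((nat \<Rightarrow> nat) \<Rightarrow> 'c) \<Rightarrow> bool" where
  "past t \<Phi> \<longleftrightarrow> (\<forall>J i x. i > b * t \<longrightarrow> \<Phi> (J(i := x)) = \<Phi> J)"

lemma past_h: "past t (\<lambda>J. h J t)"
  unfolding past_def
proof (intro allI impI)
  fix J i x assume "i > b * t"
  then show "h (J(i := x)) t = h J t"
  proof (induction t)
    case (Suc t)
    then have "i > b * t" by simp
    with Suc show ?case by (auto intro!: sum.cong)
  qed simp
qed

lemma c_nonneg: "c \<ge> 0" using \<eta> by (simp add: c_def)

lemma w_0: "w J 0 = 0" by (simp add: w_def)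

lemma w_Suc: "w J (Suc t) = w J t - \<eta> *\<^sub>R L (w J t) + \<eta> *\<^sub>R \<xi> J t"
  by (simp add: w_def \<xi>_def linear_diff[OF linear_L] scaleR_diff_right algebra_simps)

definition a :: "(nat \<Rightarrow> nat) \<Rightarrow> nat \<Rightarrow> 'h \<Rightarrow> nat \<Rightarrow> real" where
  "a J t v i = (\<Sum>x=1..n. (h J t \<bullet> k x - y x) * (k x \<bullet> v)) / real n - (h J t \<bullet> k (J i) - y (J i)) * (k (J i) \<bullet> v)"

lemma inner_\<xi>: "\<xi> J t \<bullet> v = (1 / real b) * (\<Sum>i = b * t + 1..b * (t + 1). a J t v i)"
proof -
  have "(L (h J t) - g) \<bullet> v = (\<Sum>x=1..n. (h J t \<bullet> k x - y x) * (k x \<bullet> v)) / real n"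
    by (simp add: L_def g_def inner_diff_left inner_sum_left left_diff_distrib sum_subtractf diff_divide_distrib)
  then show ?thesis
    using b by (simp add: \<xi>_def inner_diff_left inner_sum_left a_def sum_subtractf right_diff_distrib)
qed

lemma finite_I: "finite I" by (simp add: I_def)

lemma in_I: "t < T \<Longrightarrow> i \<in> {b * t + 1..b * (t + 1)} \<Longrightarrow> i \<in> I"
  using mult_le_mono2[of "t + 1" T b] by (auto simp: I_def)

lemma E_resample: "i \<in> I \<Longrightarrow> E F = E (\<lambda>J. (\<Sum>x=1..n. F (J(i := x))) / real n)"
  by (rule index_avg_resample[symmetric]) (use n finite_I in auto)

lemma a_update:
  assumes "i > b * t"
  shows "a (J(i := x)) t v i' = (if i' = i then (\<Sum>x=1..n. (h J t \<bullet> k x - y x) * (k x \<bullet> v)) / real n - (h J t \<bullet> k x - y x) * (k x \<bullet> v) else a J t v i')"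
  using past_h[of t] assms by (simp add: a_def past_def)

lemma sum_centered: "(\<Sum>x=1..n. (\<Sum>x=1..n. f x) / real n - f x) = 0"
  using n by (simp add: sum_subtractf)

text \<open>Redrawing the index \<open>i\<close> leaves \<open>\<Phi>\<close> fixed and averages
  \<open>a\<close> to zero.\<close>

lemma E_past_a:
  assumes t: "t < T" and i: "i \<in> {b * t + 1..b * (t + 1)}" and \<Phi>: "past t \<Phi>"
  shows "E (\<lambda>J. \<Phi> J * a J t v i) = 0"
proof -
  have "i > b * t" using i by simp
  then have "(\<Sum>x=1..n. \<Phi> (J(i := x)) * a (J(i := x)) t v i) = 0" for J
    using \<Phi> sum_centered[of "\<lambda>x. (h J t \<bullet> k x - y x) * (k x \<bullet> v)"]
    by (simp add: a_update past_def sum_distrib_left[symmetric])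
  then show ?thesis by (subst E_resample[OF in_I[OF t i]]) (simp add: index_avg_def)
qed

lemma E_a_a:
  assumes t: "t < T" and i: "i \<in> {b * t + 1..b * (t + 1)}" and ne: "i \<noteq> i'"
  shows "E (\<lambda>J. a J t v i * a J t v i') = 0"
proof -
  have "i > b * t" using i by simp
  then have "(\<Sum>x=1..n. a (J(i := x)) t v i * a (J(i := x)) t v i') = 0" for J
    using ne sum_centered[of "\<lambda>x. (h J t \<bullet> k x - y x) * (k x \<bullet> v)"]
    by (simp add: a_update sum_distrib_right[symmetric])
  then show ?thesis by (subst E_resample[OF in_I[OF t i]]) (simp add: index_avg_def)
qed

lemma E_a_sq:
  assumes t: "t < T" and i: "i \<in> {b * t + 1..b * (t + 1)}"
  shows "E (\<lambda>J. (a J t v i)^2) \<le> E (\<lambda>J. (\<Sum>x=1..n. (h J t \<bullet> k x - y x)^2 * (k x \<bullet> v)^2) / real n)"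
proof -
  have var: "(\<Sum>x=1..n. ((\<Sum>x=1..n. f x) / real n - f x)^2) \<le> (\<Sum>x=1..n. (f x)^2)" for f :: "nat \<Rightarrow> real"
  proof -
    define m where "m = (\<Sum>x=1..n. f x) / real n"
    have "(\<Sum>x=1..n. (m - f x)^2) = (\<Sum>x=1..n. (f x)^2) - real n * m^2"
    proof -
      have "(\<Sum>x=1..n. (m - f x)^2) = real n * m^2 - 2 * m * (\<Sum>x=1..n. f x) + (\<Sum>x=1..n. (f x)^2)"
        by (simp add: power2_diff sum.distrib sum_subtractf sum_distrib_left)
      also have "(\<Sum>x=1..n. f x) = real n * m" using n by (simp add: m_def)
      finally show ?thesis by (simp add: power2_eq_square)
    qed
    then show ?thesis unfolding m_def by simp
  qed
  have gt: "i > b * t" using i by simp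
  have "(\<Sum>x=1..n. (a (J(i := x)) t v i)^2) \<le> (\<Sum>x=1..n. (h J t \<bullet> k x - y x)^2 * (k x \<bullet> v)^2)" for J
    using var[of "\<lambda>x. (h J t \<bullet> k x - y x) * (k x \<bullet> v)"] by (simp add: a_update[OF gt] power_mult_distrib)
  then show ?thesis
    by (subst E_resample[OF in_I[OF t i]]) (intro index_avg_mono divide_right_mono, auto)
qed

text \<open>Distinct indices of a batch are uncorrelated, so the \<open>b^2\<close> products
  collapse to \<open>b\<close> variances; this is the gain \<open>1 / b\<close>.\<close>

lemma E_noise_sq:
  assumes t: "t < T"
  shows "E (\<lambda>J. (\<xi> J t \<bullet> v)^2) \<le> (1 / real b) * E (\<lambda>J. (\<Sum>x=1..n. (h J t \<bullet> k x - y x)^2 * (k x \<bullet> v)^2) / real n)"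
    (is "_ \<le> _ * ?R")
proof -
  let ?A = "{b * t + 1..b * (t + 1)}"
  have "E (\<lambda>J. (\<xi> J t \<bullet> v)^2) = E (\<lambda>J. (1 / real b)^2 * (\<Sum>i\<in>?A. \<Sum>i'\<in>?A. a J t v i * a J t v i'))"
    by (simp only: inner_\<xi> power_mult_distrib power2_eq_square[of "sum _ _"] sum_product)
  also have "\<dots> = (1 / real b)^2 * (\<Sum>i\<in>?A. \<Sum>i'\<in>?A. E (\<lambda>J. a J t v i * a J t v i'))"
    by (simp only: index_avg_cmult index_avg_sum)
  also have "\<dots> \<le> (1 / real b)^2 * (\<Sum>i\<in>?A. ?R)"
  proof (intro mult_left_mono sum_mono)
    fix i assume i: "i \<in> ?A"
    have "(\<Sum>i'\<in>?A. E (\<lambda>J. a J t v i * a J t v i')) = (\<Sum>i'\<in>?A. if i' = i then E (\<lambda>J. (a J t v i)^2) else 0)"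
    proof (intro sum.cong refl)
      fix i'
      show "E (\<lambda>J. a J t v i * a J t v i') = (if i' = i then E (\<lambda>J. (a J t v i)^2) else 0)"
        using E_a_a[OF t i, of i' v] by (cases "i' = i") (simp_all add: power2_eq_square)
    qed
    also have "\<dots> = E (\<lambda>J. (a J t v i)^2)" using i by simp
    finally show "(\<Sum>i'\<in>?A. E (\<lambda>J. a J t v i * a J t v i')) \<le> ?R" using E_a_sq[OF t i] by simp
  qed simp
  also have "card ?A = b" by simp
  then have "(1 / real b)^2 * (\<Sum>i\<in>?A. ?R) = (1 / real b) * ?R"
    using b by (simp only: sum_constant) (simp add: power2_eq_square)
  finally show ?thesis .
qed

lemma E_past_noise:
  assumes t: "t < T" and \<Phi>: "past t \<Phi>"
  shows "E (\<lambda>J. \<Phi> J * (\<xi> J t \<bullet> v)) = 0"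
proof -
  have "E (\<lambda>J. \<Phi> J * (\<xi> J t \<bullet> v)) = E (\<lambda>J. (1 / real b) * (\<Sum>i = b * t + 1..b * (t + 1). \<Phi> J * a J t v i))"
    by (simp add: inner_\<xi> sum_distrib_left mult_ac)
  also have "\<dots> = 0" unfolding index_avg_cmult index_avg_sum by (subst sum.neutral) (auto intro!: E_past_a[OF t _ \<Phi>])
  finally show ?thesis .
qed

lemma E_add_noise:
  assumes t: "t < T" and \<Phi>: "past t \<Phi>"
  shows "E (\<lambda>J. (\<Phi> J + d * (\<xi> J t \<bullet> v))^2) = E (\<lambda>J. (\<Phi> J)^2) + d^2 * E (\<lambda>J. (\<xi> J t \<bullet> v)^2)"
proof -
  have "E (\<lambda>J. (\<Phi> J + d * (\<xi> J t \<bullet> v))^2) = E (\<lambda>J. (\<Phi> J)^2 + 2 * d * (\<Phi> J * (\<xi> J t \<bullet> v)) + d^2 * (\<xi> J t \<bullet> v)^2)"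
    by (simp add: power2_sum power_mult_distrib mult_ac add_ac)
  then show ?thesis unfolding index_avg_add index_avg_cmult E_past_noise[OF t \<Phi>] by simp
qed

text \<open>The residual of SGD at a sample point is that of gradient descent, at most
  \<open>\<sigma>\<close>, plus \<open>w J t \<bullet> k x\<close>. The bound assumed for
  \<open>w\<close> controls the latter, as \<open>c * \<kappa>^2 \<le> \<sigma>^2\<close> by the
  condition on the step size. The noise bound obtained here drives the induction for
  \<open>w\<close> in turn.\<close>

lemma E_noise_sq':
  assumes t: "t < T" and IH: "\<And>v. E (\<lambda>J. (w J t \<bullet> v)^2) \<le> c * (norm v)^2"
  shows "E (\<lambda>J. (\<xi> J t \<bullet> v)^2) \<le> 4 * \<sigma>^2 / real b * sq v"
proof -
  have point: "E (\<lambda>J. (h J t \<bullet> k x - y x)^2) \<le> 4 * \<sigma>^2" if x: "x \<in> {1..n}" for x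
  proof -
    have "E (\<lambda>J. (h J t \<bullet> k x - y x)^2) \<le> E (\<lambda>J. 2 * (w J t \<bullet> k x)^2 + 2 * \<sigma>^2)"
    proof (rule index_avg_mono)
      fix J
      define r where "r = gd \<eta> h0 t \<bullet> k x - y x"
      have "h J t \<bullet> k x - y x = w J t \<bullet> k x + r" by (simp add: w_def inner_diff_left r_def)
      moreover have "r^2 \<le> \<sigma>^2"
        using power_mono[OF \<sigma>[OF less_imp_le[OF t] x], of 2] by (simp add: r_def)
      ultimately show "(h J t \<bullet> k x - y x)^2 \<le> 2 * (w J t \<bullet> k x)^2 + 2 * \<sigma>^2"
        using power2_sum2_le[of "w J t \<bullet> k x" r] by simp
    qed
    also have "\<dots> = 2 * E (\<lambda>J. (w J t \<bullet> k x)^2) + 2 * \<sigma>^2"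
      unfolding index_avg_add index_avg_cmult using n by (simp add: index_avg_const finite_I)
    also have "E (\<lambda>J. (w J t \<bullet> k x)^2) \<le> c * (norm (k x))^2" by (rule IH)
    also have "c * (norm (k x))^2 \<le> c * \<kappa>^2"
      using k_bound[OF x] c_nonneg by (intro mult_left_mono power_mono) auto
    also have "c * \<kappa>^2 \<le> \<sigma>^2"
    proof -
      have "c * \<kappa>^2 = \<sigma>^2 * ((4 * \<kappa>^2 * \<eta>) / real b)" by (simp add: c_def)
      also have "(4 * \<kappa>^2 * \<eta>) / real b \<le> 1" using \<eta> b by (simp add: divide_le_eq order_trans)
      finally show ?thesis by (simp add: mult_left_mono)
    qed
    finally show ?thesis by simp
  qed
  have "E (\<lambda>J. (\<Sum>x=1..n. (h J t \<bullet> k x - y x)^2 * (k x \<bullet> v)^2) / real n)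
      = (\<Sum>x=1..n. (k x \<bullet> v)^2 * E (\<lambda>J. (h J t \<bullet> k x - y x)^2)) / real n"
    using index_avg_cmult[of I n "1 / real n" "\<lambda>J. \<Sum>x=1..n. (k x \<bullet> v)^2 * (h J t \<bullet> k x - y x)^2"]
    by (simp add: index_avg_sum index_avg_cmult mult.commute)
  also have "\<dots> \<le> (\<Sum>x=1..n. (k x \<bullet> v)^2 * (4 * \<sigma>^2)) / real n"
    by (intro divide_right_mono sum_mono mult_left_mono point) auto
  also have "\<dots> = 4 * \<sigma>^2 * sq v" by (simp add: sq_def sum_distrib_right[symmetric] inner_commute)
  finally have "(1 / real b) * E (\<lambda>J. (\<Sum>x=1..n. (h J t \<bullet> k x - y x)^2 * (k x \<bullet> v)^2) / real n)
      \<le> (1 / real b) * (4 * \<sigma>^2 * sq v)"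
    by (rule mult_left_mono) simp
  with E_noise_sq[OF t, of v] show ?thesis by simp
qed

lemma past_w: "past t (\<lambda>J. w J t)"
  using past_h[of t] by (simp add: w_def past_def)

text \<open>Testing against a fixed \<open>v\<close> moves the step \<open>I - \<eta> L\<close> from
  \<open>w\<close> to \<open>v\<close>, so the induction is for all \<open>v\<close> at once and the
  bound involves no dimension. The contraction lowers \<open>c * (norm v)^2\<close> by what the
  noise may add.\<close>

theorem E_w_le: "t \<le> T \<Longrightarrow> E (\<lambda>J. (w J t \<bullet> v)^2) \<le> c * (norm v)^2"
proof (induction t arbitrary: v)
  case 0
  then show ?case using c_nonneg n by (simp add: w_0 index_avg_const finite_I)
next
  case (Suc t)
  then have t: "t < T" and IH: "\<And>v. E (\<lambda>J. (w J t \<bullet> v)^2) \<le> c * (norm v)^2" by auto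
  have "w J (Suc t) \<bullet> v = w J t \<bullet> (v - \<eta> *\<^sub>R L v) + \<eta> * (\<xi> J t \<bullet> v)" for J
    by (simp add: w_Suc inner_add_left inner_diff_left inner_diff_right L_selfadjoint)
  then have "E (\<lambda>J. (w J (Suc t) \<bullet> v)^2) = E (\<lambda>J. (w J t \<bullet> (v - \<eta> *\<^sub>R L v) + \<eta> * (\<xi> J t \<bullet> v))^2)" by simp
  also have "\<dots> = E (\<lambda>J. (w J t \<bullet> (v - \<eta> *\<^sub>R L v))^2) + \<eta>^2 * E (\<lambda>J. (\<xi> J t \<bullet> v)^2)"
    by (rule E_add_noise[OF t]) (use past_w[of t] in \<open>simp add: past_def\<close>)
  also have "\<dots> \<le> c * ((norm v)^2 - \<eta> * sq v) + \<eta>^2 * (4 * \<sigma>^2 / real b * sq v)"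
  proof (intro add_mono mult_left_mono E_noise_sq'[OF t IH])
    have "\<eta> * \<kappa>^2 \<le> 1" using \<eta> mult_nonneg_nonneg[of "\<kappa>^2" \<eta>] by (simp add: mult.commute)
    then have "c * (norm (v - \<eta> *\<^sub>R L v))^2 \<le> c * ((norm v)^2 - \<eta> * sq v)"
      using \<eta> c_nonneg by (intro mult_left_mono contraction) auto
    then show "E (\<lambda>J. (w J t \<bullet> (v - \<eta> *\<^sub>R L v))^2) \<le> c * ((norm v)^2 - \<eta> * sq v)"
      using IH[of "v - \<eta> *\<^sub>R L v"] by linarith
  qed simp
  also have "\<eta>^2 * (4 * \<sigma>^2 / real b * sq v) = c * (\<eta> * sq v)"
    by (simp add: c_def power2_eq_square)
  finally show ?case by (simp add: right_diff_distrib)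
qed

lemma E_noise_le: "t < T \<Longrightarrow> E (\<lambda>J. (\<xi> J t \<bullet> v)^2) \<le> 4 * \<sigma>^2 / real b * sq v"
  using E_noise_sq' E_w_le by simp

lemma E_noise_sum:
  assumes "s \<le> e'" "e' \<le> T"
  shows "E (\<lambda>J. (\<Sum>t\<in>{s..<e'}. \<xi> J t \<bullet> v)^2) \<le> real (e' - s) * (4 * \<sigma>^2 / real b * sq v)"
  using assms
proof (induction e' rule: dec_induct)
  case base then show ?case using n by (simp add: index_avg_const finite_I)
next
  case (step e)
  have p: "past e (\<lambda>J. \<Sum>t\<in>{s..<e}. \<xi> J t \<bullet> v)"
    unfolding past_def
  proof (intro allI impI sum.cong refl)
    fix J i x t assume i: "b * e < i" and t: "t \<in> {s..<e}"
    \<comment> \<open>An index beyond \<open>b * e\<close> lies outside the batches of all earlier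
      steps, so neither the iterate nor the batch sum changes.\<close>
    then have le: "b * (t + 1) \<le> b * e" by (intro mult_le_mono2) auto
    then have "h (J(i := x)) t = h J t" using past_h[of t] i by (auto simp: past_def)
    moreover have "(\<Sum>i' = b * t + 1..b * (t + 1). (h J t \<bullet> k ((J(i := x)) i') - y ((J(i := x)) i')) *\<^sub>R k ((J(i := x)) i'))
       = (\<Sum>i' = b * t + 1..b * (t + 1). (h J t \<bullet> k (J i') - y (J i')) *\<^sub>R k (J i'))"
      using le i by (intro sum.cong) auto
    ultimately show "\<xi> (J(i := x)) t \<bullet> v = \<xi> J t \<bullet> v" by (simp only: \<xi>_def)
  qed
  have eT: "e < T" using step by simp
  have "E (\<lambda>J. (\<Sum>t\<in>{s..<Suc e}. \<xi> J t \<bullet> v)^2) = E (\<lambda>J. ((\<Sum>t\<in>{s..<e}. \<xi> J t \<bullet> v) + 1 * (\<xi> J e \<bullet> v))^2)"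
    using step by simp
  also have "\<dots> = E (\<lambda>J. (\<Sum>t\<in>{s..<e}. \<xi> J t \<bullet> v)^2) + 1\<^sup>2 * E (\<lambda>J. (\<xi> J e \<bullet> v)^2)"
    by (rule E_add_noise[OF eT p])
  also have "\<dots> \<le> real (e - s) * (4 * \<sigma>^2 / real b * sq v) + 4 * \<sigma>^2 / real b * sq v"
    using step E_noise_le[OF eT, of v] by simp
  also have "\<dots> = real (Suc e - s) * (4 * \<sigma>^2 / real b * sq v)"
    unfolding Suc_diff_le[OF step(1)] of_nat_Suc by (simp only: distrib_right mult_1_left add.commute)
  finally show ?case .
qed

definition tail_w :: "(nat \<Rightarrow> nat) \<Rightarrow> 'h" where
  "tail_w J = (2 / real T) *\<^sub>R (\<Sum>t = T div 2 + 1..T. w J t)"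

text \<open>
  Writing \<open>f = (L + l) v\<close>, the sum of \<open>\<eta> w\<^sub>t \<bullet> f\<close> telescopes up to noise and \<open>l\<close> times the sum of \<open>\<eta> w\<^sub>t \<bullet> v\<close>.
\<close>

theorem E_tail_le:
  assumes T: "even T" "T > 0" and l: "l = 1 / (\<eta> * real T)" and v: "L v + l *\<^sub>R v = f"
  shows "E (\<lambda>J. (tail_w J \<bullet> f)^2) \<le> 102 * c * l * (sq v + l * (norm v)^2) + 32 * c / (real T)^2 * (norm f)^2"
proof -
  define s where "s = T div 2"
  have T2: "T = 2 * s" "s > 0" using T by (auto simp: s_def)
  have lpos: "l > 0" using l \<eta> T by simp
  have \<eta>l: "\<eta> * l * real T = 1" using l \<eta> T by simp
  define x1 where "x1 J = 2 * l * (w J s \<bullet> v - w J T \<bullet> v)" for J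
  define x2 where "x2 J = (2 / real T) * (\<Sum>t\<in>{s..<T}. \<xi> J t \<bullet> v)" for J
  define x3 where "x3 J = (2 * l / real T) * (\<Sum>t\<in>{s..<T}. w J t \<bullet> v)" for J
  define z where "z J = (2 / real T) * (w J T \<bullet> f - w J s \<bullet> f)" for J
  have decomp: "tail_w J \<bullet> f = (x1 J + x2 J + x3 J) + z J" for J
  proof -
    have tele: "(\<Sum>t\<in>{s..<T}. w J t \<bullet> v - w J (Suc t) \<bullet> v) = w J s \<bullet> v - w J T \<bullet> v"
      using sum_Suc_diff'[of s T "\<lambda>t. w J t \<bullet> v"] T2 by (simp add: sum_subtractf)
    have step: "\<eta> * (w J t \<bullet> f) = (w J t \<bullet> v - w J (Suc t) \<bullet> v) + \<eta> * (\<xi> J t \<bullet> v) + \<eta> * l * (w J t \<bullet> v)" for t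
      unfolding v[symmetric] by (simp add: w_Suc inner_simps L_selfadjoint algebra_simps)
    have "\<eta> * (\<Sum>t\<in>{s..<T}. w J t \<bullet> f) = (w J s \<bullet> v - w J T \<bullet> v) + \<eta> * (\<Sum>t\<in>{s..<T}. \<xi> J t \<bullet> v)
        + \<eta> * l * (\<Sum>t\<in>{s..<T}. w J t \<bullet> v)"
      by (simp add: sum_distrib_left step sum.distrib tele)
    then have "2 * l * (\<eta> * (\<Sum>t\<in>{s..<T}. w J t \<bullet> f))
        = 2 * l * (w J s \<bullet> v - w J T \<bullet> v) + 2 * (l * \<eta>) * (\<Sum>t\<in>{s..<T}. \<xi> J t \<bullet> v)
        + 2 * (l * \<eta>) * l * (\<Sum>t\<in>{s..<T}. w J t \<bullet> v)"
      by (simp only: distrib_left mult_ac)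
    moreover have "l * \<eta> = 1 / real T" using \<eta> by (simp add: l)
    moreover have "2 * l * (\<eta> * q) = 2 * (l * \<eta>) * q" for q by simp
    ultimately have main: "(2 / real T) * (\<Sum>t\<in>{s..<T}. w J t \<bullet> f) = x1 J + x2 J + x3 J"
      by (simp add: x1_def x2_def x3_def)
    \<comment> \<open>The telescoping runs over \<open>{s..<T}\<close>, the tail average over
      \<open>{s + 1..T}\<close>. The two endpoints give \<open>z\<close>, whence the summand with
      \<open>(norm f)^2 / T^2\<close>.\<close>
    have "(\<Sum>t = s + 1..T. w J t \<bullet> f) = (\<Sum>t\<in>{s..<T}. w J (Suc t) \<bullet> f)"
      using sum.shift_bounds_Suc_ivl[of "\<lambda>t. w J t \<bullet> f" s T] by (simp add: atLeastLessThanSuc_atLeastAtMost)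
    also have "\<dots> = (\<Sum>t\<in>{s..<T}. w J t \<bullet> f) + (w J T \<bullet> f - w J s \<bullet> f)"
      using sum_Suc_diff'[of s T "\<lambda>t. w J t \<bullet> f"] T2 by (simp add: sum_subtractf)
    finally show ?thesis
      using main by (simp add: tail_w_def inner_sum_left s_def z_def distrib_left)
  qed
  have sT: "s \<le> T" using T2 by simp
  have Ediff: "E (\<lambda>J. (w J p \<bullet> u - w J q \<bullet> u)^2) \<le> 4 * c * (norm u)^2" if "p \<le> T" "q \<le> T" for p q u
  proof -
    have "E (\<lambda>J. (w J p \<bullet> u - w J q \<bullet> u)^2) \<le> E (\<lambda>J. 2 * (w J p \<bullet> u)^2 + 2 * (w J q \<bullet> u)^2)"
      by (intro index_avg_mono) (use power2_sum2_le[of _ "- _"] in force)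
    also have "\<dots> = 2 * E (\<lambda>J. (w J p \<bullet> u)^2) + 2 * E (\<lambda>J. (w J q \<bullet> u)^2)"
      unfolding index_avg_add index_avg_cmult ..
    finally show ?thesis using E_w_le[OF that(1), of u] E_w_le[OF that(2), of u] by linarith
  qed
  have X1: "E (\<lambda>J. (x1 J)^2) \<le> 16 * c * l * (l * (norm v)^2)"
  proof -
    have "E (\<lambda>J. (x1 J)^2) = (2 * l)^2 * E (\<lambda>J. (w J s \<bullet> v - w J T \<bullet> v)^2)"
      unfolding x1_def power_mult_distrib[of "2 * l"] index_avg_cmult ..
    also have "\<dots> \<le> (2 * l)^2 * (4 * c * (norm v)^2)"
      by (intro mult_left_mono Ediff sT order_refl) auto
    finally show ?thesis by (simp add: power2_eq_square mult_ac)
  qed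
  have X2: "E (\<lambda>J. (x2 J)^2) \<le> 2 * c * l * sq v"
  proof -
    have "E (\<lambda>J. (x2 J)^2) = (2 / real T)^2 * E (\<lambda>J. (\<Sum>t\<in>{s..<T}. \<xi> J t \<bullet> v)^2)"
      unfolding x2_def power_mult_distrib[of "2 / real T"] index_avg_cmult ..
    also have "\<dots> \<le> (2 / real T)^2 * (real (T - s) * (4 * \<sigma>^2 / real b * sq v))"
      by (intro mult_left_mono E_noise_sum sT order_refl) auto
    also have "\<dots> = 2 * c * l * sq v"
      using \<eta> T2 b by (simp add: c_def l power2_eq_square field_simps)
    finally show ?thesis .
  qed
  have X3: "E (\<lambda>J. (x3 J)^2) \<le> c * l * (l * (norm v)^2)"
  proof -
    have "(x3 J)^2 \<le> (2 * l^2 / real T) * (\<Sum>t\<in>{s..<T}. (w J t \<bullet> v)^2)" for J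
    proof -
      have "(\<Sum>t\<in>{s..<T}. 1 * (w J t \<bullet> v))^2 \<le> (\<Sum>t\<in>{s..<T}. 1\<^sup>2) * (\<Sum>t\<in>{s..<T}. (w J t \<bullet> v)^2)"
        by (rule Cauchy_Schwarz_ineq_sum)
      then have "(\<Sum>t\<in>{s..<T}. w J t \<bullet> v)^2 \<le> real s * (\<Sum>t\<in>{s..<T}. (w J t \<bullet> v)^2)" using T2 by simp
      then have "(2 * l / real T)^2 * (\<Sum>t\<in>{s..<T}. w J t \<bullet> v)^2
          \<le> (2 * l / real T)^2 * (real s * (\<Sum>t\<in>{s..<T}. (w J t \<bullet> v)^2))" by (rule mult_left_mono) simp
      also have "\<dots> = (2 * l^2 / real T) * (\<Sum>t\<in>{s..<T}. (w J t \<bullet> v)^2)"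
        using T2 by (simp add: power2_eq_square field_simps)
      finally show ?thesis by (simp add: x3_def power_mult_distrib power_divide)
    qed
    then have "E (\<lambda>J. (x3 J)^2) \<le> E (\<lambda>J. (2 * l^2 / real T) * (\<Sum>t\<in>{s..<T}. (w J t \<bullet> v)^2))"
      by (intro index_avg_mono)
    also have "\<dots> = (2 * l^2 / real T) * (\<Sum>t\<in>{s..<T}. E (\<lambda>J. (w J t \<bullet> v)^2))"
      unfolding index_avg_cmult index_avg_sum ..
    also have "\<dots> \<le> (2 * l^2 / real T) * (\<Sum>t\<in>{s..<T}. c * (norm v)^2)"
      by (intro mult_left_mono sum_mono E_w_le) auto
    also have "\<dots> = c * l * (l * (norm v)^2)" using T2 by (simp add: power2_eq_square)
    finally show ?thesis .
  qed
  have Zb: "E (\<lambda>J. (z J)^2) \<le> 16 * c / (real T)^2 * (norm f)^2"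
  proof -
    have "E (\<lambda>J. (z J)^2) = (2 / real T)^2 * E (\<lambda>J. (w J T \<bullet> f - w J s \<bullet> f)^2)"
      unfolding z_def power_mult_distrib[of "2 / real T"] index_avg_cmult ..
    also have "\<dots> \<le> (2 / real T)^2 * (4 * c * (norm f)^2)"
      by (intro mult_left_mono Ediff sT order_refl) auto
    finally show ?thesis by (simp add: power_divide)
  qed
  have "E (\<lambda>J. (tail_w J \<bullet> f)^2) \<le> E (\<lambda>J. 6 * ((x1 J)^2 + (x2 J)^2 + (x3 J)^2) + 2 * (z J)^2)"
  proof (rule index_avg_mono)
    fix J show "(tail_w J \<bullet> f)^2 \<le> 6 * ((x1 J)^2 + (x2 J)^2 + (x3 J)^2) + 2 * (z J)^2"
      unfolding decomp using power2_sum2_le[of "x1 J + x2 J + x3 J" "z J"] power2_sum3_le[of "x1 J" "x2 J" "x3 J"] by linarith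
  qed
  also have "\<dots> = 6 * (E (\<lambda>J. (x1 J)^2) + E (\<lambda>J. (x2 J)^2) + E (\<lambda>J. (x3 J)^2)) + 2 * E (\<lambda>J. (z J)^2)"
    unfolding index_avg_add index_avg_cmult ..
  also have "\<dots> \<le> 6 * (16 * c * l * (l * (norm v)^2) + 2 * c * l * sq v + c * l * (l * (norm v)^2))
      + 2 * (16 * c / (real T)^2 * (norm f)^2)"
    by (intro add_mono mult_left_mono X1 X2 X3 Zb) auto
  \<comment> \<open>The norm terms carry \<open>6 * (16 + 1) = 102\<close>; the \<open>sq\<close>
    term has the factor 12 and is enlarged to match.\<close>
  also have "\<dots> \<le> 102 * c * l * (sq v + l * (norm v)^2) + 32 * c / (real T)^2 * (norm f)^2"
  proof -
    have "0 \<le> c * l * sq v" using c_nonneg lpos sq_nonneg by simp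
    then show ?thesis by (simp add: algebra_simps)
  qed
  finally show ?thesis .
qed

end

section \<open>Gradient descent on a fixed sample\<close>

lemma norm_diff_scale_sq:
  fixes x d :: "'v::real_inner"
  shows "(norm (x - r *\<^sub>R d))^2 = (norm x)^2 - 2 * r * (x \<bullet> d) + r^2 * (norm d)^2"
  unfolding power2_norm_eq_inner
  by (simp add: inner_diff_left inner_diff_right inner_commute[of d x] power2_eq_square algebra_simps)

locale compared_sample = empirical_sample n \<kappa> k y
  for n \<kappa> and k :: "nat \<Rightarrow> 'h::{real_inner,banach}" and y +
  fixes S :: "'h \<Rightarrow> 'l::{real_inner,banach}" and l :: real
  assumes S: "bounded_linear S" and S_bound: "norm (S x) \<le> \<kappa> * norm x"
    and l: "l > 0" and compare: "(norm (S x))^2 \<le> 4 * sq x + 2 * l * (norm x)^2"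
begin

text \<open>A relation instead of a norm: sources in the closed span of the singular vectors get
  their bound from \<open>T l\<close>, others the weaker \<open>norm s / sqrt l\<close>, and such
  bounds add up.\<close>

definition dual_bound :: "'h \<Rightarrow> real \<Rightarrow> bool" where
  "dual_bound s z \<longleftrightarrow> z \<ge> 0 \<and> (\<forall>x. s \<bullet> x \<le> z * sqrt ((norm (S x))^2 + l * (norm x)^2))"

lemma dual_boundD: "dual_bound s z \<Longrightarrow> s \<bullet> x \<le> z * sqrt ((norm (S x))^2 + l * (norm x)^2)"
  and dual_bound_nonneg: "dual_bound s z \<Longrightarrow> z \<ge> 0"
  by (auto simp: dual_bound_def)

lemma dual_bound_add: "dual_bound s z \<Longrightarrow> dual_bound s' z' \<Longrightarrow> dual_bound (s + s') (z + z')"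
  unfolding dual_bound_def by (auto simp: inner_add_left distrib_right add_mono)

lemma dual_bound_norm: "dual_bound s (norm s / sqrt l)"
  unfolding dual_bound_def
proof (intro conjI allI)
  show "0 \<le> norm s / sqrt l" using l by simp
  fix x
  have "s \<bullet> x \<le> norm s * norm x" by (rule norm_cauchy_schwarz)
  also have "\<dots> = norm s / sqrt l * sqrt (l * (norm x)^2)" using l by (simp add: real_sqrt_mult)
  also have "\<dots> \<le> norm s / sqrt l * sqrt ((norm (S x))^2 + l * (norm x)^2)"
    using l by (intro mult_left_mono) auto
  finally show "s \<bullet> x \<le> norm s / sqrt l * sqrt ((norm (S x))^2 + l * (norm x)^2)" .
qed

lemma dual_bound_norm_le:
  assumes "dual_bound s z" shows "(norm s)^2 \<le> z^2 * (\<kappa>^2 + l)"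
proof -
  have z: "z \<ge> 0" by (rule dual_bound_nonneg[OF assms])
  have "(norm s)^2 \<le> z * sqrt ((norm (S s))^2 + l * (norm s)^2)"
    using dual_boundD[OF assms, of s] by (simp add: power2_norm_eq_inner)
  also have "\<dots> \<le> z * sqrt ((\<kappa>^2 + l) * (norm s)^2)"
    using power_mono[OF S_bound[of s], of 2] z
    by (intro mult_left_mono) (auto simp: power_mult_distrib distrib_right)
  also have "\<dots> = (z * sqrt (\<kappa>^2 + l)) * norm s" by (simp add: real_sqrt_mult)
  finally have "norm s * norm s \<le> (z * sqrt (\<kappa>^2 + l)) * norm s" by (simp add: power2_eq_square)
  then have "norm s \<le> z * sqrt (\<kappa>^2 + l)"
    by (rule le_of_square_le_mult) (use z l in simp)
  then have "(norm s)^2 \<le> (z * sqrt (\<kappa>^2 + l))^2" by (rule power_mono) simp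
  then show ?thesis using l by (simp add: power_mult_distrib)
qed

context
  fixes \<eta> :: real and T :: nat and q s :: "nat \<Rightarrow> 'h" and \<zeta> :: "nat \<Rightarrow> real"
  assumes \<eta>: "\<eta> > 0" "4 * \<kappa>^2 * \<eta> \<le> 1" and T: "T > 0" "\<eta> * l * real T = 1"
    and q0: "q 0 = 0" and qS: "\<And>t. q (Suc t) = q t - \<eta> *\<^sub>R L (q t) + \<eta> *\<^sub>R s t"
    and \<zeta>: "\<And>t. t \<le> T \<Longrightarrow> dual_bound (s t) (\<zeta> t)"
begin

text \<open>Of the decrease \<open>2 * \<eta> * sq (q t)\<close> the source term, by Young's
  inequality and \<open>compare\<close>, and the squared step consume a quarter each. The norm term
  left over by \<open>compare\<close> costs a factor of at most
  \<open>1 + \<eta> * l = 1 + 1 / T\<close>, harmless over \<open>T\<close> steps.\<close>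

lemma energy_step:
  assumes t: "t \<le> T"
  shows "(norm (q (Suc t)))^2 \<le> (1 + 1 / real T) * (norm (q t))^2 - \<eta> * sq (q t) + 11 * \<eta> * (\<zeta> t)^2"
proof -
  let ?q = "q t" and ?s = "s t" and ?z = "\<zeta> t"
  have \<eta>l1: "\<eta> * l = 1 / real T" using T by (simp add: divide_simps)
  then have \<eta>l: "\<eta> * l = 1 / real T" "\<eta> * l \<le> 1" using T by simp_all
  have "(norm (q (Suc t)))^2 = (norm ?q)^2 - 2 * \<eta> * sq ?q + 2 * \<eta> * (?s \<bullet> ?q) + \<eta>^2 * (norm (L ?q - ?s))^2"
  proof -
    have "q (Suc t) = ?q - \<eta> *\<^sub>R (L ?q - ?s)" by (simp add: qS scaleR_diff_right)
    moreover have "?q \<bullet> (L ?q - ?s) = sq ?q - ?s \<bullet> ?q"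
      unfolding L_quadratic[symmetric] by (simp add: inner_diff_right inner_commute)
    ultimately show ?thesis by (simp only: norm_diff_scale_sq) (simp add: algebra_simps)
  qed
  also have "2 * \<eta> * (?s \<bullet> ?q) \<le> 8 * \<eta> * ?z^2 + \<eta> * sq ?q / 2 + 3 / 8 * (\<eta> * l) * (norm ?q)^2"
  proof -
    define r where "r = sqrt ((norm (S ?q))^2 + l * (norm ?q)^2)"
    have "r^2 = (norm (S ?q))^2 + l * (norm ?q)^2" using l by (simp add: r_def)
    then have r: "r^2 \<le> 4 * sq ?q + 3 * l * (norm ?q)^2" using compare[of ?q] by simp
    have "2 * (?s \<bullet> ?q) \<le> 2 * ?z * r" using dual_boundD[OF \<zeta>[OF t], of ?q] by (simp add: r_def)
    \<comment> \<open>The weights are such that \<open>r^2 / 8\<close> contains \<open>sq ?q\<close>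
      with the factor 1/2.\<close>
    also have "\<dots> \<le> 8 * ?z^2 + r^2 / 8"
      using zero_le_power2[of "8 * ?z - r"] by (simp add: power2_eq_square algebra_simps)
    also have "\<dots> \<le> 8 * ?z^2 + (4 * sq ?q + 3 * l * (norm ?q)^2) / 8" using r by simp
    finally have "\<eta> * (2 * (?s \<bullet> ?q)) \<le> \<eta> * (8 * ?z^2 + (4 * sq ?q + 3 * l * (norm ?q)^2) / 8)"
      using \<eta> by (intro mult_left_mono) auto
    also have "\<dots> = 8 * \<eta> * ?z^2 + \<eta> * sq ?q / 2 + 3 / 8 * (\<eta> * l) * (norm ?q)^2"
      by (simp add: distrib_left add_divide_distrib)
    finally show ?thesis by (simp only: mult.assoc mult.left_commute[of \<eta> 2])
  qed
  also have "\<eta>^2 * (norm (L ?q - ?s))^2 \<le> \<eta> * sq ?q / 2 + 5 / 2 * \<eta> * ?z^2"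
  proof -
    have "(norm (L ?q - ?s))^2 \<le> (norm (L ?q) + norm ?s)^2"
      by (intro power_mono norm_triangle_ineq4) auto
    also have "\<dots> \<le> 2 * (norm (L ?q))^2 + 2 * (norm ?s)^2" by (rule power2_sum2_le)
    also have "\<dots> \<le> 2 * (\<kappa>^2 * sq ?q) + 2 * (?z^2 * (\<kappa>^2 + l))"
      by (intro add_mono mult_left_mono norm_L_sq dual_bound_norm_le \<zeta> t) auto
    finally have "\<eta>^2 * (norm (L ?q - ?s))^2 \<le> \<eta>^2 * (2 * (\<kappa>^2 * sq ?q) + 2 * (?z^2 * (\<kappa>^2 + l)))"
      by (intro mult_left_mono) auto
    also have "\<dots> = (\<eta> * sq ?q / 2) * (4 * \<kappa>^2 * \<eta>) + \<eta> * ?z^2 * (4 * \<kappa>^2 * \<eta> / 2 + 2 * (\<eta> * l))"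
      by (simp add: power2_eq_square algebra_simps)
    also have "\<dots> \<le> (\<eta> * sq ?q / 2) * 1 + \<eta> * ?z^2 * (1 / 2 + 2 * 1)"
    proof (intro add_mono mult_left_mono)
      show "4 * \<kappa>^2 * \<eta> / 2 \<le> 1 / 2" using \<eta>(2) by linarith
    qed (use \<eta> \<eta>l(2) sq_nonneg in auto)
    finally show ?thesis by simp
  qed
  finally have "(norm (q (Suc t)))^2 \<le> (norm ?q)^2 - \<eta> * sq ?q + (21 / 2) * (\<eta> * ?z^2) + 3 / 8 * ((\<eta> * l) * (norm ?q)^2)"
    by (simp add: algebra_simps)
  moreover have "0 \<le> (\<eta> * l) * (norm ?q)^2" "0 \<le> \<eta> * ?z^2" using \<eta> l by auto
  ultimately have "(norm (q (Suc t)))^2 \<le> (norm ?q)^2 + (\<eta> * l) * (norm ?q)^2 - \<eta> * sq ?q + 11 * (\<eta> * ?z^2)"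
    by linarith
  then show ?thesis by (simp only: \<eta>l distrib_right mult_1_left mult.assoc)
qed

definition Z :: real where "Z = (\<Sum>t\<le>T. (\<zeta> t)^2)"

lemma Z_nonneg: "Z \<ge> 0" by (simp add: Z_def sum_nonneg)

text \<open>Discrete Gronwall: \<open>(1 + 1 / T)^(T + 1) \<le> 2 * 3\<close>, times the factor 11
  of one step.\<close>

lemma energy_norm:
  assumes t: "t \<le> Suc T" shows "(norm (q t))^2 \<le> 66 * \<eta> * Z"
proof -
  have *: "(norm (q t))^2 \<le> (1 + 1 / real T) ^ t * (11 * \<eta> * (\<Sum>i<t. (\<zeta> i)^2))" if "t \<le> Suc T" for t
    using that
  proof (induction t)
    case 0 then show ?case by (simp add: q0)
  next
    case (Suc t)
    let ?a = "1 + 1 / real T"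
    have t: "t \<le> T" using Suc by simp
    have a: "1 \<le> ?a" by simp
    have "(norm (q (Suc t)))^2 \<le> ?a * (norm (q t))^2 + 11 * \<eta> * (\<zeta> t)^2"
      using energy_step[OF t] \<eta> mult_nonneg_nonneg[of \<eta> "sq (q t)"] sq_nonneg[of "q t"] by linarith
    also have "\<dots> \<le> ?a * (?a ^ t * (11 * \<eta> * (\<Sum>i<t. (\<zeta> i)^2))) + ?a ^ Suc t * (11 * \<eta> * (\<zeta> t)^2)"
    proof (intro add_mono mult_left_mono)
      show "11 * \<eta> * (\<zeta> t)^2 \<le> ?a ^ Suc t * (11 * \<eta> * (\<zeta> t)^2)"
        using one_le_power[OF a, of "Suc t"] \<eta> mult_right_mono[of 1 "?a ^ Suc t" "11 * \<eta> * (\<zeta> t)^2"] by simp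
    qed (use Suc a in auto)
    also have "\<dots> = ?a ^ Suc t * (11 * \<eta> * (\<Sum>i<Suc t. (\<zeta> i)^2))" by (simp add: algebra_simps)
    finally show ?case .
  qed
  have "(1 + 1 / real T) ^ t \<le> (1 + 1 / real T) ^ Suc T" using t by (intro power_increasing) auto
  also have "\<dots> = (1 + 1 / real T) * (1 + 1 / real T) ^ T" by simp
  also have "\<dots> \<le> 2 * 3"
  proof (intro mult_mono)
    have "(1 + 1 / real T) ^ T \<le> exp (1 / real T) ^ T"
      using exp_ge_add_one_self[of "1 / real T"] by (intro power_mono) auto
    also have "\<dots> = exp 1" using T by (simp add: exp_of_nat_mult[symmetric])
    also have "\<dots> \<le> 3" by (rule exp_le)
    finally show "(1 + 1 / real T) ^ T \<le> 3" .
  qed (use T in auto)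
  finally have "(1 + 1 / real T) ^ t \<le> 6" by simp
  moreover have "(\<Sum>i<t. (\<zeta> i)^2) \<le> Z" unfolding Z_def using t by (intro sum_mono2) auto
  ultimately have "(1 + 1 / real T) ^ t * (11 * \<eta> * (\<Sum>i<t. (\<zeta> i)^2)) \<le> 6 * (11 * \<eta> * Z)"
    using \<eta> by (intro mult_mono mult_left_mono) (auto intro!: sum_nonneg mult_nonneg_nonneg)
  also have "6 * (11 * \<eta> * Z) = 66 * \<eta> * Z" by simp
  finally show ?thesis using *[OF t] by (rule order_trans[rotated])
qed

text \<open>When the energy steps are summed, the norms telescope; their growth contributes
  \<open>66 * (T + 1) / T \<le> 132\<close>, to which the sources add 11.\<close>

lemma energy_sq: "(\<Sum>t\<le>T. sq (q t)) \<le> 143 * Z"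
proof -
  have "\<eta> * sq (q t) \<le> (norm (q t))^2 - (norm (q (Suc t)))^2 + 66 * \<eta> * Z / real T + 11 * \<eta> * (\<zeta> t)^2" if "t \<le> T" for t
  proof -
    have "(1 / real T) * (norm (q t))^2 \<le> (1 / real T) * (66 * \<eta> * Z)"
      using that by (intro mult_left_mono energy_norm) auto
    then show ?thesis using energy_step[OF that] by (simp add: distrib_right)
  qed
  then have "(\<Sum>t\<le>T. \<eta> * sq (q t)) \<le> (\<Sum>t\<le>T. (norm (q t))^2 - (norm (q (Suc t)))^2 + 66 * \<eta> * Z / real T + 11 * \<eta> * (\<zeta> t)^2)"
    by (intro sum_mono) auto
  also have "\<dots> = (\<Sum>t\<le>T. (norm (q t))^2 - (norm (q (Suc t)))^2) + (real T + 1) * (66 * \<eta> * Z / real T) + 11 * \<eta> * Z"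
    by (simp add: sum.distrib Z_def sum_distrib_left add.commute)
  also have "(\<Sum>t\<le>T. (norm (q t))^2 - (norm (q (Suc t)))^2) = (norm (q 0))^2 - (norm (q (Suc T)))^2"
    by (rule sum_telescope)
  also have "(norm (q 0))^2 - (norm (q (Suc T)))^2 \<le> 0" by (simp add: q0)
  also have "(real T + 1) * (66 * \<eta> * Z / real T) \<le> 132 * \<eta> * Z"
  proof -
    have "(real T + 1) * (66 * \<eta> * Z / real T) = (66 * \<eta> * Z) * ((real T + 1) / real T)" by simp
    also have "\<dots> \<le> (66 * \<eta> * Z) * 2"
      using \<eta> T Z_nonneg by (intro mult_left_mono) (auto simp: divide_le_eq)
    finally show ?thesis by simp
  qed
  finally have "\<eta> * (\<Sum>t\<le>T. sq (q t)) \<le> \<eta> * (143 * Z)" by (simp add: sum_distrib_left)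
  then show ?thesis using \<eta> by simp
qed

text \<open>\<open>836 = 4 * 143 + 264\<close>, where 264 bounds the sum of the \<open>T + 1\<close>
  terms \<open>2 * l * 66 * \<eta>\<close>, because \<open>\<eta> * l * T = 1\<close> and
  \<open>T + 1 \<le> 2 * T\<close>.\<close>

theorem energy_prediction: "(\<Sum>t\<le>T. (norm (S (q t)))^2) \<le> 836 * Z"
proof -
  have "(\<Sum>t\<le>T. (norm (S (q t)))^2) \<le> (\<Sum>t\<le>T. 4 * sq (q t) + 2 * l * (66 * \<eta> * Z))"
  proof (rule sum_mono)
    fix t assume "t \<in> {..T}"
    then have "2 * l * (norm (q t))^2 \<le> 2 * l * (66 * \<eta> * Z)"
      using l by (intro mult_left_mono energy_norm) auto
    with compare[of "q t"] show "(norm (S (q t)))^2 \<le> 4 * sq (q t) + 2 * l * (66 * \<eta> * Z)" by linarith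
  qed
  also have "\<dots> = 4 * (\<Sum>t\<le>T. sq (q t)) + (real T + 1) * (132 * (\<eta> * l) * Z)"
    by (simp add: sum.distrib sum_distrib_left algebra_simps)
  also have "(real T + 1) * (132 * (\<eta> * l) * Z) \<le> 264 * Z"
  proof -
    have \<eta>l: "\<eta> * l = 1 / real T" using T by (simp add: divide_simps)
    have "(real T + 1) * (132 * (\<eta> * l) * Z) = 132 * Z * ((real T + 1) / real T)" by (simp add: \<eta>l)
    also have "\<dots> \<le> 132 * Z * 2"
      using T Z_nonneg by (intro mult_left_mono) (auto simp: divide_le_eq)
    finally show ?thesis by simp
  qed
  finally show ?thesis using energy_sq by simp
qed

end

end

section \<open>Fluctuation of SGD in the prediction norm\<close>

locale compared_sgd_sample = sgd_sample n \<kappa> k y b T \<eta> \<sigma> h0 + compared_sample n \<kappa> k y S l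
  for n \<kappa> and k :: "nat \<Rightarrow> 'h::{real_inner,banach}" and y b T \<eta> \<sigma> h0
    and S :: "'h \<Rightarrow> 'l::{real_inner,banach}" and l +
  fixes B :: "'l set" and N :: real
  assumes T: "even T" "T > 0" and l_eq: "l = 1 / (\<eta> * real T)"
    and B: "orthonormal_basis B"
    and eigen: "e \<in> B \<Longrightarrow> S (adjoint S e) = (norm (adjoint S e))^2 *\<^sub>R e"
    and trace: "F \<subseteq> B \<Longrightarrow> finite F \<Longrightarrow> (\<Sum>e\<in>F. (norm (adjoint S e))^2) \<le> \<kappa>^2"
    and dof: "F \<subseteq> B \<Longrightarrow> finite F \<Longrightarrow> (\<Sum>e\<in>F. (norm (adjoint S e))^2 / ((norm (adjoint S e))^2 + l)) \<le> N"
begin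

text \<open>The left side \<open>X\<close> equals
  \<open>v \<bullet> adjoint S e = S v \<bullet> e\<close>, so \<open>X^2\<close> is bounded both by
  \<open>(norm (S v))^2\<close> and by \<open>?s * (norm v)^2\<close>. Weighting the two with
  \<open>?s\<close> and \<open>l\<close> and applying \<open>compare\<close> gives
  \<open>X^2 * (?s + l) \<le> 4 * ?s * X\<close>: empirical degrees of freedom are at most four
  times the population ones, direction by direction.\<close>

lemma resolvent_weight:
  assumes v: "L v + l *\<^sub>R v = adjoint S e" and e: "e \<in> B"
  shows "sq v + l * (norm v)^2 \<le> 4 * ((norm (adjoint S e))^2 / ((norm (adjoint S e))^2 + l))"
proof -
  let ?s = "(norm (adjoint S e))^2"
  define X where "X = sq v + l * (norm v)^2"
  have X: "X = v \<bullet> adjoint S e"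
    unfolding v[symmetric] X_def L_quadratic[symmetric]
    by (simp add: inner_add_right power2_norm_eq_inner inner_commute)
  have X0: "X \<ge> 0" using sq_nonneg l by (simp add: X_def)
  have "\<bar>S v \<bullet> e\<bar> \<le> norm (S v)"
    using Cauchy_Schwarz_ineq2[of "S v" e] B e by (simp add: orthonormal_basis_def)
  then have 1: "X^2 \<le> (norm (S v))^2"
    using X0 unfolding X adjoint_works_hilbert[OF S, symmetric] by (intro power_mono) auto
  have "X^2 \<le> (norm v * norm (adjoint S e))^2"
    unfolding X using X0 X by (intro power_mono norm_cauchy_schwarz) auto
  then have 2: "X^2 \<le> ?s * (norm v)^2" by (simp add: power_mult_distrib mult.commute)
  have "X^2 * (?s + l) \<le> ?s * (norm (S v))^2 + l * (?s * (norm v)^2)"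
  proof -
    have "X^2 * ?s \<le> ?s * (norm (S v))^2" using mult_left_mono[OF 1, of ?s] by (simp add: mult.commute)
    moreover have "X^2 * l \<le> l * (?s * (norm v)^2)" using mult_left_mono[OF 2, of l] l by (simp add: mult.commute)
    ultimately show ?thesis unfolding distrib_left by (rule add_mono)
  qed
  also have "\<dots> \<le> ?s * (4 * sq v + 2 * l * (norm v)^2) + l * (?s * (norm v)^2)"
    by (intro add_right_mono mult_left_mono compare) auto
  also have "\<dots> = 4 * ?s * X - ?s * (l * (norm v)^2)" by (simp add: X_def algebra_simps)
  also have "\<dots> \<le> 4 * ?s * X" using l by simp
  finally have "X * X \<le> (4 * (?s / (?s + l))) * X"
    using l by (simp add: power2_eq_square pos_le_divide_eq add_nonneg_pos)
  then show ?thesis unfolding X_def[symmetric]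
    by (rule le_of_square_le_mult) (use l in \<open>simp add: add_nonneg_nonneg\<close>)
qed

text \<open>Parseval in \<open>B\<close> reduces the prediction norm to the directions
  \<open>adjoint S e\<close>, for which \<open>E_tail_le\<close> and \<open>resolvent_weight\<close>
  give \<open>4 * 102 = 408\<close>; the population degrees of freedom then sum to at most
  \<open>N\<close>.\<close>

theorem E_prediction_le:
  "E (\<lambda>J. (norm (S (tail_w J)))^2) \<le> 408 * c * l * N + 32 * c / (real T)^2 * \<kappa>^2"
proof (rule index_avg_infsum_le)
  fix J
  show "((\<lambda>e. (tail_w J \<bullet> adjoint S e)^2) has_sum (norm (S (tail_w J)))\<^sup>2) B"
    using parseval_norm[OF B, of "S (tail_w J)"] by (simp add: adjoint_works_hilbert[OF S])
next
  fix F assume F: "finite F" "F \<subseteq> B"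
  let ?s = "\<lambda>e. (norm (adjoint S e))^2"
  have "(\<Sum>e\<in>F. E (\<lambda>J. (tail_w J \<bullet> adjoint S e)^2))
     \<le> (\<Sum>e\<in>F. 408 * c * l * (?s e / (?s e + l)) + 32 * c / (real T)^2 * ?s e)"
  proof (rule sum_mono)
    fix e assume e: "e \<in> F"
    obtain v where v: "L v + l *\<^sub>R v = adjoint S e" using resolvent_exists[OF l] by blast
    have "102 * c * l * (sq v + l * (norm v)^2) \<le> 102 * c * l * (4 * (?s e / (?s e + l)))"
      using resolvent_weight[OF v] e F c_nonneg l by (intro mult_left_mono) auto
    with E_tail_le[OF T l_eq v]
    show "E (\<lambda>J. (tail_w J \<bullet> adjoint S e)^2) \<le> 408 * c * l * (?s e / (?s e + l)) + 32 * c / (real T)^2 * ?s e"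
      by simp
  qed
  also have "\<dots> = 408 * c * l * (\<Sum>e\<in>F. ?s e / (?s e + l)) + 32 * c / (real T)^2 * (\<Sum>e\<in>F. ?s e)"
    by (simp only: sum.distrib sum_distrib_left)
  also have "\<dots> \<le> 408 * c * l * N + 32 * c / (real T)^2 * \<kappa>^2"
    using dof[OF F(2,1)] trace[OF F(2,1)] c_nonneg l by (intro add_mono mult_left_mono) auto
  finally show "(\<Sum>e\<in>F. E (\<lambda>J. (tail_w J \<bullet> adjoint S e)^2)) \<le> 408 * c * l * N + 32 * c / (real T)^2 * \<kappa>^2" .
qed

end

section \<open>The two-stage experiment\<close>

text \<open>\<open>product_sigma_finite\<close> asks for sigma-finite factors at every index, so
  those outside \<open>I\<close> are replaced by a point mass, which does not change the product
  over \<open>I\<close>.\<close>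

lemma emeasure_PiM_prob:
  assumes I: "finite I" and M: "\<And>i. i \<in> I \<Longrightarrow> prob_space (M i)" and E: "\<And>i. i \<in> I \<Longrightarrow> E i \<in> sets (M i)"
  shows "emeasure (PiM I M) (Pi\<^sub>E I E) = (\<Prod>i\<in>I. emeasure (M i) (E i))"
proof -
  define M' where "M' i = (if i \<in> I then M i else return (count_space UNIV) undefined)" for i
  interpret product_sigma_finite M'
    by (rule product_sigma_finite.intro) (auto simp: M'_def M prob_space_return intro!: prob_space_imp_sigma_finite)
  have "PiM I M = PiM I M'" by (rule PiM_cong) (auto simp: M'_def)
  then have "emeasure (PiM I M) (Pi\<^sub>E I E) = (\<Prod>i\<in>I. emeasure (M' i) (E i))"
    using E by (simp add: emeasure_PiM[OF I] M'_def)
  then show ?thesis by (simp add: M'_def)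
qed

text \<open>Rectangles generate the product and are stable under intersection; on them the measure
  is a finite product of measurable functions.\<close>

lemma measurable_PiM_kernel:
  assumes I: "finite I" and K: "\<And>i. i \<in> I \<Longrightarrow> K i \<in> M \<rightarrow>\<^sub>M prob_algebra (N i)"
  shows "(\<lambda>x. PiM I (\<lambda>i. K i x)) \<in> M \<rightarrow>\<^sub>M prob_algebra (PiM I N)"
proof (rule measurable_prob_algebra_generated[OF sets_PiM Int_stable_prod_algebra prod_algebra_sets_into_space])
  have Kx: "prob_space (K i x)" "sets (K i x) = sets (N i)" if "i \<in> I" "x \<in> space M" for i x
    using measurable_space[OF K[OF that(1)] that(2)] by (auto simp: space_prob_algebra)
  show "prob_space (PiM I (\<lambda>i. K i x))" if "x \<in> space M" for x
    by (rule prob_space_PiM) (rule Kx[OF _ that])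
  show "sets (PiM I (\<lambda>i. K i x)) = sets (PiM I N)" if "x \<in> space M" for x
    by (rule sets_PiM_cong) (auto simp: Kx that)
  fix A assume "A \<in> prod_algebra I N"
  then obtain E where A: "A = Pi\<^sub>E I E" "E \<in> (\<Pi> i\<in>I. sets (N i))" by (rule prod_algebraE_all)
  have E: "E i \<in> sets (N i)" if "i \<in> I" for i using A(2) that by auto
  have "(\<lambda>x. \<Prod>i\<in>I. emeasure (K i x) (E i)) \<in> borel_measurable M"
  proof (rule borel_measurable_prod_ennreal)
    fix i assume i: "i \<in> I"
    show "(\<lambda>x. emeasure (K i x) (E i)) \<in> borel_measurable M"
      by (rule measurable_emeasure_kernel[OF measurable_prob_algebraD[OF K[OF i]] E[OF i]])
  qed
  moreover have "emeasure (PiM I (\<lambda>i. K i x)) A = (\<Prod>i\<in>I. emeasure (K i x) (E i))" if x: "x \<in> space M" for x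
    unfolding A(1) using Kx[OF _ x] E by (intro emeasure_PiM_prob I) auto
  ultimately show "(\<lambda>x. emeasure (PiM I (\<lambda>i. K i x)) A) \<in> borel_measurable M"
    by (simp cong: measurable_cong)
qed

lemma nn_integral_PiM_uniform:
  assumes I: "finite I" and n: "n > 0" and f: "\<And>J. f J \<ge> 0"
  shows "(\<integral>\<^sup>+J. ennreal (f J) \<partial>(\<Pi>\<^sub>M i\<in>I. uniform_count_measure {1..n})) = ennreal (index_avg I n f)"
proof -
  let ?X = "Pi\<^sub>E I (\<lambda>_. {1..n})" and ?U = "\<lambda>_::nat. uniform_count_measure {1..n}"
  have fin: "finite ?X" using I by (rule finite_PiE) auto
  have U: "prob_space (uniform_count_measure {1..n})"
    using n by (intro prob_space_uniform_count_measure) auto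
  have card: "card ?X = n ^ card I" by (simp add: card_PiE I)
  interpret product_sigma_finite ?U
    by (rule product_sigma_finite.intro) (rule prob_space_imp_sigma_finite[OF U])
  have "uniform_count_measure ?X = PiM I ?U"
  proof (rule PiM_eqI[OF I])
    have "sets (PiM I ?U) = sets (PiM I (\<lambda>_. count_space {1..n}))"
      by (rule sets_PiM_cong) (auto simp: sets_uniform_count_measure)
    also have "\<dots> = Pow ?X" using I by (subst count_space_PiM_finite) auto
    finally show "sets (uniform_count_measure ?X) = sets (PiM I ?U)" by (simp add: sets_uniform_count_measure)
    fix A :: "nat \<Rightarrow> nat set" assume A: "\<And>i. i \<in> I \<Longrightarrow> A i \<in> sets (uniform_count_measure {1..n})"
    then have sub: "A i \<subseteq> {1..n}" if "i \<in> I" for i using that by (auto simp: sets_uniform_count_measure)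
    have "Pi\<^sub>E I A \<subseteq> ?X" using sub by (intro PiE_mono) auto
    then have "emeasure (uniform_count_measure ?X) (Pi\<^sub>E I A) = ennreal (real (card (Pi\<^sub>E I A)) / real (card ?X))"
      by (rule emeasure_uniform_count_measure[OF fin])
    also have "real (card (Pi\<^sub>E I A)) / real (card ?X) = (\<Prod>i\<in>I. real (card (A i)) / real n)"
      using I by (simp add: card card_PiE prod_dividef)
    also have "ennreal \<dots> = (\<Prod>i\<in>I. ennreal (real (card (A i)) / real n))"
      by (rule prod_ennreal[symmetric]) simp
    also have "\<dots> = (\<Prod>i\<in>I. emeasure (uniform_count_measure {1..n}) (A i))"
      using sub by (intro prod.cong refl) (simp add: emeasure_uniform_count_measure)
    finally show "emeasure (uniform_count_measure ?X) (Pi\<^sub>E I A) = (\<Prod>i\<in>I. emeasure (uniform_count_measure {1..n}) (A i))" .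
  qed
  from this[symmetric]
  have "(\<integral>\<^sup>+J. ennreal (f J) \<partial>PiM I ?U) = (\<Sum>J\<in>?X. ennreal (1 / real (card ?X)) * ennreal (f J))"
    by (simp only: uniform_count_measure_def nn_integral_point_measure_finite[OF fin])
  also have "\<dots> = (\<Sum>J\<in>?X. ennreal (f J / real n ^ card I))"
    unfolding card using f by (intro sum.cong refl) (simp add: ennreal_mult'[symmetric])
  also have "\<dots> = ennreal (index_avg I n f)"
    using f by (subst sum_ennreal) (auto simp: index_avg_def sum_divide_distrib)
  finally show ?thesis .
qed

text \<open>The part \<open>A\<close> of \<open>E\<close> where the conditional expectation exceeds
  \<open>c\<close> belongs to \<open>F\<close>, so \<open>le\<close> applies to it and the integral
  of the excess over \<open>A\<close> is zero. Hence \<open>A\<close> is null and the bound holds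
  almost surely on \<open>E\<close>.\<close>

lemma nn_cond_exp_le_prob:
  assumes M: "prob_space M" and F: "subalgebra M F" and f: "f \<in> borel_measurable M"
    and E: "E \<in> sets F" and c: "c < \<infinity>"
    and le: "\<And>A. A \<in> sets F \<Longrightarrow> A \<subseteq> E \<Longrightarrow> (\<integral>\<^sup>+x. f x * indicator A x \<partial>M) \<le> c * emeasure M A"
  shows "measure M E \<le> measure M {x \<in> space M. nn_cond_exp M F f x \<le> c}"
proof -
  interpret prob_space M by fact
  interpret finite_measure_subalgebra M F by unfold_locales (rule F)
  have sub: "sets F \<subseteq> sets M" "space F = space M" using F by (auto simp: subalgebra_def)
  define g where "g = nn_cond_exp M F f"
  have g [measurable]: "g \<in> borel_measurable F" "g \<in> borel_measurable M" by (simp_all add: g_def)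
  define A where "A = {x \<in> space F. c < g x} \<inter> E"
  have AF: "A \<in> sets F" unfolding A_def using E by measurable
  then have AM: "A \<in> sets M" using sub by blast
  have "(\<integral>\<^sup>+x. indicator A x * g x \<partial>M) = (\<integral>\<^sup>+x. indicator A x * f x \<partial>M)"
    unfolding g_def by (rule nn_cond_exp_intg[OF _ f]) (use AF in measurable)
  also have "\<dots> \<le> c * emeasure M A"
    using le[OF AF] by (simp add: A_def mult.commute)
  finally have int: "(\<integral>\<^sup>+x. indicator A x * g x \<partial>M) \<le> c * emeasure M A" .
  have cA: "(\<integral>\<^sup>+x. c * indicator A x \<partial>M) = c * emeasure M A"
    by (rule nn_integral_cmult_indicator[OF AM])
  have fin: "c * emeasure M A \<noteq> \<infinity>"
    using c emeasure_finite[of A] by (simp add: ennreal_mult_eq_top_iff less_top)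
  have "(\<integral>\<^sup>+x. indicator A x * g x - c * indicator A x \<partial>M)
      = (\<integral>\<^sup>+x. indicator A x * g x \<partial>M) - (\<integral>\<^sup>+x. c * indicator A x \<partial>M)"
  proof (rule nn_integral_diff)
    show "AE x in M. c * indicator A x \<le> indicator A x * g x"
      by (rule AE_I2) (auto simp: indicator_def A_def)
  qed (use AM fin cA in auto)
  also have "\<dots> \<le> 0"
    using int fin unfolding cA
    by (metis diff_eq_0_ennreal infinity_ennreal_def le_zero_eq order.strict_trans1 top.not_eq_extremum)
  finally have "AE x in M. indicator A x * g x - c * indicator A x = 0"
    using AM by (subst (asm) le_zero_eq, subst (asm) nn_integral_0_iff_AE) auto
  then have "AE x in M. x \<notin> A"
  proof eventually_elim
    case (elim x)
    show ?case
    proof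
      assume x: "x \<in> A"
      then have "g x - c = 0" using elim by simp
      then have "g x \<le> c" using c by (simp add: diff_eq_0_iff_ennreal)
      then show False using x by (auto simp: A_def)
    qed
  qed
  then have A0: "measure M A = 0" using AM by (simp add: prob_eq_0)
  have EM: "E \<in> sets M" using E sub by blast
  have G: "{x \<in> space M. g x \<le> c} \<in> sets M" by measurable
  have "measure M E \<le> measure M ({x \<in> space M. g x \<le> c} \<union> A)"
    using EM G AM sets.sets_into_space[OF EM] by (intro finite_measure_mono) (auto simp: A_def sub)
  also have "\<dots> \<le> measure M {x \<in> space M. g x \<le> c} + measure M A"
    by (rule measure_subadditive) (use G AM in auto)
  finally show ?thesis by (simp add: A0 g_def)
qed

context
  fixes Q :: "('x::topological_space measure \<times> real) measure" and Y :: "real set" and n N :: nat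
  assumes Q: "prob_space Q" and Q_sets: "sets Q = sets (prob_algebra borel \<Otimes>\<^sub>M restrict_space borel Y)"
begin

abbreviation (input) "first_stage \<equiv> \<Pi>\<^sub>M j\<in>{1..n}. Q"
abbreviation (input) "second_space \<equiv> \<Pi>\<^sub>M j\<in>{1..n}. \<Pi>\<^sub>M i\<in>{1..N}. (borel :: 'x measure)"
abbreviation (input) "second_stage d \<equiv> \<Pi>\<^sub>M j\<in>{1..n}. \<Pi>\<^sub>M i\<in>{1..N}. fst (d j)"

lemma first_stage_component:
  assumes "d \<in> space first_stage" "j \<in> {1..n}"
  shows "prob_space (fst (d j))" "sets (fst (d j)) = sets borel"
proof -
  have "d j \<in> space Q" using assms by (auto simp: space_PiM)
  then have "d j \<in> space (prob_algebra borel \<Otimes>\<^sub>M restrict_space borel Y)"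
    using sets_eq_imp_space_eq[OF Q_sets] by simp
  then have "fst (d j) \<in> space (prob_algebra borel)"
    by (simp only: space_pair_measure mem_Times_iff)
  then show "prob_space (fst (d j))" "sets (fst (d j)) = sets borel"
    by (simp_all add: space_prob_algebra)
qed

lemma fst_measurable: "j \<in> {1..n} \<Longrightarrow> (\<lambda>d. fst (d j)) \<in> first_stage \<rightarrow>\<^sub>M prob_algebra borel"
proof -
  assume j: "j \<in> {1..n}"
  have "fst \<in> Q \<rightarrow>\<^sub>M prob_algebra borel"
    unfolding measurable_cong_sets[OF Q_sets refl] by (rule measurable_fst)
  from measurable_compose[OF measurable_component_singleton[OF j] this] show ?thesis by simp
qed

lemma second_stage_measurable: "second_stage \<in> first_stage \<rightarrow>\<^sub>M prob_algebra second_space"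
  by (intro measurable_PiM_kernel fst_measurable) auto

lemma second_stage_space:
  assumes d: "d \<in> space first_stage"
  shows "sets (second_stage d) = sets second_space" "space (second_stage d) = space second_space"
proof -
  show s: "sets (second_stage d) = sets second_space"
    using measurable_space[OF second_stage_measurable d] by (simp add: space_prob_algebra)
  show "space (second_stage d) = space second_space" by (rule sets_eq_imp_space_eq[OF s])
qed

lemma pair_kernel_measurable:
  "(\<lambda>d. second_stage d \<bind> (\<lambda>z. return (first_stage \<Otimes>\<^sub>M second_space) (d, z)))
     \<in> first_stage \<rightarrow>\<^sub>M prob_algebra (first_stage \<Otimes>\<^sub>M second_space)"
  by (rule measurable_bind_prob_space2[OF second_stage_measurable]) measurable

lemma space_first_stage: "space first_stage \<noteq> {}"
  using prob_space.not_empty[OF Q] by (simp add: space_PiM_empty_iff)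

lemma two_stage_sample_prob:
  shows "prob_space (two_stage_sample Q n N)"
    and two_stage_sample_sets: "sets (two_stage_sample Q n N) = sets (first_stage \<Otimes>\<^sub>M second_space)"
proof -
  interpret P: prob_space first_stage by (rule prob_space_PiM) (rule Q)
  note K = pair_kernel_measurable
  have pr: "prob_space (second_stage d \<bind> (\<lambda>z. return (first_stage \<Otimes>\<^sub>M second_space) (d, z)))"
    "sets (second_stage d \<bind> (\<lambda>z. return (first_stage \<Otimes>\<^sub>M second_space) (d, z))) = sets (first_stage \<Otimes>\<^sub>M second_space)"
    if "d \<in> space first_stage" for d
    using measurable_space[OF K that] by (auto simp: space_prob_algebra)
  show "prob_space (two_stage_sample Q n N)"
    unfolding two_stage_sample_def
    by (rule P.prob_space_bind[OF _ measurable_prob_algebraD[OF K]]) (rule AE_I2, rule pr)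
  show "sets (two_stage_sample Q n N) = sets (first_stage \<Otimes>\<^sub>M second_space)"
    unfolding two_stage_sample_def by (rule sets_bind[OF pr(2) space_first_stage])
qed

lemma nn_integral_two_stage:
  assumes f: "f \<in> borel_measurable (first_stage \<Otimes>\<^sub>M second_space)"
  shows "(\<integral>\<^sup>+p. f p \<partial>two_stage_sample Q n N) = (\<integral>\<^sup>+d. \<integral>\<^sup>+z. f (d, z) \<partial>second_stage d \<partial>first_stage)"
proof -
  have "(\<integral>\<^sup>+p. f p \<partial>two_stage_sample Q n N)
     = (\<integral>\<^sup>+d. \<integral>\<^sup>+p. f p \<partial>(second_stage d \<bind> (\<lambda>z. return (first_stage \<Otimes>\<^sub>M second_space) (d, z))) \<partial>first_stage)"
    unfolding two_stage_sample_def
    by (rule nn_integral_bind[OF f measurable_prob_algebraD[OF pair_kernel_measurable]])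
  also have "\<dots> = (\<integral>\<^sup>+d. \<integral>\<^sup>+z. f (d, z) \<partial>second_stage d \<partial>first_stage)"
  proof (rule nn_integral_cong)
    fix d assume d: "d \<in> space first_stage"
    note s = second_stage_space[OF d]
    have "(\<lambda>z. return (first_stage \<Otimes>\<^sub>M second_space) (d, z)) \<in> second_space \<rightarrow>\<^sub>M subprob_algebra (first_stage \<Otimes>\<^sub>M second_space)"
      using d by measurable
    then have "(\<lambda>z. return (first_stage \<Otimes>\<^sub>M second_space) (d, z)) \<in> second_stage d \<rightarrow>\<^sub>M subprob_algebra (first_stage \<Otimes>\<^sub>M second_space)"
      unfolding measurable_cong_sets[OF s(1) refl] .
    then have "(\<integral>\<^sup>+p. f p \<partial>(second_stage d \<bind> (\<lambda>z. return (first_stage \<Otimes>\<^sub>M second_space) (d, z))))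
       = (\<integral>\<^sup>+z. \<integral>\<^sup>+p. f p \<partial>return (first_stage \<Otimes>\<^sub>M second_space) (d, z) \<partial>second_stage d)"
      by (rule nn_integral_bind[OF f])
    also have "\<dots> = (\<integral>\<^sup>+z. f (d, z) \<partial>second_stage d)"
      by (intro nn_integral_cong nn_integral_return f) (use d s in \<open>simp add: space_pair_measure\<close>)
    finally show "(\<integral>\<^sup>+p. f p \<partial>(second_stage d \<bind> (\<lambda>z. return (first_stage \<Otimes>\<^sub>M second_space) (d, z))))
       = (\<integral>\<^sup>+z. f (d, z) \<partial>second_stage d)" .
  qed
  finally show ?thesis .
qed

text \<open>
  No measurability of \<open>err\<close> is needed: \<open>nn_cond_exp\<close> is \<open>0\<close> on functions that are not measurable.
\<close>

theorem conditional_error_bound: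
  fixes D :: "(nat \<Rightarrow> 'x measure \<times> real) \<Rightarrow> 'c" and R :: "'c measure" and k :: nat and c \<delta> :: real
    and err :: "((nat \<Rightarrow> 'x measure \<times> real) \<times> (nat \<Rightarrow> nat \<Rightarrow> 'x)) \<times> (nat \<Rightarrow> nat) \<Rightarrow> real"
  defines "\<Omega> \<equiv> sgd_experiment Q n N k"
  defines "\<sigma>D \<equiv> vimage_algebra (space \<Omega>) (\<lambda>((d, z), J). D d) R"
  assumes n: "n > 0" and D: "D \<in> first_stage \<rightarrow>\<^sub>M R"
    and G: "G \<in> sets R" "emeasure first_stage (D -` G \<inter> space first_stage) \<ge> ennreal (1 - \<delta>)"
    and \<delta>: "\<delta> \<le> 1" and c: "c \<ge> 0" and err: "\<And>\<omega>. err \<omega> \<ge> 0"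
    and le: "\<And>d. d \<in> space first_stage \<Longrightarrow> D d \<in> G \<Longrightarrow>
       (\<integral>\<^sup>+z. ennreal (index_avg {1..k} n (\<lambda>J. err ((d, z), J))) \<partial>second_stage d) \<le> ennreal c"
  shows "measure \<Omega> {\<omega> \<in> space \<Omega>. nn_cond_exp \<Omega> \<sigma>D (\<lambda>\<omega>. ennreal (err \<omega>)) \<omega> \<le> ennreal c} \<ge> 1 - \<delta>"
proof -
  let ?T = "two_stage_sample Q n N" and ?U = "\<Pi>\<^sub>M i\<in>{1..k}. uniform_count_measure {1..n}"
  interpret T: prob_space ?T by (rule two_stage_sample_prob)
  interpret U: prob_space ?U
    using n by (intro prob_space_PiM prob_space_uniform_count_measure) auto
  interpret TU: pair_prob_space ?T ?U ..
  have \<Omega>: "\<Omega> = ?T \<Otimes>\<^sub>M ?U" by (simp add: \<Omega>_def sgd_experiment_def)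
  interpret \<Omega>: prob_space \<Omega> unfolding \<Omega> by unfold_locales
  have Tspace: "space ?T = space (first_stage \<Otimes>\<^sub>M second_space)"
    by (rule sets_eq_imp_space_eq[OF two_stage_sample_sets])
  show ?thesis
  proof (cases "(\<lambda>\<omega>. ennreal (err \<omega>)) \<in> borel_measurable \<Omega>")
    case False
    then have "{\<omega> \<in> space \<Omega>. nn_cond_exp \<Omega> \<sigma>D (\<lambda>\<omega>. ennreal (err \<omega>)) \<omega> \<le> ennreal c} = space \<Omega>"
      by (simp add: nn_cond_exp_def)
    moreover have "1 - \<delta> \<le> 1"
    proof -
      have "ennreal (1 - \<delta>) \<le> 1"
        using G(2) prob_space.emeasure_le_1[OF prob_space_PiM[of "{1..n}" "\<lambda>_. Q", OF Q]] order_trans by blast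
      then show ?thesis using \<delta> by (simp add: ennreal_le_1)
    qed
    ultimately show ?thesis using \<Omega>.prob_space by simp
  next
    case True
    have fstm: "(\<lambda>((d, z), J). D d) \<in> \<Omega> \<rightarrow>\<^sub>M R"
    proof -
      have "(\<lambda>\<omega>. fst (fst \<omega>)) \<in> \<Omega> \<rightarrow>\<^sub>M first_stage"
        unfolding \<Omega>
        by (rule measurable_compose[OF measurable_fst], subst measurable_cong_sets[OF two_stage_sample_sets refl], rule measurable_fst)
      from measurable_compose[OF this D] show ?thesis by (simp add: case_prod_unfold)
    qed
    have sub: "subalgebra \<Omega> \<sigma>D"
      unfolding subalgebra_def \<sigma>D_def using measurable_space[OF fstm] measurable_sets[OF fstm]
      by (auto simp: sets_vimage_algebra2 Pi_iff)
    define E where "E = (\<lambda>((d, z), J). D d) -` G \<inter> space \<Omega>"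
    have E: "E \<in> sets \<sigma>D" unfolding E_def \<sigma>D_def by (rule in_vimage_algebra[OF G(1)])
    have int: "(\<integral>\<^sup>+\<omega>. f \<omega> \<partial>\<Omega>) = (\<integral>\<^sup>+d. \<integral>\<^sup>+z. \<integral>\<^sup>+J. f ((d, z), J) \<partial>?U \<partial>second_stage d \<partial>first_stage)"
      if f: "f \<in> borel_measurable \<Omega>" for f
    proof -
      have "(\<integral>\<^sup>+\<omega>. f \<omega> \<partial>\<Omega>) = (\<integral>\<^sup>+p. \<integral>\<^sup>+J. f (p, J) \<partial>?U \<partial>?T)"
        using f unfolding \<Omega> by (rule U.nn_integral_fst[symmetric])
      also have "\<dots> = (\<integral>\<^sup>+d. \<integral>\<^sup>+z. \<integral>\<^sup>+J. f ((d, z), J) \<partial>?U \<partial>second_stage d \<partial>first_stage)"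
      proof (rule nn_integral_two_stage)
        have "(\<lambda>p. \<integral>\<^sup>+J. f (p, J) \<partial>?U) \<in> borel_measurable ?T"
          using f unfolding \<Omega> by (intro U.borel_measurable_nn_integral_fst)
        then show "(\<lambda>p. \<integral>\<^sup>+J. f (p, J) \<partial>?U) \<in> borel_measurable (first_stage \<Otimes>\<^sub>M second_space)"
          unfolding measurable_cong_sets[OF two_stage_sample_sets refl] .
      qed
      finally show ?thesis .
    qed
    have prob2: "prob_space (second_stage d)" if "d \<in> space first_stage" for d
      using measurable_space[OF second_stage_measurable that] by (auto simp: space_prob_algebra)
    have marg: "emeasure \<Omega> ((\<lambda>((d, z), J). D d) -` B \<inter> space \<Omega>) = emeasure first_stage (D -` B \<inter> space first_stage)"
      if B: "B \<in> sets R" for B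
    proof -
      let ?A = "(\<lambda>((d, z), J). D d) -` B \<inter> space \<Omega>"
      have A: "?A \<in> sets \<Omega>" using measurable_sets[OF fstm B] .
      have A1: "D -` B \<inter> space first_stage \<in> sets first_stage" using measurable_sets[OF D B] .
      have ind: "indicator ?A ((d, z), J) = (indicator (D -` B \<inter> space first_stage) d :: ennreal)"
        if "d \<in> space first_stage" "z \<in> space (second_stage d)" "J \<in> space ?U" for d z J
      proof -
        have "((d, z), J) \<in> space \<Omega>"
          using that second_stage_space(2)[OF that(1)] by (simp add: \<Omega> space_pair_measure Tspace)
        then show ?thesis using that by (simp add: indicator_def)
      qed
      have "emeasure \<Omega> ?A = (\<integral>\<^sup>+\<omega>. indicator ?A \<omega> \<partial>\<Omega>)" using A by simp
      also have "\<dots> = (\<integral>\<^sup>+d. \<integral>\<^sup>+z. \<integral>\<^sup>+J. indicator ?A ((d, z), J) \<partial>?U \<partial>second_stage d \<partial>first_stage)"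
        using A by (intro int) auto
      also have "\<dots> = (\<integral>\<^sup>+d. \<integral>\<^sup>+z. \<integral>\<^sup>+J. indicator (D -` B \<inter> space first_stage) d \<partial>?U \<partial>second_stage d \<partial>first_stage)"
        by (intro nn_integral_cong ind)
      also have "\<dots> = (\<integral>\<^sup>+d. indicator (D -` B \<inter> space first_stage) d \<partial>first_stage)"
      proof (rule nn_integral_cong)
        fix d assume d: "d \<in> space first_stage"
        show "(\<integral>\<^sup>+z. \<integral>\<^sup>+J. indicator (D -` B \<inter> space first_stage) d \<partial>?U \<partial>second_stage d)
            = (indicator (D -` B \<inter> space first_stage) d :: ennreal)"
          using U.emeasure_space_1 prob_space.emeasure_space_1[OF prob2[OF d]] by simp
      qed
      finally show ?thesis using A1 by simp
    qed
    have "measure \<Omega> E \<le> measure \<Omega> {\<omega> \<in> space \<Omega>. nn_cond_exp \<Omega> \<sigma>D (\<lambda>\<omega>. ennreal (err \<omega>)) \<omega> \<le> ennreal c}"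
    proof (rule nn_cond_exp_le_prob[OF \<Omega>.prob_space_axioms sub True E])
      fix A assume A: "A \<in> sets \<sigma>D" "A \<subseteq> E"
      then obtain B where B: "B \<in> sets R" "A = (\<lambda>((d, z), J). D d) -` B \<inter> space \<Omega>"
        using measurable_space[OF fstm] unfolding \<sigma>D_def by (subst (asm) sets_vimage_algebra2) (auto simp: Pi_iff)
      have AM: "A \<in> sets \<Omega>" using A(1) sub by (auto simp: subalgebra_def)
      let ?A1 = "D -` B \<inter> space first_stage"
      have A1: "?A1 \<in> sets first_stage" using measurable_sets[OF D B(1)] .
      have sp: "((d, z), J) \<in> space \<Omega>" if "d \<in> space first_stage" "z \<in> space (second_stage d)" "J \<in> space ?U" for d z J
        using that second_stage_space(2)[OF that(1)] by (simp add: \<Omega> space_pair_measure Tspace)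
      have "(\<integral>\<^sup>+\<omega>. ennreal (err \<omega>) * indicator A \<omega> \<partial>\<Omega>)
         = (\<integral>\<^sup>+d. \<integral>\<^sup>+z. \<integral>\<^sup>+J. ennreal (err ((d, z), J)) * indicator A ((d, z), J) \<partial>?U \<partial>second_stage d \<partial>first_stage)"
        using True AM by (intro int) auto
      also have "\<dots> \<le> (\<integral>\<^sup>+d. ennreal c * indicator ?A1 d \<partial>first_stage)"
      proof (rule nn_integral_mono)
        fix d assume d: "d \<in> space first_stage"
        have "(\<integral>\<^sup>+z. \<integral>\<^sup>+J. ennreal (err ((d, z), J)) * indicator A ((d, z), J) \<partial>?U \<partial>second_stage d)
           = (\<integral>\<^sup>+z. \<integral>\<^sup>+J. ennreal (err ((d, z), J)) * indicator ?A1 d \<partial>?U \<partial>second_stage d)"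
          using sp[OF d] d by (intro nn_integral_cong) (auto simp: B(2) indicator_def)
        also have "\<dots> \<le> ennreal c * indicator ?A1 d"
        proof (cases "d \<in> ?A1")
          case True
          \<comment> \<open>\<open>A \<subseteq> E\<close> concerns points of the whole experiment,
            so \<open>d\<close> is completed by an arbitrary second stage and arbitrary
            indices.\<close>
          have DG: "D d \<in> G"
          proof -
            obtain z where z: "z \<in> space (second_stage d)" using prob_space.not_empty[OF prob2[OF d]] by blast
            obtain J where J: "J \<in> space ?U" using U.not_empty by blast
            have "((d, z), J) \<in> A" using sp[OF d z J] True by (simp add: B(2))
            then show ?thesis using A(2) by (auto simp: E_def)
          qed
          have "(\<integral>\<^sup>+z. \<integral>\<^sup>+J. ennreal (err ((d, z), J)) * indicator ?A1 d \<partial>?U \<partial>second_stage d)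
             = (\<integral>\<^sup>+z. ennreal (index_avg {1..k} n (\<lambda>J. err ((d, z), J))) \<partial>second_stage d)"
            using True nn_integral_PiM_uniform[of "{1..k}" n "\<lambda>J. err ((d, _), J)"] n err
            by (intro nn_integral_cong) (simp add: nn_integral_PiM_uniform)
          then show ?thesis using le[OF d DG] True by simp
        qed simp
        finally show "(\<integral>\<^sup>+z. \<integral>\<^sup>+J. ennreal (err ((d, z), J)) * indicator A ((d, z), J) \<partial>?U \<partial>second_stage d)
          \<le> ennreal c * indicator ?A1 d" .
      qed
      also have "\<dots> = ennreal c * emeasure first_stage ?A1" using A1 by (rule nn_integral_cmult_indicator)
      also have "\<dots> = ennreal c * emeasure \<Omega> A" unfolding B(2) by (simp add: marg[OF B(1)])
      finally show "(\<integral>\<^sup>+\<omega>. ennreal (err \<omega>) * indicator A \<omega> \<partial>\<Omega>) \<le> ennreal c * emeasure \<Omega> A" .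
    qed simp
    moreover have "1 - \<delta> \<le> measure \<Omega> E"
      using G(2) \<delta> unfolding marg[OF G(1), folded E_def, symmetric] \<Omega>.emeasure_eq_measure by simp
    ultimately show ?thesis by linarith
  qed
qed

end

section \<open>Population operators\<close>

lemma rkhs_kernel_section:
  assumes H: "rkhs_on A K evl" and m: "m \<in> A"
  shows "a \<in> A \<Longrightarrow> evl (kernel_section A K evl m) a = K m a"
    and "evl f m = f \<bullet> kernel_section A K evl m"
proof -
  obtain k where k: "\<forall>a\<in>A. evl k a = K m a" "\<forall>f. evl f m = f \<bullet> k"
    using H m unfolding rkhs_on_def by blast
  have "kernel_section A K evl m = k"
    unfolding kernel_section_def
  proof (rule the_equality)
    show "\<forall>a\<in>A. evl k a = K m a" by (rule k(1))
    fix k' assume "\<forall>a\<in>A. evl k' a = K m a"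
    then have "\<forall>a\<in>A. evl k' a = evl k a" using k(1) by simp
    then show "k' = k" using H unfolding rkhs_on_def by blast
  qed
  then show "a \<in> A \<Longrightarrow> evl (kernel_section A K evl m) a = K m a"
    "evl f m = f \<bullet> kernel_section A K evl m" using k by auto
qed

lemma rkhs_inner_sections:
  assumes "rkhs_on A K evl" "m \<in> A" "m' \<in> A"
  shows "kernel_section A K evl m \<bullet> kernel_section A K evl m' = K m m'"
  using rkhs_kernel_section(1)[OF assms(1,2,3)] rkhs_kernel_section(2)[OF assms(1,3), of "kernel_section A K evl m"]
  by simp

text \<open>\<open>is_L2\<close> speaks of inner products only. The defect of linearity is
  orthogonal to every class, hence to itself.\<close>

lemma L2_cls_linear:
  assumes L2: "is_L2 M cls" and f: "square_integrable M f" and g: "square_integrable M g"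
    and h: "square_integrable M h" and eq: "\<And>x. x \<in> space M \<Longrightarrow> h x = a * f x + b * g x"
  shows "cls h = a *\<^sub>R cls f + b *\<^sub>R cls g"
proof -
  note inner = L2[unfolded is_L2_def, THEN conjunct1, rule_format]
  have int: "integrable M (\<lambda>x. p x * q x)" if "square_integrable M p" "square_integrable M q" for p q
  proof (rule Bochner_Integration.integrable_bound[of M "\<lambda>x. (p x)^2 + (q x)^2"])
    show "integrable M (\<lambda>x. (p x)^2 + (q x)^2)" using that by (auto simp: square_integrable_def)
    show "(\<lambda>x. p x * q x) \<in> borel_measurable M" using that by (auto simp: square_integrable_def)
    have "\<bar>u * v\<bar> \<le> u^2 + v^2" for u v :: real
    proof -
      have "2 * (\<bar>u\<bar> * \<bar>v\<bar>) \<le> u^2 + v^2"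
        using zero_le_power2[of "\<bar>u\<bar> - \<bar>v\<bar>"] by (simp add: power2_diff)
      moreover have "0 \<le> \<bar>u\<bar> * \<bar>v\<bar>" by simp
      ultimately show ?thesis unfolding abs_mult by linarith
    qed
    then show "AE x in M. norm (p x * q x) \<le> norm ((p x)^2 + (q x)^2)" by (intro AE_I2) simp
  qed
  have lin: "cls h \<bullet> cls q = a * (cls f \<bullet> cls q) + b * (cls g \<bullet> cls q)" if q: "square_integrable M q" for q
  proof -
    have "(\<integral>x. h x * q x \<partial>M) = (\<integral>x. a * (f x * q x) + b * (g x * q x) \<partial>M)"
      by (intro Bochner_Integration.integral_cong) (auto simp: eq algebra_simps)
    then show ?thesis using int[OF f q] int[OF g q] by (simp add: inner f g h q)
  qed
  let ?d = "cls h - (a *\<^sub>R cls f + b *\<^sub>R cls g)"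
  have "?d \<bullet> cls q = 0" if "square_integrable M q" for q
    using lin[OF that] by (simp add: inner_simps)
  then have "?d \<bullet> ?d = 0" using f g h unfolding inner_diff_right inner_add_right inner_scaleR_right by simp
  then show ?thesis by simp
qed

text \<open>Continuity of the kernel sections on \<open>P\<close>, which makes evaluations
  measurable, is derived from the Hoelder condition when the theorem instantiates this
  locale.\<close>

locale population =
  fixes P :: "'g::{second_countable_topology,real_normed_vector} set" and K :: "'g \<Rightarrow> 'g \<Rightarrow> real"
    and evK :: "'h::{real_inner,banach} \<Rightarrow> 'g \<Rightarrow> real"
    and Y :: "real set" and \<rho> :: "('g \<times> real) measure"
    and cls :: "('g \<Rightarrow> real) \<Rightarrow> 'l::{real_inner,banach}" and \<kappa> :: real
  assumes HK: "rkhs_on P K evK"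
    and \<rho>_prob: "prob_space \<rho>"
    and \<rho>_sets: "sets \<rho> = sets (restrict_space borel P \<Otimes>\<^sub>M restrict_space borel Y)"
    and L2: "is_L2 (distr \<rho> (restrict_space borel P) fst) cls"
    and K_le: "m \<in> P \<Longrightarrow> K m m \<le> \<kappa>^2" and \<kappa>: "\<kappa> \<ge> 0"
    and Ks_continuous: "continuous_on P (kernel_section P K evK)"
begin

definition Ks :: "'g \<Rightarrow> 'h" where "Ks = kernel_section P K evK"
definition \<rho>\<mu> :: "'g measure" where "\<rho>\<mu> = distr \<rho> (restrict_space borel P) fst"
definition S :: "'h \<Rightarrow> 'l" where "S = inclusion cls evK"

lemma evK: "m \<in> P \<Longrightarrow> evK f m = f \<bullet> Ks m"
  unfolding Ks_def by (rule rkhs_kernel_section(2)[OF HK])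

lemma norm_Ks: "m \<in> P \<Longrightarrow> norm (Ks m) \<le> \<kappa>"
proof -
  assume m: "m \<in> P"
  have "(norm (Ks m))^2 \<le> \<kappa>^2"
    using rkhs_inner_sections[OF HK m m] K_le[OF m] by (simp add: Ks_def power2_norm_eq_inner)
  then show ?thesis by (rule power2_le_imp_le[OF _ \<kappa>])
qed

lemma inner_Ks_le: "m \<in> P \<Longrightarrow> \<bar>f \<bullet> Ks m\<bar> \<le> \<kappa> * norm f"
  using Cauchy_Schwarz_ineq2[of f "Ks m"] mult_left_mono[OF norm_Ks, of m "norm f"] by (simp add: mult.commute)

lemma space_\<rho>: "space \<rho> = P \<times> Y"
  using sets_eq_imp_space_eq[OF \<rho>_sets] by (simp add: space_pair_measure space_restrict_space)

lemma fst_\<rho>: "fst \<in> \<rho> \<rightarrow>\<^sub>M restrict_space borel P"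
  by (subst measurable_cong_sets[OF \<rho>_sets refl]) (rule measurable_fst)

lemma snd_\<rho>: "snd \<in> borel_measurable \<rho>"
proof -
  have "snd \<in> \<rho> \<rightarrow>\<^sub>M restrict_space borel Y"
    by (subst measurable_cong_sets[OF \<rho>_sets refl]) (rule measurable_snd)
  then show ?thesis by (rule measurable_restrict_space2_iff[THEN iffD1, THEN conjunct1])
qed

sublocale \<rho>: prob_space \<rho> by (rule \<rho>_prob)
sublocale \<rho>\<mu>: prob_space \<rho>\<mu> unfolding \<rho>\<mu>_def by (rule \<rho>.prob_space_distr[OF fst_\<rho>])

lemma space_\<rho>\<mu>: "space \<rho>\<mu> = P" and sets_\<rho>\<mu>: "sets \<rho>\<mu> = sets (restrict_space borel P)"
  by (simp_all add: \<rho>\<mu>_def space_restrict_space)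

lemma eval_measurable: "(\<lambda>m. f \<bullet> Ks m) \<in> borel_measurable (restrict_space borel P)"
  by (intro borel_measurable_continuous_on_restrict continuous_intros Ks_continuous[folded Ks_def])

lemma eval_measurable_\<rho>: "(\<lambda>p. f \<bullet> Ks (fst p)) \<in> borel_measurable \<rho>"
  by (rule measurable_compose[OF fst_\<rho> eval_measurable])

text \<open>\<open>'h\<close> need not be second countable, so measurability in the pair is deduced
  from continuity on \<open>P \<times> P\<close>; second countability of \<open>'g\<close>
  identifies the product of the Borel algebras with the Borel algebra of the product.\<close>

lemma kernel_measurable:
  assumes T: "continuous_on UNIV T"
  shows "(\<lambda>(m, m'). T (Ks m) \<bullet> T (Ks m')) \<in> borel_measurable (restrict_space borel P \<Otimes>\<^sub>M restrict_space borel P)"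
proof -
  have "(\<lambda>p. p) \<in> restrict_space borel P \<Otimes>\<^sub>M restrict_space borel P \<rightarrow>\<^sub>M (borel :: ('g \<times> 'g) measure)"
    unfolding borel_prod[symmetric]
    by (rule measurable_pair) (auto intro!: measurable_compose[OF measurable_fst] measurable_compose[OF measurable_snd] measurable_restrict_space1 simp: o_def)
  then have id: "(\<lambda>p. p) \<in> restrict_space borel P \<Otimes>\<^sub>M restrict_space borel P \<rightarrow>\<^sub>M restrict_space borel (P \<times> P)"
    by (intro measurable_restrict_space2) (auto simp: space_pair_measure space_restrict_space)
  have TK: "continuous_on P (\<lambda>m. T (Ks m))"
    using continuous_on_compose2[OF T Ks_continuous[folded Ks_def]] by auto
  have "continuous_on (P \<times> P) (\<lambda>p. T (Ks (fst p)) \<bullet> T (Ks (snd p)))"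
    by (intro continuous_on_inner continuous_on_compose2[OF TK] continuous_on_fst continuous_on_snd continuous_on_id) auto
  from measurable_compose[OF id borel_measurable_continuous_on_restrict[OF this]]
  show ?thesis by (simp add: case_prod_unfold)
qed

lemma square_integrable_bounded:
  assumes "f \<in> borel_measurable \<rho>\<mu>" "\<And>m. m \<in> P \<Longrightarrow> \<bar>f m\<bar> \<le> c"
  shows "square_integrable \<rho>\<mu> f"
  unfolding square_integrable_def
proof
  show "integrable \<rho>\<mu> (\<lambda>x. (f x)^2)"
  proof (rule \<rho>\<mu>.integrable_const_bound)
    show "AE x in \<rho>\<mu>. norm ((f x)^2) \<le> c^2"
      using power_mono[OF assms(2) abs_ge_zero, of _ 2] by (intro AE_I2) (simp add: space_\<rho>\<mu>)
  qed (use assms in measurable)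
qed (rule assms)

lemma square_integrable_evK: "square_integrable \<rho>\<mu> (evK f)"
proof (rule square_integrable_bounded)
  show "evK f \<in> borel_measurable \<rho>\<mu>"
    using eval_measurable[of f] by (subst measurable_cong[where g = "\<lambda>m. f \<bullet> Ks m"])
      (auto simp: space_\<rho>\<mu> evK measurable_cong_sets[OF sets_\<rho>\<mu> refl])
  show "\<bar>evK f m\<bar> \<le> \<kappa> * norm f" if "m \<in> P" for m using inner_Ks_le[OF that] evK[OF that] by simp
qed

lemma inner_cls:
  "square_integrable \<rho>\<mu> f \<Longrightarrow> square_integrable \<rho>\<mu> g \<Longrightarrow> cls f \<bullet> cls g = (\<integral>m. f m * g m \<partial>\<rho>\<mu>)"
  using L2 unfolding is_L2_def \<rho>\<mu>_def by blast

lemma inner_S_cls: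
  assumes "square_integrable \<rho>\<mu> q" shows "S f \<bullet> cls q = (\<integral>m. (f \<bullet> Ks m) * q m \<partial>\<rho>\<mu>)"
  unfolding S_def inclusion_def inner_cls[OF square_integrable_evK assms]
  by (intro Bochner_Integration.integral_cong) (auto simp: space_\<rho>\<mu> evK)

lemma inner_S: "S f \<bullet> S g = (\<integral>m. (f \<bullet> Ks m) * (g \<bullet> Ks m) \<partial>\<rho>\<mu>)"
proof -
  have "S f \<bullet> S g = (\<integral>m. (f \<bullet> Ks m) * evK g m \<partial>\<rho>\<mu>)"
    using inner_S_cls[OF square_integrable_evK[of g], of f] by (simp add: S_def inclusion_def)
  also have "\<dots> = (\<integral>m. (f \<bullet> Ks m) * (g \<bullet> Ks m) \<partial>\<rho>\<mu>)"
    by (intro Bochner_Integration.integral_cong) (auto simp: space_\<rho>\<mu> evK)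
  finally show ?thesis .
qed

lemma integral_\<rho>\<mu>:
  fixes f :: "'g \<Rightarrow> real"
  shows "f \<in> borel_measurable (restrict_space borel P) \<Longrightarrow> (\<integral>m. f m \<partial>\<rho>\<mu>) = (\<integral>p. f (fst p) \<partial>\<rho>)"
  unfolding \<rho>\<mu>_def by (rule integral_distr[OF fst_\<rho>])

lemma inner_S_\<rho>: "S f \<bullet> S g = (\<integral>p. (f \<bullet> Ks (fst p)) * (g \<bullet> Ks (fst p)) \<partial>\<rho>)"
  unfolding inner_S by (intro integral_\<rho>\<mu> borel_measurable_times eval_measurable)

lemma integrable_eval_mult: "integrable \<rho>\<mu> (\<lambda>m. (f \<bullet> Ks m) * (g \<bullet> Ks m))"
proof (rule \<rho>\<mu>.integrable_const_bound)
  show "AE m in \<rho>\<mu>. norm ((f \<bullet> Ks m) * (g \<bullet> Ks m)) \<le> (\<kappa> * norm f) * (\<kappa> * norm g)"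
    using inner_Ks_le \<kappa> by (intro AE_I2) (auto simp: space_\<rho>\<mu> abs_mult intro!: mult_mono)
  show "(\<lambda>m. (f \<bullet> Ks m) * (g \<bullet> Ks m)) \<in> borel_measurable \<rho>\<mu>"
    unfolding measurable_cong_sets[OF sets_\<rho>\<mu> refl] by (intro borel_measurable_times eval_measurable)
qed

lemma norm_S: "norm (S f) \<le> \<kappa> * norm f"
proof -
  have "(norm (S f))^2 = (\<integral>m. (f \<bullet> Ks m) * (f \<bullet> Ks m) \<partial>\<rho>\<mu>)" by (simp add: power2_norm_eq_inner inner_S)
  also have "\<dots> \<le> (\<integral>m. (\<kappa> * norm f)^2 \<partial>\<rho>\<mu>)"
  proof (rule integral_mono[OF integrable_eval_mult])
    fix m assume "m \<in> space \<rho>\<mu>"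
    then show "(f \<bullet> Ks m) * (f \<bullet> Ks m) \<le> (\<kappa> * norm f)^2"
      using power_mono[OF inner_Ks_le[of m f] abs_ge_zero, of 2] by (simp add: space_\<rho>\<mu> power2_eq_square)
  qed simp
  also have "\<dots> = (\<kappa> * norm f)^2" by (simp add: \<rho>\<mu>.prob_space)
  finally show ?thesis by (rule power2_le_imp_le) (simp add: \<kappa>)
qed

lemma bounded_linear_S: "bounded_linear S"
proof (rule bounded_linear_intro)
  have lin: "evK (a *\<^sub>R f + b *\<^sub>R g) m = a * evK f m + b * evK g m" if "m \<in> P" for a b f g m
    using that by (simp add: evK inner_add_left)
  have "S (a *\<^sub>R f + b *\<^sub>R g) = a *\<^sub>R S f + b *\<^sub>R S g" for a b f g
    unfolding S_def inclusion_def
    by (rule L2_cls_linear[OF L2[folded \<rho>\<mu>_def]]) (auto simp: square_integrable_evK space_\<rho>\<mu> lin)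
  from this[of 1 _ 1] this[of _ _ 0] show "S (f + g) = S f + S g" "S (c *\<^sub>R f) = c *\<^sub>R S f" for f g c
    by simp_all
  show "norm (S f) \<le> norm f * \<kappa>" for f using norm_S[of f] by (simp add: mult.commute)
qed

lemma adjoint_S: "S x \<bullet> y = x \<bullet> adjoint S y"
  by (rule adjoint_works_hilbert[OF bounded_linear_S])

definition LK :: "'l \<Rightarrow> 'l" where "LK = S \<circ> adjoint S"

lemma sum_norm_S_le:
  assumes F: "orthonormal F" "finite F" shows "(\<Sum>b\<in>F. (norm (S b))^2) \<le> \<kappa>^2"
proof -
  have "(\<Sum>b\<in>F. (norm (S b))^2) = (\<integral>m. (\<Sum>b\<in>F. (b \<bullet> Ks m) * (b \<bullet> Ks m)) \<partial>\<rho>\<mu>)"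
    by (simp add: power2_norm_eq_inner inner_S Bochner_Integration.integral_sum integrable_eval_mult)
  also have "\<dots> \<le> (\<integral>m. \<kappa>^2 \<partial>\<rho>\<mu>)"
  proof (rule integral_mono)
    fix m assume m: "m \<in> space \<rho>\<mu>"
    have "(\<Sum>b\<in>F. (b \<bullet> Ks m) * (b \<bullet> Ks m)) \<le> (norm (Ks m))^2"
      using bessel_finite[OF F, of "Ks m"] by (simp add: power2_eq_square inner_commute)
    also have "\<dots> \<le> \<kappa>^2" using m by (intro power_mono norm_Ks) (auto simp: space_\<rho>\<mu>)
    finally show "(\<Sum>b\<in>F. (b \<bullet> Ks m) * (b \<bullet> Ks m)) \<le> \<kappa>^2" .
  qed (auto intro: Bochner_Integration.integrable_sum integrable_eval_mult)
  also have "\<dots> = \<kappa>^2" by (simp add: \<rho>\<mu>.prob_space)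
  finally show ?thesis .
qed

text \<open>The composition of \<open>S\<close> with its adjoint has the same trace in either order:
  expand in a basis of \<open>'h\<close>, exchange the finite sums and apply Bessel's inequality to
  each \<open>S b\<close>.\<close>

lemma sum_norm_adjoint_le:
  assumes F: "orthonormal F" "finite F" shows "(\<Sum>e\<in>F. (norm (adjoint S e))^2) \<le> \<kappa>^2"
proof -
  obtain C :: "'h set" where C: "orthonormal_basis C" using orthonormal_basis_exists by blast
  have "((\<lambda>b. \<Sum>e\<in>F. (adjoint S e \<bullet> b)^2) has_sum (\<Sum>e\<in>F. (norm (adjoint S e))^2)) C"
    using F(2) by induction (auto intro!: has_sum_add parseval_norm[OF C])
  then show ?thesis
  proof (rule has_sum_le_finite_sums)
    fix G assume G: "finite G" "G \<subseteq> C"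
    have "(\<Sum>b\<in>G. \<Sum>e\<in>F. (adjoint S e \<bullet> b)^2) = (\<Sum>b\<in>G. \<Sum>e\<in>F. (S b \<bullet> e)^2)"
      by (simp add: adjoint_S inner_commute[of "adjoint S _"])
    also have "\<dots> \<le> (\<Sum>b\<in>G. (norm (S b))^2)" by (intro sum_mono bessel_finite F)
    also have "\<dots> \<le> \<kappa>^2"
      by (rule sum_norm_S_le[OF orthonormal_subset[OF orthonormal_basis_orthonormal[OF C] G(2)] G(1)])
    finally show "(\<Sum>b\<in>G. \<Sum>e\<in>F. (adjoint S e \<bullet> b)^2) \<le> \<kappa>^2" .
  qed
qed

lemma LK_inner: "LK x \<bullet> y = adjoint S x \<bullet> adjoint S y"
  by (simp add: LK_def adjoint_S)

text \<open>The very choice that \<open>op_power\<close> makes, so that the powers of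
  \<open>LK\<close> are diagonal in \<open>B\<close>.\<close>

definition B :: "'l set" where "B = (SOME B. eigenbasis LK B)"

sublocale LK: eigen_decomposition LK "\<kappa>^2" B
proof -
  interpret A: positive_trace_class LK "\<kappa>^2"
  proof (rule positive_trace_class.intro)
    show "bounded_linear LK"
      unfolding LK_def comp_def
      by (rule bounded_linear_compose[OF bounded_linear_S bounded_linear_adjoint[OF bounded_linear_S]])
    show "LK x \<bullet> y = x \<bullet> LK y" for x y using LK_inner[of x y] LK_inner[of y x] by (simp add: inner_commute)
    show "LK x \<bullet> x \<ge> 0" for x by (simp add: LK_inner)
    show "(\<Sum>e\<in>F. LK e \<bullet> e) \<le> \<kappa>^2" if "orthonormal F" "finite F" for F
      using sum_norm_adjoint_le[OF that] by (simp add: LK_inner power2_norm_eq_inner)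
  qed
  show "eigen_decomposition LK (\<kappa>^2) B"
    using someI_ex[OF A.eigenbasis_exists] by unfold_locales (simp add: B_def)
qed

abbreviation "\<sigma> \<equiv> LK.eig"

lemma eig_norm: "\<sigma> e = (norm (adjoint S e))^2"
  by (simp add: LK.eig_def LK_inner power2_norm_eq_inner)

lemma S_adjoint_eigen: "e \<in> B \<Longrightarrow> S (adjoint S e) = \<sigma> e *\<^sub>R e"
  using LK.eigenvector by (simp add: LK_def)

section \<open>Singular system of the inclusion\<close>

definition E :: "'l set" where "E = {e \<in> B. \<sigma> e > 0}"
text \<open>The right singular vectors of \<open>S\<close>; \<open>s\<close> gives the squared
  singular values. They need not span the RKHS: the orthogonal complement of \<open>Bh\<close> is
  the kernel of \<open>S\<close>.\<close>

definition vec :: "'l \<Rightarrow> 'h" where "vec e = (1 / sqrt (\<sigma> e)) *\<^sub>R adjoint S e"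
definition Bh :: "'h set" where "Bh = vec ` E"
definition s :: "'h \<Rightarrow> real" where "s b = (norm (S b))^2"

lemma E_B: "e \<in> E \<Longrightarrow> e \<in> B" and E_pos: "e \<in> E \<Longrightarrow> \<sigma> e > 0" by (auto simp: E_def)

lemma S_vec: "e \<in> E \<Longrightarrow> S (vec e) = sqrt (\<sigma> e) *\<^sub>R e"
  using E_pos[of e] by (simp add: vec_def linear_scale[OF bounded_linear.linear[OF bounded_linear_S]] S_adjoint_eigen E_B real_div_sqrt)

lemma s_vec: "e \<in> E \<Longrightarrow> s (vec e) = \<sigma> e"
  using E_pos[of e] orthonormal_norm[OF LK.on E_B] by (simp add: s_def S_vec power_mult_distrib)

lemma inner_vec: "e \<in> E \<Longrightarrow> x \<bullet> vec e = (S x \<bullet> e) / sqrt (\<sigma> e)"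
  by (simp add: vec_def adjoint_S)

lemma vec_orthonormal: "e \<in> E \<Longrightarrow> e' \<in> E \<Longrightarrow> vec e \<bullet> vec e' = (if e = e' then 1 else 0)"
  using LK.on E_pos[of e] E_B unfolding inner_vec by (auto simp: S_vec orthonormal_def)

lemma inj_vec: "inj_on vec E"
  using vec_orthonormal by (intro inj_onI) (metis zero_neq_one)

lemma Bh_orthonormal: "orthonormal Bh"
  unfolding orthonormal_def Bh_def using vec_orthonormal inj_vec by (auto simp: inj_on_eq_iff)

text \<open>Summable eigenvalues are positive for countably many eigenvectors only. Countability is
  what allows limit theorems for integrals along \<open>Bh\<close>.\<close>

lemma Bh_countable: "countable Bh"
proof -
  have "countable {e \<in> B. \<sigma> e \<noteq> 0}"
    using LK.eig_summable by (rule summable_countable_real)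
  then have "countable E" by (rule countable_subset[rotated]) (auto simp: E_def)
  then show ?thesis by (simp add: Bh_def)
qed

lemma s_pos: "b \<in> Bh \<Longrightarrow> s b > 0" using s_vec E_pos by (auto simp: Bh_def)

lemma s_le: "b \<in> Bh \<Longrightarrow> s b \<le> \<kappa>^2" using s_vec E_B LK.eig_le by (auto simp: Bh_def)

lemma adjoint_S_S: "b \<in> Bh \<Longrightarrow> adjoint S (S b) = s b *\<^sub>R b"
proof -
  assume "b \<in> Bh"
  then obtain e where e: "e \<in> E" "b = vec e" by (auto simp: Bh_def)
  have "adjoint S (S b) = sqrt (\<sigma> e) *\<^sub>R adjoint S e"
    using bounded_linear.linear[OF bounded_linear_adjoint[OF bounded_linear_S]] by (simp add: e S_vec linear_scale)
  also have "\<dots> = \<sigma> e *\<^sub>R b"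
    using E_pos[OF e(1)] by (simp add: e(2) vec_def real_div_sqrt)
  also have "\<sigma> e = s b" by (simp add: e s_vec)
  finally show ?thesis .
qed

lemma inner_S_Bh: "b \<in> Bh \<Longrightarrow> S x \<bullet> S b = s b * (x \<bullet> b)"
  by (simp add: adjoint_S adjoint_S_S)

text \<open>Parseval in \<open>B\<close>; eigenvectors with \<open>\<sigma> e = 0\<close> contribute
  nothing, because then \<open>adjoint S e = 0\<close>.\<close>

lemma norm_S_has_sum: "((\<lambda>b. s b * (x \<bullet> b)^2) has_sum (norm (S x))\<^sup>2) Bh"
proof -
  have "((\<lambda>e. (S x \<bullet> e)^2) has_sum (norm (S x))\<^sup>2) B" by (rule parseval_norm[OF LK.basis])
  then have "((\<lambda>e. (S x \<bullet> e)^2) has_sum (norm (S x))\<^sup>2) E"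
  proof (rule has_sum_cong_neutral[THEN iffD1, rotated -1])
    fix e assume "e \<in> B - E"
    then have "\<sigma> e = 0" using LK.eig_nonneg[of e] by (auto simp: E_def)
    then have "adjoint S e = 0" by (simp add: eig_norm)
    then show "(S x \<bullet> e)^2 = 0" by (simp add: adjoint_S)
  qed (auto simp: E_def)
  then have "((\<lambda>e. s (vec e) * (x \<bullet> vec e)^2) has_sum (norm (S x))\<^sup>2) E"
    by (rule has_sum_cong[THEN iffD1, rotated])
       (use E_pos in \<open>auto simp: s_vec inner_vec power_divide less_imp_le dest!: E_pos\<close>)
  then show ?thesis
    unfolding Bh_def using inj_vec by (simp add: has_sum_reindex o_def)
qed

lemma effective_dim_has_sum:
  assumes l: "l > 0" shows "((\<lambda>b. s b / (s b + l)) has_sum effective_dim LK l) Bh"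
proof -
  have "((\<lambda>e. \<sigma> e / (\<sigma> e + l)) has_sum effective_dim LK l) B"
    using LK.degrees_of_freedom_summable[OF l] by (simp add: LK.effective_dim_eq[OF l])
  then have "((\<lambda>e. \<sigma> e / (\<sigma> e + l)) has_sum effective_dim LK l) E"
    by (rule has_sum_cong_neutral[THEN iffD1, rotated -1])
       (use LK.eig_nonneg in \<open>auto simp: E_def less_le\<close>)
  then have "((\<lambda>e. s (vec e) / (s (vec e) + l)) has_sum effective_dim LK l) E"
    by (rule has_sum_cong[THEN iffD1, rotated]) (simp add: s_vec)
  then show ?thesis unfolding Bh_def using inj_vec by (simp add: has_sum_reindex o_def)
qed

end

section \<open>Source condition\<close>

definition diag :: "'v::{real_inner,banach} set \<Rightarrow> ('v \<Rightarrow> real) \<Rightarrow> 'v \<Rightarrow> 'v" where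
  "diag B c x = (\<Sum>\<^sub>\<infinity>b\<in>B. (c b * (x \<bullet> b)) *\<^sub>R b)"

locale diagonal_operator =
  fixes B :: "'v::{real_inner,banach} set" and c :: "'v \<Rightarrow> real" and C :: real
  assumes B: "orthonormal B" and c: "b \<in> B \<Longrightarrow> \<bar>c b\<bar> \<le> C" and C: "C \<ge> 0"
begin

lemma c_sq: "b \<in> B \<Longrightarrow> (c b)^2 \<le> C^2"
  using power_mono[OF c abs_ge_zero, of b 2] by simp

lemma summable: "(\<lambda>b. (c b * (x \<bullet> b))^2) summable_on B"
proof (rule summable_on_comparison_test[OF summable_on_cmult_left[OF bessel_summable[OF B, of x], of "C^2"]])
  fix b assume "b \<in> B"
  then show "(c b * (x \<bullet> b))^2 \<le> (x \<bullet> b)^2 * C^2"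
    unfolding power_mult_distrib using c_sq by (subst mult.commute) (intro mult_left_mono, auto)
qed simp

lemma coeff: "b \<in> B \<Longrightarrow> diag B c x \<bullet> b = c b * (x \<bullet> b)"
  unfolding diag_def by (rule orthonormal_series_coeff[OF B summable])

lemma inner_has_sum: "((\<lambda>b. c b * ((x \<bullet> b) * (y \<bullet> b))) has_sum (diag B c x \<bullet> y)) B"
  using has_sum_inner_orthonormal_series[OF B summable[of x], of y]
  unfolding diag_def by (simp add: inner_commute[of _ y] mult.assoc)

lemma selfadjoint: "diag B c x \<bullet> y = x \<bullet> diag B c y"
proof -
  have "((\<lambda>b. c b * ((x \<bullet> b) * (y \<bullet> b))) has_sum (diag B c y \<bullet> x)) B"
    using inner_has_sum[of y x] by (simp add: mult.commute)
  then have "diag B c x \<bullet> y = diag B c y \<bullet> x" by (rule has_sum_unique[OF inner_has_sum])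
  then show ?thesis by (simp add: inner_commute)
qed

lemma norm_has_sum: "((\<lambda>b. (c b)^2 * (x \<bullet> b)^2) has_sum (norm (diag B c x))\<^sup>2) B"
  using summable[of x] unfolding diag_def orthonormal_series_norm[OF B summable]
  by (simp add: power_mult_distrib)

lemma norm_le: "norm (diag B c x) \<le> C * norm x"
proof -
  have "(norm (diag B c x))^2 \<le> C^2 * (norm x)^2"
  proof (rule has_sum_le_finite_sums[OF norm_has_sum])
    fix F assume F: "finite F" "F \<subseteq> B"
    have "(\<Sum>b\<in>F. (c b)^2 * (x \<bullet> b)^2) \<le> (\<Sum>b\<in>F. C^2 * (x \<bullet> b)^2)"
      using F c_sq by (intro sum_mono mult_right_mono) auto
    also have "\<dots> = C^2 * (\<Sum>b\<in>F. (x \<bullet> b)^2)" by (simp add: sum_distrib_left)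
    also have "\<dots> \<le> C^2 * (norm x)^2"
      by (intro mult_left_mono bessel_finite orthonormal_subset[OF B] F) auto
    finally show "(\<Sum>b\<in>F. (c b)^2 * (x \<bullet> b)^2) \<le> C^2 * (norm x)^2" .
  qed
  also have "\<dots> = (C * norm x)^2" by (simp add: power_mult_distrib)
  finally show ?thesis by (rule power2_le_imp_le) (simp add: C)
qed

lemma bounded_linear: "bounded_linear (diag B c)"
proof (rule bounded_linear_intro)
  show "diag B c (x + y) = diag B c x + diag B c y" for x y
  proof -
    have "diag B c (x + y) = (\<Sum>\<^sub>\<infinity>b\<in>B. (c b * (x \<bullet> b)) *\<^sub>R b + (c b * (y \<bullet> b)) *\<^sub>R b)"
      unfolding diag_def by (intro infsum_cong) (simp add: inner_add_left distrib_left scaleR_add_left)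
    also have "\<dots> = diag B c x + diag B c y"
      unfolding diag_def by (intro infsum_add orthonormal_series_summable[OF B summable])
    finally show ?thesis .
  qed
  show "diag B c (r *\<^sub>R x) = r *\<^sub>R diag B c x" for r x
    unfolding diag_def using infsum_scaleR_right[of r "\<lambda>b. (c b * (x \<bullet> b)) *\<^sub>R b" B]
    by (simp add: mult.left_commute)
  show "norm (diag B c x) \<le> norm x * C" for x using norm_le[of x] by (simp add: mult.commute)
qed

end

lemma proj_on_eq_diag: "proj_on B = diag B (\<lambda>_. 1)"
  by (simp add: proj_on_def diag_def fun_eq_iff)

text \<open>With \<open>z = a * x / r\<close> this is the \<open>r\<close>-th power of
  \<open>z * exp (- z) \<le> 1\<close>.\<close>

lemma powr_exp_le:
  fixes x r a :: real
  assumes "x > 0" "r > 0" "a > 0"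
  shows "x powr r * exp (- a * x) \<le> (r / a) powr r"
proof -
  have "(a * x / r) * exp (- (a * x / r)) \<le> 1"
  proof -
    have "z * exp (- z) \<le> 1" for z :: real
    proof -
      have "z \<le> exp z" using exp_ge_add_one_self[of z] by linarith
      then have "z * exp (- z) \<le> exp z * exp (- z)" by (rule mult_right_mono) simp
      then show ?thesis by (simp only: exp_minus_inverse)
    qed
    then show ?thesis .
  qed
  then have le: "x * exp (- (a * x / r)) \<le> r / a"
    using assms by (simp add: field_simps)
  have "x powr r * exp (- a * x) = (x * exp (- (a * x / r))) powr r"
    using assms by (simp add: powr_mult exp_powr_real)
  also have "\<dots> \<le> (r / a) powr r" using le assms by (intro powr_mono2) auto
  finally show ?thesis .
qed

context population
begin

lemma diag_Bh: "(\<And>b. b \<in> Bh \<Longrightarrow> \<bar>c b\<bar> \<le> C) \<Longrightarrow> C \<ge> 0 \<Longrightarrow> diagonal_operator Bh c C"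
  by unfold_locales (auto simp: Bh_orthonormal)

interpretation proj: diagonal_operator Bh "\<lambda>_. 1" 1
  by (rule diag_Bh) auto

text \<open>Each \<open>res p\<close> is orthogonal to \<open>Bh\<close>, hence in the kernel of
  \<open>S\<close>, so \<open>res p \<bullet> Ks m = 0\<close> for almost every \<open>m\<close>. A
  countable dense set of \<open>p\<close> gives one null set for all of them; off it, continuity in
  \<open>p\<close> reaches \<open>p = m\<close>, where the equation says that \<open>res m\<close>
  has norm 0.\<close>

lemma proj_Ks_AE: "AE m in \<rho>\<mu>. proj_on Bh (Ks m) = Ks m"
proof -
  define res where "res p = Ks p - proj_on Bh (Ks p)" for p
  obtain D where D: "countable D" "D \<subseteq> P" "P \<subseteq> closure D" using separable by blast
  have perp: "res p \<bullet> b = 0" if "b \<in> Bh" for p b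
    unfolding res_def by (rule proj_on_residual[OF Bh_orthonormal that])
  have S0: "S (res p) = 0" for p
  proof -
    have "((\<lambda>b. s b * (res p \<bullet> b)^2) has_sum 0) Bh"
      by (rule has_sum_0) (simp add: perp)
    then have "(norm (S (res p)))^2 = 0" using has_sum_unique[OF norm_S_has_sum] by blast
    then show ?thesis by simp
  qed
  have "AE m in \<rho>\<mu>. res p \<bullet> Ks m = 0" for p
  proof -
    have "(\<integral>m. (res p \<bullet> Ks m) * (res p \<bullet> Ks m) \<partial>\<rho>\<mu>) = 0" by (simp only: inner_S[symmetric] S0 inner_zero_left)
    then have "AE m in \<rho>\<mu>. (res p \<bullet> Ks m) * (res p \<bullet> Ks m) = 0"
      by (subst (asm) integral_nonneg_eq_0_iff_AE[OF integrable_eval_mult]) auto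
    then show ?thesis by simp
  qed
  then have "AE m in \<rho>\<mu>. \<forall>p\<in>D. res p \<bullet> Ks m = 0"
    using D(1) by (simp add: AE_ball_countable)
  moreover have "AE m in \<rho>\<mu>. m \<in> P" by (rule AE_I2) (simp add: space_\<rho>\<mu>)
  ultimately show ?thesis
  proof eventually_elim
    case (elim m)
    have sym: "res p \<bullet> Ks m = Ks p \<bullet> res m" for p
      by (simp add: res_def proj_on_eq_diag inner_diff_left inner_diff_right proj.selfadjoint)
    have cont: "continuous_on P (\<lambda>p. Ks p \<bullet> res m)"
      by (intro continuous_intros Ks_continuous[folded Ks_def])
    obtain u where u: "\<And>i. u i \<in> D" "u \<longlonglongrightarrow> m"
      using elim(2) D(3) closure_sequential[of m D] by blast
    have "((\<lambda>p. Ks p \<bullet> res m) \<circ> u) \<longlonglongrightarrow> Ks m \<bullet> res m"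
      using cont[unfolded continuous_on_sequentially] u D(2) elim(2) by blast
    moreover have "((\<lambda>p. Ks p \<bullet> res m) \<circ> u) = (\<lambda>_. 0)"
      using elim(1) u(1) sym by (auto simp: fun_eq_iff)
    ultimately have 0: "Ks m \<bullet> res m = 0" by (simp add: LIMSEQ_const_iff)
    have "proj_on Bh (Ks m) \<bullet> res m = 0"
    proof -
      have "((\<lambda>b. (Ks m \<bullet> b) * (res m \<bullet> b)) has_sum (proj_on Bh (Ks m) \<bullet> res m)) Bh"
        using proj.inner_has_sum[of "Ks m" "res m"] by (simp add: proj_on_eq_diag)
      moreover have "((\<lambda>b. (Ks m \<bullet> b) * (res m \<bullet> b)) has_sum 0) Bh" by (rule has_sum_0) (simp add: perp)
      ultimately show ?thesis by (rule has_sum_unique)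
    qed
    with 0 have "res m \<bullet> res m = 0" by (simp add: res_def inner_diff_left)
    then show ?case by (simp add: res_def)
  qed
qed

text \<open>The coefficient of \<open>g\<close> along the left singular vector
  \<open>S b / sqrt (s b)\<close>.\<close>

definition coef :: "'l \<Rightarrow> 'h \<Rightarrow> real" where "coef g b = (g \<bullet> S b) / sqrt (s b)"

lemma coef_vec: "e \<in> E \<Longrightarrow> coef g (vec e) = g \<bullet> e"
  using E_pos[of e] by (simp add: coef_def s_vec S_vec)

lemma coef_summable: "(\<lambda>b. (coef g b)^2) summable_on Bh"
proof -
  have "(\<lambda>e. (g \<bullet> e)^2) summable_on E"
    by (rule bessel_summable) (auto intro: orthonormal_subset[OF LK.on] simp: E_def)
  then have "((\<lambda>b. (coef g b)^2) \<circ> vec) summable_on E"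
    by (rule summable_on_cong[THEN iffD1, rotated]) (simp add: coef_vec)
  then show ?thesis unfolding Bh_def using inj_vec by (simp add: summable_on_reindex)
qed

lemma op_power_coeff:
  assumes r: "r > 0" and e: "e \<in> B" shows "op_power LK r g \<bullet> e = \<sigma> e powr r * (g \<bullet> e)"
proof -
  interpret d: diagonal_operator B "\<lambda>e. \<sigma> e powr r" "(\<kappa>^2) powr r"
    using LK.on LK.eig_nonneg LK.eig_le r by unfold_locales (auto intro!: powr_mono2)
  have "op_power LK r g = diag B (\<lambda>e. \<sigma> e powr r) g"
    unfolding op_power_def diag_def LK.eig_def B_def by simp
  then show ?thesis using d.coeff[OF e] by simp
qed

lemma op_power_diff: "r > 0 \<Longrightarrow> op_power LK r (g - g') = op_power LK r g - op_power LK r g'"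
  by (rule LK.basis_eqI) (simp add: op_power_coeff inner_diff_left algebra_simps)

lemma s_powr_le: "p \<ge> 0 \<Longrightarrow> b \<in> Bh \<Longrightarrow> s b powr p \<le> (\<kappa>^2) powr p"
  using s_pos[of b] s_le[of b] by (intro powr_mono2) auto

end

section \<open>Bias of population gradient descent\<close>

locale source_condition = population P K evK Y \<rho> cls \<kappa>
  for P K evK Y \<rho> and cls :: "('g::{second_countable_topology,real_normed_vector} \<Rightarrow> real) \<Rightarrow> 'l::{real_inner,banach}"
    and \<kappa> + fixes r :: real and w :: 'l
  assumes r: "r \<ge> 1 / 2"
begin

text \<open>Since \<open>S b\<close> has norm \<open>sqrt (s b)\<close>, these coefficients lift
  \<open>op_power LK r w\<close> to the RKHS; \<open>r \<ge> 1/2\<close> keeps the exponent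
  nonnegative and thus the coefficients square summable.\<close>

definition lift_coef :: "'a \<Rightarrow> real" where "lift_coef b = s b powr (r - 1/2) * coef w b"

lemma lift_coef_sq_le: "b \<in> Bh \<Longrightarrow> (lift_coef b)^2 \<le> ((\<kappa>^2) powr (r - 1/2))^2 * (coef w b)^2"
  unfolding lift_coef_def power_mult_distrib using s_powr_le[of "r - 1/2" b] r
  by (intro mult_right_mono power_mono) auto

lemma lift_coef_summable: "(\<lambda>b. (lift_coef b)^2) summable_on Bh"
  by (rule summable_on_comparison_test[OF summable_on_cmult_right[OF coef_summable[of w], of "((\<kappa>^2) powr (r - 1/2))^2"]])
     (auto simp: lift_coef_sq_le)

text \<open>At \<open>t = 0\<close> the step size drops out, so \<open>bias 1 0\<close> can name the
  initial bias although 1 need not be an admissible step size.\<close>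

definition bias :: "real \<Rightarrow> nat \<Rightarrow> 'a" where
  "bias \<eta> t = (\<Sum>\<^sub>\<infinity>b\<in>Bh. ((1 - \<eta> * s b) ^ t * lift_coef b) *\<^sub>R b)"

context
  fixes \<eta> :: real assumes \<eta>: "\<eta> > 0" "\<eta> * \<kappa>^2 \<le> 1"
begin

lemma \<eta>s: "b \<in> Bh \<Longrightarrow> 0 \<le> 1 - \<eta> * s b" "b \<in> Bh \<Longrightarrow> 1 - \<eta> * s b \<le> 1"
proof -
  assume b: "b \<in> Bh"
  have "\<eta> * s b \<le> \<eta> * \<kappa>^2" using \<eta> s_le[OF b] by (intro mult_left_mono) auto
  then show "0 \<le> 1 - \<eta> * s b" using \<eta> by linarith
  show "1 - \<eta> * s b \<le> 1" using \<eta> s_pos[OF b] by simp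
qed

lemma bias_coef_sq_le: "b \<in> Bh \<Longrightarrow> ((1 - \<eta> * s b) ^ t * lift_coef b)^2 \<le> (lift_coef b)^2"
proof -
  assume b: "b \<in> Bh"
  have "((1 - \<eta> * s b) ^ t)^2 \<le> 1" using \<eta>s[OF b] by (intro power_le_one) auto
  then show ?thesis unfolding power_mult_distrib by (rule mult_left_le_one_le[rotated 2]) auto
qed

lemma bias_summable: "(\<lambda>b. ((1 - \<eta> * s b) ^ t * lift_coef b)^2) summable_on Bh"
  by (rule summable_on_comparison_test[OF lift_coef_summable]) (auto simp: bias_coef_sq_le)

lemma bias_coeff: "b \<in> Bh \<Longrightarrow> bias \<eta> t \<bullet> b = (1 - \<eta> * s b) ^ t * lift_coef b"
  unfolding bias_def by (rule orthonormal_series_coeff[OF Bh_orthonormal bias_summable])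

lemma bias_norm: "((\<lambda>b. ((1 - \<eta> * s b) ^ t * lift_coef b)^2) has_sum (norm (bias \<eta> t))\<^sup>2) Bh"
  unfolding bias_def orthonormal_series_norm[OF Bh_orthonormal bias_summable]
  using bias_summable by simp

lemma bias_Suc: "bias \<eta> (Suc t) = bias \<eta> t - \<eta> *\<^sub>R adjoint S (S (bias \<eta> t))"
proof -
  let ?c = "\<lambda>b. (1 - \<eta> * s b) ^ t * lift_coef b"
  have bl: "bounded_linear (\<lambda>x. x - \<eta> *\<^sub>R adjoint S (S x))"
    by (intro bounded_linear_sub bounded_linear_ident bounded_linear_compose[OF bounded_linear_scaleR_right]
        bounded_linear_compose[OF bounded_linear_adjoint[OF bounded_linear_S]] bounded_linear_S)
  have lin: "linear (adjoint S)" "linear S"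
    using bounded_linear_S bounded_linear_adjoint bounded_linear.linear by blast+
  have 1: "((\<lambda>b. ?c b *\<^sub>R b) has_sum bias \<eta> t) Bh"
    unfolding bias_def by (rule has_sum_orthonormal_series[OF Bh_orthonormal bias_summable])
  have "((\<lambda>b. ?c b *\<^sub>R b - \<eta> *\<^sub>R adjoint S (S (?c b *\<^sub>R b))) has_sum (bias \<eta> t - \<eta> *\<^sub>R adjoint S (S (bias \<eta> t)))) Bh"
    by (rule has_sum_bounded_linear[OF bl 1])
  then have "((\<lambda>b. ((1 - \<eta> * s b) ^ Suc t * lift_coef b) *\<^sub>R b) has_sum (bias \<eta> t - \<eta> *\<^sub>R adjoint S (S (bias \<eta> t)))) Bh"
  proof (rule has_sum_cong[THEN iffD1, rotated])
    fix b assume b: "b \<in> Bh"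
    have "?c b *\<^sub>R b - \<eta> *\<^sub>R adjoint S (S (?c b *\<^sub>R b)) = (?c b - \<eta> * (?c b * s b)) *\<^sub>R b"
      by (simp add: linear_scale[OF lin(1)] linear_scale[OF lin(2)] adjoint_S_S[OF b] scaleR_diff_left)
    also have "?c b - \<eta> * (?c b * s b) = (1 - \<eta> * s b) ^ Suc t * lift_coef b" by (simp add: algebra_simps)
    finally show "?c b *\<^sub>R b - \<eta> *\<^sub>R adjoint S (S (?c b *\<^sub>R b)) = ((1 - \<eta> * s b) ^ Suc t * lift_coef b) *\<^sub>R b" .
  qed
  then show ?thesis unfolding bias_def[of \<eta> "Suc t"] by (rule infsumI)
qed

lemma norm_bias_le: "norm (bias \<eta> t) \<le> norm (bias \<eta> 0)"
proof -
  have "(norm (bias \<eta> t))^2 \<le> (norm (bias \<eta> 0))^2"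
    by (rule has_sum_mono[OF bias_norm bias_norm]) (simp add: bias_coef_sq_le)
  then show ?thesis by (rule power2_le_imp_le) simp
qed

lemma S_bias_0: "S (bias \<eta> 0) = op_power LK r w"
proof (rule LK.basis_eqI)
  fix e assume e: "e \<in> B"
  have rp: "r > 0" using r by simp
  show "S (bias \<eta> 0) \<bullet> e = op_power LK r w \<bullet> e"
  proof (cases "e \<in> E")
    case True
    then have pos: "\<sigma> e > 0" by (rule E_pos)
    have "S (bias \<eta> 0) \<bullet> e = sqrt (\<sigma> e) * (bias \<eta> 0 \<bullet> vec e)" using pos True by (simp add: inner_vec)
    also have "bias \<eta> 0 \<bullet> vec e = \<sigma> e powr (r - 1/2) * (w \<bullet> e)"
      using True by (subst bias_coeff) (auto simp: Bh_def lift_coef_def s_vec coef_vec)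
    also have "sqrt (\<sigma> e) * (\<sigma> e powr (r - 1/2) * (w \<bullet> e)) = \<sigma> e powr r * (w \<bullet> e)"
      using pos by (simp add: powr_half_sqrt[symmetric] powr_add[symmetric] mult.assoc[symmetric])
    finally show ?thesis by (simp add: op_power_coeff[OF rp e])
  next
    case False
    then have "\<sigma> e = 0" using e LK.eig_nonneg[of e] by (auto simp: E_def)
    then have "adjoint S e = 0" by (simp add: eig_norm)
    then show ?thesis using \<open>\<sigma> e = 0\<close> by (simp add: adjoint_S op_power_coeff[OF rp e])
  qed
qed

text \<open>In the singular system the factor is
  \<open>s^r * (1 - \<eta> * s)^t \<le> s^r * exp (- \<eta> * t * s)\<close>, which
  \<open>powr_exp_le\<close> bounds uniformly in \<open>s\<close>; the rate does not saturate in
  \<open>r\<close>.\<close>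

lemma norm_S_bias_le:
  assumes t: "t > 0" shows "norm (S (bias \<eta> t)) \<le> (r / (\<eta> * real t)) powr r * norm w"
proof -
  let ?a = "(r / (\<eta> * real t)) powr r"
  have a: "\<eta> * real t > 0" using \<eta> t by simp
  \<comment> \<open>The normalized images \<open>S b / sqrt (s b)\<close> are orthonormal, so this
    is Bessel's inequality for \<open>w\<close>.\<close>
  have coefw: "(\<Sum>b\<in>F. (coef w b)^2) \<le> (norm w)^2" if F: "finite F" "F \<subseteq> Bh" for F
  proof -
    have onS: "orthonormal ((\<lambda>b. (1 / sqrt (s b)) *\<^sub>R S b) ` F)" and inj: "inj_on (\<lambda>b. (1 / sqrt (s b)) *\<^sub>R S b) F"
    proof -
      have ip: "((1 / sqrt (s b)) *\<^sub>R S b) \<bullet> ((1 / sqrt (s b')) *\<^sub>R S b') = (if b = b' then 1 else 0)"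
        if "b \<in> F" "b' \<in> F" for b b'
      proof -
        have b: "b \<in> Bh" "b' \<in> Bh" using that F(2) by auto
        have "((1 / sqrt (s b)) *\<^sub>R S b) \<bullet> ((1 / sqrt (s b')) *\<^sub>R S b') = s b' * (b \<bullet> b') / (sqrt (s b) * sqrt (s b'))"
          using b by (simp add: inner_S_Bh)
        also have "\<dots> = (if b = b' then 1 else 0)"
          using b Bh_orthonormal s_pos[OF b(2)] by (auto simp: orthonormal_def real_sqrt_mult[symmetric])
        finally show ?thesis .
      qed
      show inj: "inj_on (\<lambda>b. (1 / sqrt (s b)) *\<^sub>R S b) F"
      proof (rule inj_onI, rule ccontr)
        fix b b' assume b: "b \<in> F" "b' \<in> F" "(1 / sqrt (s b)) *\<^sub>R S b = (1 / sqrt (s b')) *\<^sub>R S b'" "b \<noteq> b'"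
        show False using ip[OF b(1,2)] ip[OF b(2,2)] b(4) unfolding b(3) by simp
      qed
      show "orthonormal ((\<lambda>b. (1 / sqrt (s b)) *\<^sub>R S b) ` F)"
        unfolding orthonormal_def
      proof (intro ballI, elim imageE)
        fix e f b b' assume b: "e = (1 / sqrt (s b)) *\<^sub>R S b" "b \<in> F" "f = (1 / sqrt (s b')) *\<^sub>R S b'" "b' \<in> F"
        show "e \<bullet> f = (if e = f then 1 else 0)"
          unfolding b(1,3) ip[OF b(2,4)] using inj_on_eq_iff[OF inj b(2,4)] by simp
      qed
    qed
    have "(\<Sum>b\<in>F. (coef w b)^2) = (\<Sum>e\<in>(\<lambda>b. (1 / sqrt (s b)) *\<^sub>R S b) ` F. (w \<bullet> e)^2)"
      by (simp add: sum.reindex[OF inj] coef_def)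
    also have "\<dots> \<le> (norm w)^2" using F by (intro bessel_finite[OF onS]) auto
    finally show ?thesis .
  qed
  have bnd: "s b * (bias \<eta> t \<bullet> b)^2 \<le> ?a^2 * (coef w b)^2" if b: "b \<in> Bh" for b
  proof -
    have sp: "s b > 0" by (rule s_pos[OF b])
    have "s b * (bias \<eta> t \<bullet> b)^2 = (s b powr r * (1 - \<eta> * s b) ^ t)^2 * (coef w b)^2"
    proof -
      have "s b * (s b powr (r - 1/2))^2 = (s b powr r)^2"
        using sp by (simp add: powr_power powr_add[symmetric] powr_mult_base algebra_simps)
      then show ?thesis by (simp add: bias_coeff[OF b] lift_coef_def power_mult_distrib mult_ac)
    qed
    also have "s b powr r * (1 - \<eta> * s b) ^ t \<le> ?a"
    proof -
      have "(1 - \<eta> * s b) ^ t \<le> exp (- (\<eta> * s b)) ^ t"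
        using exp_ge_add_one_self[of "- (\<eta> * s b)"] \<eta>s[OF b] by (intro power_mono) auto
      also have "\<dots> = exp (- (\<eta> * real t) * s b)" by (simp add: exp_of_nat_mult[symmetric] mult_ac)
      finally have "s b powr r * (1 - \<eta> * s b) ^ t \<le> s b powr r * exp (- (\<eta> * real t) * s b)"
        by (intro mult_left_mono) auto
      also have "\<dots> \<le> ?a" using powr_exp_le[OF sp _ a, of r] r by simp
      finally show ?thesis .
    qed
    then have "(s b powr r * (1 - \<eta> * s b) ^ t)^2 * (coef w b)^2 \<le> ?a^2 * (coef w b)^2"
      using \<eta>s[OF b] by (intro mult_right_mono power_mono) auto
    finally show ?thesis .
  qed
  have "(norm (S (bias \<eta> t)))^2 \<le> ?a^2 * (norm w)^2"
  proof (rule has_sum_le_finite_sums[OF norm_S_has_sum])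
    fix F assume F: "finite F" "F \<subseteq> Bh"
    have "(\<Sum>b\<in>F. s b * (bias \<eta> t \<bullet> b)^2) \<le> (\<Sum>b\<in>F. ?a^2 * (coef w b)^2)"
      using F by (intro sum_mono bnd) auto
    also have "\<dots> = ?a^2 * (\<Sum>b\<in>F. (coef w b)^2)" by (simp add: sum_distrib_left)
    also have "\<dots> \<le> ?a^2 * (norm w)^2" by (intro mult_left_mono coefw F) auto
    finally show "(\<Sum>b\<in>F. s b * (bias \<eta> t \<bullet> b)^2) \<le> ?a^2 * (norm w)^2" .
  qed
  also have "\<dots> = (?a * norm w)^2" by (simp add: power_mult_distrib)
  finally show ?thesis by (rule power2_le_imp_le) simp
qed

end

text \<open>Finitely many coefficients carry all but \<open>\<epsilon>/2\<close> of the squared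
  norm; for each of them the powers of \<open>1 - \<eta> * s b\<close> sum to at most
  \<open>1 / (\<eta> * s b)\<close>. At \<open>r = 1/2\<close> nothing but square summability is
  known of the coefficients, hence no rate.\<close>

lemma bias_average_small:
  assumes \<epsilon>: "\<epsilon> > 0"
  obtains C where "C \<ge> 0" "\<And>\<eta> T. \<eta> > 0 \<Longrightarrow> \<eta> * \<kappa>^2 \<le> 1 \<Longrightarrow> T > 0 \<Longrightarrow>
    (\<Sum>t\<le>T. (norm (bias \<eta> t))^2) / real T \<le> \<epsilon> + C / (\<eta> * real T)"
proof -
  obtain A where A: "((\<lambda>b. (lift_coef b)^2) has_sum A) Bh"
    using lift_coef_summable by (auto simp: summable_on_def)
  obtain F where F: "finite F" "F \<subseteq> Bh" "dist (\<Sum>b\<in>F. (lift_coef b)^2) A \<le> \<epsilon> / 2"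
    using has_sum_finite_approximation[OF A, of "\<epsilon>/2"] \<epsilon> by auto
  define C where "C = (\<Sum>b\<in>F. (lift_coef b)^2 / s b)"
  have C: "C \<ge> 0" unfolding C_def using F s_pos by (intro sum_nonneg divide_nonneg_nonneg) (auto intro: less_imp_le)
  show thesis
  proof (rule that[OF C])
    fix \<eta> :: real and T :: nat assume \<eta>: "\<eta> > 0" "\<eta> * \<kappa>^2 \<le> 1" and T: "T > 0"
    let ?v = "\<lambda>t b. ((1 - \<eta> * s b) ^ t * lift_coef b)^2"
    have split: "(norm (bias \<eta> t))^2 \<le> (\<Sum>b\<in>F. ?v t b) + \<epsilon> / 2" for t
    proof (rule has_sum_le_finite_sums[OF bias_norm[OF \<eta>]])
      fix G assume G: "finite G" "G \<subseteq> Bh"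
      have "(\<Sum>b\<in>G. ?v t b) \<le> (\<Sum>b\<in>F \<union> (G - F). ?v t b)" using F G by (intro sum_mono2) auto
      also have "\<dots> = (\<Sum>b\<in>F. ?v t b) + (\<Sum>b\<in>G - F. ?v t b)" using F G by (intro sum.union_disjoint) auto
      also have "(\<Sum>b\<in>G - F. ?v t b) \<le> (\<Sum>b\<in>G - F. (lift_coef b)^2)"
        using G by (intro sum_mono bias_coef_sq_le[OF \<eta>]) auto
      also have "\<dots> = (\<Sum>b\<in>F \<union> (G - F). (lift_coef b)^2) - (\<Sum>b\<in>F. (lift_coef b)^2)"
        using F G by (subst sum.union_disjoint) auto
      also have "(\<Sum>b\<in>F \<union> (G - F). (lift_coef b)^2) \<le> A"
        by (rule finite_sum_le_has_sum[OF A]) (use F G in auto)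
      also have "A - (\<Sum>b\<in>F. (lift_coef b)^2) \<le> \<epsilon> / 2" using F(3) unfolding dist_real_def by linarith
      finally show "(\<Sum>b\<in>G. ?v t b) \<le> (\<Sum>b\<in>F. ?v t b) + \<epsilon> / 2" by simp
    qed
    have geo: "(\<Sum>t\<le>T. ?v t b) \<le> (lift_coef b)^2 / s b / \<eta>" if b: "b \<in> F" for b
    proof -
      have bB: "b \<in> Bh" using b F by blast
      let ?x = "1 - \<eta> * s b"
      have x: "0 \<le> ?x" "?x \<le> 1" "\<eta> * s b > 0" using \<eta>s[OF \<eta> bB] s_pos[OF bB] \<eta> by auto
      have "(\<Sum>t\<le>T. ?v t b) = (\<Sum>t\<le>T. (?x ^ t)^2) * (lift_coef b)^2" by (simp add: power_mult_distrib sum_distrib_right)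
      also have "(\<Sum>t\<le>T. (?x ^ t)^2) \<le> (\<Sum>t\<le>T. ?x ^ t)"
      proof (rule sum_mono)
        fix t
        have "?x ^ t * ?x ^ t \<le> ?x ^ t * 1" using x by (intro mult_left_mono power_le_one) auto
        then show "(?x ^ t)^2 \<le> ?x ^ t" by (simp add: power2_eq_square)
      qed
      also have "\<dots> \<le> 1 / (\<eta> * s b)"
      proof -
        have "(\<eta> * s b) * (\<Sum>t\<le>T. ?x ^ t) = 1 - ?x ^ Suc T"
          using sum_gp_basic[of ?x T] by simp
        also have "\<dots> \<le> 1" using x by simp
        finally show ?thesis using x(3) by (simp add: pos_le_divide_eq mult.commute)
      qed
      finally show ?thesis by (simp add: mult_right_mono mult.commute)
    qed
    have "(\<Sum>t\<le>T. (norm (bias \<eta> t))^2) \<le> (\<Sum>t\<le>T. (\<Sum>b\<in>F. ?v t b) + \<epsilon> / 2)" by (intro sum_mono split)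
    also have "\<dots> = (\<Sum>b\<in>F. \<Sum>t\<le>T. ?v t b) + (real T + 1) * (\<epsilon> / 2)"
      by (subst sum.swap) (simp add: sum.distrib add.commute)
    also have "\<dots> \<le> (\<Sum>b\<in>F. (lift_coef b)^2 / s b / \<eta>) + (2 * real T) * (\<epsilon> / 2)"
      using T \<epsilon> by (intro add_mono sum_mono geo mult_right_mono) auto
    also have "\<dots> = C / \<eta> + real T * \<epsilon>" by (simp add: C_def sum_divide_distrib)
    finally have "(\<Sum>t\<le>T. (norm (bias \<eta> t))^2) / real T \<le> (C / \<eta> + real T * \<epsilon>) / real T"
      by (rule divide_right_mono) simp
    also have "\<dots> = \<epsilon> + C / (\<eta> * real T)" using T by (simp add: add_divide_distrib)
    finally show "(\<Sum>t\<le>T. (norm (bias \<eta> t))^2) / real T \<le> \<epsilon> + C / (\<eta> * real T)" .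
  qed
qed

end

section \<open>First-stage sampling events\<close>

context population
begin

text \<open>Increasing finite subsets, to pass from \<open>has_sum\<close> to sequential limits. The
  intersection guards against the default value of \<open>from_nat_into\<close> when
  \<open>Bh\<close> is empty.\<close>

definition exhaustion :: "nat \<Rightarrow> 'h set" where
  "exhaustion k = from_nat_into Bh ` {..<k} \<inter> Bh"

lemma exhaustion_finite: "finite (exhaustion k)" and exhaustion_sub: "exhaustion k \<subseteq> Bh"
  by (auto simp: exhaustion_def)

lemma exhaustion_eventually:
  assumes "finite F" "F \<subseteq> Bh" shows "\<exists>k0. \<forall>k\<ge>k0. F \<subseteq> exhaustion k"
  using assms
proof induction
  case (insert b F)
  then obtain k0 where k0: "\<forall>k\<ge>k0. F \<subseteq> exhaustion k" by auto
  obtain i where i: "from_nat_into Bh i = b"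
    using from_nat_into_surj[OF Bh_countable, of b] insert by auto
  have "b \<in> exhaustion k" if "k \<ge> Suc i" for k
  proof -
    have "i \<in> {..<k}" using that by simp
    then show ?thesis using i insert.prems unfolding exhaustion_def by blast
  qed
  then have "\<forall>k\<ge>max k0 (Suc i). insert b F \<subseteq> exhaustion k" using k0 by simp
  then show ?case by blast
qed simp

lemma exhaustion_sums:
  fixes f :: "'h \<Rightarrow> real"
  assumes f: "(f has_sum x) Bh"
  shows "(\<lambda>k. \<Sum>b\<in>exhaustion k. f b) \<longlonglongrightarrow> x"
proof -
  have "filterlim exhaustion (finite_subsets_at_top Bh) sequentially"
    unfolding filterlim_finite_subsets_at_top
    using exhaustion_finite exhaustion_sub exhaustion_eventually by (auto simp: eventually_sequentially)
  with f show ?thesis unfolding has_sum_def by (rule filterlim_compose)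
qed

text \<open>Fatou's lemma along the exhaustion; nonnegativity bounds every partial sum of integrals
  by \<open>A\<close>.\<close>

lemma integral_has_sum_le:
  assumes f: "\<And>b m. b \<in> Bh \<Longrightarrow> m \<in> space \<rho>\<mu> \<Longrightarrow> f b m \<ge> 0"
    and int: "\<And>b. b \<in> Bh \<Longrightarrow> integrable \<rho>\<mu> (f b)"
    and sum: "AE m in \<rho>\<mu>. ((\<lambda>b. f b m) has_sum F m) Bh" and F: "F \<in> borel_measurable \<rho>\<mu>"
    and le: "((\<lambda>b. \<integral>m. f b m \<partial>\<rho>\<mu>) has_sum A) Bh"
  shows "(\<integral>\<^sup>+m. ennreal (F m) \<partial>\<rho>\<mu>) \<le> ennreal A"
proof -
  have lim: "AE m in \<rho>\<mu>. (\<lambda>k. \<Sum>b\<in>exhaustion k. f b m) \<longlonglongrightarrow> F m"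
    using sum by eventually_elim (rule exhaustion_sums)
  have "(\<integral>\<^sup>+m. ennreal (F m) \<partial>\<rho>\<mu>) = (\<integral>\<^sup>+m. liminf (\<lambda>k. ennreal (\<Sum>b\<in>exhaustion k. f b m)) \<partial>\<rho>\<mu>)"
  proof (rule nn_integral_cong_AE)
    show "AE m in \<rho>\<mu>. ennreal (F m) = liminf (\<lambda>k. ennreal (\<Sum>b\<in>exhaustion k. f b m))"
      using lim
    proof eventually_elim
      case (elim m)
      then have "(\<lambda>k. ennreal (\<Sum>b\<in>exhaustion k. f b m)) \<longlonglongrightarrow> ennreal (F m)" by (rule tendsto_ennrealI)
      then show ?case by (intro lim_imp_Liminf[symmetric]) auto
    qed
  qed
  also have "\<dots> \<le> liminf (\<lambda>k. \<integral>\<^sup>+m. ennreal (\<Sum>b\<in>exhaustion k. f b m) \<partial>\<rho>\<mu>)"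
    using int exhaustion_sub
    by (intro nn_integral_liminf measurable_compose[OF _ measurable_ennreal] borel_measurable_sum borel_measurable_integrable) blast
  also have "\<dots> \<le> liminf (\<lambda>k. ennreal A)"
  proof (rule Liminf_mono, rule always_eventually, rule allI)
    fix k
    have "(\<integral>\<^sup>+m. ennreal (\<Sum>b\<in>exhaustion k. f b m) \<partial>\<rho>\<mu>) = ennreal (\<integral>m. (\<Sum>b\<in>exhaustion k. f b m) \<partial>\<rho>\<mu>)"
      using int exhaustion_sub
      by (intro nn_integral_eq_integral Bochner_Integration.integrable_sum AE_I2 sum_nonneg f) auto
    also have "(\<integral>m. (\<Sum>b\<in>exhaustion k. f b m) \<partial>\<rho>\<mu>) = (\<Sum>b\<in>exhaustion k. \<integral>m. f b m \<partial>\<rho>\<mu>)"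
      using int exhaustion_sub by (intro Bochner_Integration.integral_sum) auto
    also have "\<dots> \<le> A"
      using f exhaustion_sub
      by (intro finite_sum_le_has_sum[OF le] exhaustion_finite exhaustion_sub integral_nonneg_AE AE_I2) auto
    finally show "(\<integral>\<^sup>+m. ennreal (\<Sum>b\<in>exhaustion k. f b m) \<partial>\<rho>\<mu>) \<le> ennreal A" by (simp add: ennreal_leI)
  qed
  also have "\<dots> = ennreal A" by (simp add: Liminf_const)
  finally show ?thesis .
qed

lemma integral_eval_sq: "b \<in> Bh \<Longrightarrow> (\<integral>m. (b \<bullet> Ks m)^2 \<partial>\<rho>\<mu>) = s b"
  unfolding s_def power2_norm_eq_inner inner_S by (simp add: power2_eq_square)

lemma integrable_eval_sq: "integrable \<rho>\<mu> (\<lambda>m. (f \<bullet> Ks m)^2)"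
  using integrable_eval_mult[of f f] by (simp add: power2_eq_square)

text \<open>\<open>\<parallel>T l x\<parallel>\<close> is the norm dual to \<open>(\<parallel>S q\<parallel>\<^sup>2 + l \<parallel>q\<parallel>\<^sup>2)\<^bsup>1/2\<^esup>\<close>.\<close>

definition T :: "real \<Rightarrow> 'h \<Rightarrow> 'h" where "T l = diag Bh (\<lambda>b. 1 / sqrt (s b + l))"
text \<open>Inverse to \<open>T l\<close> on the closed span of \<open>Bh\<close> and zero on its
  complement.\<close>

definition U :: "real \<Rightarrow> 'h \<Rightarrow> 'h" where "U l = diag Bh (\<lambda>b. sqrt (s b + l))"

context
  fixes l :: real assumes l: "l > 0"
begin

interpretation T: diagonal_operator Bh "\<lambda>b. 1 / sqrt (s b + l)" "1 / sqrt l"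
  using l s_pos by (intro diag_Bh) (auto simp: frac_le less_imp_le)

interpretation U: diagonal_operator Bh "\<lambda>b. sqrt (s b + l)" "sqrt (\<kappa>^2 + l)"
  using l s_pos s_le by (intro diag_Bh) (auto simp: less_imp_le add_nonneg_nonneg)

lemma T_selfadjoint: "T l x \<bullet> y = x \<bullet> T l y" unfolding T_def by (rule T.selfadjoint)

lemma T_bounded_linear: "bounded_linear (T l)" unfolding T_def by (rule T.bounded_linear)

lemma T_norm_le: "norm (T l x) \<le> norm x / sqrt l" using T.norm_le[of x] unfolding T_def by simp

lemma U_norm_le: "(norm (U l q))^2 \<le> (norm (S q))^2 + l * (norm q)^2"
proof (rule has_sum_le_finite_sums[OF U.norm_has_sum[of q, folded U_def]])
  fix F assume F: "finite F" "F \<subseteq> Bh"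
  have "(\<Sum>b\<in>F. (sqrt (s b + l))^2 * (q \<bullet> b)^2) = (\<Sum>b\<in>F. s b * (q \<bullet> b)^2) + l * (\<Sum>b\<in>F. (q \<bullet> b)^2)"
    using F l s_pos by (simp add: sum_distrib_left sum.distrib[symmetric] distrib_right less_imp_le add_nonneg_nonneg subset_eq cong: sum.cong)
  also have "(\<Sum>b\<in>F. s b * (q \<bullet> b)^2) \<le> (norm (S q))^2"
    by (rule finite_sum_le_has_sum[OF norm_S_has_sum F]) (use s_pos in \<open>auto intro!: mult_nonneg_nonneg intro: less_imp_le\<close>)
  also have "l * (\<Sum>b\<in>F. (q \<bullet> b)^2) \<le> l * (norm q)^2"
    using l by (intro mult_left_mono bessel_finite orthonormal_subset[OF Bh_orthonormal] F) auto
  finally show "(\<Sum>b\<in>F. (sqrt (s b + l))^2 * (q \<bullet> b)^2) \<le> (norm (S q))^2 + l * (norm q)^2" by simp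
qed

text \<open>For \<open>x\<close> in the closed span of \<open>Bh\<close>,
  \<open>x \<bullet> q = T l x \<bullet> U l q\<close>, and Cauchy-Schwarz applies. A component of
  \<open>x\<close> in the kernel of \<open>S\<close> would be invisible to
  \<open>T l\<close>.\<close>

lemma inner_le_T:
  assumes x: "proj_on Bh x = x"
  shows "x \<bullet> q \<le> norm (T l x) * sqrt ((norm (S q))^2 + l * (norm q)^2)"
proof -
  have sp: "s b + l > 0" if "b \<in> Bh" for b using s_pos[OF that] l by simp
  have "((\<lambda>b. 1 / sqrt (s b + l) * ((x \<bullet> b) * (U l q \<bullet> b))) has_sum (T l x \<bullet> U l q)) Bh"
    unfolding T_def by (rule T.inner_has_sum)
  then have "((\<lambda>b. (x \<bullet> b) * (q \<bullet> b)) has_sum (T l x \<bullet> U l q)) Bh"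
    by (rule has_sum_cong[THEN iffD1, rotated]) (use sp in \<open>simp add: U_def U.coeff less_imp_neq[symmetric]\<close>)
  moreover have "((\<lambda>b. (x \<bullet> b) * (q \<bullet> b)) has_sum (proj_on Bh x \<bullet> q)) Bh"
  proof -
    interpret proj: diagonal_operator Bh "\<lambda>_. 1" 1 by (rule diag_Bh) auto
    show ?thesis using proj.inner_has_sum[of x q] by (simp add: proj_on_eq_diag)
  qed
  ultimately have "x \<bullet> q = T l x \<bullet> U l q" using has_sum_unique x by metis
  also have "\<dots> \<le> norm (T l x) * norm (U l q)" by (rule norm_cauchy_schwarz)
  also have "\<dots> \<le> norm (T l x) * sqrt ((norm (S q))^2 + l * (norm q)^2)"
    using U_norm_le by (intro mult_left_mono real_le_rsqrt) auto
  finally show ?thesis .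
qed

lemma TKs_norm_has_sum: "((\<lambda>b. (b \<bullet> Ks m)^2 / (s b + l)) has_sum (norm (T l (Ks m)))\<^sup>2) Bh"
  using T.norm_has_sum[of "Ks m"] unfolding T_def
  by (rule has_sum_cong[THEN iffD1, rotated])
     (use s_pos l in \<open>simp add: power_divide inner_commute add_nonneg_nonneg less_imp_le\<close>)

lemma TKs_norm_le: "m \<in> P \<Longrightarrow> (norm (T l (Ks m)))^2 \<le> \<kappa>^2 / l"
proof -
  assume m: "m \<in> P"
  have "norm (T l (Ks m)) \<le> \<kappa> / sqrt l"
    using T_norm_le[of "Ks m"] divide_right_mono[OF norm_Ks[OF m], of "sqrt l"] l by simp
  then have "(norm (T l (Ks m)))^2 \<le> (\<kappa> / sqrt l)^2" by (rule power_mono) simp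
  then show ?thesis using l by (simp add: power_divide)
qed

lemma TKs_kernel_measurable:
  "(\<lambda>(p, p'). T l (Ks (fst p)) \<bullet> T l (Ks (fst p'))) \<in> borel_measurable (\<rho> \<Otimes>\<^sub>M \<rho>)"
proof -
  have c: "continuous_on UNIV (T l)"
    using T_bounded_linear linear_continuous_on by blast
  have m: "(\<lambda>(p, p'). (fst p, fst p')) \<in> \<rho> \<Otimes>\<^sub>M \<rho> \<rightarrow>\<^sub>M restrict_space borel P \<Otimes>\<^sub>M restrict_space borel P"
    using fst_\<rho> by measurable
  from measurable_compose[OF m kernel_measurable[OF c]] show ?thesis by (simp add: case_prod_unfold)
qed

lemma TKs_norm_measurable: "(\<lambda>p. (norm (T l (Ks (fst p))))^2) \<in> borel_measurable \<rho>"
proof -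
  have "(\<lambda>p. (p, p)) \<in> \<rho> \<rightarrow>\<^sub>M \<rho> \<Otimes>\<^sub>M \<rho>" by measurable
  from measurable_compose[OF this TKs_kernel_measurable] show ?thesis by (simp add: power2_norm_eq_inner)
qed

text \<open>The mean of \<open>(b \<bullet> Ks m)^2 / (s b + l)\<close> is
  \<open>s b / (s b + l)\<close>; its sum over \<open>b\<close> is how the effective dimension
  enters the probability estimates.\<close>

lemma TKs_integral_le:
  "integrable \<rho> (\<lambda>p. (norm (T l (Ks (fst p))))^2)"
  "(\<integral>p. (norm (T l (Ks (fst p))))^2 \<partial>\<rho>) \<le> effective_dim LK l"
proof -
  show int: "integrable \<rho> (\<lambda>p. (norm (T l (Ks (fst p))))^2)"
    by (rule \<rho>.integrable_const_bound[OF AE_I2 TKs_norm_measurable, of "\<kappa>^2 / l"])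
       (auto simp: space_\<rho> TKs_norm_le)
  have meas: "(\<lambda>m. (norm (T l (Ks m)))^2) \<in> borel_measurable \<rho>\<mu>"
  proof -
    have c: "continuous_on P (\<lambda>m. (norm (T l (Ks m)))^2)"
      using T_bounded_linear linear_continuous_on
      by (intro continuous_intros continuous_on_compose2[of UNIV "T l", OF _ Ks_continuous[folded Ks_def]]) auto
    show ?thesis unfolding measurable_cong_sets[OF sets_\<rho>\<mu> refl] by (rule borel_measurable_continuous_on_restrict[OF c])
  qed
  have sb: "(\<integral>m. (b \<bullet> Ks m)^2 / (s b + l) \<partial>\<rho>\<mu>) = s b / (s b + l)" if "b \<in> Bh" for b
    using integral_eval_sq[OF that] by simp
  have "(\<integral>\<^sup>+m. ennreal ((norm (T l (Ks m)))^2) \<partial>\<rho>\<mu>) \<le> ennreal (effective_dim LK l)"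
  proof (rule integral_has_sum_le[where f = "\<lambda>b m. (b \<bullet> Ks m)^2 / (s b + l)"])
    show "0 \<le> (b \<bullet> Ks m)^2 / (s b + l)" if "b \<in> Bh" for b m using s_pos[OF that] l by simp
    show "AE m in \<rho>\<mu>. ((\<lambda>b. (b \<bullet> Ks m)^2 / (s b + l)) has_sum (norm (T l (Ks m)))\<^sup>2) Bh"
      by (rule AE_I2) (rule TKs_norm_has_sum)
    show "((\<lambda>b. \<integral>m. (b \<bullet> Ks m)^2 / (s b + l) \<partial>\<rho>\<mu>) has_sum effective_dim LK l) Bh"
      by (rule has_sum_cong[THEN iffD2, OF sb effective_dim_has_sum[OF l]])
  qed (use meas integrable_eval_sq in auto)
  moreover have "(\<integral>\<^sup>+m. ennreal ((norm (T l (Ks m)))^2) \<partial>\<rho>\<mu>) = (\<integral>\<^sup>+p. ennreal ((norm (T l (Ks (fst p))))^2) \<partial>\<rho>)"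
    unfolding \<rho>\<mu>_def
    by (rule nn_integral_distr[OF fst_\<rho>]) (use meas in \<open>simp add: measurable_cong_sets[OF sets_\<rho>\<mu> refl]\<close>)
  moreover have "(\<integral>\<^sup>+p. ennreal ((norm (T l (Ks (fst p))))^2) \<partial>\<rho>) = ennreal (\<integral>p. (norm (T l (Ks (fst p))))^2 \<partial>\<rho>)"
    by (rule nn_integral_eq_integral[OF int]) simp
  moreover have "effective_dim LK l \<ge> 0"
    using s_pos l by (intro has_sum_nonneg[OF effective_dim_has_sum[OF l]]) (auto simp: less_imp_le)
  ultimately show "(\<integral>p. (norm (T l (Ks (fst p))))^2 \<partial>\<rho>) \<le> effective_dim LK l" by simp
qed

text \<open>\<open>z\<close> is the mean in the weak sense and \<open>t\<close> a normalization. Two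
  instances are used: the sampling noise, where \<open>a\<close> is the residual and
  \<open>z = 0\<close>, and the covariance fluctuation along a vector, where \<open>a\<close> is its
  evaluation.\<close>

lemma centered_TKs:
  fixes a :: "'g \<times> real \<Rightarrow> real" and z :: 'h and c t :: real
  assumes a: "a \<in> borel_measurable \<rho>" "\<And>p. p \<in> space \<rho> \<Longrightarrow> \<bar>a p\<bar> \<le> c" and t: "t \<ge> 0"
    and z: "\<And>h. (\<integral>p. a p * (h \<bullet> Ks (fst p)) \<partial>\<rho>) = h \<bullet> z"
  shows "centered_vectors \<rho> (\<lambda>p. t *\<^sub>R T l (a p *\<^sub>R Ks (fst p) - z))
     (t * (c * \<kappa> + norm z) / sqrt l) (t^2 * (c^2 * effective_dim LK l))"
proof -
  have Tlin: "linear (T l)" using T_bounded_linear by (rule bounded_linear.linear)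
  define X where "X p = t *\<^sub>R T l (a p *\<^sub>R Ks (fst p) - z)" for p
  have X: "X p = t *\<^sub>R (a p *\<^sub>R T l (Ks (fst p)) - T l z)" for p
    by (simp add: X_def linear_diff[OF Tlin] linear_scale[OF Tlin])
  have inner: "v \<bullet> X p = t * (a p * (T l v \<bullet> Ks (fst p)) - T l v \<bullet> z)" for v p
    by (simp add: X inner_diff_right T_selfadjoint)
  have meas_in: "(\<lambda>p. v \<bullet> X p) \<in> borel_measurable \<rho>" for v
    unfolding inner by (intro borel_measurable_times borel_measurable_diff borel_measurable_const a eval_measurable_\<rho>)
  have c0: "c \<ge> 0" using a(2) \<rho>.not_empty by (meson abs_ge_zero all_not_in_conv order_trans)
  have ia: "integrable \<rho> (\<lambda>p. a p * (h \<bullet> Ks (fst p)))" for h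
  proof (rule \<rho>.integrable_const_bound[OF AE_I2])
    fix p assume "p \<in> space \<rho>"
    then show "norm (a p * (h \<bullet> Ks (fst p))) \<le> c * (\<kappa> * norm h)"
      using a(2) inner_Ks_le[of "fst p" h] c0 by (auto simp: abs_mult space_\<rho> intro!: mult_mono)
  qed (intro borel_measurable_times a eval_measurable_\<rho>)
  have nX: "norm (X p) \<le> t * (c * \<kappa> + norm z) / sqrt l" if p: "p \<in> space \<rho>" for p
  proof -
    have "norm (a p *\<^sub>R Ks (fst p) - z) \<le> norm (a p *\<^sub>R Ks (fst p)) + norm z" by (rule norm_triangle_ineq4)
    also have "norm (a p *\<^sub>R Ks (fst p)) \<le> c * \<kappa>"
      using a(2)[OF p] norm_Ks[of "fst p"] p c0 by (auto simp: space_\<rho> intro!: mult_mono)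
    finally have "norm (T l (a p *\<^sub>R Ks (fst p) - z)) \<le> (c * \<kappa> + norm z) / sqrt l"
      using T_norm_le[of "a p *\<^sub>R Ks (fst p) - z"] l by (meson divide_right_mono order_trans real_sqrt_ge_zero less_imp_le add_right_mono)
    then have "t * norm (T l (a p *\<^sub>R Ks (fst p) - z)) \<le> t * ((c * \<kappa> + norm z) / sqrt l)"
      using t by (rule mult_left_mono)
    then show ?thesis using t by (simp add: X_def)
  qed
  have "centered_vectors \<rho> X (t * (c * \<kappa> + norm z) / sqrt l) (t^2 * (c^2 * effective_dim LK l))"
  proof (intro centered_vectors.intro centered_vectors_axioms.intro \<rho>_prob meas_in nX)
    show "(\<lambda>(m, m'). X m \<bullet> X m') \<in> borel_measurable (\<rho> \<Otimes>\<^sub>M \<rho>)"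
    proof -
      have eq: "X p \<bullet> X p' = t^2 * (a p * a p' * (T l (Ks (fst p)) \<bullet> T l (Ks (fst p'))) - a p * (T l (T l z) \<bullet> Ks (fst p))
           - a p' * (T l (T l z) \<bullet> Ks (fst p')) + T l z \<bullet> T l z)" for p p'
        unfolding X
        by (simp add: inner_diff_left inner_diff_right power2_eq_square T_selfadjoint[of "T l z"] T_selfadjoint[of _ "T l z"]
            inner_commute[of "Ks _"] algebra_simps)
      have [measurable]: "a \<in> borel_measurable \<rho>" by (rule a)
      have [measurable]: "(\<lambda>p. h \<bullet> Ks (fst p)) \<in> borel_measurable \<rho>" for h by (rule eval_measurable_\<rho>)
      have [measurable]: "(\<lambda>q. T l (Ks (fst (fst q))) \<bullet> T l (Ks (fst (snd q)))) \<in> borel_measurable (\<rho> \<Otimes>\<^sub>M \<rho>)"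
        using TKs_kernel_measurable by (simp add: case_prod_unfold)
      have [measurable]: "(\<lambda>q. h \<bullet> Ks (fst (fst q))) \<in> borel_measurable (\<rho> \<Otimes>\<^sub>M \<rho>)"
        "(\<lambda>q. h \<bullet> Ks (fst (snd q))) \<in> borel_measurable (\<rho> \<Otimes>\<^sub>M \<rho>)" for h
        using measurable_compose[OF measurable_fst eval_measurable_\<rho>[of h]] measurable_compose[OF measurable_snd eval_measurable_\<rho>[of h]]
        by simp_all
      show ?thesis unfolding eq case_prod_unfold by measurable
    qed
    show "(\<integral>p. v \<bullet> X p \<partial>\<rho>) = 0" for v
      unfolding inner using ia by (simp add: z \<rho>.prob_space)
    have "(\<integral>p. (norm (X p))^2 \<partial>\<rho>) = (\<integral>p. t^2 * ((a p)^2 * (norm (T l (Ks (fst p))))^2 - 2 * (a p * (T l (T l z) \<bullet> Ks (fst p))) + (norm (T l z))^2) \<partial>\<rho>)"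
      by (intro Bochner_Integration.integral_cong refl)
         (simp add: X power2_norm_eq_inner inner_diff_left inner_diff_right T_selfadjoint[of "T l z"]
            inner_commute[of "T l (Ks _)" "T l z"] power2_eq_square[of t] power2_eq_square[of "a _"] algebra_simps)
    also have "\<dots> = t^2 * ((\<integral>p. (a p)^2 * (norm (T l (Ks (fst p))))^2 \<partial>\<rho>) - (norm (T l z))^2)"
    proof -
      have i1: "integrable \<rho> (\<lambda>p. (a p)^2 * (norm (T l (Ks (fst p))))^2)"
      proof (rule \<rho>.integrable_const_bound[OF AE_I2])
        fix p assume p: "p \<in> space \<rho>"
        then have "(a p)^2 \<le> c^2" using power_mono[OF a(2) abs_ge_zero, of p 2] by simp
        then show "norm ((a p)^2 * (norm (T l (Ks (fst p))))^2) \<le> c^2 * (\<kappa>^2 / l)"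
          using mult_mono[OF _ TKs_norm_le[of "fst p"], of "(a p)^2" "c^2"] p by (auto simp: space_\<rho>)
      qed (intro borel_measurable_times borel_measurable_power a TKs_norm_measurable)
      have "T l (T l z) \<bullet> z = (norm (T l z))^2" by (simp add: T_selfadjoint power2_norm_eq_inner)
      then show ?thesis using i1 ia by (simp add: z \<rho>.prob_space)
    qed
    also have "\<dots> \<le> t^2 * (c^2 * effective_dim LK l)"
    proof (intro mult_left_mono)
      have "(\<integral>p. (a p)^2 * (norm (T l (Ks (fst p))))^2 \<partial>\<rho>) \<le> (\<integral>p. c^2 * (norm (T l (Ks (fst p))))^2 \<partial>\<rho>)"
      proof (rule integral_mono_AE')
        show "integrable \<rho> (\<lambda>p. c^2 * (norm (T l (Ks (fst p))))^2)" using TKs_integral_le(1) by simp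
        show "AE p in \<rho>. (a p)^2 * (norm (T l (Ks (fst p))))^2 \<le> c^2 * (norm (T l (Ks (fst p))))^2"
        proof (rule AE_I2)
          fix p assume "p \<in> space \<rho>"
          then have "(a p)^2 \<le> c^2" using power_mono[OF a(2) abs_ge_zero, of p 2] by simp
          then show "(a p)^2 * (norm (T l (Ks (fst p))))^2 \<le> c^2 * (norm (T l (Ks (fst p))))^2"
            by (intro mult_right_mono) auto
        qed
      qed simp
      also have "\<dots> \<le> c^2 * effective_dim LK l" using TKs_integral_le(2) by (simp add: mult_left_mono)
      finally show "(\<integral>p. (a p)^2 * (norm (T l (Ks (fst p))))^2 \<partial>\<rho>) - (norm (T l z))^2 \<le> c^2 * effective_dim LK l"
        using zero_le_power2[of "norm (T l z)"] by linarith
    qed simp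
    finally show "(\<integral>p. (norm (X p))^2 \<partial>\<rho>) \<le> t^2 * (c^2 * effective_dim LK l)" .
  qed
  then show ?thesis by (simp add: X_def[abs_def])
qed

end

end

lemma markov_event:
  assumes F: "F \<in> borel_measurable M" and le: "(\<integral>\<^sup>+\<omega>. ennreal (F \<omega>) \<partial>M) \<le> ennreal e" and c: "c > 0"
  shows "\<exists>A\<in>sets M. emeasure M (space M - A) \<le> ennreal (e / c) \<and> (\<forall>\<omega>\<in>A. F \<omega> \<le> c)"
proof (intro bexI conjI ballI)
  let ?A = "{\<omega> \<in> space M. F \<omega> < c}"
  show "?A \<in> sets M" using F by measurable
  have "emeasure M (space M - ?A) \<le> emeasure M {\<omega> \<in> space M. ennreal (1 / c) * ennreal (F \<omega>) \<ge> 1}"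
  proof (rule emeasure_mono)
    show "space M - ?A \<subseteq> {\<omega> \<in> space M. 1 \<le> ennreal (1 / c) * ennreal (F \<omega>)}"
    proof
      fix \<omega> assume \<omega>: "\<omega> \<in> space M - ?A"
      then have "c \<le> F \<omega>" by auto
      then have "1 \<le> 1 / c * F \<omega>" using c by simp
      then have "ennreal 1 \<le> ennreal (1 / c * F \<omega>)" by (rule ennreal_leI)
      then show "\<omega> \<in> {\<omega> \<in> space M. 1 \<le> ennreal (1 / c) * ennreal (F \<omega>)}"
        using \<omega> c by (simp only: ennreal_mult' ennreal_1 mem_Collect_eq divide_nonneg_pos zero_le_one simp_thms Diff_iff)
    qed
  qed (use F in measurable)
  also have "\<dots> \<le> ennreal (1 / c) * (\<integral>\<^sup>+\<omega>. ennreal (F \<omega>) \<partial>M)"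
    using nn_integral_Markov_inequality[of "\<lambda>\<omega>. ennreal (F \<omega>)" "space M" M "ennreal (1 / c)"] F
    by (simp cong: nn_integral_cong)
  also have "\<dots> \<le> ennreal (1 / c) * ennreal e" by (intro mult_left_mono le) simp
  also have "\<dots> = ennreal (e / c)" using c by (simp add: ennreal_mult'[symmetric])
  finally show "emeasure M (space M - ?A) \<le> ennreal (e / c)" .
qed auto

context population
begin

abbreviation sample :: "nat \<Rightarrow> (nat \<Rightarrow> 'g \<times> real) measure" where
  "sample n \<equiv> \<Pi>\<^sub>M j\<in>{1..n}. \<rho>"

text \<open>Some measurable event with small complement implies \<open>Q\<close>; in this form
  \<open>Q\<close> itself need not be shown measurable.\<close>

abbreviation likely :: "nat \<Rightarrow> ennreal \<Rightarrow> ((nat \<Rightarrow> 'g \<times> real) \<Rightarrow> bool) \<Rightarrow> bool" where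
  "likely n p Q \<equiv> \<exists>A\<in>sets (sample n). emeasure (sample n) (space (sample n) - A) \<le> p \<and> (\<forall>\<omega>\<in>A. Q \<omega>)"

abbreviation emp_cov :: "nat \<Rightarrow> (nat \<Rightarrow> 'g \<times> real) \<Rightarrow> 'h \<Rightarrow> 'h" where
  "emp_cov n \<omega> v \<equiv> (1 / real n) *\<^sub>R (\<Sum>j=1..n. (v \<bullet> Ks (fst (\<omega> j))) *\<^sub>R Ks (fst (\<omega> j)))"

abbreviation emp_residual :: "nat \<Rightarrow> (nat \<Rightarrow> 'g \<times> real) \<Rightarrow> 'h \<Rightarrow> 'h" where
  "emp_residual n \<omega> f \<equiv> (1 / real n) *\<^sub>R (\<Sum>j=1..n. (snd (\<omega> j) - f \<bullet> Ks (fst (\<omega> j))) *\<^sub>R Ks (fst (\<omega> j)))"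

lemma prob_space_PiM_\<rho>: "prob_space (\<Pi>\<^sub>M j\<in>{1..n}. \<rho>)"
  by (intro prob_space_PiM \<rho>_prob)

context
  fixes l V :: real and n :: nat
  assumes l: "l > 0" and n: "n > 0" and V: "effective_dim LK l \<le> V" "V > 0"
begin

lemma noise_event:
  fixes f :: 'h
  assumes \<delta>: "\<delta> > 0" and Mf: "Mf > 0" "\<And>p. p \<in> space \<rho> \<Longrightarrow> \<bar>snd p - f \<bullet> Ks (fst p)\<bar> \<le> Mf"
    and mean: "\<And>h. (\<integral>p. (snd p - f \<bullet> Ks (fst p)) * (h \<bullet> Ks (fst p)) \<partial>\<rho>) = 0"
    and large: "\<kappa>^2 \<le> real n * V * l"
  shows "likely n (ennreal (\<delta> / 3)) (\<lambda>\<omega>. norm (T l (emp_residual n \<omega> f))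
       \<le> Mf * sqrt (V / real n) * (4 + ln (6 / \<delta>)))"
proof -
  \<comment> \<open>With this scaling the summands have total variance at most 1, and norm at most 1
    by \<open>large\<close>; \<open>u = 4 + ln (6 / \<delta>)\<close> then makes the tail bound
    \<open>2 * exp (4 - u) = \<delta> / 3\<close>.\<close>
  define t where "t = 1 / (Mf * sqrt (real n * V))"
  define X where "X p = t *\<^sub>R T l ((snd p - f \<bullet> Ks (fst p)) *\<^sub>R Ks (fst p) - 0)" for p
  define u where "u = 4 + ln (6 / \<delta>)"
  have t: "t > 0" using Mf n V by (simp add: t_def)
  have t2: "t^2 * Mf^2 = 1 / (real n * V)"
    using Mf n V by (simp add: t_def power_divide power_mult_distrib)
  interpret X: centered_vectors \<rho> X "t * (Mf * \<kappa> + norm (0::'h)) / sqrt l" "t^2 * (Mf^2 * effective_dim LK l)"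
    unfolding X_def
    by (rule centered_TKs[OF l _ Mf(2)]) (use t mean in \<open>auto intro!: borel_measurable_diff snd_\<rho> eval_measurable_\<rho>\<close>)
  have b: "t * (Mf * \<kappa> + norm (0::'h)) / sqrt l \<le> 1"
  proof -
    have "t * (Mf * \<kappa> + norm (0::'h)) / sqrt l = \<kappa> / sqrt (real n * V * l)"
      using Mf by (simp add: t_def real_sqrt_mult)
    moreover have "\<kappa> \<le> sqrt (real n * V * l)" using large by (rule real_le_rsqrt)
    ultimately show ?thesis using n V l by simp
  qed
  let ?P = "sample n"
  define A where "A = {\<omega> \<in> space ?P. norm (\<Sum>i=1..n. X (\<omega> i)) < u}"
  have A: "A \<in> sets ?P" unfolding A_def using X.sum_norm_meas[of n] by measurable
  have "space ?P - A = {\<omega> \<in> space ?P. norm (\<Sum>i=1..n. X (\<omega> i)) \<ge> u}" by (auto simp: A_def)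
  then have "emeasure ?P (space ?P - A) \<le> ennreal (2 * exp (4 * real n * (t^2 * (Mf^2 * effective_dim LK l)) - u))"
    using X.sum_tail_bound[OF b, of n u] by simp
  also have "\<dots> \<le> ennreal (\<delta> / 3)"
  proof (rule ennreal_leI)
    have "real n * (t^2 * (Mf^2 * effective_dim LK l)) = real n * ((t^2 * Mf^2) * effective_dim LK l)" by simp
    also have "\<dots> = effective_dim LK l / V" unfolding t2 using n by simp
    also have "\<dots> \<le> 1" using V by simp
    finally have "exp (4 * real n * (t^2 * (Mf^2 * effective_dim LK l)) - u) \<le> exp (- ln (6 / \<delta>))"
      by (simp add: u_def)
    also have "\<dots> = \<delta> / 6" using \<delta> by (simp add: exp_minus)
    finally show "2 * exp (4 * real n * (t^2 * (Mf^2 * effective_dim LK l)) - u) \<le> \<delta> / 3" by simp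
  qed
  finally have prob: "emeasure ?P (space ?P - A) \<le> ennreal (\<delta> / 3)" .
  have "norm (T l (emp_residual n \<omega> f))
       \<le> Mf * sqrt (V / real n) * u" (is "norm (T l (_ *\<^sub>R ?s)) \<le> _") if \<omega>: "\<omega> \<in> A" for \<omega>
  proof -
    have lin: "linear (T l)" using T_bounded_linear[OF l] by (rule bounded_linear.linear)
    have "(\<Sum>i=1..n. X (\<omega> i)) = t *\<^sub>R T l ?s"
      by (simp add: X_def linear_sum[OF lin] scaleR_sum_right)
    then have "t * norm (T l ?s) \<le> u" using \<omega> t by (simp add: A_def)
    then have "norm (T l ?s) \<le> u / t" using t by (simp add: pos_le_divide_eq mult.commute)
    then have "norm (T l ?s) / real n \<le> u / t / real n" by (rule divide_right_mono) simp
    moreover have "u / t / real n = Mf * sqrt (V / real n) * u"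
      using n V by (simp add: t_def real_sqrt_mult real_sqrt_divide field_simps)
    ultimately show ?thesis by (simp add: linear_scale[OF lin])
  qed
  then show ?thesis using A prob unfolding u_def by blast
qed

text \<open>The \<open>v t\<close> are deterministic, so second moments can be summed over time
  before Markov's inequality is applied once; no union bound over the iterations occurs.\<close>

lemma drift_event:
  fixes v :: "nat \<Rightarrow> 'h"
  assumes c: "c > 0"
  shows "likely n (ennreal (\<kappa>^2 * V * (\<Sum>t\<le>k. (norm (v t))^2) / (real n * c))) (\<lambda>\<omega>. (\<Sum>t\<le>k. (norm (T l (adjoint S (S (v t)) - emp_cov n \<omega> (v t))))^2) \<le> c)"
proof -
  let ?P = "sample n"
  define X :: "nat \<Rightarrow> 'g \<times> real \<Rightarrow> 'h" where "X t p = 1 *\<^sub>R T l ((v t \<bullet> Ks (fst p)) *\<^sub>R Ks (fst p) - adjoint S (S (v t)))" for t p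
  have X: "centered_vectors \<rho> (X t) (1 * (\<kappa> * norm (v t) * \<kappa> + norm (adjoint S (S (v t)))) / sqrt l)
     (1\<^sup>2 * ((\<kappa> * norm (v t))^2 * effective_dim LK l))" for t
    unfolding X_def
    by (rule centered_TKs[OF l])
       (auto simp: space_\<rho> inner_Ks_le eval_measurable_\<rho> adjoint_S[symmetric] inner_S_\<rho>[symmetric] inner_commute)
  have Xm [measurable]: "(\<lambda>\<omega>. norm (\<Sum>j=1..n. X t (\<omega> j))) \<in> borel_measurable ?P" for t
    by (rule centered_vectors.sum_norm_meas[OF X])
  define F where "F \<omega> = (\<Sum>t\<le>k. (norm (\<Sum>j=1..n. X t (\<omega> j)))^2)" for \<omega>
  have Fm: "F \<in> borel_measurable ?P"
    unfolding F_def by measurable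
  have "(\<integral>\<^sup>+\<omega>. ennreal (F \<omega>) \<partial>?P) = (\<integral>\<^sup>+\<omega>. (\<Sum>t\<le>k. ennreal ((norm (\<Sum>j=1..n. X t (\<omega> j)))^2)) \<partial>?P)"
    unfolding F_def by (intro nn_integral_cong sum_ennreal[symmetric]) simp
  also have "\<dots> = (\<Sum>t\<le>k. \<integral>\<^sup>+\<omega>. ennreal ((norm (\<Sum>j=1..n. X t (\<omega> j)))^2) \<partial>?P)"
    by (rule nn_integral_sum) measurable
  also have "\<dots> \<le> (\<Sum>t\<le>k. ennreal (real n * (\<kappa>^2 * V * (norm (v t))^2)))"
  proof (rule sum_mono)
    fix t
    have "(\<integral>\<^sup>+\<omega>. ennreal ((norm (\<Sum>j=1..n. X t (\<omega> j)))^2) \<partial>?P) \<le> ennreal (real n * (1\<^sup>2 * ((\<kappa> * norm (v t))^2 * effective_dim LK l)))"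
      by (rule centered_vectors.second_moment_sum[OF X])
    also have "\<dots> \<le> ennreal (real n * (\<kappa>^2 * V * (norm (v t))^2))"
      using V mult_left_mono[of "effective_dim LK l" V "real n * (\<kappa> * norm (v t))^2"]
      by (intro ennreal_leI) (simp add: power_mult_distrib mult_ac)
    finally show "(\<integral>\<^sup>+\<omega>. ennreal ((norm (\<Sum>j=1..n. X t (\<omega> j)))^2) \<partial>?P) \<le> ennreal (real n * (\<kappa>^2 * V * (norm (v t))^2))" .
  qed
  also have "\<dots> = ennreal (real n * (\<kappa>^2 * V * (\<Sum>t\<le>k. (norm (v t))^2)))"
    using V by (subst sum_ennreal) (auto simp: sum_distrib_left)
  finally have F_int: "(\<integral>\<^sup>+\<omega>. ennreal (F \<omega>) \<partial>?P) \<le> ennreal (real n * (\<kappa>^2 * V * (\<Sum>t\<le>k. (norm (v t))^2)))" .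
  have cn: "(real n)^2 * c > 0" using n c by simp
  obtain A where A: "A \<in> sets ?P" "\<And>\<omega>. \<omega> \<in> A \<Longrightarrow> F \<omega> \<le> (real n)^2 * c"
    and A': "emeasure ?P (space ?P - A) \<le> ennreal (real n * (\<kappa>^2 * V * (\<Sum>t\<le>k. (norm (v t))^2)) / ((real n)^2 * c))"
    using markov_event[OF Fm F_int cn] by auto
  have prob: "emeasure ?P (space ?P - A) \<le> ennreal (\<kappa>^2 * V * (\<Sum>t\<le>k. (norm (v t))^2) / (real n * c))"
    using A' n by (simp add: power2_eq_square[of "real n"] mult.assoc)
  have "(\<Sum>t\<le>k. (norm (T l (adjoint S (S (v t)) - emp_cov n \<omega> (v t))))^2) \<le> c"
    if \<omega>: "\<omega> \<in> A" for \<omega>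
  proof -
    have lin: "linear (T l)" using T_bounded_linear[OF l] by (rule bounded_linear.linear)
    have eq: "(norm (T l (adjoint S (S (v t)) - emp_cov n \<omega> (v t))))^2
        = (norm (\<Sum>j=1..n. X t (\<omega> j)))^2 / (real n)^2" for t
    proof -
      have "(\<Sum>j=1..n. X t (\<omega> j)) = T l (\<Sum>j=1..n. (v t \<bullet> Ks (fst (\<omega> j))) *\<^sub>R Ks (fst (\<omega> j)) - adjoint S (S (v t)))"
        unfolding X_def scaleR_one by (rule linear_sum[OF lin, symmetric])
      also have "(\<Sum>j=1..n. (v t \<bullet> Ks (fst (\<omega> j))) *\<^sub>R Ks (fst (\<omega> j)) - adjoint S (S (v t)))
          = - (real n *\<^sub>R (adjoint S (S (v t)) - emp_cov n \<omega> (v t)))"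
        using n by (simp add: sum_subtractf scaleR_diff_right scaleR_conv_of_real[symmetric] sum_constant_scaleR)
      finally show ?thesis using n by (simp add: linear_neg[OF lin] linear_scale[OF lin] power_mult_distrib)
    qed
    have "F \<omega> / (real n)^2 \<le> c" using A(2)[OF \<omega>] n by (simp add: divide_le_eq mult.commute)
    then show ?thesis unfolding eq F_def sum_divide_distrib .
  qed
  then show ?thesis using A(1) prob by blast
qed

interpretation T: diagonal_operator Bh "\<lambda>b. 1 / sqrt (s b + l)" "1 / sqrt l"
  using l s_pos by (intro diag_Bh) (auto simp: frac_le less_imp_le)

text \<open>The part of a kernel section that the comparison in the finitely many directions
  \<open>F\<close> does not see.\<close>

definition residual :: "'h set \<Rightarrow> 'h \<Rightarrow> 'h" where "residual F x = x - (\<Sum>b\<in>F. (x \<bullet> b) *\<^sub>R b)"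

lemma proj_residual:
  assumes F: "finite F" "F \<subseteq> Bh" and x: "proj_on Bh x = x"
  shows "proj_on Bh (residual F x) = residual F x"
proof -
  interpret proj: diagonal_operator Bh "\<lambda>_. 1" 1 by (rule diag_Bh) auto
  have lin: "linear (proj_on Bh)"
    unfolding proj_on_eq_diag by (rule bounded_linear.linear[OF proj.bounded_linear])
  have "proj_on Bh b = b" if "b \<in> Bh" for b
  proof -
    have "((\<lambda>b'. (b \<bullet> b') *\<^sub>R b') has_sum b) Bh"
    proof (rule has_sum_finite_neutralI[of "{b}"])
      show "b = (\<Sum>b'\<in>{b}. (b \<bullet> b') *\<^sub>R b')"
        using Bh_orthonormal that by (simp add: orthonormal_def)
    qed (use Bh_orthonormal that in \<open>auto simp: orthonormal_def\<close>)
    then show ?thesis unfolding proj_on_def by (rule infsumI)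
  qed
  then show ?thesis
    using F x unfolding residual_def
    by (auto simp: linear_diff[OF lin] linear_sum[OF lin] linear_scale[OF lin] intro!: sum.cong)
qed

lemma residual_coeff:
  assumes F: "finite F" "F \<subseteq> Bh" and b: "b \<in> Bh"
  shows "residual F x \<bullet> b = (if b \<in> F then 0 else x \<bullet> b)"
proof -
  have "(\<Sum>b'\<in>F. (x \<bullet> b') * (b' \<bullet> b)) = (\<Sum>b'\<in>F. if b' = b then x \<bullet> b else 0)"
    using Bh_orthonormal F b by (intro sum.cong) (auto simp: orthonormal_def)
  also have "\<dots> = (if b \<in> F then x \<bullet> b else 0)" using F(1) by simp
  finally show ?thesis by (auto simp: residual_def inner_diff_left inner_sum_left)
qed

lemma residual_measurable:
  "(\<lambda>m. (norm (T l (residual F (Ks m))))^2) \<in> borel_measurable (restrict_space borel P)"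
proof -
  have T: "continuous_on UNIV (T l)"
    using T_bounded_linear[OF l] linear_continuous_on by blast
  have "continuous_on P (\<lambda>m. residual F (Ks m))"
    unfolding residual_def by (intro continuous_intros Ks_continuous[folded Ks_def])
  then have "continuous_on P (\<lambda>m. T l (residual F (Ks m)))"
    by (rule continuous_on_compose2[OF T]) simp
  then have "continuous_on P (\<lambda>m. (norm (T l (residual F (Ks m))))^2)"
    by (intro continuous_on_power continuous_on_norm)
  then show ?thesis by (rule borel_measurable_continuous_on_restrict)
qed

text \<open>As for the whole section, but only terms outside \<open>F\<close> survive: the bound is
  a tail of the effective dimension, small for large \<open>F\<close>.\<close>

lemma residual_integral_le:
  assumes F: "finite F" "F \<subseteq> Bh"
  shows "(\<integral>\<^sup>+p. ennreal ((norm (T l (residual F (Ks (fst p)))))^2) \<partial>\<rho>) \<le> ennreal (effective_dim LK l - (\<Sum>b\<in>F. s b / (s b + l)))"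
proof -
  let ?f = "\<lambda>b m. if b \<in> F then 0 else (b \<bullet> Ks m)^2 / (s b + l)"
  have sb: "(\<integral>m. ?f b m \<partial>\<rho>\<mu>) = s b / (s b + l) - (if b \<in> F then s b / (s b + l) else 0)" if "b \<in> Bh" for b
    using integral_eval_sq[OF that] by simp
  have "(\<integral>\<^sup>+p. ennreal ((norm (T l (residual F (Ks (fst p)))))^2) \<partial>\<rho>) = (\<integral>\<^sup>+m. ennreal ((norm (T l (residual F (Ks m))))^2) \<partial>\<rho>\<mu>)"
    unfolding \<rho>\<mu>_def
    by (rule nn_integral_distr[OF fst_\<rho>, symmetric]) (simp only: measurable_distr_eq1, rule measurable_compose[OF residual_measurable measurable_ennreal])
  also have "\<dots> \<le> ennreal (effective_dim LK l - (\<Sum>b\<in>F. s b / (s b + l)))"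
  proof (rule integral_has_sum_le[where f = ?f])
    show "0 \<le> ?f b m" if "b \<in> Bh" for b m using s_pos[OF that] l by simp
    show "integrable \<rho>\<mu> (?f b)" for b using integrable_eval_sq by (cases "b \<in> F") auto
    show "AE m in \<rho>\<mu>. ((\<lambda>b. ?f b m) has_sum (norm (T l (residual F (Ks m))))\<^sup>2) Bh"
    proof (rule AE_I2)
      fix m
      have "((\<lambda>b. (1 / sqrt (s b + l))^2 * (residual F (Ks m) \<bullet> b)^2) has_sum (norm (T l (residual F (Ks m))))\<^sup>2) Bh"
        unfolding T_def by (rule T.norm_has_sum)
      then show "((\<lambda>b. ?f b m) has_sum (norm (T l (residual F (Ks m))))\<^sup>2) Bh"
        by (rule has_sum_cong[THEN iffD1, rotated])
           (use s_pos l in \<open>simp add: power_divide residual_coeff[OF F] inner_commute[of "Ks m"] add_nonneg_nonneg less_imp_le\<close>)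
    qed
    show "(\<lambda>m. (norm (T l (residual F (Ks m))))^2) \<in> borel_measurable \<rho>\<mu>"
      unfolding measurable_cong_sets[OF sets_\<rho>\<mu> refl] by (rule residual_measurable)
    have "((\<lambda>b. if b \<in> F then s b / (s b + l) else 0) has_sum (\<Sum>b\<in>F. s b / (s b + l))) Bh"
      by (rule has_sum_finite_neutralI[OF F]) (auto intro!: sum.cong)
    then have "((\<lambda>b. s b / (s b + l) - (if b \<in> F then s b / (s b + l) else 0)) has_sum
        (effective_dim LK l - (\<Sum>b\<in>F. s b / (s b + l)))) Bh"
      using has_sum_add[OF effective_dim_has_sum[OF l] has_sum_uminusI] by fastforce
    then show "((\<lambda>b. \<integral>m. ?f b m \<partial>\<rho>\<mu>) has_sum (effective_dim LK l - (\<Sum>b\<in>F. s b / (s b + l)))) Bh"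
      by (intro has_sum_cong[THEN iffD2, OF sb]) auto
  qed
  finally show ?thesis .
qed

lemma residual_event:
  assumes F: "finite F" "F \<subseteq> Bh" "effective_dim LK l - (\<Sum>b\<in>F. s b / (s b + l)) \<le> \<epsilon>" and c: "c > 0"
  shows "likely n (ennreal (\<epsilon> / c)) (\<lambda>\<omega>. (\<Sum>j=1..n. (norm (T l (residual F (Ks (fst (\<omega> j))))))^2) \<le> real n * c)"
proof -
  let ?P = "sample n"
  let ?f = "\<lambda>p. (norm (T l (residual F (Ks (fst p)))))^2"
  have f: "?f \<in> borel_measurable \<rho>" by (rule measurable_compose[OF fst_\<rho> residual_measurable])
  have comp: "(\<lambda>\<omega>. \<omega> j) \<in> ?P \<rightarrow>\<^sub>M \<rho>" if "j \<in> {1..n}" for j by (rule measurable_component_singleton[OF that])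
  have "(\<integral>\<^sup>+\<omega>. ennreal (\<Sum>j=1..n. ?f (\<omega> j)) \<partial>?P) = (\<integral>\<^sup>+\<omega>. (\<Sum>j=1..n. ennreal (?f (\<omega> j))) \<partial>?P)"
    by (intro nn_integral_cong sum_ennreal[symmetric]) simp
  also have "\<dots> = (\<Sum>j=1..n. \<integral>\<^sup>+\<omega>. ennreal (?f (\<omega> j)) \<partial>?P)"
    by (rule nn_integral_sum) (rule measurable_compose[OF measurable_compose[OF comp f] measurable_ennreal])
  also have "\<dots> = (\<Sum>j=1..n. \<integral>\<^sup>+p. ennreal (?f p) \<partial>\<rho>)"
  proof (rule sum.cong[OF refl])
    fix j assume j: "j \<in> {1..n}"
    have "(\<integral>\<^sup>+p. ennreal (?f p) \<partial>distr ?P \<rho> (\<lambda>\<omega>. \<omega> j)) = (\<integral>\<^sup>+\<omega>. ennreal (?f (\<omega> j)) \<partial>?P)"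
      by (rule nn_integral_distr[OF comp[OF j]]) (simp only: measurable_distr_eq1, rule measurable_compose[OF f measurable_ennreal])
    then show "(\<integral>\<^sup>+\<omega>. ennreal (?f (\<omega> j)) \<partial>?P) = (\<integral>\<^sup>+p. ennreal (?f p) \<partial>\<rho>)"
      using distr_PiM_component[of "{1..n}" "\<lambda>_. \<rho>" j] \<rho>_prob j by simp
  qed
  also have "\<dots> \<le> (\<Sum>j=1..n. ennreal \<epsilon>)"
    by (intro sum_mono order_trans[OF residual_integral_le[OF F(1,2)]] ennreal_leI F(3))
  also have "\<dots> = ennreal (real n * \<epsilon>)"
  proof -
    have "\<epsilon> \<ge> 0"
    proof (rule order_trans[OF _ F(3)])
      show "0 \<le> effective_dim LK l - (\<Sum>b\<in>F. s b / (s b + l))"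
        using finite_sum_le_has_sum[OF effective_dim_has_sum[OF l] F(1,2)] s_pos l by (simp add: less_imp_le add_nonneg_nonneg)
    qed
    then show ?thesis by (simp add: ennreal_mult' ennreal_of_nat_eq_real_of_nat)
  qed
  finally have int: "(\<integral>\<^sup>+\<omega>. ennreal (\<Sum>j=1..n. ?f (\<omega> j)) \<partial>?P) \<le> ennreal (real n * \<epsilon>)" .
  have "(\<lambda>\<omega>. \<Sum>j=1..n. ?f (\<omega> j)) \<in> borel_measurable ?P"
    by (intro borel_measurable_sum measurable_compose[OF comp f])
  from markov_event[OF this int, of "real n * c"] show ?thesis using n c by simp
qed

lemma proj_event:
  "likely n (0) (\<lambda>\<omega>. \<forall>j\<in>{1..n}. proj_on Bh (Ks (fst (\<omega> j))) = Ks (fst (\<omega> j)))"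
proof -
  let ?P = "sample n"
  have "AE p in \<rho>. proj_on Bh (Ks (fst p)) = Ks (fst p)"
    using AE_distrD[OF fst_\<rho> proj_Ks_AE[unfolded \<rho>\<mu>_def]] .
  then have "AE \<omega> in ?P. proj_on Bh (Ks (fst (\<omega> j))) = Ks (fst (\<omega> j))" if "j \<in> {1..n}" for j
    using AE_PiM_component[of "{1..n}" "\<lambda>_. \<rho>" j] that \<rho>_prob by auto
  then have "AE \<omega> in ?P. \<forall>j\<in>{1..n}. proj_on Bh (Ks (fst (\<omega> j))) = Ks (fst (\<omega> j))"
    by (intro AE_finite_allI) auto
  then obtain N where N: "N \<in> null_sets ?P" "{\<omega> \<in> space ?P. \<not> (\<forall>j\<in>{1..n}. proj_on Bh (Ks (fst (\<omega> j))) = Ks (fst (\<omega> j)))} \<subseteq> N"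
    by (auto elim!: AE_E simp: null_sets_def)
  show ?thesis
  proof (intro bexI conjI)
    show "space ?P - N \<in> sets ?P" using N(1) by auto
    have "space ?P - (space ?P - N) = N" using sets.sets_into_space[of N ?P] N(1) by auto
    then show "emeasure ?P (space ?P - (space ?P - N)) \<le> 0" using N(1) by auto
  qed (use N(2) in auto)
qed

text \<open>\<open>lower_comparison\<close> settles the directions in \<open>F\<close>. What lies
  outside enters twice: the residuals of the sampled sections are controlled on average by
  \<open>residual_event\<close>, and the \<open>s b\<close> outside \<open>F\<close> are at most
  \<open>2 * \<epsilon> * l\<close>, since each term \<open>s b / (s b + l)\<close> of the tail is
  at most \<open>\<epsilon>\<close>.\<close>

lemma comparison_event:
  assumes large: "16 * (\<kappa>^2 / l + 1) \<le> real n" and p: "p > 0"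
  shows "likely n (ennreal (128 * (\<kappa>^2 / l)^2 * V / (real n)^2 + p)) (\<lambda>\<omega>. (\<forall>j\<in>{1..n}. proj_on Bh (Ks (fst (\<omega> j))) = Ks (fst (\<omega> j))) \<and>
      (\<forall>q. (norm (S q))^2 \<le> 3 * ((\<Sum>j=1..n. (q \<bullet> Ks (fst (\<omega> j)))^2) / real n) + 7 / 4 * l * (norm q)^2))"
proof -
  let ?P = "sample n"
  \<comment> \<open>\<open>p / 120\<close> lets the residual event fail with probability at most
    \<open>p\<close> at the threshold \<open>1/120\<close>; \<open>1/24\<close> keeps the
    \<open>s b\<close> outside \<open>F\<close> below \<open>l / 12\<close>.\<close>
  define \<epsilon> where "\<epsilon> = min (p / 120) (1 / 24)"
  have \<epsilon>: "\<epsilon> > 0" "\<epsilon> \<le> 1 / 24" "\<epsilon> / (1 / 120) \<le> p" using p by (auto simp: \<epsilon>_def)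
  have "(\<lambda>k. \<Sum>b\<in>exhaustion k. s b / (s b + l)) \<longlonglongrightarrow> effective_dim LK l"
    by (rule exhaustion_sums[OF effective_dim_has_sum[OF l]])
  then have "\<forall>\<^sub>F k in sequentially. (\<Sum>b\<in>exhaustion k. s b / (s b + l)) > effective_dim LK l - \<epsilon>"
    using \<epsilon>(1) by (intro order_tendstoD) auto
  then obtain k where "(\<Sum>b\<in>exhaustion k. s b / (s b + l)) > effective_dim LK l - \<epsilon>"
    unfolding eventually_sequentially by blast
  then have k: "effective_dim LK l - (\<Sum>b\<in>exhaustion k. s b / (s b + l)) \<le> \<epsilon>" by linarith
  define F where "F = exhaustion k"
  have F: "finite F" "F \<subseteq> Bh" "effective_dim LK l - (\<Sum>b\<in>F. s b / (s b + l)) \<le> \<epsilon>"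
    using exhaustion_finite exhaustion_sub k by (auto simp: F_def)
  have sl: "s b + l > 0" "s b + l \<ge> 0" "s b + l \<noteq> 0" if "b \<in> Bh" for b using s_pos[OF that] l by auto
  define \<psi> where "\<psi> b p = (b \<bullet> Ks (fst p)) / sqrt (s b + l)" for b and p :: "'g \<times> real"
  interpret D: diagonal_design \<rho> F \<psi> "\<lambda>b. s b / (s b + l)" "\<kappa>^2 / l" V
  proof (intro diagonal_design.intro diagonal_design_axioms.intro \<rho>_prob F(1))
    show "\<psi> e \<in> borel_measurable \<rho>" for e
      unfolding \<psi>_def by (intro borel_measurable_divide eval_measurable_\<rho> borel_measurable_const)
    show "(\<Sum>e\<in>F. (\<psi> e m)^2) \<le> \<kappa>^2 / l" if m: "m \<in> space \<rho>" for m
    proof -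
      have "(\<Sum>e\<in>F. (\<psi> e m)^2) = (\<Sum>b\<in>F. (b \<bullet> Ks (fst m))^2 / (s b + l))"
        using sl F by (intro sum.cong) (auto simp: \<psi>_def power_divide less_imp_le)
      also have "\<dots> \<le> (norm (T l (Ks (fst m))))^2"
        by (rule finite_sum_le_has_sum[OF TKs_norm_has_sum[OF l] F(1,2)]) (use sl in \<open>auto simp: less_imp_le\<close>)
      also have "\<dots> \<le> \<kappa>^2 / l" using m space_\<rho> by (intro TKs_norm_le[OF l]) auto
      finally show ?thesis .
    qed
    show "(\<integral>m. \<psi> e m * \<psi> k m \<partial>\<rho>) = (if e = k then s e / (s e + l) else 0)" if "e \<in> F" "k \<in> F" for e k
    proof -
      have ek: "e \<in> Bh" "k \<in> Bh" using that F(2) by auto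
      have "(\<integral>m. \<psi> e m * \<psi> k m \<partial>\<rho>) = (\<integral>m. (e \<bullet> Ks (fst m)) * (k \<bullet> Ks (fst m)) / (sqrt (s e + l) * sqrt (s k + l)) \<partial>\<rho>)"
        by (intro Bochner_Integration.integral_cong) (simp_all add: \<psi>_def)
      also have "\<dots> = s k * (e \<bullet> k) / (sqrt (s e + l) * sqrt (s k + l))"
        by (simp add: inner_S_\<rho>[symmetric] inner_S_Bh[OF ek(2)])
      also have "\<dots> = (if e = k then s e / (s e + l) else 0)"
        using Bh_orthonormal ek sl[OF ek(1)] by (auto simp: orthonormal_def less_imp_le)
      finally show ?thesis .
    qed
    show "0 \<le> s e / (s e + l)" "s e / (s e + l) \<le> 1" if "e \<in> F" for e
      using s_pos[of e] l that F(2) by (auto simp: divide_le_eq less_imp_le)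
    show "(\<Sum>b\<in>F. s b / (s b + l)) \<le> V"
      using finite_sum_le_has_sum[OF effective_dim_has_sum[OF l] F(1,2)] s_pos sl V(1)
      by (simp add: less_imp_le)
  qed
  obtain A1 where A1: "A1 \<in> sets ?P" "emeasure ?P (space ?P - A1) \<le> ennreal p"
    "\<And>\<omega>. \<omega> \<in> A1 \<Longrightarrow> (\<Sum>j=1..n. (norm (T l (residual F (Ks (fst (\<omega> j))))))^2) \<le> real n * (1 / 120)"
    using residual_event[OF F, of "1 / 120"] ennreal_leI[OF \<epsilon>(3)] by (auto intro: order_trans)
  obtain A2 where A2: "A2 \<in> sets ?P" "emeasure ?P (space ?P - A2) \<le> 0"
    "\<And>\<omega> j. \<omega> \<in> A2 \<Longrightarrow> j \<in> {1..n} \<Longrightarrow> proj_on Bh (Ks (fst (\<omega> j))) = Ks (fst (\<omega> j))"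
    using proj_event by blast
  let ?A = "D.good n \<inter> A1 \<inter> A2"
  show ?thesis
  proof (intro bexI conjI ballI allI)
    show "?A \<in> sets ?P" using D.good_meas A1 A2 by auto
    have "space ?P - ?A = (space ?P - D.good n) \<union> (space ?P - A1) \<union> (space ?P - A2)" by auto
    then have "emeasure ?P (space ?P - ?A) \<le> emeasure ?P (space ?P - D.good n) + emeasure ?P (space ?P - A1) + emeasure ?P (space ?P - A2)"
      using A1(1) A2(1) D.good_meas[of n]
      by (auto intro!: order_trans[OF emeasure_subadditive] add_right_mono emeasure_subadditive)
    also have "\<dots> \<le> ennreal (128 * (\<kappa>^2 / l)^2 * V / (real n)^2) + ennreal p + 0"
      using A1(2) A2(2) D.not_good_prob[OF n] by (intro add_mono)
    also have "\<dots> = ennreal (128 * (\<kappa>^2 / l)^2 * V / (real n)^2 + p)"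
      using V p by (simp add: ennreal_plus)
    finally show "emeasure ?P (space ?P - ?A) \<le> ennreal (128 * (\<kappa>^2 / l)^2 * V / (real n)^2 + p)" .
  next
    fix \<omega> j assume "\<omega> \<in> ?A" "j \<in> {1..n}"
    then show "proj_on Bh (Ks (fst (\<omega> j))) = Ks (fst (\<omega> j))" using A2(3) by blast
  next
    fix \<omega> q assume \<omega>: "\<omega> \<in> ?A"
    define W where "W = (norm (S q))^2 + l * (norm q)^2"
    define Pq where "Pq = (\<Sum>j=1..n. (q \<bullet> Ks (fst (\<omega> j)))^2)"
    define v where "v b = sqrt (s b + l) * (q \<bullet> b)" for b
    define \<Sigma> where "\<Sigma> = (\<Sum>b\<in>F. s b * (q \<bullet> b)^2)"
    define Q where "Q = (\<Sum>b\<in>F. (q \<bullet> b)^2)"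
    have W0: "W \<ge> 0" using l by (simp add: W_def)
    have low: "real n * (\<Sum>e\<in>F. s e / (s e + l) * (v e)^2) - real n / 2 * (\<Sum>e\<in>F. (v e)^2)
        \<le> (\<Sum>j=1..n. (\<Sum>e\<in>F. \<psi> e (\<omega> j) * v e)^2)"
      using D.lower_comparison[of \<omega> n v] \<omega> large by simp
    have v2: "(v e)^2 = (s e + l) * (q \<bullet> e)^2" "s e + l \<noteq> 0" if "e \<in> F" for e
      using sl[of e] that F(2) by (auto simp: v_def power_mult_distrib)
    have v1: "(\<Sum>e\<in>F. s e / (s e + l) * (v e)^2) = \<Sigma>" "(\<Sum>e\<in>F. (v e)^2) = \<Sigma> + l * Q"
      unfolding \<Sigma>_def Q_def sum_distrib_left sum.distrib[symmetric]
      by (auto intro!: sum.cong simp: v2) (simp add: distrib_right)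
    have xj: "(\<Sum>e\<in>F. \<psi> e (\<omega> j) * v e)^2 \<le> 5 / 4 * (q \<bullet> Ks (fst (\<omega> j)))^2 + 5 * ((norm (T l (residual F (Ks (fst (\<omega> j))))))^2 * W)"
      if j: "j \<in> {1..n}" for j
    proof -
      let ?k = "Ks (fst (\<omega> j))"
      have "(\<Sum>e\<in>F. \<psi> e (\<omega> j) * v e) = (\<Sum>e\<in>F. (?k \<bullet> e) * (e \<bullet> q))"
        using sl F(2) by (auto intro!: sum.cong simp: \<psi>_def v_def inner_commute subset_eq)
      also have "\<dots> = q \<bullet> ?k - residual F ?k \<bullet> q"
        by (simp add: residual_def inner_diff_left inner_sum_left inner_commute[of "Ks _"])
      finally have eq: "(\<Sum>e\<in>F. \<psi> e (\<omega> j) * v e) = q \<bullet> ?k - residual F ?k \<bullet> q" .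
      have pr: "proj_on Bh (residual F ?k) = residual F ?k"
        using A2(3) \<omega> j by (intro proj_residual F) auto
      have neg: "norm (S (- q)) = norm (S q)"
        using bounded_linear.linear[OF bounded_linear_S] by (simp add: linear_neg)
      have "\<bar>residual F ?k \<bullet> q\<bar> \<le> norm (T l (residual F ?k)) * sqrt W"
        using inner_le_T[OF l pr, of q] inner_le_T[OF l pr, of "- q"] by (simp add: W_def neg abs_le_iff)
      then have "\<bar>residual F ?k \<bullet> q\<bar>^2 \<le> (norm (T l (residual F ?k)) * sqrt W)^2" by (rule power_mono) simp
      then have r2: "(residual F ?k \<bullet> q)^2 \<le> (norm (T l (residual F ?k)))^2 * W" using W0 by (simp add: power_mult_distrib)
      \<comment> \<open>The weight 5 on the residual meets the threshold \<open>1/120\<close>: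
        together they cost \<open>1/24\<close> of \<open>W\<close>.\<close>
      have "(x - y)^2 \<le> 5 / 4 * x^2 + 5 * y^2" for x y :: real
        using zero_le_power2[of "x / 2 + 2 * y"] by (simp add: power2_eq_square algebra_simps)
      from this[of "q \<bullet> ?k" "residual F ?k \<bullet> q"] r2 show ?thesis unfolding eq by linarith
    qed
    have "(\<Sum>j=1..n. (\<Sum>e\<in>F. \<psi> e (\<omega> j) * v e)^2) \<le> (\<Sum>j=1..n. 5 / 4 * (q \<bullet> Ks (fst (\<omega> j)))^2 + 5 * ((norm (T l (residual F (Ks (fst (\<omega> j))))))^2 * W))"
      by (rule sum_mono[OF xj])
    also have "\<dots> = 5 / 4 * Pq + 5 * ((\<Sum>j=1..n. (norm (T l (residual F (Ks (fst (\<omega> j))))))^2) * W)"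
      unfolding Pq_def sum.distrib sum_distrib_left sum_distrib_right ..
    also have "\<dots> \<le> 5 / 4 * Pq + 5 * (real n * (1 / 120) * W)"
      using A1(3) \<omega> W0 by (intro add_left_mono mult_left_mono mult_right_mono) auto
    finally have "real n * \<Sigma> - real n / 2 * (\<Sigma> + l * Q) \<le> 5 / 4 * Pq + 5 * (real n * (1 / 120) * W)"
      using low unfolding v1 by linarith
    moreover have "real n * (\<Sigma> / 2 - l * Q / 2 - W / 24) = real n * \<Sigma> - real n / 2 * (\<Sigma> + l * Q) - 5 * (real n * (1 / 120) * W)"
      by (simp add: field_simps)
    ultimately have "real n * (\<Sigma> / 2 - l * Q / 2 - W / 24) \<le> 5 / 4 * Pq" by linarith
    then have main: "\<Sigma> / 2 - l * Q / 2 - W / 24 \<le> 5 / 4 * (Pq / real n)"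
      using n by (simp add: pos_le_divide_eq mult.commute)
    have S_le: "(norm (S q))^2 \<le> \<Sigma> + 2 * \<epsilon> * l * (norm q)^2"
    proof (rule has_sum_le_finite_sums[OF norm_S_has_sum[of q]])
      fix G assume G: "finite G" "G \<subseteq> Bh"
      have small: "s b \<le> 2 * \<epsilon> * l" if b: "b \<in> Bh - F" for b
      proof -
        have "(\<Sum>b\<in>insert b F. s b / (s b + l)) \<le> effective_dim LK l"
          by (rule finite_sum_le_has_sum[OF effective_dim_has_sum[OF l]]) (use F(1,2) b s_pos sl in \<open>auto simp: less_imp_le\<close>)
        then have "s b / (s b + l) \<le> \<epsilon>" using F b by simp
        then have "s b \<le> \<epsilon> * (s b + l)" using sl[of b] b by (simp add: pos_divide_le_eq)
        also have "\<dots> \<le> s b / 24 + \<epsilon> * l" using mult_right_mono[OF \<epsilon>(2), of "s b"] s_pos[of b] b by (simp add: distrib_left)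
        finally show ?thesis using s_pos[of b] b by simp
      qed
      have "(\<Sum>b\<in>G. s b * (q \<bullet> b)^2) = (\<Sum>b\<in>G \<inter> F. s b * (q \<bullet> b)^2) + (\<Sum>b\<in>G - F. s b * (q \<bullet> b)^2)"
        by (rule sum.Int_Diff[OF G(1)])
      also have "(\<Sum>b\<in>G \<inter> F. s b * (q \<bullet> b)^2) \<le> \<Sigma>"
        unfolding \<Sigma>_def using s_pos F(2) by (intro sum_mono2 F(1)) (auto intro!: mult_nonneg_nonneg intro: less_imp_le)
      also have "(\<Sum>b\<in>G - F. s b * (q \<bullet> b)^2) \<le> (\<Sum>b\<in>G - F. 2 * \<epsilon> * l * (q \<bullet> b)^2)"
        using G small by (intro sum_mono mult_right_mono) auto
      also have "\<dots> \<le> 2 * \<epsilon> * l * (norm q)^2"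
        unfolding sum_distrib_left[symmetric] using \<epsilon> l G
        by (intro mult_left_mono bessel_finite orthonormal_subset[OF Bh_orthonormal]) auto
      finally show "(\<Sum>b\<in>G. s b * (q \<bullet> b)^2) \<le> \<Sigma> + 2 * \<epsilon> * l * (norm q)^2" by simp
    qed
    have lq: "0 \<le> l * (norm q)^2" using l by simp
    have "2 * \<epsilon> * (l * (norm q)^2) \<le> 1 / 12 * (l * (norm q)^2)"
      using lq \<epsilon>(2) by (intro mult_right_mono) auto
    with S_le have S_le': "(norm (S q))^2 \<le> \<Sigma> + 1 / 12 * (l * (norm q)^2)" by (simp add: mult.assoc)
    have Pq0: "Pq / real n \<ge> 0" by (simp add: Pq_def sum_nonneg)
    have "Q \<le> (norm q)^2" unfolding Q_def by (intro bessel_finite orthonormal_subset[OF Bh_orthonormal] F)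
    then have "l * Q \<le> l * (norm q)^2" using l by (intro mult_left_mono) auto
    \<comment> \<open>Moving \<open>1/24\<close> of \<open>(norm (S q))^2\<close> to the left leaves
      the factor \<open>11/24\<close> there; then \<open>30/11 \<le> 3\<close> and
      \<open>14/11 \<le> 7/4\<close>.\<close>
    then have "(norm (S q))^2 \<le> 3 * (Pq / real n) + 7 / 4 * (l * (norm q)^2)"
      using main S_le' lq Pq0 unfolding W_def by argo
    then show "(norm (S q))^2 \<le> 3 * ((\<Sum>j=1..n. (q \<bullet> Ks (fst (\<omega> j)))^2) / real n) + 7 / 4 * l * (norm q)^2"
      by (simp add: Pq_def)
  qed
qed

end

end

section \<open>Prediction error on a fixed sample\<close>

context empirical_sample
begin

text \<open>A deterministic bound without any comparison of forms: by
  \<open>(x - y)^2 - 2 * (x - y) * x \<le> y^2\<close> a step raises the squared norm by at most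
  \<open>\<eta> * M^2\<close>, whatever the batch.\<close>

lemma norm_iter_sq_le:
  assumes y: "\<And>j. j \<in> {1..n} \<Longrightarrow> \<bar>y j\<bar> \<le> M" and \<eta>: "\<eta> > 0" "4 * \<kappa>^2 * \<eta> \<le> 1" and b: "b > 0"
    and J: "J \<in> {1..b * T} \<rightarrow> {1..n}" and t: "t \<le> T"
  shows "(norm (iter b \<eta> h0 J t))^2 \<le> (norm h0)^2 + \<eta> * real t * M^2"
  using t
proof (induction t)
  case (Suc t)
  let ?h = "iter b \<eta> h0 J t" and ?I = "{b * t + 1..b * (t + 1)}"
  let ?e = "\<lambda>i. ?h \<bullet> k (J i) - y (J i)"
  let ?d = "\<Sum>i\<in>?I. ?e i *\<^sub>R k (J i)"
  have J: "J i \<in> {1..n}" if "i \<in> ?I" for i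
    using that J Suc.prems mult_le_mono2[of "t + 1" T b] by (auto simp: Pi_iff)
  have card: "card ?I = b" by simp
  have d: "(norm ?d)^2 \<le> real b * \<kappa>^2 * (\<Sum>i\<in>?I. (?e i)^2)"
  proof -
    have "norm ?d \<le> (\<Sum>i\<in>?I. \<bar>?e i\<bar> * \<kappa>)"
      by (rule sum_norm_le) (use J k_bound in \<open>auto intro!: mult_left_mono\<close>)
    then have "(norm ?d)^2 \<le> (\<Sum>i\<in>?I. \<bar>?e i\<bar> * \<kappa>)^2" by (rule power_mono) simp
    also have "\<dots> \<le> (\<Sum>i\<in>?I. (\<bar>?e i\<bar> * \<kappa>)^2) * real (card ?I)"
      by (rule sum_squared_le_sum_of_squares)
    finally show ?thesis unfolding card by (simp add: power_mult_distrib sum_distrib_left mult_ac)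
  qed
  define c where "c = \<eta> / real b"
  define e where "e i = ?e i" for i
  define g where "g i = ?h \<bullet> k (J i)" for i
  have c: "c \<ge> 0" "c * real b = \<eta>" using \<eta> b by (auto simp: c_def)
  have "(norm (iter b \<eta> h0 J (Suc t)))^2 = (norm ?h)^2 - 2 * c * (\<Sum>i\<in>?I. e i * g i) + c^2 * (norm ?d)^2"
    by (simp only: iter.simps norm_diff_scale_sq inner_sum_right inner_scaleR_right c_def e_def g_def)
  moreover have "c^2 * (norm ?d)^2 \<le> c^2 * (real b * \<kappa>^2 * (\<Sum>i\<in>?I. (e i)^2))"
    unfolding e_def by (intro mult_left_mono d) simp
  moreover have "c^2 * (real b * \<kappa>^2 * (\<Sum>i\<in>?I. (e i)^2)) = c * ((\<eta> * \<kappa>^2) * (\<Sum>i\<in>?I. (e i)^2))"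
    unfolding c(2)[symmetric] by (simp add: power2_eq_square[of c])
  moreover have "c * ((\<eta> * \<kappa>^2) * (\<Sum>i\<in>?I. (e i)^2)) \<le> c * (1 * (\<Sum>i\<in>?I. (e i)^2))"
    using c \<eta> mult_nonneg_nonneg[of "\<kappa>^2" \<eta>]
    by (intro mult_left_mono mult_right_mono sum_nonneg) (auto simp: mult.commute)
  moreover have "c * (\<Sum>i\<in>?I. (e i)^2) - 2 * c * (\<Sum>i\<in>?I. e i * g i) \<le> c * (\<Sum>i\<in>?I. M^2)"
  proof -
    have "(e i)^2 - 2 * (e i * g i) \<le> M^2" if i: "i \<in> ?I" for i
    proof -
      have "(x - y)^2 - 2 * ((x - y) * x) \<le> y^2" for x y :: real
        using zero_le_power2[of x] by (simp add: power2_eq_square algebra_simps)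
      from this[of "g i" "y (J i)"] show ?thesis
        using power_mono[OF y[OF J[OF i]], of 2] by (simp add: e_def g_def)
    qed
    then have "c * (\<Sum>i\<in>?I. (e i)^2 - 2 * (e i * g i)) \<le> c * (\<Sum>i\<in>?I. M^2)"
      using c by (intro mult_left_mono sum_mono) auto
    then show ?thesis by (simp only: sum_subtractf sum_distrib_left[symmetric] right_diff_distrib)
  qed
  moreover have "c * (\<Sum>i\<in>?I. M^2) = \<eta> * M^2" unfolding sum_constant card using c by simp
  moreover have "(norm ?h)^2 \<le> (norm h0)^2 + \<eta> * real t * M^2" using Suc by simp
  moreover have "\<eta> * real (Suc t) * M^2 = \<eta> * real t * M^2 + \<eta> * M^2" by (simp add: algebra_simps)
  ultimately show ?case by linarith
qed simp

end

text \<open>\<open>noise_mean\<close> is the normal equation: the residual of the target is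
  orthogonal to every function of the RKHS.\<close>

locale regression = source_condition P K evK Y \<rho> cls \<kappa> r w
  for P K evK Y \<rho> and cls :: "('g::{second_countable_topology,real_normed_vector} \<Rightarrow> real) \<Rightarrow> 'l::{real_inner,banach}"
    and \<kappa> r w + fixes h0 :: 'a and M :: real
  assumes M: "M > 0" "Y \<subseteq> {-M..M}"
    and noise_mean: "(\<integral>p. (snd p - (h0 - bias 1 0) \<bullet> Ks (fst p)) * (h \<bullet> Ks (fst p)) \<partial>\<rho>) = 0"
begin

definition v0 :: 'a where "v0 = bias 1 0"
definition f :: 'a where "f = h0 - v0"

text \<open>A Lipschitz constant of the gradient \<open>(y - u \<bullet> k) k\<close> in the section
  \<open>k\<close>, for \<open>u\<close> of norm at most \<open>norm f + norm v0\<close>.\<close>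

definition c0 :: real where "c0 = M + 2 * \<kappa> * norm f + 2 * \<kappa> * norm v0"

lemma c0: "c0 \<ge> 0" using M \<kappa> by (simp add: c0_def)

definition section_dist :: "(nat \<Rightarrow> 'g) \<Rightarrow> (nat \<Rightarrow> 'g) \<Rightarrow> nat \<Rightarrow> real" where
  "section_dist m m' n = (\<Sum>j=1..n. (norm (Ks (m' j) - Ks (m j)))^2) / real n"

definition tail_average :: "nat \<Rightarrow> (nat \<Rightarrow> 'a) \<Rightarrow> 'a" where
  "tail_average t0 h = (2 / real t0) *\<^sub>R (\<Sum>t = t0 div 2 + 1..t0. h t)"

abbreviation avg_error :: "nat \<Rightarrow> nat \<Rightarrow> nat \<Rightarrow> real \<Rightarrow> (nat \<Rightarrow> 'g) \<Rightarrow> (nat \<Rightarrow> real) \<Rightarrow> real" where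
  "avg_error n b t0 \<eta> m y \<equiv> index_avg {1..b * t0} n
     (\<lambda>J. norm (S (tail_average t0 (empirical_sample.iter (\<lambda>j. Ks (m j)) y b \<eta> h0 J)) - S f))"

definition \<zeta>0 :: "real \<Rightarrow> real \<Rightarrow> real" where "\<zeta>0 c1 A0 = 3 * A0 + 3 * c0 / sqrt c1"

text \<open>One summand for each term of \<open>batch_error_le\<close>: SGD fluctuation, sources,
  bias, crude bound.\<close>

definition rate_const :: "real \<Rightarrow> real \<Rightarrow> real \<Rightarrow> real \<Rightarrow> real" where
  "rate_const c1 c2 c3 A0 = 42 * sqrt c3 * (M + \<kappa> * (norm f + norm v0 + 9 * (\<zeta>0 c1 A0 / sqrt c1))) + 41 * \<zeta>0 c1 A0
     + (2 * r * c2) powr r * norm w + 60 * (\<kappa> * (norm h0 + norm f + M / sqrt c1) / c1)"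

lemma bias_0: "bias \<eta> 0 = v0" by (simp add: v0_def bias_def)

lemma proj_bias:
  assumes \<eta>: "\<eta> > 0" "\<eta> * \<kappa>^2 \<le> 1" shows "proj_on Bh (bias \<eta> t) = bias \<eta> t"
proof -
  have "proj_on Bh (bias \<eta> t) = (\<Sum>\<^sub>\<infinity>b\<in>Bh. ((1 - \<eta> * s b) ^ t * lift_coef b) *\<^sub>R b)"
    unfolding proj_on_def by (intro infsum_cong) (simp add: bias_coeff[OF \<eta>])
  then show ?thesis by (simp only: bias_def)
qed

lemma linear_proj: "linear (proj_on Bh)"
proof -
  interpret proj: diagonal_operator Bh "\<lambda>_. 1" 1 by (rule diag_Bh) auto
  show ?thesis unfolding proj_on_eq_diag by (rule bounded_linear.linear[OF proj.bounded_linear])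
qed

section \<open>Error for fixed first-stage points \<open>m\<close> and second-stage points
  \<open>m'\<close>\<close>

context
  fixes m m' :: "nat \<Rightarrow> 'g" and y :: "nat \<Rightarrow> real" and n b t0 :: nat and \<eta> l V A :: real
  assumes n: "n > 0" and b: "b > 0" and \<eta>: "\<eta> > 0" "4 * \<kappa>^2 * \<eta> \<le> 1" and t0: "even t0" "t0 > 0"
    and l_eq: "l = 1 / (\<eta> * real t0)" and V: "effective_dim LK l \<le> V" "V \<ge> 1"
    and m: "\<And>j. j \<in> {1..n} \<Longrightarrow> m j \<in> P" and m': "\<And>j. j \<in> {1..n} \<Longrightarrow> m' j \<in> P"
    and y: "\<And>j. j \<in> {1..n} \<Longrightarrow> \<bar>y j\<bar> \<le> M"
    and proj: "\<And>j. j \<in> {1..n} \<Longrightarrow> proj_on Bh (Ks (m j)) = Ks (m j)"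
    and compare: "\<And>q. (norm (S q))^2 \<le> 3 * ((\<Sum>j=1..n. (q \<bullet> Ks (m j))^2) / real n) + 7 / 4 * l * (norm q)^2"
    and A: "A \<ge> 0" and noise: "norm (T l ((1 / real n) *\<^sub>R (\<Sum>j=1..n. (y j - f \<bullet> Ks (m j)) *\<^sub>R Ks (m j)))) \<le> A"
    and drift: "(\<Sum>t\<le>t0. (norm (T l (adjoint S (S (bias \<eta> t)) - (1 / real n) *\<^sub>R (\<Sum>j=1..n. (bias \<eta> t \<bullet> Ks (m j)) *\<^sub>R Ks (m j)))))^2) \<le> real t0 * A^2"
begin

interpretation E: empirical_sample n \<kappa> "\<lambda>j. Ks (m' j)" y
  by unfold_locales (use n m' norm_Ks in auto)

abbreviation D2 :: real where "D2 \<equiv> section_dist m m' n"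
text \<open>Bounds the root mean square over time of the dual norms of the sources: \<open>A\<close>
  accounts for noise and drift, the second summand for the second-stage error.\<close>

definition \<zeta> :: real where "\<zeta> = 3 * A + 3 * c0 * sqrt D2 / sqrt l"
abbreviation tail_avg :: "(nat \<Rightarrow> 'a) \<Rightarrow> 'a" where "tail_avg \<equiv> tail_average t0"
text \<open>Bound for the residuals of gradient descent on the second-stage sample, as
  \<open>sgd_sample\<close> demands it.\<close>

definition \<tau> :: real where "\<tau> = M + \<kappa> * (norm f + norm v0 + 9 * \<zeta> / sqrt l)"

lemma l: "l > 0" using \<eta> t0 by (simp add: l_eq)
lemma \<eta>l: "\<eta> * l * real t0 = 1" using \<eta> t0 by (simp add: l_eq)
lemma \<eta>1: "\<eta> * \<kappa>^2 \<le> 1" using \<eta> mult_nonneg_nonneg[of "\<kappa>^2" \<eta>] by (simp add: mult.commute)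
lemma D2: "D2 \<ge> 0" by (simp add: section_dist_def sum_nonneg)
lemma \<zeta>_nonneg: "\<zeta> \<ge> 0" using A c0 D2 l by (simp add: \<zeta>_def mult.assoc)
lemma S_lin: "linear S" by (rule bounded_linear.linear[OF bounded_linear_S])

lemma mean_dist: "(\<Sum>j=1..n. norm (Ks (m' j) - Ks (m j))) / real n \<le> sqrt D2"
proof (rule real_le_rsqrt)
  have "(\<Sum>j=1..n. norm (Ks (m' j) - Ks (m j)))^2 \<le> (\<Sum>j=1..n. (norm (Ks (m' j) - Ks (m j)))^2) * real (card {1..n})"
    by (rule sum_squared_le_sum_of_squares)
  then show "((\<Sum>j=1..n. norm (Ks (m' j) - Ks (m j))) / real n)^2 \<le> D2"
    using n by (simp add: section_dist_def power_divide divide_simps power2_eq_square[of "real n"])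
qed

lemma tail_avg_add: "tail_avg (\<lambda>t. g t + h t) = tail_avg g + tail_avg h"
  by (simp add: tail_average_def sum.distrib scaleR_add_right)

lemma card_tail: "2 * real (card {t0 div 2 + 1..t0}) = real t0"
  using t0(1) by (auto elim!: evenE)

lemma tail_avg_const: "tail_avg (\<lambda>_. x) = x"
  using card_tail t0 by (simp add: tail_average_def sum_constant_scaleR field_simps del: card_atLeastAtMost)

lemma norm_S_tail_avg: "norm (S (tail_avg h)) \<le> (2 / real t0) * (\<Sum>t = t0 div 2 + 1..t0. norm (S (h t)))"
  unfolding tail_average_def linear_scale[OF S_lin] linear_sum[OF S_lin]
  using norm_sum[of "\<lambda>t. S (h t)" "{t0 div 2 + 1..t0}"] by (simp add: mult_left_mono divide_right_mono)

lemma norm_S_tail_avg_sq: "(norm (S (tail_avg h)))^2 \<le> (2 / real t0) * (\<Sum>t\<le>t0. (norm (S (h t)))^2)"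
proof -
  let ?I = "{t0 div 2 + 1..t0}"
  have "(norm (S (tail_avg h)))^2 \<le> ((2 / real t0) * (\<Sum>t\<in>?I. norm (S (h t))))^2"
    by (intro power_mono norm_S_tail_avg) simp
  also have "\<dots> \<le> (2 / real t0)^2 * ((\<Sum>t\<in>?I. (norm (S (h t)))^2) * real (card ?I))"
    unfolding power_mult_distrib by (intro mult_left_mono sum_squared_le_sum_of_squares) auto
  also have "\<dots> = (2 / real t0) * (\<Sum>t\<in>?I. (norm (S (h t)))^2)"
    unfolding power2_eq_square[of "2 / _"] using card_tail t0 by (simp add: field_simps)
  also have "\<dots> \<le> (2 / real t0) * (\<Sum>t\<le>t0. (norm (S (h t)))^2)"
    by (intro mult_left_mono sum_mono2) auto
  finally show ?thesis .
qed

text \<open>Only iterations \<open>t > t0 / 2\<close> enter the tail average, where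
  \<open>r / (\<eta> * t) \<le> 2 * r * l\<close>. Averaging from the start would spoil the rate for
  \<open>r > 1\<close>.\<close>

lemma tail_bias_le: "norm (S (tail_avg (bias \<eta>))) \<le> (2 * r * l) powr r * norm w"
proof -
  have "norm (S (tail_avg (bias \<eta>))) \<le> (2 / real t0) * (\<Sum>t = t0 div 2 + 1..t0. norm (S (bias \<eta> t)))"
    by (rule norm_S_tail_avg)
  also have "\<dots> \<le> (2 / real t0) * (\<Sum>t = t0 div 2 + 1..t0. (2 * r * l) powr r * norm w)"
  proof (intro mult_left_mono sum_mono)
    fix t assume t: "t \<in> {t0 div 2 + 1..t0}"
    then have t': "t > 0" "real t0 \<le> 2 * real t" by (auto simp: of_nat_mult[symmetric] simp del: of_nat_mult)
    have "r / (\<eta> * real t) \<le> 2 * r * l"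
      using t' \<eta> r t0 by (simp add: l_eq field_simps mult_left_mono)
    then have "(r / (\<eta> * real t)) powr r \<le> (2 * r * l) powr r" using r \<eta> t' by (intro powr_mono2) auto
    then show "norm (S (bias \<eta> t)) \<le> (2 * r * l) powr r * norm w"
      using norm_S_bias_le[OF \<eta>(1) \<eta>1 t'(1)] by (meson mult_right_mono norm_ge_zero order_trans)
  qed simp
  also have "\<dots> = (2 * r * l) powr r * norm w"
    unfolding sum_constant using card_tail t0 by (simp add: field_simps)
  finally show ?thesis .
qed

lemma crude_error_le:
  assumes J: "J \<in> {1..b * t0} \<rightarrow> {1..n}"
  shows "norm (S (tail_avg (E.iter b \<eta> h0 J)) - S f) \<le> \<kappa> * (norm h0 + norm f + M / sqrt l)"
proof -
  have h: "norm (E.iter b \<eta> h0 J t) \<le> norm h0 + M / sqrt l" if "t \<le> t0" for t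
  proof (rule power2_le_imp_le)
    have "(norm (E.iter b \<eta> h0 J t))^2 \<le> (norm h0)^2 + \<eta> * real t * M^2"
      by (rule E.norm_iter_sq_le[OF y \<eta> b J that])
    also have "\<dots> \<le> (norm h0)^2 + \<eta> * real t0 * M^2"
      using that \<eta> by (intro add_left_mono mult_right_mono mult_left_mono) auto
    also have "\<eta> * real t0 * M^2 = (M / sqrt l)^2" using l \<eta> t0 by (simp add: l_eq power_divide)
    also have "(norm h0)^2 + (M / sqrt l)^2 \<le> (norm h0 + M / sqrt l)^2" using M l by (simp add: power2_sum)
    finally show "(norm (E.iter b \<eta> h0 J t))^2 \<le> (norm h0 + M / sqrt l)^2" .
  qed (use M l in simp)
  have "norm (S (tail_avg (E.iter b \<eta> h0 J)) - S f) = norm (S (tail_avg (E.iter b \<eta> h0 J) - f))"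
    by (simp add: linear_diff[OF S_lin])
  also have "\<dots> \<le> \<kappa> * norm (tail_avg (E.iter b \<eta> h0 J) - f)" by (rule norm_S)
  also have "\<dots> \<le> \<kappa> * (norm h0 + M / sqrt l + norm f)"
  proof (intro mult_left_mono \<kappa> order_trans[OF norm_triangle_ineq4] add_right_mono)
    have "norm (tail_avg (E.iter b \<eta> h0 J)) \<le> (2 / real t0) * (\<Sum>t = t0 div 2 + 1..t0. norm h0 + M / sqrt l)"
      unfolding tail_average_def norm_scaleR using h
      by (auto intro!: mult_left_mono divide_right_mono order_trans[OF norm_sum] sum_mono simp del: sum_constant)
    also have "\<dots> = norm h0 + M / sqrt l"
      unfolding sum_constant using card_tail t0 by (simp add: field_simps)
    finally show "norm (tail_avg (E.iter b \<eta> h0 J)) \<le> norm h0 + M / sqrt l" .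
  qed
  finally show ?thesis by (simp add: algebra_simps)
qed

lemma good_error_le:
  assumes small: "D2 \<le> l / 60"
  shows "avg_error n b t0 \<eta> m' y
    \<le> 42 * sqrt (\<eta> * l * V / real b) * \<tau> + 41 * \<zeta> + (2 * r * l) powr r * norm w"
proof -
  \<comment> \<open>Replacing \<open>m\<close> by \<open>m'\<close> turns the constants 3 and 7/4 of
    \<open>compare\<close> into \<open>15/4 \<le> 4\<close> and \<open>7/4 + 15/60 = 2\<close>; this
    is where \<open>D2 \<le> l / 60\<close> comes from.\<close>
  interpret C: compared_sample n \<kappa> "\<lambda>j. Ks (m' j)" y S l
  proof (intro compared_sample.intro compared_sample_axioms.intro E.empirical_sample_axioms bounded_linear_S norm_S l)
    fix x
    have "(x \<bullet> Ks (m j))^2 \<le> 5 / 4 * (x \<bullet> Ks (m' j))^2 + 5 * ((norm x)^2 * (norm (Ks (m' j) - Ks (m j)))^2)" for j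
    proof -
      have *: "(p - q)^2 \<le> 5 / 4 * p^2 + 5 * q^2" for p q :: real
        using zero_le_power2[of "p / 2 + 2 * q"] by (simp add: power2_eq_square algebra_simps)
      have "\<bar>x \<bullet> (Ks (m' j) - Ks (m j))\<bar>^2 \<le> (norm x * norm (Ks (m' j) - Ks (m j)))^2"
        by (intro power_mono Cauchy_Schwarz_ineq2) simp
      then show ?thesis
        using *[of "x \<bullet> Ks (m' j)" "x \<bullet> (Ks (m' j) - Ks (m j))"] by (simp add: inner_diff_right power_mult_distrib)
    qed
    then have "(\<Sum>j=1..n. (x \<bullet> Ks (m j))^2) \<le> (\<Sum>j=1..n. 5 / 4 * (x \<bullet> Ks (m' j))^2 + 5 * ((norm x)^2 * (norm (Ks (m' j) - Ks (m j)))^2))"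
      by (rule sum_mono)
    also have "\<dots> = 5 / 4 * (\<Sum>j=1..n. (x \<bullet> Ks (m' j))^2) + 5 * ((norm x)^2 * (\<Sum>j=1..n. (norm (Ks (m' j) - Ks (m j)))^2))"
      by (simp only: sum.distrib sum_distrib_left)
    finally have *: "(\<Sum>j=1..n. (x \<bullet> Ks (m j))^2)
        \<le> 5 / 4 * (\<Sum>j=1..n. (x \<bullet> Ks (m' j))^2) + 5 * ((norm x)^2 * (\<Sum>j=1..n. (norm (Ks (m' j) - Ks (m j)))^2))" .
    have "(\<Sum>j=1..n. (x \<bullet> Ks (m j))^2) / real n \<le> 5 / 4 * E.sq x + 5 * ((norm x)^2 * D2)"
      using divide_right_mono[OF *, of "real n"] by (simp add: E.sq_def section_dist_def add_divide_distrib)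
    moreover have "(norm x)^2 * D2 \<le> (norm x)^2 * (l / 60)" by (intro mult_left_mono small) simp
    ultimately show "(norm (S x))^2 \<le> 4 * E.sq x + 2 * l * (norm x)^2"
      using compare[of x] E.sq_nonneg[of x] by (simp add: mult.commute)
  qed
  define u where "u t = f + bias \<eta> t" for t
  define q where "q t = E.gd \<eta> h0 t - u t" for t
  define s where "s t = E.g - E.L (u t) + adjoint S (S (bias \<eta> t))" for t
  define e where "e = (1 / real n) *\<^sub>R (\<Sum>j=1..n. (y j - f \<bullet> Ks (m j)) *\<^sub>R Ks (m j))"
  define d where "d t = adjoint S (S (bias \<eta> t)) - (1 / real n) *\<^sub>R (\<Sum>j=1..n. (bias \<eta> t \<bullet> Ks (m j)) *\<^sub>R Ks (m j))" for t
  define x where "x t = E.g - E.L (u t) - (1 / real n) *\<^sub>R (\<Sum>j=1..n. (y j - u t \<bullet> Ks (m j)) *\<^sub>R Ks (m j))" for t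
  \<comment> \<open>\<open>e\<close> is the sampling noise, \<open>d t\<close> the covariance
    fluctuation along the bias, \<open>x t\<close> the effect of replacing \<open>m\<close> by
    \<open>m'\<close>.\<close>
  have s_eq: "s t = e + d t + x t" for t
    by (simp add: s_def e_def d_def x_def u_def inner_add_left diff_diff_eq[symmetric] scaleR_diff_left sum_subtractf scaleR_diff_right)
  have q0: "q 0 = 0" by (simp add: q_def u_def bias_0 f_def)
  have qS: "q (Suc t) = q t - \<eta> *\<^sub>R E.L (q t) + \<eta> *\<^sub>R s t" for t
    by (simp add: q_def s_def u_def bias_Suc[OF \<eta>(1) \<eta>1] linear_diff[OF E.linear_L] linear_add[OF E.linear_L] scaleR_diff_right scaleR_add_right)
  have u_norm: "norm (u t) \<le> norm f + norm v0" for t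
    unfolding u_def using norm_triangle_ineq[of f "bias \<eta> t"] norm_bias_le[OF \<eta>(1) \<eta>1, of t] by (simp add: bias_0)
  have x_norm: "norm (x t) \<le> c0 * sqrt D2" for t
  proof -
    have one: "norm ((y j - u t \<bullet> Ks (m' j)) *\<^sub>R Ks (m' j) - (y j - u t \<bullet> Ks (m j)) *\<^sub>R Ks (m j)) \<le> c0 * norm (Ks (m' j) - Ks (m j))"
      if j: "j \<in> {1..n}" for j
    proof -
      let ?k = "Ks (m j)" and ?k' = "Ks (m' j)" and ?u = "u t"
      have "(y j - ?u \<bullet> ?k') *\<^sub>R ?k' - (y j - ?u \<bullet> ?k) *\<^sub>R ?k = (y j - ?u \<bullet> ?k') *\<^sub>R (?k' - ?k) - (?u \<bullet> (?k' - ?k)) *\<^sub>R ?k"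
        by (simp add: inner_diff_right algebra_simps)
      then have "norm ((y j - ?u \<bullet> ?k') *\<^sub>R ?k' - (y j - ?u \<bullet> ?k) *\<^sub>R ?k)
          \<le> \<bar>y j - ?u \<bullet> ?k'\<bar> * norm (?k' - ?k) + \<bar>?u \<bullet> (?k' - ?k)\<bar> * norm ?k"
        using norm_triangle_ineq4[of "(y j - ?u \<bullet> ?k') *\<^sub>R (?k' - ?k)" "(?u \<bullet> (?k' - ?k)) *\<^sub>R ?k"] by simp
      also have "\<dots> \<le> (M + \<kappa> * norm ?u) * norm (?k' - ?k) + (norm ?u * norm (?k' - ?k)) * \<kappa>"
        using y[OF j] inner_Ks_le[OF m'[OF j], of ?u]
        by (intro add_mono mult_mono Cauchy_Schwarz_ineq2 norm_Ks m j) (auto intro: order_trans[OF abs_triangle_ineq4])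
      also have "\<dots> = (M + 2 * (\<kappa> * norm ?u)) * norm (?k' - ?k)" by (simp add: algebra_simps)
      also have "\<dots> \<le> c0 * norm (?k' - ?k)"
        using mult_left_mono[OF u_norm[of t] \<kappa>] by (intro mult_right_mono) (auto simp: c0_def algebra_simps)
      finally show ?thesis .
    qed
    have "x t = (1 / real n) *\<^sub>R (\<Sum>j=1..n. (y j - u t \<bullet> Ks (m' j)) *\<^sub>R Ks (m' j) - (y j - u t \<bullet> Ks (m j)) *\<^sub>R Ks (m j))"
      by (simp add: x_def E.g_def E.L_def scaleR_diff_right[symmetric] sum_subtractf scaleR_diff_left)
    then have "norm (x t) = (1 / real n) * norm (\<Sum>j=1..n. (y j - u t \<bullet> Ks (m' j)) *\<^sub>R Ks (m' j) - (y j - u t \<bullet> Ks (m j)) *\<^sub>R Ks (m j))" by simp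
    also have "\<dots> \<le> (1 / real n) * (\<Sum>j=1..n. c0 * norm (Ks (m' j) - Ks (m j)))"
      by (intro mult_left_mono sum_norm_le one) auto
    also have "\<dots> = c0 * ((\<Sum>j=1..n. norm (Ks (m' j) - Ks (m j))) / real n)" by (simp add: sum_distrib_left[symmetric])
    also have "\<dots> \<le> c0 * sqrt D2" by (intro mult_left_mono mean_dist c0)
    finally show ?thesis .
  qed
  \<comment> \<open>\<open>e\<close> and \<open>d t\<close> lie in the closed span of
    \<open>Bh\<close>. The vector \<open>x t\<close> involves sections at second-stage points, for
    which this is not known, so it is measured by its norm.\<close>
  have dual: "C.dual_bound z (norm (T l z))" if "proj_on Bh z = z" for z
    unfolding C.dual_bound_def using inner_le_T[OF l that] by simp
  have e: "proj_on Bh e = e"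
    using proj by (simp add: e_def linear_scale[OF linear_proj] linear_sum[OF linear_proj])
  have d: "proj_on Bh (d t) = d t" for t
  proof -
    have "adjoint S (S (bias \<eta> t)) = (1 / \<eta>) *\<^sub>R (bias \<eta> t - bias \<eta> (Suc t))"
      using \<eta> by (simp add: bias_Suc[OF \<eta>(1) \<eta>1])
    then have "proj_on Bh (adjoint S (S (bias \<eta> t))) = adjoint S (S (bias \<eta> t))"
      by (simp add: linear_scale[OF linear_proj] linear_diff[OF linear_proj] proj_bias[OF \<eta>(1) \<eta>1])
    then show ?thesis
      using proj by (simp add: d_def linear_diff[OF linear_proj] linear_scale[OF linear_proj] linear_sum[OF linear_proj])
  qed
  define z where "z t = norm (T l e) + norm (T l (d t)) + norm (x t) / sqrt l" for t
  have z: "C.dual_bound (s t) (z t)" for t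
    unfolding s_eq z_def by (intro C.dual_bound_add dual e d C.dual_bound_norm)
  have Z: "C.Z t0 z \<le> real t0 * \<zeta>^2"
  proof -
    let ?c = "c0 * sqrt D2 / sqrt l"
    have c: "?c \<ge> 0" using c0 D2 l by simp
    have "(z t)^2 \<le> 3 * (A^2 + (norm (T l (d t)))^2 + ?c^2)" for t
    proof -
      have "(norm (T l e))^2 \<le> A^2" using noise by (intro power_mono) (auto simp: e_def)
      moreover have "(norm (x t) / sqrt l)^2 \<le> ?c^2" using x_norm l by (intro power_mono divide_right_mono) auto
      ultimately show ?thesis unfolding z_def by (intro order_trans[OF power2_sum3_le]) simp
    qed
    then have "C.Z t0 z \<le> (\<Sum>t\<le>t0. 3 * (A^2 + (norm (T l (d t)))^2 + ?c^2))"
      unfolding C.Z_def[OF \<eta> t0(2) \<eta>l q0 qS z] by (intro sum_mono)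
    also have "\<dots> = 3 * ((real t0 + 1) * A^2 + (\<Sum>t\<le>t0. (norm (T l (d t)))^2) + (real t0 + 1) * ?c^2)"
      by (simp add: sum_distrib_left[symmetric] sum.distrib add.commute)
    also have "\<dots> \<le> 3 * ((2 * real t0) * A^2 + real t0 * A^2 + (2 * real t0) * ?c^2)"
      using t0 drift by (intro mult_left_mono add_mono mult_right_mono) (auto simp: d_def)
    also have "\<dots> \<le> real t0 * (9 * A^2 + 9 * ?c^2)" by (simp add: algebra_simps mult_left_mono)
    also have "\<dots> \<le> real t0 * \<zeta>^2"
    proof (rule mult_left_mono)
      have "(3 * A + 3 * x)^2 = 9 * A^2 + 9 * x^2 + 18 * (A * x)" for x by (simp add: power2_eq_square algebra_simps)
      from this[of ?c] have "\<zeta>^2 = 9 * A^2 + 9 * ?c^2 + 18 * (A * ?c)" by (simp add: \<zeta>_def mult.assoc)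
      then show "9 * A^2 + 9 * ?c^2 \<le> \<zeta>^2" using mult_nonneg_nonneg[OF A c] by simp
    qed simp
    finally show ?thesis .
  qed
  have q_norm: "norm (q t) \<le> 9 * \<zeta> / sqrt l" if "t \<le> t0" for t
  proof (rule power2_le_imp_le)
    have "(norm (q t))^2 \<le> 66 * \<eta> * C.Z t0 z"
      by (rule C.energy_norm[OF \<eta> t0(2) \<eta>l q0 qS z]) (use that in simp)
    also have "\<dots> \<le> 66 * \<eta> * (real t0 * \<zeta>^2)" using \<eta> by (intro mult_left_mono Z) auto
    also have "\<dots> = 66 * \<zeta>^2 / l" using \<eta> t0 by (simp add: l_eq)
    also have "\<dots> \<le> 81 * \<zeta>^2 / l" using l by (intro divide_right_mono) auto
    also have "\<dots> = (9 * \<zeta> / sqrt l)^2" using l by (simp add: power_divide power_mult_distrib)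
    finally show "(norm (q t))^2 \<le> (9 * \<zeta> / sqrt l)^2" .
  qed (use \<zeta>_nonneg l in simp)
  have q_avg: "norm (S (tail_avg q)) \<le> 41 * \<zeta>"
  proof (rule power2_le_imp_le)
    have "(norm (S (tail_avg q)))^2 \<le> (2 / real t0) * (\<Sum>t\<le>t0. (norm (S (q t)))^2)" by (rule norm_S_tail_avg_sq)
    also have "\<dots> \<le> (2 / real t0) * (836 * (real t0 * \<zeta>^2))"
      using C.energy_prediction[OF \<eta> t0(2) \<eta>l q0 qS z] Z by (intro mult_left_mono) auto
    \<comment> \<open>\<open>2 * 836 = 1672 \<le> 1681 = 41^2\<close>.\<close>
    also have "\<dots> \<le> (41 * \<zeta>)^2" using t0 by (simp add: power_mult_distrib)
    finally show "(norm (S (tail_avg q)))^2 \<le> (41 * \<zeta>)^2" .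
  qed (use \<zeta>_nonneg in simp)
  have gd: "E.gd \<eta> h0 t = f + bias \<eta> t + q t" for t by (simp add: q_def u_def)
  interpret SGD: compared_sgd_sample n \<kappa> "\<lambda>j. Ks (m' j)" y b t0 \<eta> \<tau> h0 S l B V
  proof (unfold_locales)
    show "\<bar>E.gd \<eta> h0 t \<bullet> Ks (m' j) - y j\<bar> \<le> \<tau>" if "t \<le> t0" "j \<in> {1..n}" for t j
    proof -
      have "norm (E.gd \<eta> h0 t) \<le> norm (u t) + norm (q t)" unfolding gd u_def by (rule norm_triangle_ineq)
      then have "norm (E.gd \<eta> h0 t) \<le> norm f + norm v0 + 9 * \<zeta> / sqrt l" using u_norm[of t] q_norm[OF that(1)] by linarith
      then have "\<kappa> * norm (E.gd \<eta> h0 t) \<le> \<kappa> * (norm f + norm v0 + 9 * \<zeta> / sqrt l)" by (intro mult_left_mono \<kappa>)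
      then show ?thesis
        using inner_Ks_le[OF m'[OF that(2)], of "E.gd \<eta> h0 t"] y[OF that(2)] unfolding \<tau>_def by linarith
    qed
    show "S (adjoint S e) = (norm (adjoint S e))^2 *\<^sub>R e" if "e \<in> B" for e
      using S_adjoint_eigen[OF that] by (simp add: eig_norm)
    show "(\<Sum>e\<in>F. (norm (adjoint S e))^2) \<le> \<kappa>^2" if "F \<subseteq> B" "finite F" for F
      using that by (intro sum_norm_adjoint_le orthonormal_subset[OF LK.on])
    show "(\<Sum>e\<in>F. (norm (adjoint S e))^2 / ((norm (adjoint S e))^2 + l)) \<le> V" if "F \<subseteq> B" "finite F" for F
    proof -
      have "(\<Sum>e\<in>F. LK.eig e / (LK.eig e + l)) \<le> effective_dim LK l"
        unfolding LK.effective_dim_eq[OF l]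
        by (rule finite_sum_le_infsum[OF LK.degrees_of_freedom_summable[OF l]])
           (use that LK.eig_nonneg l in \<open>auto simp: add_nonneg_nonneg\<close>)
      then show ?thesis using V by (simp add: eig_norm)
    qed
  qed (use b \<eta> t0 l_eq LK.basis in auto)
  have \<tau>0: "\<tau> \<ge> 0" using M \<kappa> \<zeta>_nonneg l by (simp add: \<tau>_def)
  let ?E = "index_avg {1..b * t0} n"
  have tail: "?E (\<lambda>J. norm (S (SGD.tail_w J))) \<le> 42 * sqrt (\<eta> * l * V / real b) * \<tau>"
  proof (rule power2_le_imp_le)
    have "(?E (\<lambda>J. norm (S (SGD.tail_w J))))^2 \<le> ?E (\<lambda>J. (norm (S (SGD.tail_w J)))^2)"
      by (rule index_avg_power2_le) (use n in auto)
    also have "\<dots> \<le> 408 * SGD.c * l * V + 32 * SGD.c / (real t0)^2 * \<kappa>^2"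
      using SGD.E_prediction_le unfolding SGD.I_def .
    also have "32 * SGD.c / (real t0)^2 * \<kappa>^2 \<le> 8 * (SGD.c * l * V)"
    proof -
      have inv: "1 / real t0 = \<eta> * l" using \<eta> t0 by (simp add: l_eq)
      have t1: "\<eta> * l \<le> 1" unfolding inv[symmetric] using t0 by simp
      have "32 * SGD.c / (real t0)^2 * \<kappa>^2 = 32 * SGD.c * (1 / real t0)^2 * \<kappa>^2" by (simp add: power_divide)
      also have "\<dots> = 8 * (SGD.c * l) * ((4 * \<kappa>^2 * \<eta>) * (\<eta> * l))" unfolding inv by (simp add: power2_eq_square)
      also have "\<dots> \<le> 8 * (SGD.c * l) * (1 * 1)"
        using \<eta> l t1 SGD.c_nonneg by (intro mult_left_mono mult_mono) auto
      also have "\<dots> \<le> 8 * (SGD.c * l) * V" using V SGD.c_nonneg l by (intro mult_left_mono) auto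
      finally show ?thesis by (simp add: mult.assoc)
    qed
    \<comment> \<open>\<open>SGD.c\<close> contains a factor 4, and \<open>416 * 4 = 1664\<close> is
      covered by \<open>42^2 = 1764\<close>.\<close>
    also have "408 * SGD.c * l * V + 8 * (SGD.c * l * V) = 1664 * ((\<eta> * l * V / real b) * \<tau>^2)"
      by (simp add: SGD.c_def mult_ac)
    also have "\<dots> \<le> 1764 * ((\<eta> * l * V / real b) * \<tau>^2)" using \<eta> l V by (intro mult_right_mono) auto
    also have "\<dots> = (42 * sqrt (\<eta> * l * V / real b) * \<tau>)^2" using \<eta> l V by (simp add: power_mult_distrib)
    finally show "(?E (\<lambda>J. norm (S (SGD.tail_w J))))^2 \<le> (42 * sqrt (\<eta> * l * V / real b) * \<tau>)^2" by simp
  qed (use \<eta> l V \<tau>0 in simp)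
  have "avg_error n b t0 \<eta> m' y
      \<le> ?E (\<lambda>J. norm (S (SGD.tail_w J)) + (41 * \<zeta> + (2 * r * l) powr r * norm w))"
  proof (rule index_avg_mono)
    fix J
    have "tail_avg (E.iter b \<eta> h0 J) = tail_avg (\<lambda>t. SGD.w J t + (f + (bias \<eta> t + q t)))"
      by (simp add: SGD.w_def gd add.assoc)
    also have "\<dots> = SGD.tail_w J + (f + (tail_avg (bias \<eta>) + tail_avg q))"
      unfolding tail_avg_add tail_avg_const by (simp add: SGD.tail_w_def tail_average_def)
    finally have "S (tail_avg (E.iter b \<eta> h0 J)) - S f = S (SGD.tail_w J) + (S (tail_avg (bias \<eta>)) + S (tail_avg q))"
      by (simp add: linear_add[OF S_lin])
    then have "norm (S (tail_avg (E.iter b \<eta> h0 J)) - S f) \<le> norm (S (SGD.tail_w J)) + (norm (S (tail_avg (bias \<eta>))) + norm (S (tail_avg q)))"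
      using norm_triangle_ineq[of "S (SGD.tail_w J)" "S (tail_avg (bias \<eta>)) + S (tail_avg q)"]
        norm_triangle_ineq[of "S (tail_avg (bias \<eta>))" "S (tail_avg q)"] by simp
    then show "norm (S (tail_avg (E.iter b \<eta> h0 J)) - S f) \<le> norm (S (SGD.tail_w J)) + (41 * \<zeta> + (2 * r * l) powr r * norm w)"
      using tail_bias_le q_avg by linarith
  qed
  also have "\<dots> = ?E (\<lambda>J. norm (S (SGD.tail_w J))) + (41 * \<zeta> + (2 * r * l) powr r * norm w)"
    by (simp add: index_avg_add index_avg_const n)
  finally show ?thesis using tail by linarith
qed

text \<open>If \<open>D2 > l / 60\<close>, the factor \<open>60 * D2 / l\<close> exceeds 1 and pays
  for the crude bound. The estimate thus holds for every second stage and can be integrated over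
  it.\<close>

theorem batch_error_le:
  "avg_error n b t0 \<eta> m' y
    \<le> 42 * sqrt (\<eta> * l * V / real b) * \<tau> + 41 * \<zeta> + (2 * r * l) powr r * norm w
      + 60 * D2 / l * (\<kappa> * (norm h0 + norm f + M / sqrt l))"
proof (cases "D2 \<le> l / 60")
  case True
  have "0 \<le> 60 * D2 / l * (\<kappa> * (norm h0 + norm f + M / sqrt l))" using D2 l M \<kappa> by simp
  with good_error_le[OF True] show ?thesis by linarith
next
  case False
  let ?c = "\<kappa> * (norm h0 + norm f + M / sqrt l)"
  have "avg_error n b t0 \<eta> m' y \<le> index_avg {1..b * t0} n (\<lambda>_. ?c)"
    by (intro index_avg_mono crude_error_le) auto
  also have "\<dots> = ?c" by (simp add: index_avg_const n)
  also have "\<dots> \<le> 60 * D2 / l * ?c"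
  proof -
    have "1 * ?c \<le> 60 * D2 / l * ?c" using False l M \<kappa> by (intro mult_right_mono) (auto simp: field_simps)
    then show ?thesis by simp
  qed
  moreover have "0 \<le> 42 * sqrt (\<eta> * l * V / real b) * \<tau> + 41 * \<zeta> + (2 * r * l) powr r * norm w"
    using \<zeta>_nonneg \<eta> l V M \<kappa> by (simp add: \<tau>_def)
  ultimately show ?thesis by linarith
qed

text \<open>Everything is expressed through \<open>p = a^(-r)\<close> and
  \<open>X = D2 * a^(2 r + 1)\<close>, the second-stage error on the scale at which it affects the
  rate. \<open>p * sqrt a \<le> 1\<close> because \<open>r \<ge> 1/2\<close>, and
  \<open>sqrt X \<le> 1 + X\<close> makes the bound affine in \<open>D2\<close>.\<close>

theorem batch_rate_le:
  assumes a: "a \<ge> 1" and c: "c1 > 0" "c1 / a \<le> l" "l \<le> c2 / a" "\<eta> * l * V / real b \<le> c3 * a powr (- 2 * r)"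
    and A_eq: "A = A0 * \<Lambda> * a powr (- r)" and A0: "A0 \<ge> 0" and \<Lambda>: "\<Lambda> \<ge> 1"
  shows "avg_error n b t0 \<eta> m' y
    \<le> rate_const c1 c2 c3 A0 * \<Lambda> * a powr (- r) * (1 + D2 * a powr (2 * r + 1))"
proof -
  define X where "X = D2 * a powr (2 * r + 1)"
  define p where "p = a powr (- r)"
  have p: "p > 0" "p \<le> 1" using a r by (auto simp: p_def powr_minus_divide ge_one_powr_ge_zero)
  have X: "X \<ge> 0" using D2 by (simp add: X_def)
  have sa: "sqrt a = a powr (1 / 2)" using a by (simp add: powr_half_sqrt)
  have sl: "1 / sqrt l \<le> sqrt a / sqrt c1"
  proof -
    have "sqrt (c1 / a) \<le> sqrt l" using c by simp
    then have "1 / sqrt l \<le> 1 / sqrt (c1 / a)" using a c by (intro divide_left_mono) (auto intro!: mult_pos_pos l)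
    then show ?thesis by (simp add: real_sqrt_divide)
  qed
  have psa: "p * sqrt a \<le> 1"
  proof -
    have "p * sqrt a = a powr (1 / 2 - r)" unfolding p_def sa powr_add[symmetric] by simp
    also have "\<dots> \<le> a powr 0" using a r by (intro powr_mono) auto
    finally show ?thesis using a by simp
  qed
  have D2_eq: "D2 = X * p * p / a"
  proof -
    have "X * p * p / a = D2 * (a powr (2 * r + 1) * a powr (- r) * a powr (- r) * a powr (- 1))"
      using a by (simp add: X_def p_def powr_minus_divide)
    also have "\<dots> = D2" unfolding powr_add[symmetric] using a by simp
    finally show ?thesis ..
  qed
  have sX: "sqrt X \<le> 1 + X" using X by (intro real_le_lsqrt) (auto simp: power2_eq_square algebra_simps)
  have D: "sqrt D2 * sqrt a \<le> p * (1 + X)"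
  proof -
    have "sqrt D2 * sqrt a = p * sqrt X"
      using p a X by (simp add: D2_eq real_sqrt_mult real_sqrt_divide)
    then show ?thesis using sX p by simp
  qed
  have \<zeta>0: "\<zeta>0 c1 A0 \<ge> 0" using A0 c0 c by (simp add: \<zeta>0_def)
  have \<zeta>_le: "\<zeta> \<le> \<zeta>0 c1 A0 * \<Lambda> * p * (1 + X)"
  proof -
    have "sqrt D2 / sqrt l \<le> sqrt D2 * (sqrt a / sqrt c1)"
      using mult_left_mono[OF sl, of "sqrt D2"] D2 by simp
    also have "\<dots> \<le> p * (1 + X) / sqrt c1" using D c by (simp add: divide_right_mono)
    also have "\<dots> \<le> \<Lambda> * (p * (1 + X) / sqrt c1)"
      using mult_right_mono[OF \<Lambda>, of "p * (1 + X) / sqrt c1"] p X c by simp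
    finally have "3 * c0 * (sqrt D2 / sqrt l) \<le> 3 * c0 * (\<Lambda> * (p * (1 + X) / sqrt c1))" using c0 by (intro mult_left_mono) auto
    moreover have "3 * (A0 * \<Lambda> * p) * 1 \<le> 3 * (A0 * \<Lambda> * p) * (1 + X)" using A0 \<Lambda> p X by (intro mult_left_mono) auto
    moreover have "\<zeta> = 3 * (A0 * \<Lambda> * p) * 1 + 3 * c0 * (sqrt D2 / sqrt l)"
      unfolding \<zeta>_def by (simp add: A_eq p_def)
    moreover have "3 * (A0 * \<Lambda> * p) * (1 + X) + 3 * c0 * (\<Lambda> * (p * (1 + X) / sqrt c1)) = \<zeta>0 c1 A0 * \<Lambda> * p * (1 + X)"
      by (simp add: \<zeta>0_def distrib_right distrib_left add_divide_distrib mult.assoc)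
    ultimately show ?thesis by linarith
  qed
  have \<tau>_le: "\<tau> \<le> (M + \<kappa> * (norm f + norm v0 + 9 * (\<zeta>0 c1 A0 / sqrt c1))) * (\<Lambda> * (1 + X))"
  proof -
    have y: "1 \<le> \<Lambda> * (1 + X)" using mult_mono[of 1 \<Lambda> 1 "1 + X"] \<Lambda> X by simp
    have "\<zeta> / sqrt l \<le> (\<zeta>0 c1 A0 * \<Lambda> * p * (1 + X)) * (sqrt a / sqrt c1)"
      using mult_mono[OF \<zeta>_le sl] \<zeta>0 \<Lambda> p X l by simp
    also have "\<dots> = (\<zeta>0 c1 A0 / sqrt c1 * (\<Lambda> * (1 + X))) * (p * sqrt a)" by simp
    also have "\<dots> \<le> (\<zeta>0 c1 A0 / sqrt c1 * (\<Lambda> * (1 + X))) * 1"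
      using \<zeta>0 c \<Lambda> X by (intro mult_left_mono psa) auto
    finally have z: "\<zeta> / sqrt l \<le> \<zeta>0 c1 A0 / sqrt c1 * (\<Lambda> * (1 + X))" by simp
    have "norm f + norm v0 + 9 * \<zeta> / sqrt l \<le> (norm f + norm v0) * (\<Lambda> * (1 + X)) + 9 * (\<zeta>0 c1 A0 / sqrt c1 * (\<Lambda> * (1 + X)))"
      using z mult_left_mono[OF y, of "norm f + norm v0"] by simp
    also have "\<dots> = (norm f + norm v0 + 9 * (\<zeta>0 c1 A0 / sqrt c1)) * (\<Lambda> * (1 + X))" by (simp add: algebra_simps)
    finally have "\<kappa> * (norm f + norm v0 + 9 * \<zeta> / sqrt l) \<le> \<kappa> * ((norm f + norm v0 + 9 * (\<zeta>0 c1 A0 / sqrt c1)) * (\<Lambda> * (1 + X)))"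
      by (intro mult_left_mono \<kappa>)
    moreover have "M * 1 \<le> M * (\<Lambda> * (1 + X))" using M y by (intro mult_left_mono) auto
    ultimately show ?thesis by (simp add: \<tau>_def distrib_right mult.assoc)
  qed
  have \<tau>0: "\<tau> \<ge> 0" using M \<kappa> \<zeta>_nonneg l by (simp add: \<tau>_def)
  have sq_le: "sqrt (\<eta> * l * V / real b) \<le> sqrt c3 * p"
  proof -
    have "sqrt (\<eta> * l * V / real b) \<le> sqrt (c3 * a powr (- 2 * r))" using c by simp
    also have "a powr (- 2 * r) = p^2" unfolding p_def power2_eq_square powr_add[symmetric] by simp
    finally show ?thesis using p by (simp add: real_sqrt_mult)
  qed
  have "0 \<le> sqrt c3 * p" by (rule order_trans[OF _ sq_le]) (use \<eta> l V in simp)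
  then have t1: "42 * sqrt (\<eta> * l * V / real b) * \<tau> \<le> 42 * (sqrt c3 * p) * ((M + \<kappa> * (norm f + norm v0 + 9 * (\<zeta>0 c1 A0 / sqrt c1))) * (\<Lambda> * (1 + X)))"
    using sq_le \<tau>0 \<tau>_le by (intro mult_mono mult_left_mono) auto
  have t3: "(2 * r * l) powr r * norm w \<le> (2 * r * c2) powr r * norm w * (\<Lambda> * p * (1 + X))"
  proof -
    have "(2 * r * l) powr r \<le> (2 * r * c2 * (1 / a)) powr r"
      using r l mult_left_mono[OF c(3), of "2 * r"] by (intro powr_mono2) auto
    also have "\<dots> = (2 * r * c2) powr r * p"
    proof -
      have "0 < c2 / a" using l c(3) by linarith
      then have "c2 > 0" using a by (simp add: zero_less_divide_iff)
      then have "(2 * r * c2 * (1 / a)) powr r = (2 * r * c2) powr r * (1 / a) powr r" using r a by (intro powr_mult)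
      then show ?thesis using a by (simp add: p_def powr_divide powr_minus_divide)
    qed
    finally have "(2 * r * l) powr r * norm w \<le> (2 * r * c2) powr r * p * norm w * 1" by (simp add: mult_right_mono)
    also have "\<dots> \<le> (2 * r * c2) powr r * p * norm w * (\<Lambda> * (1 + X))"
      using mult_mono[of 1 \<Lambda> 1 "1 + X"] \<Lambda> X p by (intro mult_left_mono) auto
    finally show ?thesis by (simp add: mult_ac)
  qed
  have t4: "60 * D2 / l * (\<kappa> * (norm h0 + norm f + M / sqrt l))
      \<le> 60 * (\<kappa> * (norm h0 + norm f + M / sqrt c1) / c1) * (\<Lambda> * p * (1 + X))"
  proof -
    let ?H = "norm h0 + norm f"
    have "sqrt a \<ge> 1" using a by simp
    then have "?H * 1 \<le> ?H * sqrt a" by (intro mult_left_mono) auto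
    moreover have "M * (1 / sqrt l) \<le> M * (sqrt a / sqrt c1)" using M by (intro mult_left_mono sl) auto
    ultimately have "?H + M / sqrt l \<le> (?H + M / sqrt c1) * sqrt a" by (simp add: distrib_right)
    moreover have "D2 / l \<le> X * p * p / c1"
    proof -
      have "c1 \<le> l * a" using c a by (simp add: pos_divide_le_eq)
      then have "1 / (l * a) \<le> 1 / c1" using c l a by (intro divide_left_mono) auto
      then have "X * p * p * (1 / (l * a)) \<le> X * p * p * (1 / c1)" using X p by (intro mult_left_mono) auto
      then show ?thesis unfolding D2_eq by (simp add: mult_ac)
    qed
    ultimately have "(D2 / l) * (\<kappa> * (?H + M / sqrt l)) \<le> (X * p * p / c1) * (\<kappa> * ((?H + M / sqrt c1) * sqrt a))"
      using X p c M \<kappa> D2 l by (intro mult_mono mult_left_mono) auto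
    also have "\<dots> = (\<kappa> * (?H + M / sqrt c1) / c1) * (X * p) * (p * sqrt a)" by simp
    also have "\<dots> \<le> (\<kappa> * (?H + M / sqrt c1) / c1) * (X * p) * 1"
      using \<kappa> M c X p by (intro mult_left_mono psa) auto
    also have "\<dots> \<le> (\<kappa> * (?H + M / sqrt c1) / c1) * (\<Lambda> * p * (1 + X))"
    proof -
      have "X \<le> \<Lambda> * (1 + X)" using mult_mono[of 1 \<Lambda> X "1 + X"] \<Lambda> X by simp
      then have "X * p \<le> \<Lambda> * (1 + X) * p" using p by (intro mult_right_mono) auto
      then have "X * p \<le> \<Lambda> * p * (1 + X)" by (simp add: mult_ac)
      then show ?thesis unfolding mult_1_right using \<kappa> M c by (intro mult_left_mono) auto
    qed
    finally have "60 * ((D2 / l) * (\<kappa> * (?H + M / sqrt l))) \<le> 60 * ((\<kappa> * (?H + M / sqrt c1) / c1) * (\<Lambda> * p * (1 + X)))"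
      by simp
    then show ?thesis by simp
  qed
  have "avg_error n b t0 \<eta> m' y
      \<le> 42 * (sqrt c3 * p) * ((M + \<kappa> * (norm f + norm v0 + 9 * (\<zeta>0 c1 A0 / sqrt c1))) * (\<Lambda> * (1 + X)))
       + 41 * (\<zeta>0 c1 A0 * \<Lambda> * p * (1 + X)) + (2 * r * c2) powr r * norm w * (\<Lambda> * p * (1 + X))
       + 60 * (\<kappa> * (norm h0 + norm f + M / sqrt c1) / c1) * (\<Lambda> * p * (1 + X))"
    using batch_error_le t1 \<zeta>_le t3 t4 by linarith
  also have "\<dots> = rate_const c1 c2 c3 A0 * (\<Lambda> * p * (1 + X))"
  proof -
    have "42 * (u * p) * (t * (\<Lambda> * (1 + X))) + 41 * (z * \<Lambda> * p * (1 + X)) + v * (\<Lambda> * p * (1 + X)) + x * (\<Lambda> * p * (1 + X))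
        = (42 * u * t + 41 * z + v + x) * (\<Lambda> * p * (1 + X))" for u t z v x :: real
      by (simp add: algebra_simps)
    then show ?thesis unfolding rate_const_def .
  qed
  finally show ?thesis by (simp add: X_def p_def mult.assoc)
qed

end

end

section \<open>Mean embeddings\<close>

context population
begin

text \<open>\<open>conditional_distribution\<close> describes \<open>\<rho>\<close> on sets. It is
  rewritten as the bind of \<open>\<rho>\<mu>\<close> with the images of \<open>\<rho>y m\<close>
  under \<open>y \<mapsto> (m, y)\<close>, for which integrals of bounded functions can be
  iterated.\<close>

lemma integral_disintegrate:
  fixes F :: "'g \<times> real \<Rightarrow> real"
  assumes cond: "conditional_distribution \<rho> \<rho>\<mu> Y \<rho>y" and F: "F \<in> borel_measurable \<rho>" "\<And>p. p \<in> space \<rho> \<Longrightarrow> \<bar>F p\<bar> \<le> c"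
  shows "(\<integral>p. F p \<partial>\<rho>) = (\<integral>m. \<integral>y. F (m, y) \<partial>\<rho>y m \<partial>\<rho>\<mu>)"
proof -
  let ?Y = "restrict_space borel Y" and ?X = "restrict_space borel P"
  have k: "\<rho>y \<in> ?X \<rightarrow>\<^sub>M prob_algebra ?Y"
    using cond unfolding conditional_distribution_def measurable_cong_sets[OF sets_\<rho>\<mu> refl] by blast
  have k': "\<rho>y \<in> ?X \<rightarrow>\<^sub>M subprob_algebra ?Y" by (rule measurable_prob_algebraD[OF k])
  have sets_k: "sets (\<rho>y m) = sets ?Y" if "m \<in> P" for m
    using measurable_space[OF k, of m] that by (simp add: space_prob_algebra space_restrict_space)
  define \<kappa>' where "\<kappa>' m = distr (\<rho>y m) (?X \<Otimes>\<^sub>M ?Y) (Pair m)" for m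
  have pair: "Pair m \<in> \<rho>y m \<rightarrow>\<^sub>M ?X \<Otimes>\<^sub>M ?Y" if "m \<in> P" for m
    unfolding measurable_cong_sets[OF sets_k[OF that] refl] using that by (intro measurable_Pair1') (simp add: space_restrict_space)
  have \<kappa>': "\<kappa>' \<in> \<rho>\<mu> \<rightarrow>\<^sub>M subprob_algebra (?X \<Otimes>\<^sub>M ?Y)"
    unfolding measurable_cong_sets[OF sets_\<rho>\<mu> refl] \<kappa>'_def by (rule measurable_distr2[OF _ k']) simp
  have ne: "space \<rho>\<mu> \<noteq> {}" by (rule \<rho>\<mu>.not_empty)
  have "\<rho> = \<rho>\<mu> \<bind> \<kappa>'"
  proof (rule measure_eqI)
    show "sets \<rho> = sets (\<rho>\<mu> \<bind> \<kappa>')" using sets_bind[OF sets_kernel[OF \<kappa>'] ne] \<rho>_sets by simp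
    fix A assume A: "A \<in> sets \<rho>"
    then have A': "A \<in> sets (?X \<Otimes>\<^sub>M ?Y)" using \<rho>_sets by simp
    have "emeasure \<rho> A = (\<integral>\<^sup>+m. emeasure (\<rho>y m) {y. (m, y) \<in> A} \<partial>\<rho>\<mu>)"
      using cond A unfolding conditional_distribution_def by blast
    also have "\<dots> = (\<integral>\<^sup>+m. emeasure (\<kappa>' m) A \<partial>\<rho>\<mu>)"
    proof (rule nn_integral_cong)
      fix m assume "m \<in> space \<rho>\<mu>"
      then have m: "m \<in> P" by (simp add: space_\<rho>\<mu>)
      have "Pair m -` A \<inter> space (\<rho>y m) = {y. (m, y) \<in> A}"
        using sets.sets_into_space[OF A] sets_eq_imp_space_eq[OF sets_k[OF m]] by (auto simp: space_\<rho> space_restrict_space)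
      then show "emeasure (\<rho>y m) {y. (m, y) \<in> A} = emeasure (\<kappa>' m) A"
        unfolding \<kappa>'_def by (subst emeasure_distr[OF pair[OF m] A']) simp
    qed
    also have "\<dots> = emeasure (\<rho>\<mu> \<bind> \<kappa>') A" by (rule emeasure_bind[OF ne \<kappa>' A', symmetric])
    finally show "emeasure \<rho> A = emeasure (\<rho>\<mu> \<bind> \<kappa>') A" .
  qed
  then have "(\<integral>p. F p \<partial>\<rho>) = (\<integral>p. F p \<partial>join (distr \<rho>\<mu> (subprob_algebra (?X \<Otimes>\<^sub>M ?Y)) \<kappa>'))"
    using bind_nonempty''[OF \<kappa>' ne] by simp
  also have "\<dots> = (\<integral>M'. integral\<^sup>L M' F \<partial>distr \<rho>\<mu> (subprob_algebra (?X \<Otimes>\<^sub>M ?Y)) \<kappa>')"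
  proof (rule integral_join[where B = c and B' = 1])
    show "F \<in> borel_measurable (?X \<Otimes>\<^sub>M ?Y)" using F(1) unfolding measurable_cong_sets[OF \<rho>_sets refl] .
    show "\<bar>F x\<bar> \<le> c" if "x \<in> space (?X \<Otimes>\<^sub>M ?Y)" for x using F(2) that sets_eq_imp_space_eq[OF \<rho>_sets] by simp
    show "finite_measure (distr \<rho>\<mu> (subprob_algebra (?X \<Otimes>\<^sub>M ?Y)) \<kappa>')"
      using \<rho>\<mu>.prob_space_distr[OF \<kappa>'] by (rule prob_space.finite_measure)
    show "AE M' in distr \<rho>\<mu> (subprob_algebra (?X \<Otimes>\<^sub>M ?Y)) \<kappa>'. emeasure M' (space M') \<le> ennreal 1"
      by (rule AE_I2) (auto simp: space_subprob_algebra subprob_space.emeasure_space_le_1)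
  qed simp
  also have "\<dots> = (\<integral>m. integral\<^sup>L (\<kappa>' m) F \<partial>\<rho>\<mu>)"
    by (rule integral_distr[OF \<kappa>' integral_measurable_subprob_algebra]) (use F(1) measurable_cong_sets[OF \<rho>_sets refl] in blast)
  also have "\<dots> = (\<integral>m. \<integral>y. F (m, y) \<partial>\<rho>y m \<partial>\<rho>\<mu>)"
    unfolding \<kappa>'_def
    by (intro Bochner_Integration.integral_cong refl integral_distr pair)
       (use F(1) measurable_cong_sets[OF \<rho>_sets refl] space_\<rho>\<mu> in auto)
  finally show ?thesis .
qed

text \<open>After disintegration the label tested against \<open>h\<close> gives the inner product
  of \<open>S h\<close> with the class of the regression function, which is
  \<open>S h \<bullet> S f\<close>.\<close>

lemma regression_noise_mean:
  assumes cond: "conditional_distribution \<rho> \<rho>\<mu> Y \<rho>y" and Y: "Y \<subseteq> {-M..M}"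
    and f: "S f = cls (\<lambda>m. \<integral>y. y \<partial>\<rho>y m)"
  shows "(\<integral>p. (snd p - f \<bullet> Ks (fst p)) * (h \<bullet> Ks (fst p)) \<partial>\<rho>) = 0"
proof -
  let ?\<phi> = "\<lambda>m. \<integral>y. y \<partial>\<rho>y m"
  have k: "\<rho>y \<in> restrict_space borel P \<rightarrow>\<^sub>M prob_algebra (restrict_space borel Y)"
    using cond unfolding conditional_distribution_def measurable_cong_sets[OF sets_\<rho>\<mu> refl] by blast
  have pr: "prob_space (\<rho>y m)" "space (\<rho>y m) = Y" if "m \<in> P" for m
    using measurable_space[OF k, of m] that sets_eq_imp_space_eq[of "\<rho>y m" "restrict_space borel Y"]
    by (auto simp: space_prob_algebra space_restrict_space)
  have \<phi>: "?\<phi> \<in> borel_measurable \<rho>\<mu>"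
    unfolding measurable_cong_sets[OF sets_\<rho>\<mu> refl]
    by (rule measurable_compose[OF measurable_prob_algebraD[OF k] integral_measurable_subprob_algebra])
       (simp add: measurable_restrict_space1)
  have Mb: "\<bar>y\<bar> \<le> \<bar>M\<bar>" if "y \<in> Y" for y using Y that by force
  have "\<bar>?\<phi> m\<bar> \<le> \<bar>M\<bar>" if m: "m \<in> P" for m
  proof -
    interpret k: prob_space "\<rho>y m" by (rule pr[OF m])
    have "\<bar>?\<phi> m\<bar> \<le> (\<integral>y. \<bar>M\<bar> \<partial>\<rho>y m)"
      using integral_abs_bound[of "\<rho>y m" "\<lambda>y. y"]
      by (rule order_trans) (intro integral_mono_AE' AE_I2, auto simp: pr[OF m] Mb)
    then show ?thesis by (simp add: k.prob_space)
  qed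
  then have sq: "square_integrable \<rho>\<mu> ?\<phi>" by (rule square_integrable_bounded[OF \<phi>])
  have i1: "integrable \<rho> (\<lambda>p. snd p * (h \<bullet> Ks (fst p)))"
  proof (rule \<rho>.integrable_const_bound[OF AE_I2])
    show "norm (snd p * (h \<bullet> Ks (fst p))) \<le> \<bar>M\<bar> * (\<kappa> * norm h)" if "p \<in> space \<rho>" for p
      using that inner_Ks_le[of "fst p" h] Mb by (auto simp: space_\<rho> abs_mult intro!: mult_mono)
  qed (intro borel_measurable_times snd_\<rho> eval_measurable_\<rho>)
  have i2: "integrable \<rho> (\<lambda>p. (f \<bullet> Ks (fst p)) * (h \<bullet> Ks (fst p)))"
  proof (rule \<rho>.integrable_const_bound[OF AE_I2])
    show "norm ((f \<bullet> Ks (fst p)) * (h \<bullet> Ks (fst p))) \<le> (\<kappa> * norm f) * (\<kappa> * norm h)" if "p \<in> space \<rho>" for p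
      using that inner_Ks_le[of "fst p"] \<kappa> by (auto simp: space_\<rho> abs_mult intro!: mult_mono)
  qed (intro borel_measurable_times eval_measurable_\<rho>)
  have "(\<integral>p. snd p * (h \<bullet> Ks (fst p)) \<partial>\<rho>) = (\<integral>m. \<integral>y. snd (m, y) * (h \<bullet> Ks (fst (m, y))) \<partial>\<rho>y m \<partial>\<rho>\<mu>)"
  proof (rule integral_disintegrate[OF cond])
    show "\<bar>snd p * (h \<bullet> Ks (fst p))\<bar> \<le> \<bar>M\<bar> * (\<kappa> * norm h)" if "p \<in> space \<rho>" for p
      using that inner_Ks_le[of "fst p" h] Mb by (auto simp: space_\<rho> abs_mult intro!: mult_mono)
  qed (intro borel_measurable_times snd_\<rho> eval_measurable_\<rho>)
  also have "\<dots> = S h \<bullet> cls ?\<phi>" unfolding inner_S_cls[OF sq] by (simp add: mult.commute)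
  finally show ?thesis
    using i1 i2 by (simp add: left_diff_distrib inner_S_\<rho>[symmetric] f[symmetric] inner_commute)
qed

end

text \<open>The squared distance of two sections is \<open>G x x - 2 * G x a + G a a\<close>,
  continuous in \<open>x\<close> and 0 at \<open>a\<close>.\<close>

lemma kernel_section_continuous:
  fixes G :: "'x::topological_space \<Rightarrow> 'x \<Rightarrow> real" and evG :: "'g::{real_inner,banach} \<Rightarrow> 'x \<Rightarrow> real"
  assumes G: "mercer_kernel G" and HG: "rkhs_on UNIV G evG"
  shows "continuous_on UNIV (kernel_section UNIV G evG)"
proof -
  let ?g = "kernel_section UNIV G evG"
  have cont: "continuous_on UNIV (\<lambda>p. G (fst p) (snd p))"
    using G unfolding mercer_kernel_def by (simp add: case_prod_unfold)
  have sym: "G s t = G t s" for s t using G unfolding mercer_kernel_def by blast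
  have "(?g \<longlongrightarrow> ?g a) (at a)" for a
  proof -
    have eq: "dist (?g x) (?g a) = sqrt (G x x - 2 * G x a + G a a)" for x
      using sym unfolding dist_norm norm_eq_sqrt_inner
      by (simp add: inner_diff_left inner_diff_right rkhs_inner_sections[OF HG])
    have c: "continuous_on UNIV (\<lambda>x. G (fst (x, h x)) (snd (x, h x)))" if "continuous_on UNIV h" for h
      by (rule continuous_on_compose2[OF cont]) (intro continuous_on_Pair continuous_on_id that, simp)
    have "continuous_on UNIV (\<lambda>x. sqrt (G x x - 2 * G x a + G a a))"
      using c[OF continuous_on_id] c[OF continuous_on_const]
      by (intro continuous_on_real_sqrt continuous_on_add continuous_on_diff continuous_on_mult continuous_on_const) simp_all
    then have "((\<lambda>x. sqrt (G x x - 2 * G x a + G a a)) \<longlongrightarrow> sqrt (G a a - 2 * G a a + G a a)) (at a)"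
      unfolding continuous_on_def by blast
    then have "((\<lambda>x. dist (?g x) (?g a)) \<longlongrightarrow> 0) (at a)" unfolding eq by simp
    then show ?thesis by (rule tendsto_dist_iff[THEN iffD2])
  qed
  then show ?thesis by (simp add: continuous_on_def)
qed

locale mean_embedded =
  fixes G :: "'x::topological_space \<Rightarrow> 'x \<Rightarrow> real"
    and evG :: "'g::{real_inner,banach,second_countable_topology} \<Rightarrow> 'x \<Rightarrow> real" and \<gamma> :: real
  assumes G: "mercer_kernel G" and HG: "rkhs_on UNIV G evG" and G_le: "G s s \<le> \<gamma>^2" and \<gamma>: "\<gamma> \<ge> 0"
begin

abbreviation "Gs \<equiv> kernel_section UNIV G evG"
abbreviation "\<mu> \<equiv> mean_embedding G evG"

lemma norm_Gs: "norm (Gs s) \<le> \<gamma>"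
  by (rule power2_le_imp_le[OF _ \<gamma>]) (simp add: power2_norm_eq_inner rkhs_inner_sections[OF HG] G_le)

lemma Gs_measurable [measurable]: "Gs \<in> borel_measurable borel"
  by (rule borel_measurable_continuous_onI[OF kernel_section_continuous[OF G HG]])

lemma mean_embedding_measurable:
  "\<mu> \<in> prob_algebra borel \<rightarrow>\<^sub>M restrict_space borel (mean_embeddings G evG)"
proof (rule measurable_restrict_space2)
  show "\<mu> \<in> space (prob_algebra borel) \<rightarrow> mean_embeddings G evG"
    by (auto simp: mean_embeddings_def space_prob_algebra)
  have "(\<lambda>x. integral\<^sup>L x Gs) \<in> borel_measurable (prob_algebra borel)"
    unfolding prob_algebra_def by (intro measurable_restrict_space1 integral_measurable_subprob_algebra Gs_measurable)
  then show "\<mu> \<in> borel_measurable (prob_algebra borel)" by (simp add: mean_embedding_def[abs_def])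
qed

text \<open>It is the mean embedding of the empirical measure, the image of the uniform law on
  \<open>{1..N}\<close>, where every map is measurable. Hence \<open>K\<close> and the Hoelder
  condition apply at second-stage points.\<close>

lemma empirical_mean_embedding:
  assumes N: "N > 0"
  shows "(1 / real N) *\<^sub>R (\<Sum>i=1..N. Gs (z i)) \<in> mean_embeddings G evG"
proof -
  let ?U = "uniform_count_measure {1..N}"
  let ?x = "distr ?U borel z"
  interpret U: prob_space ?U by (rule prob_space_uniform_count_measure) (use N in auto)
  have z: "z \<in> ?U \<rightarrow>\<^sub>M borel" by (simp add: measurable_def sets_uniform_count_measure space_uniform_count_measure)
  have "\<mu> ?x = (\<integral>i. Gs (z i) \<partial>?U)"
    unfolding mean_embedding_def by (rule integral_distr[OF z Gs_measurable])
  also have "\<dots> = (\<Sum>i=1..N. (1 / real N) *\<^sub>R Gs (z i))"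
    unfolding uniform_count_measure_def by (subst lebesgue_integral_point_measure_finite) auto
  finally have "\<mu> ?x = (1 / real N) *\<^sub>R (\<Sum>i=1..N. Gs (z i))" by (simp add: scaleR_sum_right)
  moreover have "prob_space ?x" "sets ?x = sets borel" using U.prob_space_distr[OF z] by auto
  ultimately show ?thesis unfolding mean_embeddings_def by (metis (mono_tags, lifting) image_eqI mem_Collect_eq)
qed

context
  fixes x :: "'x measure" assumes x: "prob_space x" "sets x = sets borel"
begin

interpretation x: prob_space x by (rule x)

lemma Gs_measurable': "Gs \<in> borel_measurable x"
  unfolding measurable_cong_sets[OF x(2) refl] by (rule Gs_measurable)

lemma Gs_integrable: "integrable x Gs"
  by (rule x.integrable_const_bound[OF AE_I2 Gs_measurable']) (rule norm_Gs)

lemma inner_mean_embedding: "h \<bullet> \<mu> x = (\<integral>s. h \<bullet> Gs s \<partial>x)"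
  unfolding mean_embedding_def by (rule integral_inner_right[OF Gs_integrable, symmetric])

lemma norm_mean_embedding: "norm (\<mu> x) \<le> \<gamma>"
proof -
  have "norm (\<mu> x) \<le> (\<integral>s. norm (Gs s) \<partial>x)" unfolding mean_embedding_def by simp
  also have "\<dots> \<le> (\<integral>s. \<gamma> \<partial>x)" using Gs_integrable norm_Gs by (intro integral_mono) auto
  finally show ?thesis by (simp add: x.prob_space)
qed

lemma centered_Gs: "centered_vectors x (\<lambda>s. Gs s - \<mu> x) (2 * \<gamma>) (\<gamma>^2)"
proof (intro centered_vectors.intro centered_vectors_axioms.intro x(1))
  have [measurable]: "Gs \<in> borel_measurable x" by (rule Gs_measurable')
  show "(\<lambda>m. s \<bullet> (Gs m - \<mu> x)) \<in> borel_measurable x" for s by measurable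
  show "(\<lambda>(m, m'). (Gs m - \<mu> x) \<bullet> (Gs m' - \<mu> x)) \<in> borel_measurable (x \<Otimes>\<^sub>M x)" by measurable
  show "norm (Gs m - \<mu> x) \<le> 2 * \<gamma>" for m
    using norm_triangle_ineq4[of "Gs m" "\<mu> x"] norm_Gs[of m] norm_mean_embedding by linarith
  have i: "integrable x (\<lambda>m. s \<bullet> Gs m)" for s using Gs_integrable by simp
  show "(\<integral>m. s \<bullet> (Gs m - \<mu> x) \<partial>x) = 0" for s
    using i by (simp add: inner_diff_right inner_mean_embedding[symmetric] x.prob_space)
  have i2: "integrable x (\<lambda>m. (norm (Gs m))^2)"
    by (rule x.integrable_const_bound[OF AE_I2, of _ "\<gamma>^2"]) (auto intro!: power_mono norm_Gs)
  have "(\<integral>m. (norm (Gs m - \<mu> x))^2 \<partial>x) = (\<integral>m. (norm (Gs m))^2 - 2 * (\<mu> x \<bullet> Gs m) + (norm (\<mu> x))^2 \<partial>x)"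
    by (intro Bochner_Integration.integral_cong refl)
       (simp add: power2_norm_eq_inner inner_diff_left inner_diff_right inner_commute)
  also have "\<dots> = (\<integral>m. (norm (Gs m))^2 \<partial>x) - (norm (\<mu> x))^2"
    using i2 i by (simp add: inner_mean_embedding[symmetric] x.prob_space power2_norm_eq_inner)
  also have "\<dots> \<le> (\<integral>m. \<gamma>^2 \<partial>x)"
  proof -
    have "(\<integral>m. (norm (Gs m))^2 \<partial>x) \<le> (\<integral>m. \<gamma>^2 \<partial>x)"
      using i2 by (intro integral_mono) (auto intro!: power_mono norm_Gs)
    then show ?thesis using zero_le_power2[of "norm (\<mu> x)"] by linarith
  qed
  finally show "(\<integral>m. (norm (Gs m - \<mu> x))^2 \<partial>x) \<le> \<gamma>^2" by (simp add: x.prob_space)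
qed

lemma embedding_error_measurable:
  "(\<lambda>z. (norm ((1 / real N) *\<^sub>R (\<Sum>i=1..N. Gs (z i)) - \<mu> x))^2) \<in> borel_measurable (\<Pi>\<^sub>M i\<in>{1..N}. x)"
proof -
  have "(\<lambda>z. Gs (z i)) \<in> borel_measurable (\<Pi>\<^sub>M i\<in>{1..N}. x)" if "i \<in> {1..N}" for i
    by (rule measurable_compose[OF measurable_component_singleton[OF that] Gs_measurable'])
  then show ?thesis
    by (intro borel_measurable_power measurable_compose[OF _ borel_measurable_norm] borel_measurable_diff borel_measurable_scaleR
        borel_measurable_sum borel_measurable_const)
qed

lemma embedding_error_le:
  assumes N: "N > 0"
  shows "(\<integral>\<^sup>+z. ennreal ((norm ((1 / real N) *\<^sub>R (\<Sum>i=1..N. Gs (z i)) - \<mu> x))^2) \<partial>(\<Pi>\<^sub>M i\<in>{1..N}. x)) \<le> ennreal (\<gamma>^2 / real N)"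
proof -
  interpret centered_vectors x "\<lambda>s. Gs s - \<mu> x" "2 * \<gamma>" "\<gamma>^2" by (rule centered_Gs)
  let ?P = "\<Pi>\<^sub>M i\<in>{1..N}. x"
  have eq: "(norm ((1 / real N) *\<^sub>R (\<Sum>i=1..N. Gs (z i)) - \<mu> x))^2 = (1 / (real N)^2) * (norm (\<Sum>i=1..N. Gs (z i) - \<mu> x))^2" for z
  proof -
    have "(1 / real N) *\<^sub>R (\<Sum>i=1..N. Gs (z i)) - \<mu> x = (1 / real N) *\<^sub>R (\<Sum>i=1..N. Gs (z i) - \<mu> x)"
      using N by (simp add: sum_subtractf scaleR_diff_right sum_constant_scaleR)
    then show ?thesis by (simp add: power_divide)
  qed
  have "(\<integral>\<^sup>+z. ennreal ((norm ((1 / real N) *\<^sub>R (\<Sum>i=1..N. Gs (z i)) - \<mu> x))^2) \<partial>?P)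
      = ennreal (1 / (real N)^2) * (\<integral>\<^sup>+z. ennreal ((norm (\<Sum>i=1..N. Gs (z i) - \<mu> x))^2) \<partial>?P)"
    unfolding eq ennreal_mult'[OF zero_le_divide_1_iff[THEN iffD2, OF zero_le_power2[of "real N"]]]
    by (rule nn_integral_cmult)
       (rule measurable_compose[OF borel_measurable_power[OF sum_norm_meas] measurable_ennreal])
  also have "\<dots> \<le> ennreal (1 / (real N)^2) * ennreal (real N * \<gamma>^2)"
    by (intro mult_left_mono second_moment_sum) simp
  also have "\<dots> = ennreal (\<gamma>^2 / real N)"
    using N by (simp add: ennreal_mult'[symmetric] power2_eq_square[of "real N"])
  finally show ?thesis .
qed

end

text \<open>By linearity over \<open>j\<close>: each marginal is an \<open>N\<close>-fold product,
  where the variance bound \<open>\<gamma>^2 / N\<close> applies.\<close>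

lemma second_stage_error_le:
  assumes x: "\<And>j. j \<in> {1..n} \<Longrightarrow> prob_space (x j) \<and> sets (x j) = sets borel" and N: "N > 0" and n: "n > 0"
  shows "(\<integral>\<^sup>+z. ennreal ((\<Sum>j=1..n. (norm ((1 / real N) *\<^sub>R (\<Sum>i=1..N. Gs (z j i)) - \<mu> (x j)))^2) / real n)
      \<partial>(\<Pi>\<^sub>M j\<in>{1..n}. \<Pi>\<^sub>M i\<in>{1..N}. x j)) \<le> ennreal (\<gamma>^2 / real N)"
    and "(\<lambda>z. (\<Sum>j=1..n. (norm ((1 / real N) *\<^sub>R (\<Sum>i=1..N. Gs (z j i)) - \<mu> (x j)))^2) / real n)
      \<in> borel_measurable (\<Pi>\<^sub>M j\<in>{1..n}. \<Pi>\<^sub>M i\<in>{1..N}. x j)"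
proof -
  let ?P = "\<Pi>\<^sub>M j\<in>{1..n}. \<Pi>\<^sub>M i\<in>{1..N}. x j"
  let ?e = "\<lambda>j z. (norm ((1 / real N) *\<^sub>R (\<Sum>i=1..N. Gs (z i)) - \<mu> (x j)))^2"
  have comp: "(\<lambda>z. z j) \<in> ?P \<rightarrow>\<^sub>M (\<Pi>\<^sub>M i\<in>{1..N}. x j)" if "j \<in> {1..n}" for j
    by (rule measurable_component_singleton[OF that])
  have e: "?e j \<in> borel_measurable (\<Pi>\<^sub>M i\<in>{1..N}. x j)" if "j \<in> {1..n}" for j
    using x[OF that] by (intro embedding_error_measurable) auto
  have m: "(\<lambda>z. ?e j (z j)) \<in> borel_measurable ?P" if "j \<in> {1..n}" for j
    by (rule measurable_compose[OF comp[OF that] e[OF that]])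
  then show meas: "(\<lambda>z. (\<Sum>j=1..n. ?e j (z j)) / real n) \<in> borel_measurable ?P"
    by (intro borel_measurable_divide borel_measurable_sum borel_measurable_const)
  have "(\<integral>\<^sup>+z. ennreal ((\<Sum>j=1..n. ?e j (z j)) / real n) \<partial>?P) = (\<integral>\<^sup>+z. (\<Sum>j=1..n. ennreal (1 / real n) * ennreal (?e j (z j))) \<partial>?P)"
    by (intro nn_integral_cong)
       (simp add: sum_divide_distrib ennreal_mult'[symmetric])
  also have "\<dots> = (\<Sum>j=1..n. ennreal (1 / real n) * (\<integral>\<^sup>+z. ennreal (?e j (z j)) \<partial>?P))"
    using m by (subst nn_integral_sum) (auto simp: nn_integral_cmult)
  also have "\<dots> \<le> (\<Sum>j=1..n. ennreal (1 / real n) * ennreal (\<gamma>^2 / real N))"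
  proof (intro sum_mono mult_left_mono)
    fix j assume j: "j \<in> {1..n}"
    have pr: "prob_space (\<Pi>\<^sub>M i\<in>{1..N}. x j)" if "j \<in> {1..n}" for j using x[OF that] by (intro prob_space_PiM) auto
    have "(\<integral>\<^sup>+z. ennreal (?e j (z j)) \<partial>?P) = (\<integral>\<^sup>+z. ennreal (?e j z) \<partial>distr ?P (\<Pi>\<^sub>M i\<in>{1..N}. x j) (\<lambda>z. z j))"
      by (rule nn_integral_distr[OF comp[OF j], symmetric]) (simp only: measurable_distr_eq1, rule measurable_compose[OF e[OF j] measurable_ennreal])
    also have "\<dots> = (\<integral>\<^sup>+z. ennreal (?e j z) \<partial>(\<Pi>\<^sub>M i\<in>{1..N}. x j))"
      using distr_PiM_component[of "{1..n}" "\<lambda>j. \<Pi>\<^sub>M i\<in>{1..N}. x j" j, OF pr j] by simp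
    also have "\<dots> \<le> ennreal (\<gamma>^2 / real N)" using x[OF j] N by (intro embedding_error_le) auto
    finally show "(\<integral>\<^sup>+z. ennreal (?e j (z j)) \<partial>?P) \<le> ennreal (\<gamma>^2 / real N)" .
  qed simp
  also have "\<dots> = ennreal (\<gamma>^2 / real N)"
    using n by (simp add: ennreal_mult'[symmetric] ennreal_of_nat_eq_real_of_nat)
  finally show "(\<integral>\<^sup>+z. ennreal ((\<Sum>j=1..n. ?e j (z j)) / real n) \<partial>?P) \<le> ennreal (\<gamma>^2 / real N)" .
qed

end

section \<open>Conditional expectation of the error\<close>

context regression
begin

text \<open>The quantifier over \<open>m'\<close> and \<open>y\<close> stands inside the event,
  which thus depends on the first stage alone and serves every second stage. The failure
  probabilities are \<open>\<delta>/3\<close> each for noise and drift and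
  \<open>\<delta>/6 + \<delta>/6\<close> for the comparison.\<close>

theorem first_stage_event:
  assumes n: "n > 0" and b: "b > 0" and \<eta>: "\<eta> > 0" "4 * \<kappa>^2 * \<eta> \<le> 1" and t0: "even t0" "t0 > 0"
    and l_eq: "l = 1 / (\<eta> * real t0)" and V: "effective_dim LK l \<le> V" "V \<ge> 1"
    and a: "a \<ge> 1" and c: "c1 > 0" "c1 / a \<le> l" "l \<le> c2 / a" "\<eta> * l * V / real b \<le> c3 * a powr (- 2 * r)"
    and A_eq: "A = A0 * \<Lambda> * a powr (- r)" and A0: "A0 > 0" and \<Lambda>: "\<Lambda> \<ge> 1" and \<delta>: "\<delta> > 0"
    and large: "\<kappa>^2 \<le> real n * V * l" "16 * (\<kappa>^2 / l + 1) \<le> real n" "128 * (\<kappa>^2 / l)^2 * V / (real n)^2 \<le> \<delta> / 6"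
    and noise: "(M + \<kappa> * norm f) * sqrt (V / real n) * (4 + ln (6 / \<delta>)) \<le> A"
    and drift: "\<kappa>^2 * V * (\<Sum>t\<le>t0. (norm (bias \<eta> t))^2) / (real n * (real t0 * A^2)) \<le> \<delta> / 3"
  shows "likely n (ennreal \<delta>) (\<lambda>\<omega>. \<forall>m' y. (\<forall>j\<in>{1..n}. m' j \<in> P \<and> y j = snd (\<omega> j)) \<longrightarrow>
      avg_error n b t0 \<eta> m' y
      \<le> rate_const c1 c2 c3 A0 * \<Lambda> * a powr (- r) *
          (1 + (\<Sum>j=1..n. (norm (Ks (m' j) - Ks (fst (\<omega> j))))^2) / real n * a powr (2 * r + 1)))"
proof -
  let ?P = "sample n"
  have l: "l > 0" using \<eta> t0 by (simp add: l_eq)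
  have V0: "V > 0" using V by simp
  have A: "A > 0" using A0 \<Lambda> a by (simp add: A_eq)
  have Mf: "M + \<kappa> * norm f > 0" using M \<kappa> by (simp add: add_pos_nonneg)
  have Y: "\<bar>snd p\<bar> \<le> M" if "p \<in> space \<rho>" for p using that M by (force simp: space_\<rho>)
  have res: "\<bar>snd p - f \<bullet> Ks (fst p)\<bar> \<le> M + \<kappa> * norm f" if p: "p \<in> space \<rho>" for p
  proof -
    have "fst p \<in> P" using p by (auto simp: space_\<rho>)
    then show ?thesis using inner_Ks_le[of "fst p" f] Y[OF p] by linarith
  qed
  have mean: "(\<integral>p. (snd p - f \<bullet> Ks (fst p)) * (h \<bullet> Ks (fst p)) \<partial>\<rho>) = 0" for h
    using noise_mean[of h] by (simp add: f_def v0_def)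
  obtain A1 where A1: "A1 \<in> sets ?P" "emeasure ?P (space ?P - A1) \<le> ennreal (\<delta> / 3)"
    "\<And>\<omega>. \<omega> \<in> A1 \<Longrightarrow> norm (T l (emp_residual n \<omega> f))
       \<le> (M + \<kappa> * norm f) * sqrt (V / real n) * (4 + ln (6 / \<delta>))"
    using noise_event[OF l n V(1) V0 \<delta> Mf res mean large(1)] by blast
  have c0': "real t0 * A^2 > 0" using A t0 by simp
  obtain A2 where A2: "A2 \<in> sets ?P"
    "emeasure ?P (space ?P - A2) \<le> ennreal (\<kappa>^2 * V * (\<Sum>t\<le>t0. (norm (bias \<eta> t))^2) / (real n * (real t0 * A^2)))"
    "\<And>\<omega>. \<omega> \<in> A2 \<Longrightarrow> (\<Sum>t\<le>t0. (norm (T l (adjoint S (S (bias \<eta> t)) - emp_cov n \<omega> (bias \<eta> t))))^2) \<le> real t0 * A^2"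
    using drift_event[OF l n V(1) V0 c0', where v = "bias \<eta>" and k = t0] by blast
  have p6: "\<delta> / 6 > 0" using \<delta> by simp
  obtain A3 where A3: "A3 \<in> sets ?P"
    "emeasure ?P (space ?P - A3) \<le> ennreal (128 * (\<kappa>^2 / l)^2 * V / (real n)^2 + \<delta> / 6)"
    "\<And>\<omega> j. \<omega> \<in> A3 \<Longrightarrow> j \<in> {1..n} \<Longrightarrow> proj_on Bh (Ks (fst (\<omega> j))) = Ks (fst (\<omega> j))"
    "\<And>\<omega> q. \<omega> \<in> A3 \<Longrightarrow> (norm (S q))^2 \<le> 3 * ((\<Sum>j=1..n. (q \<bullet> Ks (fst (\<omega> j)))^2) / real n) + 7 / 4 * l * (norm q)^2"
    using comparison_event[OF l n V(1) V0 large(2) p6] by blast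
  let ?G = "A1 \<inter> A2 \<inter> A3"
  show ?thesis
  proof (intro bexI conjI ballI allI impI)
    show "?G \<in> sets ?P" using A1 A2 A3 by auto
    have "space ?P - ?G = (space ?P - A1) \<union> (space ?P - A2) \<union> (space ?P - A3)" by auto
    then have "emeasure ?P (space ?P - ?G) \<le> emeasure ?P (space ?P - A1) + emeasure ?P (space ?P - A2) + emeasure ?P (space ?P - A3)"
      using A1(1) A2(1) A3(1) by (auto intro!: order_trans[OF emeasure_subadditive] add_right_mono emeasure_subadditive)
    also have "\<dots> \<le> ennreal (\<delta> / 3) + ennreal (\<delta> / 3) + ennreal (\<delta> / 3)"
      using A1(2) A2(2) A3(2) drift large(3)
      by (intro add_mono) (auto elim!: order_trans intro!: ennreal_leI)
    also have "\<dots> = ennreal \<delta>" using \<delta> by (simp add: ennreal_plus[symmetric] del: ennreal_plus)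
    finally show "emeasure ?P (space ?P - ?G) \<le> ennreal \<delta>" .
  next
    fix \<omega> m' y assume \<omega>: "\<omega> \<in> ?G" and my: "\<forall>j\<in>{1..n}. m' j \<in> P \<and> y j = snd (\<omega> j)"
    have sp: "\<omega> j \<in> space \<rho>" if "j \<in> {1..n}" for j
    proof -
      have "\<omega> \<in> space ?P" using \<omega> A1(1) sets.sets_into_space[of A1 ?P] by blast
      then show ?thesis using that unfolding space_PiM by (rule PiE_mem)
    qed
    have "fst (\<omega> j) \<in> P" if "j \<in> {1..n}" for j using sp[OF that] by (auto simp: space_\<rho>)
    moreover have "\<bar>y j\<bar> \<le> M" if "j \<in> {1..n}" for j using Y[OF sp[OF that]] my that by simp
    moreover have "norm (T l ((1 / real n) *\<^sub>R (\<Sum>j=1..n. (y j - f \<bullet> Ks (fst (\<omega> j))) *\<^sub>R Ks (fst (\<omega> j))))) \<le> A"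
    proof -
      have "(\<Sum>j=1..n. (y j - f \<bullet> Ks (fst (\<omega> j))) *\<^sub>R Ks (fst (\<omega> j))) = (\<Sum>j=1..n. (snd (\<omega> j) - f \<bullet> Ks (fst (\<omega> j))) *\<^sub>R Ks (fst (\<omega> j)))"
        using my by (intro sum.cong) auto
      then show ?thesis using A1(3)[of \<omega>] \<omega> noise by simp
    qed
    ultimately have "avg_error n b t0 \<eta> m' y
      \<le> rate_const c1 c2 c3 A0 * \<Lambda> * a powr (- r) * (1 + section_dist (\<lambda>j. fst (\<omega> j)) m' n * a powr (2 * r + 1))"
      using A2(3) A3(3,4) \<omega> my A A0
      by (intro batch_rate_le[where V = V and A = A and l = l] n b \<eta> t0 l_eq V a c A_eq \<Lambda>) auto
    then show "avg_error n b t0 \<eta> m' y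
      \<le> rate_const c1 c2 c3 A0 * \<Lambda> * a powr (- r) *
          (1 + (\<Sum>j=1..n. (norm (Ks (m' j) - Ks (fst (\<omega> j))))^2) / real n * a powr (2 * r + 1))"
      by (simp add: section_dist_def)
  qed
qed

end

text \<open>Replaces the concave power by an affine function of \<open>t\<close>, so that the mean
  of \<open>t\<close> suffices; \<open>s\<close> will be of the order of a bound for that
  mean.\<close>

lemma powr_le_affine:
  fixes t s \<alpha> :: real
  assumes "t \<ge> 0" "s > 0" "0 < \<alpha>" "\<alpha> \<le> 1"
  shows "t powr \<alpha> \<le> s powr \<alpha> * (1 + t / s)"
proof -
  have "(t / s) powr \<alpha> \<le> 1 + t / s"
  proof (cases "t \<le> s")
    case True
    then have "(t / s) powr \<alpha> \<le> 1 powr \<alpha>" using assms by (intro powr_mono2) auto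
    then show ?thesis using assms by (simp add: add_increasing2)
  next
    case False
    then have "(t / s) powr \<alpha> \<le> (t / s) powr 1" using assms by (intro powr_mono) auto
    then show ?thesis using assms by simp
  qed
  then have "s powr \<alpha> * (t / s) powr \<alpha> \<le> s powr \<alpha> * (1 + t / s)" by (intro mult_left_mono) auto
  then show ?thesis using assms by (simp add: powr_divide)
qed

locale two_stage_regression =
  mean_embedded G evG \<gamma> + regression "mean_embeddings G evG" K evK Y \<rho> cls \<kappa> r w h0 M
  for G :: "'x::topological_space \<Rightarrow> 'x \<Rightarrow> real"
    and evG :: "'g::{real_inner,banach,second_countable_topology} \<Rightarrow> 'x \<Rightarrow> real" and \<gamma>
    and K :: "'g \<Rightarrow> 'g \<Rightarrow> real" and evK :: "'h::{real_inner,banach} \<Rightarrow> 'g \<Rightarrow> real"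
    and Y \<rho> and cls :: "('g \<Rightarrow> real) \<Rightarrow> 'l::{real_inner,banach}" and \<kappa> r w h0 M +
  fixes Q :: "('x measure \<times> real) measure" and \<alpha> L :: real
  assumes Q_prob: "prob_space Q"
    and Q_sets: "sets Q = sets (prob_algebra borel \<Otimes>\<^sub>M restrict_space borel Y)"
    and \<rho>_law: "distr Q \<rho> (\<lambda>(x, y). (\<mu> x, y)) = \<rho>"
    and \<alpha>: "0 < \<alpha>" "\<alpha> \<le> 1" and L: "L > 0"
    and holder: "m1 \<in> mean_embeddings G evG \<Longrightarrow> m2 \<in> mean_embeddings G evG \<Longrightarrow>
      norm (Ks m1 - Ks m2) \<le> L * norm (m1 - m2) powr \<alpha>"
begin

lemma holder_sq:
  fixes s :: real
  assumes m: "m1 \<in> mean_embeddings G evG" "m2 \<in> mean_embeddings G evG" and s: "s > 0"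
  shows "(norm (Ks m1 - Ks m2))^2 \<le> L^2 * s powr \<alpha> * (1 + (norm (m1 - m2))^2 / s)"
proof -
  have "(norm (Ks m1 - Ks m2))^2 \<le> (L * norm (m1 - m2) powr \<alpha>)^2" by (intro power_mono holder m) simp
  also have "\<dots> = L^2 * ((norm (m1 - m2))^2) powr \<alpha>"
    by (simp add: power_mult_distrib power2_eq_square powr_mult)
  also have "\<dots> \<le> L^2 * (s powr \<alpha> * (1 + (norm (m1 - m2))^2 / s))"
    using s \<alpha> by (intro mult_left_mono powr_le_affine) auto
  finally show ?thesis by (simp add: mult.assoc)
qed

lemma sgd_eq_iter:
  assumes N: "N > 0"
  shows "sgd evK Ks b \<eta> h0 (second_stage_data Gs N d z) J t =
    empirical_sample.iter (\<lambda>j. Ks ((1 / real N) *\<^sub>R (\<Sum>i=1..N. Gs (z j i)))) (\<lambda>j. snd (d j)) b \<eta> h0 J t"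
proof -
  \<comment> \<open>\<open>iter\<close> does not depend on the sample size; any instance of the
    locale, here with one point, gives access to its equations.\<close>
  interpret E: empirical_sample 1 \<kappa> "\<lambda>j. Ks ((1 / real N) *\<^sub>R (\<Sum>i=1..N. Gs (z j i)))" "\<lambda>j. snd (d j)"
    by unfold_locales (simp, rule norm_Ks[OF empirical_mean_embedding[OF N]])
  show ?thesis
    by (induction t) (simp_all only: sgd.simps E.iter.simps second_stage_data_def fst_conv snd_conv evK[OF empirical_mean_embedding[OF N]])
qed

lemma first_stage_law:
  shows "first_stage_data \<mu> n \<in> (\<Pi>\<^sub>M j\<in>{1..n}. Q) \<rightarrow>\<^sub>M sample n"
    and "distr (\<Pi>\<^sub>M j\<in>{1..n}. Q) (sample n) (first_stage_data \<mu> n) = sample n"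
proof -
  let ?h = "\<lambda>(x, y). (\<mu> x, y)"
  have D: "first_stage_data \<mu> n = compose {1..n} ?h"
    by (auto simp: first_stage_data_def compose_def fun_eq_iff restrict_def split: prod.split)
  have h: "?h \<in> Q \<rightarrow>\<^sub>M \<rho>"
    unfolding measurable_cong_sets[OF Q_sets \<rho>_sets] case_prod_unfold
    by (intro measurable_Pair measurable_compose[OF measurable_fst mean_embedding_measurable] measurable_snd)
  show "distr (\<Pi>\<^sub>M j\<in>{1..n}. Q) (sample n) (first_stage_data \<mu> n) = sample n"
    unfolding D by (subst distr_PiM_finite_prob_space') (use h Q_prob \<rho>_prob \<rho>_law in auto)
  show "first_stage_data \<mu> n \<in> (\<Pi>\<^sub>M j\<in>{1..n}. Q) \<rightarrow>\<^sub>M sample n"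
    unfolding first_stage_data_def
  proof (rule measurable_restrict)
    fix j assume "j \<in> {1..n}"
    from measurable_compose[OF measurable_component_singleton[OF this] h]
    show "(\<lambda>d. (\<mu> (fst (d j)), snd (d j))) \<in> (\<Pi>\<^sub>M j\<in>{1..n}. Q) \<rightarrow>\<^sub>M \<rho>" by (simp add: case_prod_unfold)
  qed
qed

text \<open>The conclusion of the final theorem, with \<open>f\<rho>\<close> written as
  \<open>S f\<close>.\<close>

definition error_within :: "nat \<Rightarrow> nat \<Rightarrow> nat \<Rightarrow> real \<Rightarrow> nat \<Rightarrow> real \<Rightarrow> real \<Rightarrow> bool" where
  "error_within n N b \<eta> t0 \<delta> c \<longleftrightarrow> (let \<Omega> = sgd_experiment Q n N (b * t0) in
    measure \<Omega> {\<omega> \<in> space \<Omega>.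
      nn_cond_exp \<Omega> (vimage_algebra (space \<Omega>) (\<lambda>((d, z), J). first_stage_data \<mu> n d) (sample n))
        (\<lambda>\<omega>. ennreal ((\<lambda>((d, z), J). norm (S (tail_averaged_sgd evK Ks b \<eta> h0 (second_stage_data Gs N d z) J t0) - S f)) \<omega>)) \<omega>
      \<le> ennreal c} \<ge> 1 - \<delta>)"

text \<open>On a good first stage \<open>holder_sq\<close> turns the bound into an affine function
  of the mean squared embedding error \<open>W\<close>, whose expectation is at most
  \<open>\<gamma>^2 / N\<close>; the lower bound on \<open>N\<close> compensates the factor
  \<open>a^(2 r + 1)\<close>.\<close>

theorem experiment_error_le:
  assumes n: "n > 0" and N: "N > 0" "a powr ((2 * r + 1) / \<alpha>) \<le> real N"
    and b: "b > 0" and \<eta>: "\<eta> > 0" "4 * \<kappa>^2 * \<eta> \<le> 1" and t0: "even t0" "t0 > 0"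
    and l_eq: "l = 1 / (\<eta> * real t0)" and V: "effective_dim LK l \<le> V" "V \<ge> 1"
    and a: "a \<ge> 1" and c: "c1 > 0" "c1 / a \<le> l" "l \<le> c2 / a" "\<eta> * l * V / real b \<le> c3 * a powr (- 2 * r)" and c3: "c3 \<ge> 0"
    and A_eq: "A = A0 * \<Lambda> * a powr (- r)" and A0: "A0 > 0" and \<Lambda>: "\<Lambda> \<ge> 1" and \<delta>: "\<delta> > 0" "\<delta> \<le> 1"
    and large: "\<kappa>^2 \<le> real n * V * l" "16 * (\<kappa>^2 / l + 1) \<le> real n" "128 * (\<kappa>^2 / l)^2 * V / (real n)^2 \<le> \<delta> / 6"
    and noise: "(M + \<kappa> * norm f) * sqrt (V / real n) * (4 + ln (6 / \<delta>)) \<le> A"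
    and drift: "\<kappa>^2 * V * (\<Sum>t\<le>t0. (norm (bias \<eta> t))^2) / (real n * (real t0 * A^2)) \<le> \<delta> / 3"
  shows "error_within n N b \<eta> t0 \<delta> (rate_const c1 c2 c3 A0 * (1 + 2 * (L^2 * (\<gamma>^2 + 1))) * \<Lambda> * a powr (- r))"
proof -
  let ?Q = "\<Pi>\<^sub>M j\<in>{1..n}. Q" and ?R = "sample n"
  define C where "C = rate_const c1 c2 c3 A0 * \<Lambda> * a powr (- r)"
  define H where "H = L^2 * (\<gamma>^2 + 1)"
  \<comment> \<open>Just above the bound for the mean of \<open>W\<close>; the added 1 keeps
    \<open>s\<close> positive and gives
    \<open>(\<gamma>^2 + 1) powr \<alpha> \<le> \<gamma>^2 + 1\<close>.\<close>
  define s where "s = (\<gamma>^2 + 1) / real N"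
  have s: "s > 0" using N by (simp add: s_def add_nonneg_pos)
  have H: "H \<ge> 0" by (simp add: H_def)
  have c2: "c2 \<ge> 0"
  proof -
    have "0 \<le> c1 / a" using c(1) a by simp
    then have "0 \<le> c2 / a" using c(2,3) by linarith
    then show ?thesis using a by (simp add: zero_le_divide_iff)
  qed
  have C: "C \<ge> 0"
    using A0 c0 c(1) c3 M \<kappa> \<Lambda> unfolding C_def rate_const_def \<zeta>0_def
    by (intro mult_nonneg_nonneg add_nonneg_nonneg divide_nonneg_pos) auto
  have N\<alpha>: "s powr \<alpha> * a powr (2 * r + 1) \<le> \<gamma>^2 + 1"
  proof -
    have "a powr (2 * r + 1) = (a powr ((2 * r + 1) / \<alpha>)) powr \<alpha>" using \<alpha> by (simp add: powr_powr)
    also have "\<dots> \<le> real N powr \<alpha>" using N \<alpha> by (intro powr_mono2) auto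
    finally have "s powr \<alpha> * a powr (2 * r + 1) \<le> s powr \<alpha> * real N powr \<alpha>" by (intro mult_left_mono) auto
    also have "\<dots> = (\<gamma>^2 + 1) powr \<alpha>" using N by (simp add: s_def powr_divide)
    also have "\<dots> \<le> (\<gamma>^2 + 1) powr 1" using \<alpha> by (intro powr_mono) auto
    finally show ?thesis by simp
  qed
  obtain G0 where G0: "G0 \<in> sets ?R" "emeasure ?R (space ?R - G0) \<le> ennreal \<delta>"
    and err: "\<And>\<omega> m' y. \<omega> \<in> G0 \<Longrightarrow> (\<forall>j\<in>{1..n}. m' j \<in> mean_embeddings G evG \<and> y j = snd (\<omega> j)) \<Longrightarrow>
      avg_error n b t0 \<eta> m' y
      \<le> C * (1 + (\<Sum>j=1..n. (norm (Ks (m' j) - Ks (fst (\<omega> j))))^2) / real n * a powr (2 * r + 1))"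
    using first_stage_event[OF n b \<eta> t0 l_eq V a c A_eq A0 \<Lambda> \<delta>(1) large noise drift] unfolding C_def by blast
  interpret Q: prob_space ?Q by (intro prob_space_PiM Q_prob)
  interpret R: prob_space ?R by (rule prob_space_PiM_\<rho>)
  note D = first_stage_law[of n]
  have prob: "emeasure ?Q (first_stage_data \<mu> n -` G0 \<inter> space ?Q) \<ge> ennreal (1 - \<delta>)"
  proof -
    have "emeasure ?Q (first_stage_data \<mu> n -` G0 \<inter> space ?Q) = emeasure ?R G0"
      using emeasure_distr[OF D(1) G0(1)] unfolding D(2) by simp
    moreover have "R.prob (space ?R - G0) \<le> \<delta>"
      using G0(2) \<delta>(1) unfolding R.emeasure_eq_measure by (subst (asm) ennreal_le_iff) auto
    then have "1 - \<delta> \<le> R.prob G0" using R.prob_compl[OF G0(1)] by linarith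
    then have "ennreal (1 - \<delta>) \<le> emeasure ?R G0" unfolding R.emeasure_eq_measure by (rule ennreal_leI)
    ultimately show ?thesis by (simp only:)
  qed
  show ?thesis
    unfolding error_within_def Let_def
  proof (rule conditional_error_bound[OF Q_prob Q_sets n D(1) G0(1) prob \<delta>(2)])
    show "0 \<le> rate_const c1 c2 c3 A0 * (1 + 2 * (L^2 * (\<gamma>^2 + 1))) * \<Lambda> * a powr (- r)"
    proof -
      have "0 \<le> C * (1 + 2 * H)" using C H by simp
      then show ?thesis by (simp add: C_def H_def mult_ac)
    qed
    show "0 \<le> (\<lambda>((d, z), J). norm (S (tail_averaged_sgd evK Ks b \<eta> h0 (second_stage_data Gs N d z) J t0) - S f)) \<omega>" for \<omega>
      by (simp add: case_prod_unfold)
    fix d assume d: "d \<in> space ?Q" "first_stage_data \<mu> n d \<in> G0"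
    let ?x = "\<lambda>j. fst (d j)" and ?Z = "\<Pi>\<^sub>M j\<in>{1..n}. \<Pi>\<^sub>M i\<in>{1..N}. fst (d j)"
    let ?m' = "\<lambda>z j. (1 / real N) *\<^sub>R (\<Sum>i=1..N. Gs (z j i))"
    let ?I = "\<lambda>z. index_avg {1..b * t0} n (\<lambda>J. norm (S (tail_averaged_sgd evK Ks b \<eta> h0 (second_stage_data Gs N d z) J t0) - S f))"
    define W where "W z = (\<Sum>j=1..n. (norm (?m' z j - \<mu> (?x j)))^2) / real n" for z
    have W0: "W z \<ge> 0" for z by (simp add: W_def sum_nonneg)
    have x: "prob_space (?x j) \<and> sets (?x j) = sets borel" if "j \<in> {1..n}" for j
      using first_stage_component[OF Q_prob Q_sets d(1) that] by blast
    have W: "(\<integral>\<^sup>+z. ennreal (W z) \<partial>?Z) \<le> ennreal (\<gamma>^2 / real N)" "W \<in> borel_measurable ?Z"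
      unfolding W_def using second_stage_error_le[where x = ?x, OF x N(1) n] by blast+
    have m: "\<mu> (?x j) \<in> mean_embeddings G evG" if "j \<in> {1..n}" for j
      unfolding mean_embeddings_def using x[OF that] by blast
    have "?I z
        \<le> C * (1 + H) + C * H / s * W z" for z
    proof -
      have "?I z
          \<le> C * (1 + (\<Sum>j=1..n. (norm (Ks (?m' z j) - Ks (fst (first_stage_data \<mu> n d j))))^2) / real n * a powr (2 * r + 1))"
        unfolding tail_averaged_sgd_def sgd_eq_iter[OF N(1)] tail_average_def[symmetric]
        by (rule err[OF d(2)]) (auto simp: empirical_mean_embedding[OF N(1)] first_stage_data_def simp del: One_nat_def)
      also have "(\<Sum>j=1..n. (norm (Ks (?m' z j) - Ks (fst (first_stage_data \<mu> n d j))))^2) \<le> (\<Sum>j=1..n. L^2 * s powr \<alpha> * (1 + (norm (?m' z j - \<mu> (?x j)))^2 / s))"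
      proof (rule sum_mono)
        fix j assume j: "j \<in> {1..n}"
        have "first_stage_data \<mu> n d j = (\<mu> (?x j), snd (d j))" using j by (simp add: first_stage_data_def)
        then show "(norm (Ks (?m' z j) - Ks (fst (first_stage_data \<mu> n d j))))^2 \<le> L^2 * s powr \<alpha> * (1 + (norm (?m' z j - \<mu> (?x j)))^2 / s)"
          using holder_sq[OF empirical_mean_embedding[OF N(1)] m[OF j] s] by simp
      qed
      also have "(\<Sum>j=1..n. L^2 * s powr \<alpha> * (1 + (norm (?m' z j - \<mu> (?x j)))^2 / s)) = real n * (L^2 * s powr \<alpha> * (1 + W z / s))"
      proof -
        have "(\<Sum>j=1..n. (norm (?m' z j - \<mu> (?x j)))^2) = real n * W z" using n by (simp add: W_def)
        then show ?thesis by (simp add: sum_distrib_left[symmetric] sum.distrib sum_divide_distrib[symmetric] distrib_left)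
      qed
      finally have "?I z
          \<le> C * (1 + real n * (L^2 * s powr \<alpha> * (1 + W z / s)) / real n * a powr (2 * r + 1))"
        using C by (simp add: mult_left_mono divide_right_mono mult_right_mono)
      also have "real n * (L^2 * s powr \<alpha> * (1 + W z / s)) / real n * a powr (2 * r + 1) = L^2 * (s powr \<alpha> * a powr (2 * r + 1)) * (1 + W z / s)"
        using n by simp
      also have "\<dots> \<le> H * (1 + W z / s)"
        unfolding H_def using s N\<alpha> W0[of z] by (intro mult_right_mono mult_left_mono) auto
      finally have "?I z
          \<le> C * (1 + H * (1 + W z / s))" using C by (simp add: mult_left_mono)
      also have "\<dots> = C * (1 + H) + C * H / s * W z" by (simp add: algebra_simps)
      finally show ?thesis .
    qed
    then have "(\<integral>\<^sup>+z. ennreal (?I z) \<partial>?Z)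
        \<le> (\<integral>\<^sup>+z. ennreal (C * (1 + H)) + ennreal (C * H / s) * ennreal (W z) \<partial>?Z)"
      using C H s by (intro nn_integral_mono) (auto simp: ennreal_mult'[symmetric] ennreal_plus[symmetric] W0 simp del: ennreal_plus intro!: ennreal_leI)
    also have "\<dots> = ennreal (C * (1 + H)) * emeasure ?Z (space ?Z) + ennreal (C * H / s) * (\<integral>\<^sup>+z. ennreal (W z) \<partial>?Z)"
      using W(2) by (simp add: nn_integral_add nn_integral_cmult)
    also have "\<dots> \<le> ennreal (C * (1 + H)) * 1 + ennreal (C * H / s) * ennreal (\<gamma>^2 / real N)"
    proof (intro add_mono mult_left_mono W(1))
      have "prob_space ?Z" using x by (intro prob_space_PiM) auto
      then show "emeasure ?Z (space ?Z) \<le> 1" by (simp add: prob_space.emeasure_space_1)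
    qed auto
    also have "\<dots> = ennreal (C * (1 + H) + C * H / s * (\<gamma>^2 / real N))"
      using C H s by (simp add: ennreal_mult'[symmetric] ennreal_plus[symmetric] del: ennreal_plus)
    also have "\<dots> \<le> ennreal (C * (1 + 2 * H))"
    proof (rule ennreal_leI)
      have "C * H / s * (\<gamma>^2 / real N) \<le> C * H / s * s"
        using C H s N by (intro mult_left_mono) (auto simp: s_def divide_right_mono)
      then show "C * (1 + H) + C * H / s * (\<gamma>^2 / real N) \<le> C * (1 + 2 * H)" using s by (simp add: algebra_simps)
    qed
    finally show "(\<integral>\<^sup>+z. ennreal (index_avg {1..b * t0} n (\<lambda>J. (\<lambda>((d, z), J). norm (S (tail_averaged_sgd evK Ks b \<eta> h0 (second_stage_data Gs N d z) J t0) - S f)) ((d, z), J))) \<partial>?Z)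
        \<le> ennreal (rate_const c1 c2 c3 A0 * (1 + 2 * (L^2 * (\<gamma>^2 + 1))) * \<Lambda> * a powr (- r))"
      by (simp add: C_def H_def mult_ac)
  qed
qed

end

section \<open>Rates\<close>

context two_stage_regression
begin

text \<open>What the three parameter choices have in common, with constants \<open>n1\<close>,
  \<open>c1\<close>, \<open>c2\<close>, \<open>c4\<close> that do not vary with
  \<open>n\<close>.\<close>

definition regime :: "real \<Rightarrow> real \<Rightarrow> real \<Rightarrow> real \<Rightarrow> real \<Rightarrow> nat \<Rightarrow> nat \<Rightarrow> nat \<Rightarrow> nat \<Rightarrow> real \<Rightarrow> real \<Rightarrow> bool" where
  "regime \<nu> n1 c1 c2 c4 n N b t0 \<eta> a \<longleftrightarrow>
     real n = n1 * a powr (2 * r + \<nu>) \<and> a powr ((2 * r + 1) / \<alpha>) \<le> real N \<and> b > 0 \<and>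
     \<eta> > 0 \<and> 4 * \<kappa>^2 * \<eta> < 1 \<and> even t0 \<and> t0 > 0 \<and>
     c1 / a \<le> 1 / (\<eta> * real t0) \<and> 1 / (\<eta> * real t0) \<le> c2 / a \<and> \<eta> / real b \<le> c4 * a powr (- (2 * r + \<nu> - 1))"

text \<open>\<open>C\<close> is fixed before \<open>\<delta>\<close>, and only the threshold
  \<open>a0\<close> sees \<open>\<delta>\<close>. By \<open>r \<ge> 1/2\<close> one has
  \<open>n \<ge> n1 * a^(1 + \<nu>)\<close>, and the surplus \<open>a^\<nu>\<close> outgrows what
  the three conditions called \<open>large\<close> demand.\<close>

theorem asymptotic_rate:
  assumes \<nu>: "0 < \<nu>" and dim: "\<And>l. l > 0 \<Longrightarrow> effective_dim LK l \<le> c\<nu> * l powr (- \<nu>)"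
    and n1: "n1 > 0" and c: "c1 > 0" "c2 > 0" "c4 > 0"
  shows "\<exists>C. \<forall>\<delta>. 0 < \<delta> \<and> \<delta> \<le> 1 \<longrightarrow> (\<exists>a0. \<forall>n N b t0 \<eta> a.
    a \<ge> a0 \<longrightarrow> regime \<nu> n1 c1 c2 c4 n N b t0 \<eta> a \<longrightarrow>
    error_within n N b \<eta> t0 \<delta> (C * ln (6 / \<delta>) * a powr (- r)))"
proof -
  define cV where "cV = max c\<nu> 1"
  define V0 where "V0 = cV * c1 powr (- \<nu>)"
  define Mf where "Mf = M + \<kappa> * norm f"
  \<comment> \<open>The 5 comes from
    \<open>4 + ln (6 / \<delta>) \<le> 5 * ln (6 / \<delta>)\<close>, as the logarithm is at least
    1.\<close>
  define A0 where "A0 = 5 * Mf * sqrt (V0 / n1)"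
  have cV: "cV \<ge> 1" "c\<nu> \<le> cV" by (auto simp: cV_def)
  have V0: "V0 > 0" using cV c by (simp add: V0_def)
  have Mf: "Mf > 0" using M \<kappa> by (simp add: Mf_def add_pos_nonneg)
  have A0: "A0 > 0" using Mf V0 n1 by (simp add: A0_def)
  show ?thesis
  proof (rule exI[of _ "rate_const c1 c2 (c4 * c2 * V0) A0 * (1 + 2 * (L^2 * (\<gamma>^2 + 1)))"], intro allI impI)
    fix \<delta> :: real assume \<delta>: "0 < \<delta> \<and> \<delta> \<le> 1"
    \<comment> \<open>Chosen such that \<open>\<kappa>^2\<close> times the time average of the
      squared bias norms ends below \<open>2 * \<delta> * Mf^2\<close>; the drift event then fails
      with probability at most \<open>2 * \<delta> / 25\<close>.\<close>
    define \<epsilon> where "\<epsilon> = \<delta> * Mf^2 / (\<kappa>^2 + 1)"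
    have \<epsilon>: "\<epsilon> > 0" using \<delta> Mf by (simp add: \<epsilon>_def add_nonneg_pos)
    obtain C' where C': "C' \<ge> 0" "\<And>\<eta> t0. \<eta> > 0 \<Longrightarrow> \<eta> * \<kappa>^2 \<le> 1 \<Longrightarrow> t0 > 0 \<Longrightarrow>
        (\<Sum>t\<le>t0. (norm (bias \<eta> t))^2) / real t0 \<le> \<epsilon> + C' / (\<eta> * real t0)"
      using bias_average_small[OF \<epsilon>] by blast
    \<comment> \<open>\<open>B1\<close>, \<open>B2\<close>, \<open>B3\<close> are lower bounds on
      \<open>a powr \<nu>\<close> that secure \<open>large1\<close>, \<open>large2\<close>,
      \<open>large3\<close>.\<close>
    define B1 where "B1 = \<kappa>^2 / (n1 * c1)"
    define B2 where "B2 = 16 * (\<kappa>^2 / c1 + 1) / n1"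
    define B3 where "B3 = 768 * (\<kappa>^2 / c1)^2 * V0 / (n1^2 * \<delta>)"
    have B: "B1 \<ge> 0" "B2 \<ge> 0" "B3 \<ge> 0" using n1 c V0 \<delta> by (auto simp: B1_def B2_def B3_def)
    define a0 where "a0 = 1 + c2 + (B1 + B2 + B3) powr (1 / \<nu>) + C' * c2 / \<epsilon>"
    define \<Lambda> where "\<Lambda> = ln (6 / \<delta>)"
    have \<Lambda>: "\<Lambda> \<ge> 1"
    proof -
      have "exp 1 \<le> 6 / \<delta>" using exp_le \<delta> by (simp add: pos_le_divide_eq mult_mono[of "exp 1" 3 \<delta> 2, simplified])
      then show ?thesis unfolding \<Lambda>_def using \<delta> by (subst ln_ge_iff) auto
    qed
    show "\<exists>a0. \<forall>n N b t0 \<eta> a.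
      a \<ge> a0 \<longrightarrow> regime \<nu> n1 c1 c2 c4 n N b t0 \<eta> a \<longrightarrow>
      error_within n N b \<eta> t0 \<delta> (rate_const c1 c2 (c4 * c2 * V0) A0 * (1 + 2 * (L^2 * (\<gamma>^2 + 1))) * ln (6 / \<delta>) * a powr (- r))"
    proof (rule exI[of _ a0], intro allI impI)
      fix n N b t0 \<eta> a
      assume a0: "a \<ge> a0" and "regime \<nu> n1 c1 c2 c4 n N b t0 \<eta> a"
      then have n: "real n = n1 * a powr (2 * r + \<nu>)" and N: "a powr ((2 * r + 1) / \<alpha>) \<le> real N" and b: "b > 0"
        and \<eta>: "\<eta> > 0" "4 * \<kappa>^2 * \<eta> < 1" and t0: "even t0" "t0 > 0"
        and l1: "c1 / a \<le> 1 / (\<eta> * real t0)" and l2: "1 / (\<eta> * real t0) \<le> c2 / a"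
        and \<eta>b: "\<eta> / real b \<le> c4 * a powr (- (2 * r + \<nu> - 1))"
        unfolding regime_def by blast+
      define l where "l = 1 / (\<eta> * real t0)"
      define V where "V = cV * l powr (- \<nu>)"
      define A where "A = A0 * \<Lambda> * a powr (- r)"
      have a: "a \<ge> 1" "a \<ge> c2" "a \<ge> (B1 + B2 + B3) powr (1 / \<nu>)" "a \<ge> C' * c2 / \<epsilon>"
        using a0 c C' \<epsilon> powr_ge_zero[of "B1 + B2 + B3" "1 / \<nu>"] unfolding a0_def by (auto simp: divide_nonneg_pos intro: order_trans[OF _ a0[unfolded a0_def]])
      have l: "l > 0" "c1 / a \<le> l" "l \<le> c2 / a" using \<eta> t0 l1 l2 by (auto simp: l_def)
      have l_le: "l \<le> 1" using l(3) a by (simp add: order_trans[of l "c2 / a" 1])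
      have a\<nu>: "B1 + B2 + B3 \<le> a powr \<nu>"
      proof -
        have "B1 + B2 + B3 = ((B1 + B2 + B3) powr (1 / \<nu>)) powr \<nu>" using B \<nu> by (simp add: powr_powr)
        also have "\<dots> \<le> a powr \<nu>" using a \<nu> by (intro powr_mono2) auto
        finally show ?thesis .
      qed
      have V1: "V \<ge> 1"
      proof -
        have "1 \<le> l powr (- \<nu>)" using l l_le \<nu> by (simp add: powr_minus_divide powr_le1)
        then show ?thesis using mult_mono[of 1 cV 1 "l powr (- \<nu>)"] cV by (simp add: V_def)
      qed
      have V2: "V \<le> V0 * a powr \<nu>"
      proof -
        have "l powr (- \<nu>) \<le> (c1 / a) powr (- \<nu>)" using l c a \<nu> by (intro powr_mono2') auto
        also have "\<dots> = c1 powr (- \<nu>) * a powr \<nu>" using c a by (simp add: powr_divide powr_minus_divide)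
        finally show ?thesis using cV by (simp add: V_def V0_def mult.assoc mult_left_mono)
      qed
      have Vd: "effective_dim LK l \<le> V"
        unfolding V_def using dim[OF l(1)] cV mult_right_mono[OF cV(2), of "l powr (- \<nu>)"] by simp
      have ar: "a powr (2 * r + \<nu>) = a powr (2 * r - 1) * (a powr \<nu> * a)"
      proof -
        have "a powr (2 * r + \<nu>) = a powr (2 * r - 1) * (a powr \<nu> * a powr 1)" unfolding powr_add[symmetric] by simp
        then show ?thesis using a by simp
      qed
      have ar1: "a powr (2 * r - 1) \<ge> 1" using a r by (intro ge_one_powr_ge_zero) auto
      have npos: "real n > 0" unfolding n using n1 a by simp
      have n_ge: "n1 * (a powr \<nu> * a) \<le> real n"
        unfolding n ar using n1 a ar1 mult_right_mono[OF ar1, of "a powr \<nu> * a"] by (intro mult_left_mono) auto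
      have large1: "\<kappa>^2 \<le> real n * V * l"
      proof -
        have "\<kappa>^2 = n1 * c1 * B1" using n1 c by (simp add: B1_def)
        also have "\<dots> \<le> n1 * c1 * a powr \<nu>" using a\<nu> B n1 c by (intro mult_left_mono) auto
        also have "\<dots> = (n1 * (a powr \<nu> * a)) * 1 * (c1 / a)" using a by simp
        also have "\<dots> \<le> real n * V * l" using n_ge V1 l n1 a c by (intro mult_mono) auto
        finally show ?thesis .
      qed
      have kl: "\<kappa>^2 / l \<le> \<kappa>^2 / c1 * a"
      proof -
        have "\<kappa>^2 / l \<le> \<kappa>^2 / (c1 / a)" using l c a by (intro divide_left_mono) auto
        then show ?thesis by simp
      qed
      have large2: "16 * (\<kappa>^2 / l + 1) \<le> real n"
      proof -
        have "16 * (\<kappa>^2 / l + 1) \<le> 16 * (\<kappa>^2 / c1 * a + a)" using kl a by simp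
        also have "\<dots> = 16 * (\<kappa>^2 / c1 + 1) * a" by (simp add: distrib_left distrib_right)
        also have "\<dots> = n1 * (B2 * a)" using n1 by (simp add: B2_def)
        also have "\<dots> \<le> n1 * (a powr \<nu> * a)" using a\<nu> B a n1 by (intro mult_left_mono mult_right_mono) auto
        finally show ?thesis using n_ge by linarith
      qed
      have large3: "128 * (\<kappa>^2 / l)^2 * V / (real n)^2 \<le> \<delta> / 6"
      proof -
        have "128 * (\<kappa>^2 / l)^2 * V / (real n)^2 \<le> 128 * (\<kappa>^2 / c1 * a)^2 * (V0 * a powr \<nu>) / (n1 * (a powr \<nu> * a))^2"
          using kl V0 V1 V2 n_ge n1 a l by (intro frac_le mult_mono power_mono mult_nonneg_nonneg) auto
        also have "\<dots> = \<delta> / 6 * (B3 / a powr \<nu>)"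
          using a n1 \<delta> by (simp add: B3_def power_mult_distrib power2_eq_square)
        also have "\<dots> \<le> \<delta> / 6 * 1" using a\<nu> B a \<delta> by (intro mult_left_mono) auto
        finally show ?thesis by simp
      qed
      have Vn: "V / real n \<le> V0 / n1 * a powr (- 2 * r)"
      proof -
        have "V / real n \<le> V0 * a powr \<nu> / real n" using V2 by (intro divide_right_mono) auto
        also have "\<dots> = V0 / n1 * (a powr \<nu> / a powr (2 * r + \<nu>))" unfolding n by simp
        also have "a powr \<nu> / a powr (2 * r + \<nu>) = a powr (- 2 * r)" by (simp add: powr_diff[symmetric])
        finally show ?thesis .
      qed
      have p2: "a powr (- 2 * r) = (a powr (- r))^2" unfolding power2_eq_square powr_add[symmetric] by simp
      have noise: "(M + \<kappa> * norm f) * sqrt (V / real n) * (4 + ln (6 / \<delta>)) \<le> A"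
      proof -
        have "sqrt (V / real n) \<le> sqrt (V0 / n1) * a powr (- r)"
          using real_sqrt_le_mono[OF Vn[unfolded p2]] unfolding real_sqrt_mult real_sqrt_abs by simp
        then have "Mf * sqrt (V / real n) * (4 + \<Lambda>) \<le> Mf * (sqrt (V0 / n1) * a powr (- r)) * (5 * \<Lambda>)"
          using Mf \<Lambda> V1 V0 n1 by (intro mult_mono mult_left_mono) auto
        also have "\<dots> = A" by (simp add: A_def A0_def)
        finally show ?thesis unfolding Mf_def \<Lambda>_def .
      qed
      have drift: "\<kappa>^2 * V * (\<Sum>t\<le>t0. (norm (bias \<eta> t))^2) / (real n * (real t0 * A^2)) \<le> \<delta> / 3"
      proof -
        have \<eta>\<kappa>: "\<eta> * \<kappa>^2 \<le> 1" using \<eta> mult_nonneg_nonneg[of "\<kappa>^2" \<eta>] by (simp add: mult.commute)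
        let ?v = "(\<Sum>t\<le>t0. (norm (bias \<eta> t))^2) / real t0"
        have v0: "?v \<ge> 0" by (simp add: sum_nonneg)
        have "C' * l \<le> C' * (c2 / a)" using l C' by (intro mult_left_mono) auto
        also have "\<dots> \<le> \<epsilon>" using a \<epsilon> by (simp add: pos_divide_le_eq mult.commute)
        finally have "?v \<le> 2 * \<epsilon>" using C'(2)[OF \<eta>(1) \<eta>\<kappa> t0(2)] by (simp add: l_def)
        then have "\<kappa>^2 * ?v \<le> (\<kappa>^2 + 1) * (2 * \<epsilon>)" using v0 by (intro mult_mono) auto
        also have "\<dots> = 2 * (\<delta> * Mf^2)"
        proof -
          have "\<kappa>^2 + 1 \<noteq> 0" using zero_le_power2[of \<kappa>] by linarith
          then show ?thesis by (simp add: \<epsilon>_def)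
        qed
        finally have kv: "\<kappa>^2 * ?v \<le> 2 * \<delta> * Mf^2" by simp
        have "A^2 = 25 * Mf^2 * \<Lambda>^2 * (V0 / n1 * a powr (- 2 * r))"
          unfolding p2 using V0 n1 by (simp add: A_def A0_def power_mult_distrib)
        moreover have "1 \<le> \<Lambda>^2" using \<Lambda> by (rule one_le_power)
        then have "25 * Mf^2 * 1 * (V / real n) \<le> 25 * Mf^2 * \<Lambda>^2 * (V0 / n1 * a powr (- 2 * r))"
          using Vn V1 by (intro mult_mono mult_left_mono) auto
        ultimately have A2: "25 * Mf^2 * (V / real n) \<le> A^2" by simp
        have Vp: "0 < 25 * Mf^2 * (V / real n)" using Mf V1 npos by simp
        have "\<kappa>^2 * V * (\<Sum>t\<le>t0. (norm (bias \<eta> t))^2) / (real n * (real t0 * A^2)) = (V / real n) * (\<kappa>^2 * ?v) / A^2" by (simp add: mult_ac)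
        also have "\<dots> \<le> (V / real n) * (2 * \<delta> * Mf^2) / (25 * Mf^2 * (V / real n))"
          using kv A2 Vp V1 v0 \<delta> by (intro frac_le mult_left_mono mult_nonneg_nonneg) auto
        also have "\<dots> = 2 * \<delta> / 25" using Mf V1 npos by simp
        finally show ?thesis using \<delta> by simp
      qed
      have c3: "\<eta> * l * V / real b \<le> c4 * c2 * V0 * a powr (- 2 * r)"
      proof -
        have "\<eta> * l * V / real b = (\<eta> / real b) * l * V" by simp
        also have "\<dots> \<le> (c4 * a powr (- (2 * r + \<nu> - 1))) * (c2 / a) * (V0 * a powr \<nu>)"
          using \<eta>b l V1 V2 \<eta> c a by (intro mult_mono) (auto intro!: mult_nonneg_nonneg)
        also have "\<dots> = c4 * c2 * V0 * (a powr (- (2 * r + \<nu> - 1)) * a powr (- 1) * a powr \<nu>)"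
          using a by (simp add: powr_minus_divide)
        also have "a powr (- (2 * r + \<nu> - 1)) * a powr (- 1) * a powr \<nu> = a powr (- 2 * r)"
          unfolding powr_add[symmetric] by simp
        finally show ?thesis .
      qed
      have N0: "N > 0"
      proof -
        have "0 < a powr ((2 * r + 1) / \<alpha>)" using a by simp
        then have "real N > 0" using N by linarith
        then show ?thesis by simp
      qed
      have "n > 0" using npos by simp
      moreover have "0 \<le> c4 * c2 * V0" using c V0 by simp
      ultimately show "error_within n N b \<eta> t0 \<delta> (rate_const c1 c2 (c4 * c2 * V0) A0 * (1 + 2 * (L^2 * (\<gamma>^2 + 1))) * ln (6 / \<delta>) * a powr (- r))"
        unfolding \<Lambda>_def[symmetric]
        using experiment_error_le[OF _ N0 N b \<eta>(1) less_imp_le[OF \<eta>(2)] t0 l_def Vd V1 a(1) c(1) l(2,3) c3 _ A_def A0 \<Lambda> _ _ large1 large2 large3 noise drift] \<delta>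
        by simp
    qed
  qed
qed

end

text \<open>Rounding moves \<open>v\<close> by less than 2, which for \<open>v \<ge> 4\<close> is at
  most half of it.\<close>

lemma iterations_bounds:
  assumes "iterations_for v T" "v \<ge> 4"
  shows "even T" "T > 0" "v / 2 \<le> real T" "real T \<le> 2 * v"
  using assms by (auto simp: iterations_for_def abs_less_iff intro!: Nat.gr0I)

lemma step_count_bounds:
  fixes p a x :: real
  assumes "p > 0" "a > 0" "p * a / 2 \<le> x" "x \<le> 2 * p * a"
  shows "1 / (2 * p) / a \<le> 1 / x" "1 / x \<le> 2 / p / a"
proof -
  have x: "x > 0" using assms mult_pos_pos[of p a] by linarith
  have "1 / (2 * p * a) \<le> 1 / x" using assms x by (intro divide_left_mono) auto
  then show "1 / (2 * p) / a \<le> 1 / x" by simp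
  have "1 / x \<le> 1 / (p * a / 2)" using assms x by (intro divide_left_mono) auto
  then show "1 / x \<le> 2 / p / a" by simp
qed

text \<open>
  With \<open>a = (R\<^sup>2 n / M\<^sup>2)\<^bsup>1/q\<^esup>\<close> and \<open>q = 2 r + \<nu>\<close>, all three parameter choices give \<open>\<eta> T \<sim> a\<close>
  and \<open>\<eta> / b \<lesssim> a\<^bsup>1-q\<^esup>\<close>.
\<close>

lemma parameter_choices:
  fixes R M r \<nu> \<eta>0 :: real and n :: nat
  defines "q \<equiv> 2 * r + \<nu>" and "n1 \<equiv> M\<^sup>2 / R^2"
  defines "a \<equiv> (R^2 * real n / M^2) powr (1 / q)"
  defines "p \<equiv> \<eta>0 + \<eta>0 / n1"
  assumes R: "R > 0" and M: "M > 0" and q: "q > 1" and \<eta>0: "\<eta>0 > 0" and n: "n > 0" and a: "a \<ge> 4"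
    and choice: "one_pass_sgd R M r \<nu> \<eta>0 n b \<eta> T \<or> early_stopping_sgd R M r \<nu> \<eta>0 n b \<eta> T \<or> batch_gd R M r \<nu> \<eta>0 n b \<eta> T"
  shows "real n = n1 * a powr q" "b > 0" "\<eta> > 0" "even T" "T > 0"
    "1 / (2 * p) / a \<le> 1 / (\<eta> * real T)" "1 / (\<eta> * real T) \<le> (2 / \<eta>0 + 2 * n1 / \<eta>0) / a"
    "\<eta> / real b \<le> (\<eta>0 / n1 + 2 * \<eta>0 / n1 powr ((q - 1) / q)) * a powr (- (q - 1))"
proof -
  define u where "u = R^2 * real n / M^2"
  define \<theta> where "\<theta> = (q - 1) / q"
  have n1: "n1 > 0" using R M by (simp add: n1_def)
  have u: "u > 0" using R M n by (simp add: u_def)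
  have uq: "a powr q = u" using q u by (simp add: a_def u_def[symmetric] powr_powr)
  have \<theta>: "0 \<le> \<theta>" "\<theta> \<le> 1" "\<theta> * q = q - 1" using q by (auto simp: \<theta>_def divide_le_eq)
  show nq: "real n = n1 * a powr q" unfolding uq u_def n1_def using R M by simp
  have a0: "a > 0" using a by simp
  have p: "\<eta>0 \<le> p" "\<eta>0 / n1 \<le> p" "\<eta>0 / n1 > 0" using \<eta>0 n1 by (auto simp: p_def)
  have n\<theta>: "real n powr \<theta> = n1 powr \<theta> * a powr (q - 1)"
    unfolding nq using n1 \<theta>(3) by (simp add: powr_mult powr_powr mult.commute)
  have n1\<theta>: "n1 powr \<theta> > 0" using n1 by simp
  \<comment> \<open>\<open>p'\<close> is the ratio of \<open>\<eta> T\<close> to \<open>a\<close> up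
    to rounding: \<open>\<eta>0 / n1\<close> for one pass, \<open>\<eta>0\<close> for the other two
    choices. The constants are sums over both cases and so serve all three.\<close>
  have steps: "1 / (2 * p) / a \<le> 1 / (\<eta> * real T)" "1 / (\<eta> * real T) \<le> (2 / \<eta>0 + 2 * n1 / \<eta>0) / a"
    if p': "p' = \<eta>0 \<or> p' = \<eta>0 / n1" and x: "p' * a / 2 \<le> \<eta> * real T" "\<eta> * real T \<le> 2 * p' * a" for p'
  proof -
    have p'0: "p' > 0" "p' \<le> p" using p' p \<eta>0 by auto
    note sc = step_count_bounds[OF p'0(1) a0 x]
    have "1 / (2 * p) / a \<le> 1 / (2 * p') / a" using p'0 a0 by (intro divide_right_mono divide_left_mono) auto
    then show "1 / (2 * p) / a \<le> 1 / (\<eta> * real T)" using sc(1) by linarith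
    have "2 / p' \<le> 2 / \<eta>0 + 2 * n1 / \<eta>0" using p' \<eta>0 n1 by auto
    then have "2 / p' / a \<le> (2 / \<eta>0 + 2 * n1 / \<eta>0) / a" using a0 by (intro divide_right_mono) auto
    then show "1 / (\<eta> * real T) \<le> (2 / \<eta>0 + 2 * n1 / \<eta>0) / a" using sc(2) by linarith
  qed
  have batch: "\<eta>0 / real b \<le> (\<eta>0 / n1 + 2 * \<eta>0 / n1 powr \<theta>) * a powr (- (q - 1))"
    if b: "b > 0" "real n powr \<theta> / 2 \<le> real b"
  proof -
    have "\<eta>0 / real b \<le> \<eta>0 / (real n powr \<theta> / 2)" using b \<eta>0 n by (intro divide_left_mono) auto
    also have "\<dots> = (2 * \<eta>0 / n1 powr \<theta>) * a powr (- (q - 1))" unfolding n\<theta> powr_minus_divide by simp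
    also have "\<dots> \<le> (\<eta>0 / n1 + 2 * \<eta>0 / n1 powr \<theta>) * a powr (- (q - 1))"
      using p by (intro mult_right_mono) auto
    finally show ?thesis .
  qed
  consider "one_pass_sgd R M r \<nu> \<eta>0 n b \<eta> T"
    | "\<eta> = \<eta>0" "b > 0" "real n powr \<theta> / 2 \<le> real b" "iterations_for a T"
  proof -
    have "b > 0 \<and> real n powr \<theta> / 2 \<le> real b" if "early_stopping_sgd R M r \<nu> \<eta>0 n b \<eta> T"
    proof -
      have "b > 0" "real n powr \<theta> < real b + 1"
        using that by (auto simp: early_stopping_sgd_def batch_size_for_def q_def[symmetric] \<theta>_def)
      \<comment> \<open>If the prescribed value is at most 2, \<open>b \<ge> 1\<close> is at least
        half of it; otherwise rounding loses less than 1, which is less than half.\<close>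
      then show ?thesis by (cases "real n powr \<theta> \<le> 2") auto
    qed
    moreover have "b > 0 \<and> real n powr \<theta> / 2 \<le> real b" if "batch_gd R M r \<nu> \<eta>0 n b \<eta> T"
    proof -
      have "real n powr \<theta> \<le> real n powr 1" using n \<theta> by (intro powr_mono) auto
      then show ?thesis using that n by (simp add: batch_gd_def)
    qed
    ultimately show ?thesis
      using choice that unfolding early_stopping_sgd_def batch_gd_def a_def q_def by blast
  qed
  then have "b > 0 \<and> \<eta> > 0 \<and> even T \<and> T > 0 \<and> 1 / (2 * p) / a \<le> 1 / (\<eta> * real T) \<and>
    1 / (\<eta> * real T) \<le> (2 / \<eta>0 + 2 * n1 / \<eta>0) / a \<and> \<eta> / real b \<le> (\<eta>0 / n1 + 2 * \<eta>0 / n1 powr \<theta>) * a powr (- (q - 1))"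
  proof cases
    case 1
    have "R^2 / M^2 = 1 / n1" by (simp add: n1_def)
    moreover have "(M^2 / (R^2 * real n)) powr \<theta> = a powr (- (q - 1))"
    proof -
      have "(M^2 / (R^2 * real n)) powr \<theta> = (1 / u) powr \<theta>" by (simp add: u_def)
      also have "\<dots> = (a powr (- q)) powr \<theta>" using uq by (simp add: powr_minus_divide)
      also have "\<dots> = a powr (- (q - 1))" using \<theta>(3) by (simp add: powr_powr mult.commute)
      finally show ?thesis .
    qed
    ultimately have \<eta>: "\<eta> = \<eta>0 / n1 * a powr (- (q - 1))" and b: "b = 1" and T: "iterations_for u T"
    proof -
      have *: "b = 1" "\<eta> = \<eta>0 * (R^2 / M^2) * (M^2 / (R^2 * real n)) powr \<theta>" "iterations_for (R^2 / M^2 * real n) T"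
        using 1 unfolding one_pass_sgd_def q_def[symmetric] \<theta>_def[symmetric] by blast+
      have "R^2 / M^2 * real n = u" by (simp add: u_def)
      then show "b = 1" "iterations_for u T" using * by auto
      assume "R^2 / M^2 = 1 / n1" "(M^2 / (R^2 * real n)) powr \<theta> = a powr (- (q - 1))"
      then show "\<eta> = \<eta>0 / n1 * a powr (- (q - 1))" unfolding *(2) by simp
    qed
    have "a powr 1 \<le> a powr q" using a q by (intro powr_mono) auto
    then have u4: "u \<ge> 4" using a uq by simp
    note it = iterations_bounds[OF T u4]
    have \<eta>p: "\<eta> > 0" unfolding \<eta> using p a0 by (intro mult_pos_pos) auto
    have au: "a powr (- (q - 1)) * u = a"
      unfolding uq[symmetric] powr_add[symmetric] using a0 by simp
    have \<eta>u: "\<eta> * u = \<eta>0 / n1 * a" unfolding \<eta> using au by (simp add: mult.assoc)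
    have "\<eta> * (u / 2) \<le> \<eta> * real T" "\<eta> * real T \<le> \<eta> * (2 * u)"
      using it \<eta>p by (auto intro!: mult_left_mono)
    then have x: "\<eta>0 / n1 * a / 2 \<le> \<eta> * real T" "\<eta> * real T \<le> 2 * (\<eta>0 / n1) * a" using \<eta>u by auto
    have "\<eta> / real b \<le> (\<eta>0 / n1 + 2 * \<eta>0 / n1 powr \<theta>) * a powr (- (q - 1))"
      unfolding \<eta> b using \<eta>0 n1\<theta> by (simp add: distrib_right)
    then show ?thesis using b \<eta>p it steps[OF _ x] by simp
  next
    case 2
    note it = iterations_bounds[OF 2(4) a]
    have "\<eta>0 * (a / 2) \<le> \<eta>0 * real T" "\<eta>0 * real T \<le> \<eta>0 * (2 * a)"
      using it \<eta>0 by (auto intro!: mult_left_mono)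
    then have x: "\<eta>0 * a / 2 \<le> \<eta> * real T" "\<eta> * real T \<le> 2 * \<eta>0 * a" using 2(1) by auto
    then show ?thesis using 2 \<eta>0 it batch[OF 2(2,3)] steps[OF _ x] by simp
  qed
  then show "b > 0" "\<eta> > 0" "even T" "T > 0"
    "1 / (2 * p) / a \<le> 1 / (\<eta> * real T)" "1 / (\<eta> * real T) \<le> (2 / \<eta>0 + 2 * n1 / \<eta>0) / a"
    "\<eta> / real b \<le> (\<eta>0 / n1 + 2 * \<eta>0 / n1 powr ((q - 1) / q)) * a powr (- (q - 1))"
    by (auto simp: \<theta>_def)
qed

text \<open>\<open>start\<close> asks of the initial iterate the regularity of the target, so that
  the initial error is a power of \<open>LK\<close>; \<open>h0 = 0\<close> with
  \<open>g0 = 0\<close> is an instance. The conditional expectation is taken in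
  \<open>ennreal\<close>, where no integrability is at stake.\<close>

theorem corollary3p5:
  fixes G :: "'x::topological_space \<Rightarrow> 'x \<Rightarrow> real"
    and evG :: "'g::{real_inner,banach,second_countable_topology} \<Rightarrow> 'x \<Rightarrow> real"
    and K :: "'g \<Rightarrow> 'g \<Rightarrow> real"
    and evK :: "'h::{real_inner,banach} \<Rightarrow> 'g \<Rightarrow> real"
    and Y :: "real set" and M :: real
    and Q :: "('x measure \<times> real) measure"
    and \<rho> :: "('g \<times> real) measure"
    and \<rho>y :: "'g \<Rightarrow> real measure"
    and cls :: "('g \<Rightarrow> real) \<Rightarrow> 'l::{real_inner,banach}"
    and h\<rho> g0 :: 'l and h0 :: 'h
    and \<gamma> \<kappa> \<alpha> L r R \<nu> c\<nu> \<eta>0 :: real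
  defines "Gs \<equiv> kernel_section UNIV G evG"
    and "\<mu> \<equiv> mean_embedding G evG"
    and "P \<equiv> mean_embeddings G evG"
  defines "Ks \<equiv> kernel_section P K evK"
    and "\<rho>\<mu> \<equiv> distr \<rho> (restrict_space borel P) fst"
    and "S \<equiv> inclusion cls evK"
  defines "LK \<equiv> S \<circ> adjoint S"
    and "f\<rho> \<equiv> cls (\<lambda>m. \<integral>y. y \<partial>\<rho>y m)"
  assumes X_compact: "compact (UNIV :: 'x set)"
    and Y_bounded: "Y \<subseteq> {-M..M}" "M > 0"
    and G_mercer: "mercer_kernel G"
    and HG: "rkhs_on UNIV G evG"
    and HK: "rkhs_on P K evK"
    and Q_prob: "prob_space Q"
    and Q_sets: "sets Q = sets (prob_algebra borel \<Otimes>\<^sub>M restrict_space borel Y)"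
    and \<rho>_prob: "prob_space \<rho>"
    and \<rho>_sets: "sets \<rho> = sets (restrict_space borel P \<Otimes>\<^sub>M restrict_space borel Y)"
    and \<rho>_law: "distr Q \<rho> (\<lambda>(x, y). (\<mu> x, y)) = \<rho>"
    and \<rho>y: "conditional_distribution \<rho> \<rho>\<mu> Y \<rho>y"
    and L2: "is_L2 \<rho>\<mu> cls"
    and i: "bdd_above (range (\<lambda>s. G s s))" "(SUP s. G s s) = \<gamma>\<^sup>2" "\<gamma> \<ge> 0"
    and ii: "bdd_above ((\<lambda>m. K m m) ` P)" "(SUP m\<in>P. K m m) = \<kappa>\<^sup>2" "\<kappa> \<ge> 0"
    and iii: "0 < \<alpha>" "\<alpha> \<le> 1" "L > 0"
      "\<And>m1 m2. m1 \<in> P \<Longrightarrow> m2 \<in> P \<Longrightarrow> norm (Ks m1 - Ks m2) \<le> L * norm (m1 - m2) powr \<alpha>"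
    and iv: "f\<rho> = op_power LK r h\<rho>" "norm h\<rho> \<le> R" "R > 0" "r \<ge> 1 / 2"
    and v: "0 < \<nu>" "\<nu> \<le> 1" "\<And>l. l > 0 \<Longrightarrow> effective_dim LK l \<le> c\<nu> * l powr (- \<nu>)"
    and start: "S h0 = op_power LK r g0"
    and \<eta>0: "\<eta>0 > 0" "4 * \<kappa>\<^sup>2 * \<eta>0 < 1"
  shows "\<exists>C::real. \<forall>\<delta>. 0 < \<delta> \<and> \<delta> \<le> 1 \<longrightarrow> (\<exists>n0::nat. \<forall>n\<ge>n0. \<forall>N b T::nat. \<forall>\<eta>::real.
     (one_pass_sgd R M r \<nu> \<eta>0 n b \<eta> T \<or>
      early_stopping_sgd R M r \<nu> \<eta>0 n b \<eta> T \<or>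
      batch_gd R M r \<nu> \<eta>0 n b \<eta> T) \<longrightarrow>
     real N \<ge> ln (real n) powr (2 / \<alpha>) *
       (R\<^sup>2 * real n / M\<^sup>2) powr ((2 * r + 1) / (\<alpha> * (2 * r + \<nu>))) \<longrightarrow>
     (let l = 1 / (\<eta> * real T) in
       real n \<ge> 32 * \<kappa>\<^sup>2 * ln (4 / \<delta>) / l *
         ln (exp 1 * effective_dim LK l * (1 + l / onorm LK))) \<longrightarrow>
     4 * \<kappa>\<^sup>2 * \<eta> < 1 \<longrightarrow>
     (let \<Omega> = sgd_experiment Q n N (b * T);
          \<sigma>D = vimage_algebra (space \<Omega>) (\<lambda>((d, z), J). first_stage_data \<mu> n d)
                 (\<Pi>\<^sub>M j\<in>{1..n}. \<rho>);
          err = (\<lambda>((d, z), J). norm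
                  (S (tail_averaged_sgd evK Ks b \<eta> h0 (second_stage_data Gs N d z) J T) - f\<rho>))
      in measure \<Omega> {\<omega> \<in> space \<Omega>.
             nn_cond_exp \<Omega> \<sigma>D (\<lambda>\<omega>. ennreal (err \<omega>)) \<omega>
               \<le> ennreal (C * ln (6 / \<delta>) * R * (M\<^sup>2 / (R\<^sup>2 * real n)) powr (r / (2 * r + \<nu>)))}
           \<ge> 1 - \<delta>))"
proof -
  interpret pop: population P K evK Y \<rho> cls \<kappa>
  proof (rule population.intro[OF HK \<rho>_prob \<rho>_sets L2[unfolded \<rho>\<mu>_def] _ ii(3)])
    show "K m m \<le> \<kappa>^2" if "m \<in> P" for m using cSUP_upper[OF that ii(1)] ii(2) by simp
    have "\<forall>m\<in>P. (Ks \<longlongrightarrow> Ks m) (at m within P)"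
    proof
      fix m assume m: "m \<in> P"
      have "((\<lambda>x. L * norm (x - m) powr \<alpha>) \<longlongrightarrow> L * norm (m - m) powr \<alpha>) (at m within P)"
        using iii by (intro tendsto_intros) auto
      then have lim: "((\<lambda>x. L * norm (x - m) powr \<alpha>) \<longlongrightarrow> 0) (at m within P)" by simp
      have "((\<lambda>x. norm (Ks x - Ks m)) \<longlongrightarrow> 0) (at m within P)"
      proof (rule tendsto_sandwich[OF _ _ tendsto_const lim])
        show "\<forall>\<^sub>F x in at m within P. norm (Ks x - Ks m) \<le> L * norm (x - m) powr \<alpha>"
          unfolding eventually_at_filter by (rule always_eventually) (use iii(4)[OF _ m] in auto)
      qed simp
      then show "(Ks \<longlongrightarrow> Ks m) (at m within P)" by (simp add: tendsto_norm_zero_iff LIM_zero_iff)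
    qed
    then show "continuous_on P (kernel_section P K evK)" unfolding continuous_on_def Ks_def .
  qed
  have S_eq: "pop.S = S" by (simp add: pop.S_def S_def)
  have Ks_eq: "pop.Ks = Ks" by (simp add: pop.Ks_def Ks_def)
  have LK_eq: "pop.LK = LK" by (simp add: pop.LK_def LK_def S_eq)
  interpret src: source_condition P K evK Y \<rho> cls \<kappa> r "g0 - h\<rho>" by unfold_locales (use iv in simp)
  define f where "f = h0 - src.bias 1 0"
  have S_f: "S f = f\<rho>"
  proof -
    have \<eta>\<kappa>: "\<eta>0 * \<kappa>^2 \<le> 1" using \<eta>0 mult_nonneg_nonneg[of "\<kappa>^2" \<eta>0] by (simp add: mult.commute)
    \<comment> \<open>\<open>S_bias_0\<close> is available for admissible step sizes only; at time 0
      they all give the same vector.\<close>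
    have "src.bias 1 0 = src.bias \<eta>0 0" by (simp add: src.bias_def)
    then have "S (src.bias 1 0) = op_power LK r (g0 - h\<rho>)"
      using src.S_bias_0[OF \<eta>0(1) \<eta>\<kappa>] by (simp add: S_eq LK_eq)
    also have "\<dots> = op_power LK r g0 - op_power LK r h\<rho>"
      using pop.op_power_diff[of r g0 h\<rho>] iv by (simp add: LK_eq)
    finally show ?thesis
      using bounded_linear.linear[OF pop.bounded_linear_S] by (simp add: f_def linear_diff S_eq start iv(1))
  qed
  have cond: "conditional_distribution \<rho> pop.\<rho>\<mu> Y \<rho>y" using \<rho>y by (simp add: pop.\<rho>\<mu>_def \<rho>\<mu>_def)
  interpret reg: regression P K evK Y \<rho> cls \<kappa> r "g0 - h\<rho>" h0 M
  proof (unfold_locales)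
    show "(\<integral>p. (snd p - (h0 - src.bias 1 0) \<bullet> pop.Ks (fst p)) * (h \<bullet> pop.Ks (fst p)) \<partial>\<rho>) = 0" for h
      by (rule pop.regression_noise_mean[OF cond Y_bounded(1)]) (use S_f in \<open>simp add: S_eq f_def f\<rho>_def\<close>)
  qed (use Y_bounded in auto)
  interpret emb: mean_embedded G evG \<gamma>
  proof (unfold_locales)
    show "G s s \<le> \<gamma>^2" for s using cSUP_upper[OF UNIV_I i(1)] i(2) by simp
  qed (use G_mercer HG i in auto)
  interpret two: two_stage_regression G evG \<gamma> K evK Y \<rho> cls \<kappa> r "g0 - h\<rho>" h0 M Q \<alpha> L
    by (intro two_stage_regression.intro two_stage_regression_axioms.intro emb.mean_embedded_axioms
          reg.regression_axioms[unfolded P_def] Q_prob Q_sets iii(1,2,3))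
       (use \<rho>_law iii(4) in \<open>simp_all add: \<mu>_def P_def Ks_def population.Ks_def[OF pop.population_axioms[unfolded P_def]]\<close>)
  define q where "q = 2 * r + \<nu>"
  define n1 where "n1 = M^2 / R^2"
  define p where "p = \<eta>0 + \<eta>0 / n1"
  have q: "q > 1" using iv v by (simp add: q_def)
  have n1: "n1 > 0" using iv(3) Y_bounded by (simp add: n1_def)
  have f_eq: "two.f = f" by (simp add: two.f_def two.v0_def f_def P_def)
  have dim: "effective_dim two.LK l \<le> c\<nu> * l powr (- \<nu>)" if "l > 0" for l
    using v(3)[OF that] LK_eq by (simp add: P_def)
  have c: "1 / (2 * p) > 0" "2 / \<eta>0 + 2 * n1 / \<eta>0 > 0" "\<eta>0 / n1 + 2 * \<eta>0 / n1 powr ((q - 1) / q) > 0"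
    using \<eta>0 n1 by (auto simp: p_def intro!: add_pos_pos)
  obtain C where "\<forall>\<delta>. 0 < \<delta> \<and> \<delta> \<le> 1 \<longrightarrow> (\<exists>a0. \<forall>n N b t0 \<eta> a. a \<ge> a0 \<longrightarrow>
    two.regime \<nu> n1 (1 / (2 * p)) (2 / \<eta>0 + 2 * n1 / \<eta>0) (\<eta>0 / n1 + 2 * \<eta>0 / n1 powr ((q - 1) / q)) n N b t0 \<eta> a \<longrightarrow>
    two.error_within n N b \<eta> t0 \<delta> (C * ln (6 / \<delta>) * a powr (- r)))"
    using two.asymptotic_rate[OF v(1) dim n1 c] by blast
  from this[unfolded choice_iff']
  obtain a0 where a0: "\<And>\<delta> n N b t0 \<eta> a. 0 < \<delta> \<and> \<delta> \<le> 1 \<Longrightarrow> a \<ge> a0 \<delta> \<Longrightarrow>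
    two.regime \<nu> n1 (1 / (2 * p)) (2 / \<eta>0 + 2 * n1 / \<eta>0) (\<eta>0 / n1 + 2 * \<eta>0 / n1 powr ((q - 1) / q)) n N b t0 \<eta> a \<Longrightarrow>
    two.error_within n N b \<eta> t0 \<delta> (C * ln (6 / \<delta>) * a powr (- r))" by blast
  \<comment> \<open>The 4 is for the rounding in \<open>parameter_choices\<close>. In
    \<open>n0\<close> the 3 gives \<open>ln n \<ge> 1\<close>, and the other term gives
    \<open>a \<ge> a1 \<delta>\<close>.\<close>
  define a1 where "a1 \<delta> = max (a0 \<delta>) 4" for \<delta>
  define n0 where "n0 \<delta> = nat \<lceil>max 3 (n1 * a1 \<delta> powr q)\<rceil>" for \<delta>
  show ?thesis
  \<comment> \<open>The stated bound carries a factor \<open>R\<close> that the rate in terms of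
    \<open>a\<close> does not have.\<close>
  proof (rule exI[of _ "C / R"], intro allI impI, rule exI[of _ "n0 \<delta>" for \<delta>], intro allI impI)
    fix \<delta> :: real and n N b T :: nat and \<eta> :: real
    assume \<delta>: "0 < \<delta> \<and> \<delta> \<le> 1" and n0: "n \<ge> n0 \<delta>"
      and choice: "one_pass_sgd R M r \<nu> \<eta>0 n b \<eta> T \<or> early_stopping_sgd R M r \<nu> \<eta>0 n b \<eta> T \<or> batch_gd R M r \<nu> \<eta>0 n b \<eta> T"
      and N: "real N \<ge> ln (real n) powr (2 / \<alpha>) * (R^2 * real n / M^2) powr ((2 * r + 1) / (\<alpha> * (2 * r + \<nu>)))"
      and \<eta>: "4 * \<kappa>^2 * \<eta> < 1"
    have n: "real n \<ge> 3" "real n \<ge> n1 * a1 \<delta> powr q"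
      using n0 unfolding n0_def by (auto simp: nat_le_iff ceiling_le_iff)
    define u where "u = R^2 * real n / M^2"
    define a where "a = u powr (1 / q)"
    have u: "u = real n / n1" by (simp add: u_def n1_def)
    have u0: "u > 0" unfolding u using n n1 by simp
    have a_ge: "a \<ge> a1 \<delta>"
    proof -
      have "a1 \<delta> powr q \<le> u" unfolding u using n n1 by (simp add: pos_le_divide_eq mult.commute)
      then have "(a1 \<delta> powr q) powr (1 / q) \<le> u powr (1 / q)" using q by (intro powr_mono2) auto
      then show ?thesis using q by (simp add: a_def powr_powr a1_def)
    qed
    then have a: "a \<ge> 4" "a \<ge> a0 \<delta>" by (auto simp: a1_def)
    have n_pos: "n > 0" using n by simp
    note par = parameter_choices[OF iv(3) Y_bounded(2) q[unfolded q_def] \<eta>0(1) n_pos _ choice,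
        folded q_def n1_def, folded p_def u_def, folded a_def, OF a(1)]
    have N': "a powr ((2 * r + 1) / \<alpha>) \<le> real N"
    proof -
      have "1 \<le> ln (real n)" using n exp_le by (subst ln_ge_iff) auto
      then have "1 \<le> ln (real n) powr (2 / \<alpha>)" using iii by (intro ge_one_powr_ge_zero) auto
      moreover have "u powr ((2 * r + 1) / (\<alpha> * q)) = a powr ((2 * r + 1) / \<alpha>)"
        by (simp add: a_def powr_powr mult.commute)
      ultimately show ?thesis
        using N mult_right_mono[of 1 "ln (real n) powr (2 / \<alpha>)" "a powr ((2 * r + 1) / \<alpha>)"]
        by (simp add: u_def q_def)
    qed
    have rate: "C / R * ln (6 / \<delta>) * R * (M^2 / (R^2 * real n)) powr (r / (2 * r + \<nu>)) = C * ln (6 / \<delta>) * a powr (- r)"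
    proof -
      have "M^2 / (R^2 * real n) = 1 / u" by (simp add: u_def)
      then have "(M^2 / (R^2 * real n)) powr (r / q) = a powr (- r)"
        using u0 by (simp add: a_def powr_powr powr_divide powr_minus_divide)
      then show ?thesis using iv(3) by (simp add: q_def)
    qed
    have reg: "two.regime \<nu> n1 (1 / (2 * p)) (2 / \<eta>0 + 2 * n1 / \<eta>0) (\<eta>0 / n1 + 2 * \<eta>0 / n1 powr ((q - 1) / q)) n N b T \<eta> a"
      unfolding two.regime_def q_def[symmetric] by (intro conjI par N' \<eta>)
    show "let \<Omega> = sgd_experiment Q n N (b * T);
         \<sigma>D = vimage_algebra (space \<Omega>) (\<lambda>((d, z), J). first_stage_data \<mu> n d) (\<Pi>\<^sub>M j\<in>{1..n}. \<rho>);
         err = (\<lambda>((d, z), J). norm (S (tail_averaged_sgd evK Ks b \<eta> h0 (second_stage_data Gs N d z) J T) - f\<rho>))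
     in measure \<Omega> {\<omega> \<in> space \<Omega>. nn_cond_exp \<Omega> \<sigma>D (\<lambda>\<omega>. ennreal (err \<omega>)) \<omega>
          \<le> ennreal (C / R * ln (6 / \<delta>) * R * (M^2 / (R^2 * real n)) powr (r / (2 * r + \<nu>)))} \<ge> 1 - \<delta>"
      using a0[OF \<delta> a(2) reg]
      unfolding two.error_within_def f_eq S_f S_eq[unfolded P_def] Ks_eq[unfolded P_def] \<mu>_def[symmetric] Gs_def[symmetric] Let_def rate .
  qed
qed

end
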